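(* Let $\varepsilon>0$ be a fixed sufficiently small constant and let $G(i_{\max})$ be the graph of the triangle-free process on $n$ vertices at the Bohman--Keevash tracking time $i_{\max}=t_{\max}n^{3/2}$, where $t_{\max}=\frac12\sqrt{(1/2-\varepsilon)\log n}$. Then, with high probability as $n\to\infty$, $$h_5^{\mathrm f}(G(i_{\max}))\to\infty,$$ that is, for every constant $K$, $\Pr\bigl(h_5^{\mathrm f}(G(i_{\max}))\ge K\bigr)\to 1$. More quantitatively, for every fixed $0<\delta<1/2$, with high probability $$h_5^{\mathrm f}(G(i_{\max}))\ge n^{\delta/2-o(1)}.$$
   Context: All graphs are finite and simple; subgraphs need not be induced. $\chi_{\mathrm f}$ is the fractional chromatic number; $\log$ is natural; the girth of a forest is $\infty$. $h_5^{\mathrm f}(G)=\max\{\chi_{\mathrm f}(H):H\subseteq G,\ \operatorname{girth}(H)\ge 5\}$. The triangle-free process on $n$ vertices starts from the empty graph $G(0)$ on $n$ vertices; $G(i)$ is obtained from $G(i-1)$ by adding an edge chosen uniformly at random among all non-edges of $G(i-1)$ whose addition creates no triangle, as long as such a pair exists. $i_{\max}$ is understood up to rounding to an integer; with high probability the process lasts at least $i_{\max}$ steps, and the assertion includes this event. "With high probability" means with probability tending to $1$ as $n\to\infty$. *)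

theory Defs
  imports "HOL-Probability.Probability"
begin

text \<open>A graph is a pair of a vertex set and a set of two-element vertex sets.\<close>

type_synonym 'a graph = "'a set \<times> 'a set set"

abbreviation verts :: "'a graph \<Rightarrow> 'a set" where "verts \<equiv> fst"
abbreviation edges :: "'a graph \<Rightarrow> 'a set set" where "edges \<equiv> snd"

definition simple_graph :: "'a graph \<Rightarrow> bool" where
  "simple_graph G \<longleftrightarrow> finite (verts G) \<and> (\<forall>e\<in>edges G. e \<subseteq> verts G \<and> card e = 2)"

definition subgraph :: "'a graph \<Rightarrow> 'a graph \<Rightarrow> bool" where
  "subgraph H G \<longleftrightarrow> simple_graph H \<and> verts H \<subseteq> verts G \<and> edges H \<subseteq> edges G"

text \<open>A cycle is given by the list of its vertices in cyclic order.\<close>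

definition is_cycle :: "'a graph \<Rightarrow> 'a list \<Rightarrow> bool" where
  "is_cycle G c \<longleftrightarrow> 3 \<le> length c \<and> distinct c \<and> set c \<subseteq> verts G \<and>
     (\<forall>i<length c. {c ! i, c ! (Suc i mod length c)} \<in> edges G)"

text \<open>In \<^typ>\<open>enat\<close> the infimum of the empty set is \<open>\<infinity>\<close>, so forests have girth \<open>\<infinity>\<close>.\<close>

definition girth :: "'a graph \<Rightarrow> enat" where
  "girth G = Inf {enat (length c) |c. is_cycle G c}"

definition independent_sets :: "'a graph \<Rightarrow> 'a set set" where
  "independent_sets G = {I. I \<subseteq> verts G \<and> (\<forall>u\<in>I. \<forall>v\<in>I. {u, v} \<notin> edges G)}"

definition fractional_colouring :: "'a graph \<Rightarrow> ('a set \<Rightarrow> real) \<Rightarrow> bool" where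
  "fractional_colouring G w \<longleftrightarrow> (\<forall>I\<in>independent_sets G. 0 \<le> w I) \<and>
     (\<forall>v\<in>verts G. 1 \<le> (\<Sum>I | I \<in> independent_sets G \<and> v \<in> I. w I))"

definition fractional_chromatic_number :: "'a graph \<Rightarrow> real" where
  "fractional_chromatic_number G =
     Inf {(\<Sum>I\<in>independent_sets G. w I) |w. fractional_colouring G w}"

definition h5f :: "'a graph \<Rightarrow> real" where
  "h5f G = Max {fractional_chromatic_number H |H. subgraph H G \<and> 5 \<le> girth H}"

text \<open>The maximum ranges over a finite nonempty set.\<close>

lemma h5f_set_finite:
  assumes "simple_graph G"
  shows "finite {fractional_chromatic_number H |H. subgraph H G \<and> 5 \<le> girth H}"
proof -
  have "finite (verts G)" "edges G \<subseteq> Pow (verts G)"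
    using assms by (auto simp: simple_graph_def)
  then have "finite (Pow (verts G) \<times> Pow (edges G))"
    by (meson finite_Pow_iff finite_SigmaI finite_subset)
  moreover have "{H. subgraph H G \<and> 5 \<le> girth H} \<subseteq> Pow (verts G) \<times> Pow (edges G)"
    by (auto simp: subgraph_def)
  ultimately have "finite {H. subgraph H G \<and> 5 \<le> girth H}"
    by (rule finite_subset[rotated])
  then show ?thesis
    unfolding setcompr_eq_image by (rule finite_imageI)
qed

lemma h5f_set_nonempty:
  "{fractional_chromatic_number H |H. subgraph H G \<and> 5 \<le> girth H} \<noteq> {}"
proof -
  have "subgraph ({}, {}) G" by (simp add: subgraph_def simple_graph_def)
  moreover have "girth ({}, {} :: 'a set set) = \<infinity>"
    by (auto simp: girth_def is_cycle_def top_enat_def)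
  ultimately show ?thesis by fastforce
qed

definition triangle_free :: "'a set set \<Rightarrow> bool" where
  "triangle_free E \<longleftrightarrow>
     \<not> (\<exists>x y z. distinct [x, y, z] \<and> {x, y} \<in> E \<and> {y, z} \<in> E \<and> {x, z} \<in> E)"

definition open_pairs :: "nat \<Rightarrow> nat set set \<Rightarrow> nat set set" where
  "open_pairs n E = {e. e \<subseteq> {..<n} \<and> card e = 2 \<and> e \<notin> E \<and> triangle_free (insert e E)}"

text \<open>
  The distribution of the edge set after \<open>i\<close> steps of the triangle-free process on
  the vertex set \<open>{..<n}\<close>; \<^const>\<open>None\<close> means that the process has stopped
  before completing \<open>i\<close> steps.
\<close>

primrec triangle_free_process :: "nat \<Rightarrow> nat \<Rightarrow> nat set set option pmf" where
  "triangle_free_process n 0 = return_pmf (Some {})"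
| "triangle_free_process n (Suc i) =
     bind_pmf (triangle_free_process n i)
       (\<lambda>s. case s of
          None \<Rightarrow> return_pmf None
        | Some E \<Rightarrow>
            if open_pairs n E = {} then return_pmf None
            else map_pmf (\<lambda>e. Some (insert e E)) (pmf_of_set (open_pairs n E)))"

definition t_max :: "real \<Rightarrow> nat \<Rightarrow> real" where
  "t_max \<epsilon> n = 1 / 2 * sqrt ((1 / 2 - \<epsilon>) * ln (real n))"

text \<open>The tracking time, rounded down.\<close>

definition i_max :: "real \<Rightarrow> nat \<Rightarrow> nat" where
  "i_max \<epsilon> n = nat \<lfloor>t_max \<epsilon> n * real n powr (3 / 2)\<rfloor>"

text \<open>
  The probability that the process lasts at least \<open>i_max \<epsilon> n\<close> steps and that the graph
  it has then reached satisfies \<open>h5f \<ge> K\<close>.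
\<close>

definition prob_h5f_ge :: "real \<Rightarrow> nat \<Rightarrow> real \<Rightarrow> real" where
  "prob_h5f_ge \<epsilon> n K =
     measure_pmf.prob (triangle_free_process n (i_max \<epsilon> n)) {Some E |E. K \<le> h5f ({..<n}, E)}"

end

(* Scale time as t = i / n^(3/2).  The normalised error of the number of (open, edge) cherries at a
   pair changes in one step by an average of the same errors over a link, i.e. over the pairs uw with
   w in the open neighbourhood of u joined to v.  Normalising by the actual number of open pairs
   removes the drift of the mean.  The link operator is close to averaging over rows, because an
   exponential supermartingale bounds all edge counts e(S, R) from above, and together with
   near-regularity such one-sided bounds force two-sided discrepancy.  Measured in l^M for a large
   constant M the errors therefore grow only by a factor n^(o(1)) over the whole process, so
   martingale noise of size n^(-c) stays small and open pairs remain up to i_max.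

   After about n^(1 + delta/2) steps the graph has o(n) four-cycles, and by a union bound no
   independent set of size C n^(1 - delta/2) log n.  Deleting one vertex of every four-cycle leaves a
   graph of girth at least 5 on at least n/2 vertices, whose fractional chromatic number is at least
   its order divided by its independence number; it survives as a subgraph up to i_max. *)

theory Submission
  imports Defs "HOL-Real_Asymp.Real_Asymp"
begin

section \<open>One step of the process\<close>

text \<open>A mixed codegree has size about t / \<open>cw\<close>, and 4 t^2 <= (1/2 - \<epsilon>)
  ln n keeps \<open>cw\<close> below n^(-\<epsilon>): codegrees stay polynomially large, hence
  concentrated, up to the tracking time. The obstacle is that T^2 is of order ln n. An error
  equation with growth rate C t multiplies the initial noise by exp (C T^2 / 2), a power of n that
  can exceed the power of n saved in the noise. In the sup norm the link operator is bounded only by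
  its row sums, about t, and C cannot be made small. In l^M a few exceptional vertices cost little:
  once its row average is removed, the operator has norm at most a small multiple of t, while the
  return from l^M to pointwise bounds costs only n^(2/M). The row averages themselves are harmless
  because they enter with a damping sign. So only codegrees and degrees have to be tracked, with no
  larger family of extension counts. One-sided edge counts suffice because a lack of edges between S
  and R would have to be made up, by regularity, by an excess between S and the complement of R,
  which the upper bound forbids.\<close>

definition nbr :: "nat set set \<Rightarrow> nat \<Rightarrow> nat set" where
  "nbr E v = {w. {v, w} \<in> E}"

definition opn :: "nat \<Rightarrow> nat set set \<Rightarrow> nat \<Rightarrow> nat set" where
  "opn n E u = {w. {u, w} \<in> open_pairs n E}"

definition valid :: "nat \<Rightarrow> nat set set \<Rightarrow> bool" where
  "valid n E \<longleftrightarrow> triangle_free E \<and> (\<forall>e\<in>E. e \<subseteq> {..<n} \<and> card e = 2)"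

definition nopen :: "nat \<Rightarrow> nat set set \<Rightarrow> nat" where
  "nopen n E = card (open_pairs n E)"

text \<open>If uv is open and gets added, the open pairs uw counted here are closed, so these
  numbers govern how fast open pairs die. They are not symmetric: u is the open side, v the edge
  side.\<close>

definition mixed_codeg :: "nat \<Rightarrow> nat set set \<Rightarrow> nat \<Rightarrow> nat \<Rightarrow> nat" where
  "mixed_codeg n E u v = card (opn n E u \<inter> nbr E v)"

definition open_codeg :: "nat \<Rightarrow> nat set set \<Rightarrow> nat \<Rightarrow> nat \<Rightarrow> nat" where
  "open_codeg n E u v = card (opn n E u \<inter> opn n E v)"

definition open_deg :: "nat \<Rightarrow> nat set set \<Rightarrow> nat \<Rightarrow> nat" where
  "open_deg n E u = card (opn n E u)"

definition codeg :: "nat set set \<Rightarrow> nat \<Rightarrow> nat \<Rightarrow> nat" where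
  "codeg E u v = card (nbr E u \<inter> nbr E v)"

lemma nbr_sym: "w \<in> nbr E v \<longleftrightarrow> v \<in> nbr E w"
  by (simp add: nbr_def insert_commute)

lemma opn_sym: "w \<in> opn n E v \<longleftrightarrow> v \<in> opn n E w"
  by (simp add: opn_def insert_commute)

lemma valid_nbr:
  assumes "valid n E" "w \<in> nbr E v"
  shows "v < n" "w < n" "v \<noteq> w"
proof -
  have "{v, w} \<subseteq> {..<n}" "card {v, w} = 2"
    using assms by (auto simp: valid_def nbr_def)
  then show "v < n" "w < n" "v \<noteq> w" by (auto simp: card_insert_if split: if_splits)
qed

lemma open_iff:
  assumes V: "valid n E"
  shows "{u, w} \<in> open_pairs n E \<longleftrightarrow>
    u < n \<and> w < n \<and> u \<noteq> w \<and> w \<notin> nbr E u \<and> nbr E u \<inter> nbr E w = {}"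
proof
  assume o: "{u, w} \<in> open_pairs n E"
  then have "u \<noteq> w" by (auto simp: open_pairs_def card_insert_if split: if_splits)
  moreover have "nbr E u \<inter> nbr E w = {}"
  proof (rule ccontr)
    assume "nbr E u \<inter> nbr E w \<noteq> {}"
    then obtain x where x: "{u, x} \<in> E" "{w, x} \<in> E" by (auto simp: nbr_def)
    then have "u \<noteq> x" "w \<noteq> x" using valid_nbr(3)[OF V] by (auto simp: nbr_def)
    with x \<open>u \<noteq> w\<close> have "\<not> triangle_free (insert {u, w} E)"
      unfolding triangle_free_def not_not
      by (intro exI[of _ u] exI[of _ w] exI[of _ x]) auto
    with o show False by (auto simp: open_pairs_def)
  qed
  ultimately show "u < n \<and> w < n \<and> u \<noteq> w \<and> w \<notin> nbr E u \<and> nbr E u \<inter> nbr E w = {}"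
    using o by (auto simp: open_pairs_def nbr_def)
next
  assume a: "u < n \<and> w < n \<and> u \<noteq> w \<and> w \<notin> nbr E u \<and> nbr E u \<inter> nbr E w = {}"
  have tf: "\<not> (distinct [x, y, z] \<and> {x, y} \<in> E \<and> {y, z} \<in> E \<and> {x, z} \<in> E)" for x y z
    using V unfolding valid_def triangle_free_def by blast
  have nc: "\<not> ({u, x} \<in> E \<and> {w, x} \<in> E)" for x
    using a by (auto simp: nbr_def)
  have "triangle_free (insert {u, w} E)"
    unfolding triangle_free_def
  proof (intro notI, elim exE conjE)
    fix x y z assume d: "distinct [x, y, z]"
      and e: "{x, y} \<in> insert {u, w} E" "{y, z} \<in> insert {u, w} E" "{x, z} \<in> insert {u, w} E"
    consider "{x, y} = {u, w}" | "{y, z} = {u, w}" | "{x, z} = {u, w}"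
      using e tf[of x y z] d by blast
    then show False
    proof cases
      case 1
      then have "{y, z} \<in> E" "{x, z} \<in> E" using e d by (auto simp: doubleton_eq_iff)
      then show False using 1 nc[of z] by (auto simp: doubleton_eq_iff)
    next
      case 2
      then have "{x, y} \<in> E" "{x, z} \<in> E" using e d by (auto simp: doubleton_eq_iff)
      then show False using 2 nc[of x] by (auto simp: doubleton_eq_iff insert_commute)
    next
      case 3
      then have "{x, y} \<in> E" "{y, z} \<in> E" using e d by (auto simp: doubleton_eq_iff)
      then show False using 3 nc[of y] by (auto simp: doubleton_eq_iff insert_commute)
    qed
  qed
  with a show "{u, w} \<in> open_pairs n E" by (auto simp: open_pairs_def nbr_def)
qed

lemma opn_iff:
  assumes "valid n E"
  shows "w \<in> opn n E u \<longleftrightarrow>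
    u < n \<and> w < n \<and> u \<noteq> w \<and> w \<notin> nbr E u \<and> nbr E u \<inter> nbr E w = {}"
  using open_iff[OF assms] by (simp add: opn_def)

lemma open_pairs_E:
  assumes "e \<in> open_pairs n E"
  obtains x y where "e = {x, y}" "x \<noteq> y" "x < n" "y < n"
proof -
  have "card e = 2" "e \<subseteq> {..<n}" using assms by (auto simp: open_pairs_def)
  then show ?thesis using that by (auto simp: card_2_iff)
qed

lemma finite_open_pairs [simp]: "finite (open_pairs n E)"
  by (rule finite_subset[of _ "Pow {..<n}"]) (auto simp: open_pairs_def)

lemma finite_opn [simp]: "finite (opn n E u)"
  by (rule finite_subset[of _ "{..<n}"]) (auto simp: opn_def open_pairs_def)

lemma opn_less: "w \<in> opn n E u \<Longrightarrow> w < n \<and> u < n \<and> u \<noteq> w"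
  by (auto simp: opn_def open_pairs_def card_insert_if split: if_splits)

lemma finite_nbr: "valid n E \<Longrightarrow> finite (nbr E u)"
  by (rule finite_subset[of _ "{..<n}"]) (use valid_nbr in auto)

lemma valid_empty [simp]: "valid n {}"
  by (auto simp: valid_def triangle_free_def)

lemma valid_insert:
  assumes "valid n E" "e \<in> open_pairs n E" shows "valid n (insert e E)"
  using assms by (auto simp: valid_def open_pairs_def)

text \<open>Adding \<open>{x, y}\<close> makes exactly these pairs stop being open.\<close>

definition kills :: "nat \<Rightarrow> nat set set \<Rightarrow> nat \<Rightarrow> nat \<Rightarrow> nat set set" where
  "kills n E x y = insert {x, y} ((\<lambda>w. {x, w}) ` (opn n E x \<inter> nbr E y) \<union>
     (\<lambda>w. {y, w}) ` (opn n E y \<inter> nbr E x))"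

lemma kills_commute: "kills n E x y = kills n E y x"
  by (auto simp: kills_def insert_commute)

text \<open>\<open>kills\<close> is symmetric in its endpoints; the union over both orderings turns
  it into a function of the unordered pair without choosing an orientation.\<close>

definition killset :: "nat \<Rightarrow> nat set set \<Rightarrow> nat set \<Rightarrow> nat set set" where
  "killset n E e = (\<Union>(x, y)\<in>{(x, y). e = {x, y}}. kills n E x y)"

lemma killset_pair [simp]: "killset n E {x, y} = kills n E x y"
  by (auto simp: killset_def doubleton_eq_iff kills_commute)

lemma finite_kills [simp]: "finite (kills n E x y)"
  by (simp add: kills_def)

lemma kills_subset: "y \<in> opn n E x \<Longrightarrow> kills n E x y \<subseteq> open_pairs n E"
  by (auto simp: kills_def opn_def)

text \<open>The three parts of \<open>kills\<close> are disjoint: an overlap would put x into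
  \<open>nbr E x\<close> or y into \<open>nbr E y\<close>.\<close>

lemma card_kills:
  assumes V: "valid n E" and o: "y \<in> opn n E x"
  shows "card (kills n E x y) = 1 + mixed_codeg n E x y + mixed_codeg n E y x"
proof -
  have i1: "inj_on (\<lambda>w. {x, w}) A" for A by (auto simp: inj_on_def doubleton_eq_iff)
  have i2: "inj_on (\<lambda>w. {y, w}) A" for A by (auto simp: inj_on_def doubleton_eq_iff)
  have xy: "x \<noteq> y" using opn_less[OF o] by auto
  have nn: "x \<notin> nbr E y" using o opn_iff[OF V] nbr_sym by blast
  have d: "(\<lambda>w. {x, w}) ` (opn n E x \<inter> nbr E y) \<inter> (\<lambda>w. {y, w}) ` (opn n E y \<inter> nbr E x) = {}"
    using xy valid_nbr[OF V] nn by (auto simp: doubleton_eq_iff)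
  have "{x, y} \<notin> (\<lambda>w. {x, w}) ` (opn n E x \<inter> nbr E y) \<union> (\<lambda>w. {y, w}) ` (opn n E y \<inter> nbr E x)"
    using xy valid_nbr[OF V] by (auto simp: doubleton_eq_iff)
  then show ?thesis
    unfolding kills_def mixed_codeg_def using d
    by (simp add: card_Un_disjoint card_image i1 i2)
qed

lemma kills_iff:
  assumes "{u, w} \<in> open_pairs n E"
  shows "{u, w} \<in> kills n E x y \<longleftrightarrow> {x, y} = {u, w} \<or>
    (x = u \<and> w \<in> nbr E y) \<or> (x = w \<and> u \<in> nbr E y) \<or> (y = u \<and> w \<in> nbr E x) \<or> (y = w \<and> u \<in> nbr E x)"
proof -
  have "w \<in> opn n E u" using assms by (simp add: opn_def)
  moreover from this have "u \<in> opn n E w" using opn_sym by blast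
  ultimately show ?thesis
    unfolding kills_def insert_iff Un_iff image_iff doubleton_eq_iff Int_iff Bex_def by blast
qed

text \<open>Two distinct open pairs close one another exactly when they share a vertex and their
  other ends are adjacent, a symmetric condition. This is what makes the double counting of removed
  pairs possible.\<close>

lemma kills_sym:
  assumes "y \<in> opn n E x" "w \<in> opn n E u"
  shows "{x, y} \<in> kills n E u w \<longleftrightarrow> {u, w} \<in> kills n E x y"
proof -
  have "{x, y} \<in> open_pairs n E" "{u, w} \<in> open_pairs n E" using assms by (auto simp: opn_def)
  note k = kills_iff[OF this(1), of u w] kills_iff[OF this(2), of x y]
  have "y \<in> nbr E w \<longleftrightarrow> w \<in> nbr E y" "x \<in> nbr E w \<longleftrightarrow> w \<in> nbr E x"
    "y \<in> nbr E u \<longleftrightarrow> u \<in> nbr E y" "x \<in> nbr E u \<longleftrightarrow> u \<in> nbr E x" by (rule nbr_sym)+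
  then show ?thesis unfolding k by metis
qed

lemma nbr_insert: "nbr (insert {x, y} E) u =
    nbr E u \<union> (if u = x then {y} else {}) \<union> (if u = y then {x} else {})"
  by (auto simp: nbr_def doubleton_eq_iff)

lemma open_insert:
  assumes V: "valid n E" and o: "y \<in> opn n E x"
  shows "open_pairs n (insert {x, y} E) = open_pairs n E - kills n E x y"
proof (rule set_eqI)
  fix f
  have V': "valid n (insert {x, y} E)" using valid_insert[OF V] o by (simp add: opn_def)
  show "f \<in> open_pairs n (insert {x, y} E) \<longleftrightarrow> f \<in> open_pairs n E - kills n E x y"
  proof (cases "\<exists>u w. f = {u, w}")
    case False
    then show ?thesis by (metis DiffD1 open_pairs_E)
  next
    case True
    then obtain u w where f: "f = {u, w}" by blast
    have xy: "x < n" "y < n" "x \<noteq> y" "y \<notin> nbr E x" "x \<notin> nbr E y" "nbr E x \<inter> nbr E y = {}"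
      using o opn_iff[OF V] nbr_sym by blast+
    show ?thesis
    proof (cases "{u, w} \<in> open_pairs n E")
      case False
      then have "{u, w} \<notin> open_pairs n (insert {x, y} E)"
        unfolding open_iff[OF V] open_iff[OF V'] nbr_insert by auto
      then show ?thesis using False f by simp
    next
      case True
      note t = True[unfolded open_iff[OF V]]
      have un: "u \<notin> nbr E u" "w \<notin> nbr E w" using valid_nbr(3)[OF V] by blast+
      have r: "x \<in> nbr E u \<longleftrightarrow> u \<in> nbr E x" "y \<in> nbr E u \<longleftrightarrow> u \<in> nbr E y"
        "x \<in> nbr E w \<longleftrightarrow> w \<in> nbr E x" "y \<in> nbr E w \<longleftrightarrow> w \<in> nbr E y" by (rule nbr_sym)+
      have s: "w \<notin> nbr E u" "u \<notin> nbr E w" using t nbr_sym by blast+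
      show ?thesis unfolding f
        using True kills_iff[OF True, of x y] t un s xy r unfolding open_iff[OF V'] nbr_insert
        by (auto simp: doubleton_eq_iff)
    qed
  qed
qed

lemma opn_insert:
  assumes V: "valid n E" and o: "y \<in> opn n E x"
  shows "opn n (insert {x, y} E) u = {w \<in> opn n E u. {u, w} \<notin> kills n E x y}"
  using open_insert[OF assms] by (auto simp: opn_def)

lemma nopen_insert:
  assumes V: "valid n E" and o: "y \<in> opn n E x"
  shows "nopen n (insert {x, y} E) + (1 + mixed_codeg n E x y + mixed_codeg n E y x) = nopen n E"
proof -
  have "kills n E x y \<subseteq> open_pairs n E" by (rule kills_subset[OF o])
  then show ?thesis
    unfolding nopen_def open_insert[OF V o] card_kills[OF V o, symmetric]
    by (metis card_Diff_subset card_mono finite_kills finite_open_pairs le_add_diff_inverse2)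
qed

lemma card_filter_sum: "finite A \<Longrightarrow> card {w \<in> A. P w} = (\<Sum>w\<in>A. if P w then 1 else 0)"
  by (simp add: sum.If_cases Int_def)

text \<open>Double counting of the pairs (chosen pair, pair removed from a row).\<close>

lemma sum_removed:
  assumes V: "valid n E" and fin: "finite O'" and O: "O' \<subseteq> open_pairs n E" and A: "finite A"
    and Au: "A \<subseteq> opn n E u"
  shows "(\<Sum>e\<in>O'. card {w \<in> A. {u, w} \<in> killset n E e}) =
    (\<Sum>w\<in>A. card (O' \<inter> kills n E u w))"
proof -
  have "({u, w} \<in> killset n E e) \<longleftrightarrow> e \<in> kills n E u w" if "e \<in> O'" "w \<in> A" for e w
  proof -
    have "e \<in> open_pairs n E" using that O by blast
    then obtain a b where e: "e = {a, b}" by (rule open_pairs_E)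
    have "b \<in> opn n E a" using that O e by (auto simp: opn_def)
    moreover have "w \<in> opn n E u" using Au that by blast
    ultimately show ?thesis using kills_sym[of b n E a w u] by (simp add: e)
  qed
  then have "{w \<in> A. {u, w} \<in> killset n E e} = {w \<in> A. e \<in> kills n E u w}" if "e \<in> O'" for e
    using that by blast
  then have "(\<Sum>e\<in>O'. card {w \<in> A. {u, w} \<in> killset n E e}) =
      (\<Sum>e\<in>O'. \<Sum>w\<in>A. if e \<in> kills n E u w then 1 else 0)"
    by (intro sum.cong refl) (simp only: card_filter_sum[OF A])
  also have "\<dots> = (\<Sum>w\<in>A. \<Sum>e\<in>O'. if e \<in> kills n E u w then 1 else 0)"
    by (rule sum.swap)
  also have "\<dots> = (\<Sum>w\<in>A. card (O' \<inter> kills n E u w))"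
  proof (intro sum.cong refl)
    fix w
    have "O' \<inter> kills n E u w = {e \<in> O'. e \<in> kills n E u w}" by blast
    then show "(\<Sum>e\<in>O'. if e \<in> kills n E u w then 1 else 0) = card (O' \<inter> kills n E u w)"
      by (simp only: card_filter_sum[OF fin])
  qed
  finally show ?thesis .
qed

lemma sum_count_pairs:
  assumes "finite O'" "finite B" "\<And>w. w \<in> B \<Longrightarrow> {v, w} \<in> O'"
  shows "(\<Sum>e\<in>O'. card {w \<in> B. e = {v, w}}) = card B"
proof -
  have "(\<Sum>e\<in>O'. card {w \<in> B. e = {v, w}}) = (\<Sum>e\<in>O'. \<Sum>w\<in>B. if e = {v, w} then 1 else 0)"
    by (intro sum.cong refl) (simp only: card_filter_sum[OF assms(2)])
  also have "\<dots> = (\<Sum>w\<in>B. \<Sum>e\<in>O'. if e = {v, w} then 1 else 0)" by (rule sum.swap)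
  also have "\<dots> = (\<Sum>w\<in>B. 1)"
    by (intro sum.cong refl) (use assms in \<open>simp add: sum.delta\<close>)
  finally show ?thesis by simp
qed

section \<open>One-step change of mixed codegrees\<close>

lemma open_pair_cases:
  assumes "e \<in> open_pairs n E"
  obtains x y where "e = {x, y}" "y \<in> opn n E x" "x \<in> opn n E y" "x \<noteq> y"
proof -
  obtain x y where e: "e = {x, y}" "x \<noteq> y" using assms by (rule open_pairs_E)
  have y: "y \<in> opn n E x" using assms e by (simp add: opn_def)
  moreover have "x \<in> opn n E y" using y opn_sym by blast
  ultimately show ?thesis using that e by blast
qed

lemma card_split_filter:
  assumes "finite A"
  shows "real (card {w \<in> A. \<not> P w}) = real (card A) - real (card {w \<in> A. P w})"
proof -
  have "{w \<in> A. \<not> P w} \<union> {w \<in> A. P w} = A" by blast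
  moreover have "card ({w \<in> A. \<not> P w} \<union> {w \<in> A. P w}) = card {w \<in> A. \<not> P w} + card {w \<in> A. P w}"
    using assms by (intro card_Un_disjoint) auto
  ultimately show ?thesis by simp
qed

text \<open>The chosen pair can create a cherry only as its edge side vw, with uw already open. The
  point is \<open>sur\<close>: the same choice does not close uw, because u and v are neither equal
  nor adjacent. The choice uv is left out since it would empty the set at once.\<close>

lemma mixed_step_set:
  assumes V: "valid n E" and uv: "u \<noteq> v" "v \<notin> nbr E u"
    and e: "e \<in> open_pairs n E" "e \<noteq> {u, v}"
  shows "opn n (insert e E) u \<inter> nbr (insert e E) v =
    {w \<in> opn n E u \<inter> nbr E v. {u, w} \<notin> killset n E e} \<union> {w \<in> opn n E u \<inter> opn n E v. e = {v, w}}"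
proof -
  obtain x y where xy: "e = {x, y}" "y \<in> opn n E x" "x \<in> opn n E y" "x \<noteq> y"
    using e(1) by (rule open_pair_cases)
  have vu: "u \<notin> nbr E v" using uv nbr_sym by blast
  have nb: "w \<in> nbr (insert e E) v \<longleftrightarrow> w \<in> nbr E v \<or> e = {v, w}" for w
    unfolding xy(1) nbr_insert by (auto simp: doubleton_eq_iff)
  have sur: "{u, w} \<notin> kills n E x y" if w: "w \<in> opn n E u" and ew: "e = {v, w}" for w
  proof
    assume k: "{u, w} \<in> kills n E x y"
    have "{u, w} \<in> open_pairs n E" using w by (simp add: opn_def)
    note k' = k[unfolded kills_iff[OF this]]
    have "u \<noteq> w" using opn_less[OF w] by auto
    have "(x = v \<and> y = w) \<or> (x = w \<and> y = v)" using ew xy(1) by (auto simp: doubleton_eq_iff)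
    then show False
    proof
      assume "x = v \<and> y = w"
      then show False using k' uv vu \<open>u \<noteq> w\<close> xy(4) by (auto simp: doubleton_eq_iff)
    next
      assume "x = w \<and> y = v"
      then show False using k' uv vu \<open>u \<noteq> w\<close> xy(4) by (auto simp: doubleton_eq_iff)
    qed
  qed
  have vo: "w \<in> opn n E v" if "e = {v, w}" for w
    using e(1) that by (simp add: opn_def)
  show ?thesis
  proof (rule set_eqI)
    fix w
    have "w \<in> opn n (insert e E) u \<longleftrightarrow> w \<in> opn n E u \<and> {u, w} \<notin> killset n E e"
      using opn_insert[OF V xy(2), of u] by (simp add: xy(1))
    moreover have "{u, w} \<notin> killset n E e" if "w \<in> opn n E u" "e = {v, w}"
      using sur[OF that] by (simp add: xy(1))
    ultimately show "w \<in> opn n (insert e E) u \<inter> nbr (insert e E) v \<longleftrightarrow>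
      w \<in> {w \<in> opn n E u \<inter> nbr E v. {u, w} \<notin> killset n E e} \<union> {w \<in> opn n E u \<inter> opn n E v. e = {v, w}}"
      using nb[of w] vo[of w] by blast
  qed
qed

lemma mixed_step:
  assumes V: "valid n E" and uv: "u \<noteq> v" "v \<notin> nbr E u"
    and e: "e \<in> open_pairs n E" "e \<noteq> {u, v}"
  shows "real (mixed_codeg n (insert e E) u v) = real (mixed_codeg n E u v)
    - real (card {w \<in> opn n E u \<inter> nbr E v. {u, w} \<in> killset n E e})
    + real (card {w \<in> opn n E u \<inter> opn n E v. e = {v, w}})"
proof -
  let ?A = "opn n E u \<inter> nbr E v"
  have "opn n E v \<inter> nbr E v = {}" using opn_iff[OF V] by blast
  then have d: "{w \<in> ?A. {u, w} \<notin> killset n E e} \<inter> {w \<in> opn n E u \<inter> opn n E v. e = {v, w}} = {}" by blast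
  have "real (card {w \<in> ?A. {u, w} \<notin> killset n E e}) = real (card ?A) - real (card {w \<in> ?A. {u, w} \<in> killset n E e})"
    by (rule card_split_filter) simp
  moreover have "card ({w \<in> ?A. {u, w} \<notin> killset n E e} \<union> {w \<in> opn n E u \<inter> opn n E v. e = {v, w}}) =
    card {w \<in> ?A. {u, w} \<notin> killset n E e} + card {w \<in> opn n E u \<inter> opn n E v. e = {v, w}}"
    by (rule card_Un_disjoint[OF _ _ d]) auto
  ultimately show ?thesis
    unfolding mixed_codeg_def mixed_step_set[OF assms] by simp
qed

text \<open>For an open pair uv this is the number of choices that remove it from the open pairs,
  the 1 being uv itself. Divided by \<open>nopen\<close> it is the probability of removal in the
  next step.\<close>

definition closers :: "nat \<Rightarrow> nat set set \<Rightarrow> nat \<Rightarrow> nat \<Rightarrow> real" where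
  "closers n E u v = 1 + real (mixed_codeg n E u v) + real (mixed_codeg n E v u)"

lemma sum_removed_all:
  assumes V: "valid n E" and Au: "A \<subseteq> opn n E u"
  shows "(\<Sum>e\<in>open_pairs n E. real (card {w \<in> A. {u, w} \<in> killset n E e})) = (\<Sum>w\<in>A. closers n E u w)"
proof -
  have fA: "finite A" using Au by (rule finite_subset) simp
  have "(\<Sum>e\<in>open_pairs n E. card {w \<in> A. {u, w} \<in> killset n E e}) =
    (\<Sum>w\<in>A. card (open_pairs n E \<inter> kills n E u w))"
    by (rule sum_removed[OF V]) (use fA Au in auto)
  also have "\<dots> = (\<Sum>w\<in>A. 1 + mixed_codeg n E u w + mixed_codeg n E w u)"
  proof (intro sum.cong refl)
    fix w assume "w \<in> A"
    then have w: "w \<in> opn n E u" using Au by blast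
    have "open_pairs n E \<inter> kills n E u w = kills n E u w" using kills_subset[OF w] by blast
    then show "card (open_pairs n E \<inter> kills n E u w) = 1 + mixed_codeg n E u w + mixed_codeg n E w u"
      using card_kills[OF V w] by simp
  qed
  finally have *: "(\<Sum>e\<in>open_pairs n E. card {w \<in> A. {u, w} \<in> killset n E e}) =
    (\<Sum>w\<in>A. 1 + mixed_codeg n E u w + mixed_codeg n E w u)" .
  have "(\<Sum>e\<in>open_pairs n E. real (card {w \<in> A. {u, w} \<in> killset n E e})) =
    real (\<Sum>e\<in>open_pairs n E. card {w \<in> A. {u, w} \<in> killset n E e})" by simp
  also have "\<dots> = (\<Sum>w\<in>A. closers n E u w)" unfolding * closers_def by (simp add: add.assoc)
  finally show ?thesis .
qed

text \<open>Double counting: each w in the open codegree is gained by the choice vw, each w in the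
  mixed codegree is lost by \<open>closers n E u w\<close> choices. If uv is open, the latter
  include uv itself, which is left out of the sum; the last term corrects for it.\<close>

lemma mixed_drift:
  assumes V: "valid n E" and uv: "u \<noteq> v" "v \<notin> nbr E u"
  shows "(\<Sum>e\<in>open_pairs n E - {{u, v}}. real (mixed_codeg n (insert e E) u v) - real (mixed_codeg n E u v)) =
    real (open_codeg n E u v) - (\<Sum>w\<in>opn n E u \<inter> nbr E v. closers n E u w)
    + (if v \<in> opn n E u then real (mixed_codeg n E u v) else 0)"
    and "(\<Sum>e\<in>open_pairs n E - {{u, v}}. \<bar>real (mixed_codeg n (insert e E) u v) - real (mixed_codeg n E u v)\<bar>) \<le>
    real (open_codeg n E u v) + (\<Sum>w\<in>opn n E u \<inter> nbr E v. closers n E u w)"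
proof -
  let ?A = "opn n E u \<inter> nbr E v" and ?B = "opn n E u \<inter> opn n E v"
  let ?O = "open_pairs n E - {{u, v}}"
  let ?k = "\<lambda>e. real (card {w \<in> ?A. {u, w} \<in> killset n E e})"
  let ?g = "\<lambda>e. real (card {w \<in> ?B. e = {v, w}})"
  have g: "(\<Sum>e\<in>?O. ?g e) = real (open_codeg n E u v)"
  proof -
    have "(\<Sum>e\<in>?O. card {w \<in> ?B. e = {v, w}}) = card ?B"
    proof (rule sum_count_pairs)
      fix w assume w: "w \<in> ?B"
      then have "{v, w} \<in> open_pairs n E" by (auto simp: opn_def)
      moreover have "w \<noteq> u" using w opn_less by blast
      ultimately show "{v, w} \<in> ?O" by (auto simp: doubleton_eq_iff)
    qed auto
    then have "real (\<Sum>e\<in>?O. card {w \<in> ?B. e = {v, w}}) = real (card ?B)" by (rule arg_cong)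
    then show ?thesis unfolding open_codeg_def of_nat_sum .
  qed
  have tot: "(\<Sum>e\<in>open_pairs n E. ?k e) = (\<Sum>w\<in>?A. closers n E u w)"
    by (rule sum_removed_all[OF V]) auto
  have uvk: "?k {u, v} = real (mixed_codeg n E u v)" if "v \<in> opn n E u"
  proof -
    have "{u, w} \<in> kills n E u v" if "w \<in> ?A" for w
      using that by (auto simp: kills_def)
    then have "{w \<in> ?A. {u, w} \<in> killset n E {u, v}} = ?A" by auto
    then show ?thesis by (simp add: mixed_codeg_def)
  qed
  have k: "(\<Sum>e\<in>?O. ?k e) = (\<Sum>w\<in>?A. closers n E u w) - (if v \<in> opn n E u then real (mixed_codeg n E u v) else 0)"
  proof (cases "v \<in> opn n E u")
    case True
    then have "{u, v} \<in> open_pairs n E" by (simp add: opn_def)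
    then have "(\<Sum>e\<in>open_pairs n E. ?k e) = ?k {u, v} + (\<Sum>e\<in>?O. ?k e)"
      by (intro sum.remove) auto
    then show ?thesis using tot uvk[OF True] True by simp
  next
    case False
    then have "?O = open_pairs n E" by (auto simp: opn_def)
    then show ?thesis using tot False by simp
  qed
  have st: "real (mixed_codeg n (insert e E) u v) - real (mixed_codeg n E u v) = ?g e - ?k e" if "e \<in> ?O" for e
    using mixed_step[OF V uv, of e] that by simp
  have "(\<Sum>e\<in>?O. real (mixed_codeg n (insert e E) u v) - real (mixed_codeg n E u v)) = (\<Sum>e\<in>?O. ?g e - ?k e)"
    by (rule sum.cong[OF refl st])
  then show "(\<Sum>e\<in>?O. real (mixed_codeg n (insert e E) u v) - real (mixed_codeg n E u v)) =
    real (open_codeg n E u v) - (\<Sum>w\<in>?A. closers n E u w)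
    + (if v \<in> opn n E u then real (mixed_codeg n E u v) else 0)"
    unfolding sum_subtractf g k by simp
  have "(\<Sum>e\<in>?O. \<bar>real (mixed_codeg n (insert e E) u v) - real (mixed_codeg n E u v)\<bar>) \<le> (\<Sum>e\<in>?O. ?g e + ?k e)"
  proof (rule sum_mono)
    fix e assume "e \<in> ?O"
    then show "\<bar>real (mixed_codeg n (insert e E) u v) - real (mixed_codeg n E u v)\<bar> \<le> ?g e + ?k e"
      using st[of e] by linarith
  qed
  also have "\<dots> \<le> real (open_codeg n E u v) + (\<Sum>w\<in>?A. closers n E u w)"
    unfolding sum.distrib g k by simp
  finally show "(\<Sum>e\<in>?O. \<bar>real (mixed_codeg n (insert e E) u v) - real (mixed_codeg n E u v)\<bar>) \<le>
    real (open_codeg n E u v) + (\<Sum>w\<in>?A. closers n E u w)" .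
qed

text \<open>A pair uw is closed through an endpoint shared with xy. If that is w there are at most
  two such w; only if it is u can many elements of the row go at once, and they all are neighbours
  of the other end.\<close>

lemma removed_row_subset:
  assumes "y \<in> opn n E x" "A \<subseteq> opn n E u"
  shows "{w \<in> A. {u, w} \<in> kills n E x y} \<subseteq> {x, y} \<union> (if u = x then A \<inter> nbr E y else if u = y then A \<inter> nbr E x else {})"
proof
  fix w assume "w \<in> {w \<in> A. {u, w} \<in> kills n E x y}"
  then have w: "w \<in> A" "{u, w} \<in> kills n E x y" by auto
  then have o: "{u, w} \<in> open_pairs n E" using assms by (auto simp: opn_def)
  have "x \<noteq> y" using opn_less[OF assms(1)] by blast
  then show "w \<in> {x, y} \<union> (if u = x then A \<inter> nbr E y else if u = y then A \<inter> nbr E x else {})"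
    using w kills_iff[OF o, of x y] by (auto simp: doubleton_eq_iff)
qed

lemma card_removed_row_le:
  assumes o: "y \<in> opn n E x" and A: "A \<subseteq> opn n E u"
    and b: "\<And>z. z \<in> {x, y} \<Longrightarrow> {u, z} = {x, y} \<Longrightarrow> card (A \<inter> nbr E z) \<le> b"
  shows "card {w \<in> A. {u, w} \<in> kills n E x y} \<le> 2 + b"
proof -
  let ?B = "if u = x then A \<inter> nbr E y else if u = y then A \<inter> nbr E x else {}"
  have fA: "finite A" using A by (rule finite_subset) simp
  have "card {w \<in> A. {u, w} \<in> kills n E x y} \<le> card ({x, y} \<union> ?B)"
    by (rule card_mono[OF _ removed_row_subset[OF o A]]) (use fA in auto)
  also have "\<dots> \<le> card {x, y} + card ?B" by (rule card_Un_le)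
  also have "card ?B \<le> b" using b[of y] b[of x] by (auto simp: insert_commute)
  also have "card {x, y} \<le> 2" by (simp add: card_insert_if)
  finally show ?thesis by simp
qed

text \<open>Many cherries die together only for a choice ua with a different from v, and their
  middle vertices then lie in the common neighbourhood of a and v. This is why plain codegrees have
  to be kept below some z.\<close>

lemma mixed_jump:
  assumes V: "valid n E" and uv: "u \<noteq> v" "v \<notin> nbr E u"
    and e: "e \<in> open_pairs n E" "e \<noteq> {u, v}"
    and z: "\<And>x. x \<noteq> v \<Longrightarrow> codeg E x v \<le> z"
  shows "\<bar>real (mixed_codeg n (insert e E) u v) - real (mixed_codeg n E u v)\<bar> \<le> 2 + real z"
proof -
  let ?A = "opn n E u \<inter> nbr E v"
  obtain x y where xy: "e = {x, y}" "y \<in> opn n E x" "x \<in> opn n E y" "x \<noteq> y"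
    using e(1) by (rule open_pair_cases)
  have "card {w \<in> ?A. {u, w} \<in> kills n E x y} \<le> 2 + z"
  proof (rule card_removed_row_le[OF xy(2)])
    fix a assume a: "a \<in> {x, y}" "{u, a} = {x, y}"
    then have "a \<noteq> v" using e xy(1) by auto
    have "card (?A \<inter> nbr E a) \<le> codeg E a v"
      unfolding codeg_def by (rule card_mono) (use finite_nbr[OF V] in auto)
    also have "\<dots> \<le> z" by (rule z[OF \<open>a \<noteq> v\<close>])
    finally show "card (?A \<inter> nbr E a) \<le> z" .
  qed auto
  moreover have "card {w \<in> opn n E u \<inter> opn n E v. e = {v, w}} \<le> 1"
  proof -
    have "w = w'" if "e = {v, w}" "e = {v, w'}" for w w' using that by (auto simp: doubleton_eq_iff)
    then obtain b where "{w \<in> opn n E u \<inter> opn n E v. e = {v, w}} \<subseteq> {b}" by blast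
    then have "card {w \<in> opn n E u \<inter> opn n E v. e = {v, w}} \<le> card {b}" by (intro card_mono) auto
    then show ?thesis by simp
  qed
  ultimately show ?thesis using mixed_step[OF V uv e] by (simp add: xy(1))
qed

section \<open>One-step change of open degrees, open codegrees and codegrees\<close>

lemma row_step:
  assumes V: "valid n E" and e: "e \<in> open_pairs n E"
  shows "opn n (insert e E) u = {w \<in> opn n E u. {u, w} \<notin> killset n E e}"
proof -
  obtain x y where xy: "e = {x, y}" "y \<in> opn n E x" "x \<in> opn n E y" "x \<noteq> y"
    using e by (rule open_pair_cases)
  show ?thesis using opn_insert[OF V xy(2), of u] by (simp add: xy(1))
qed

lemma open_deg_step:
  assumes V: "valid n E" and e: "e \<in> open_pairs n E"
  shows "real (open_deg n (insert e E) u) - real (open_deg n E u) =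
    - real (card {w \<in> opn n E u. {u, w} \<in> killset n E e})"
  unfolding open_deg_def row_step[OF assms] by (subst card_split_filter) auto

lemma open_deg_drift:
  assumes V: "valid n E"
  shows "(\<Sum>e\<in>open_pairs n E. real (open_deg n (insert e E) u) - real (open_deg n E u)) =
      - (\<Sum>w\<in>opn n E u. closers n E u w)"
    and "(\<Sum>e\<in>open_pairs n E. \<bar>real (open_deg n (insert e E) u) - real (open_deg n E u)\<bar>) \<le>
      (\<Sum>w\<in>opn n E u. closers n E u w)"
  using sum_removed_all[OF V order_refl, of u]
  by (simp_all add: open_deg_step[OF V] sum_negf)

lemma removed_row_bound:
  assumes V: "valid n E" and e: "e \<in> open_pairs n E" and A: "A \<subseteq> opn n E u"
    and b: "\<And>y. y \<noteq> u \<Longrightarrow> mixed_codeg n E u y \<le> b"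
  shows "card {w \<in> A. {u, w} \<in> killset n E e} \<le> 2 + b"
proof -
  obtain x y where xy: "e = {x, y}" "y \<in> opn n E x" "x \<in> opn n E y" "x \<noteq> y"
    using e by (rule open_pair_cases)
  have "card {w \<in> A. {u, w} \<in> kills n E x y} \<le> 2 + b"
  proof (rule card_removed_row_le[OF xy(2) A])
    fix a assume a: "a \<in> {x, y}" "{u, a} = {x, y}"
    have "a \<noteq> u" using a xy(4) by auto
    have "card (A \<inter> nbr E a) \<le> mixed_codeg n E u a"
      unfolding mixed_codeg_def by (rule card_mono) (use A in auto)
    also have "\<dots> \<le> b" by (rule b[OF \<open>a \<noteq> u\<close>])
    finally show "card (A \<inter> nbr E a) \<le> b" .
  qed
  then show ?thesis by (simp add: xy(1))
qed

lemma open_deg_jump: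
  assumes V: "valid n E" and e: "e \<in> open_pairs n E"
    and b: "\<And>y. y \<noteq> u \<Longrightarrow> mixed_codeg n E u y \<le> b"
  shows "\<bar>real (open_deg n (insert e E) u) - real (open_deg n E u)\<bar> \<le> 2 + real b"
  using removed_row_bound[OF V e order_refl b] unfolding open_deg_step[OF V e] by simp

lemma open_codeg_step:
  assumes V: "valid n E" and e: "e \<in> open_pairs n E"
  shows "real (open_codeg n (insert e E) u v) - real (open_codeg n E u v) =
    - (real (card {w \<in> opn n E u \<inter> opn n E v. {u, w} \<in> killset n E e})
     + real (card {w \<in> opn n E u \<inter> opn n E v. {v, w} \<in> killset n E e})
     - real (card {w \<in> opn n E u \<inter> opn n E v. {u, w} \<in> killset n E e \<and> {v, w} \<in> killset n E e}))"
proof -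
  let ?X = "opn n E u \<inter> opn n E v"
  have s: "opn n (insert e E) u \<inter> opn n (insert e E) v =
      {w \<in> ?X. \<not> ({u, w} \<in> killset n E e \<or> {v, w} \<in> killset n E e)}"
    unfolding row_step[OF assms] by blast
  let ?P = "{w \<in> ?X. {u, w} \<in> killset n E e}" and ?Q = "{w \<in> ?X. {v, w} \<in> killset n E e}"
  have e1: "?P \<union> ?Q = {w \<in> ?X. {u, w} \<in> killset n E e \<or> {v, w} \<in> killset n E e}" by blast
  have e2: "?P \<inter> ?Q = {w \<in> ?X. {u, w} \<in> killset n E e \<and> {v, w} \<in> killset n E e}" by blast
  have "card ?P + card ?Q = card (?P \<union> ?Q) + card (?P \<inter> ?Q)"
    by (rule card_Un_Int) auto
  then have c: "real (card ?P) + real (card ?Q) =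
      real (card {w \<in> ?X. {u, w} \<in> killset n E e \<or> {v, w} \<in> killset n E e}) +
      real (card {w \<in> ?X. {u, w} \<in> killset n E e \<and> {v, w} \<in> killset n E e})"
    unfolding e1 e2 by linarith
  have "real (card {w \<in> ?X. \<not> ({u, w} \<in> killset n E e \<or> {v, w} \<in> killset n E e)}) =
      real (card ?X) - real (card {w \<in> ?X. {u, w} \<in> killset n E e \<or> {v, w} \<in> killset n E e})"
    by (rule card_split_filter) simp
  then show ?thesis using c unfolding open_codeg_def s by linarith
qed

text \<open>A choice closing both uw and vw must contain w: otherwise there would be a loop, or an
  edge among u, v, w, against openness and the nonadjacency of u and v. So there are at most
  \<open>codeg E u v\<close> double losses per w, a negligible number.\<close>

lemma killed_twice:
  assumes V: "valid n E" and uv: "u \<noteq> v" "v \<notin> nbr E u"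
    and w: "w \<in> opn n E u" "w \<in> opn n E v" and o: "y \<in> opn n E x"
    and k: "{u, w} \<in> kills n E x y" "{v, w} \<in> kills n E x y"
  shows "{x, y} \<in> (\<lambda>a. {w, a}) ` (nbr E u \<inter> nbr E v)"
proof -
  have ou: "{u, w} \<in> open_pairs n E" and ov: "{v, w} \<in> open_pairs n E" using w by (auto simp: opn_def)
  have ne: "u \<noteq> w" "v \<noteq> w" "x \<noteq> y" using opn_less[OF w(1)] opn_less[OF w(2)] opn_less[OF o] by auto
  have na: "u \<notin> nbr E v" "w \<notin> nbr E u" "w \<notin> nbr E v" "u \<notin> nbr E w" "v \<notin> nbr E w"
    using uv w opn_iff[OF V] nbr_sym by blast+
  have "u \<notin> nbr E u" "v \<notin> nbr E v" "w \<notin> nbr E w" using valid_nbr(3)[OF V] by blast+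
  then have "(x = w \<and> u \<in> nbr E y \<and> v \<in> nbr E y) \<or> (y = w \<and> u \<in> nbr E x \<and> v \<in> nbr E x)"
    using k[unfolded kills_iff[OF ou] kills_iff[OF ov]] ne na uv by (auto simp: doubleton_eq_iff)
  then show ?thesis
  proof
    assume "x = w \<and> u \<in> nbr E y \<and> v \<in> nbr E y"
    moreover from this have "y \<in> nbr E u \<inter> nbr E v" using nbr_sym by blast
    ultimately show ?thesis by auto
  next
    assume "y = w \<and> u \<in> nbr E x \<and> v \<in> nbr E x"
    moreover from this have "x \<in> nbr E u \<inter> nbr E v" using nbr_sym by blast
    ultimately show ?thesis by (metis imageI insert_commute)
  qed
qed

text \<open>A common open neighbour w is lost when uw or vw is closed. Adding the two rates counts
  double losses twice, and \<open>killed_twice\<close> bounds this excess; hence the gap between the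
  first two bounds.\<close>

lemma open_codeg_drift:
  assumes V: "valid n E" and uv: "u \<noteq> v" "v \<notin> nbr E u"
  defines "S \<equiv> (\<Sum>w\<in>opn n E u \<inter> opn n E v. closers n E u w + closers n E v w)"
  shows "(\<Sum>e\<in>open_pairs n E. real (open_codeg n (insert e E) u v) - real (open_codeg n E u v)) \<ge> - S"
    and "(\<Sum>e\<in>open_pairs n E. real (open_codeg n (insert e E) u v) - real (open_codeg n E u v)) \<le>
      - S + real (open_codeg n E u v) * real (codeg E u v)"
    and "(\<Sum>e\<in>open_pairs n E. \<bar>real (open_codeg n (insert e E) u v) - real (open_codeg n E u v)\<bar>) \<le> S"
proof -
  let ?X = "opn n E u \<inter> opn n E v" and ?O = "open_pairs n E"
  let ?a = "\<lambda>e. real (card {w \<in> ?X. {u, w} \<in> killset n E e})"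
  let ?b = "\<lambda>e. real (card {w \<in> ?X. {v, w} \<in> killset n E e})"
  let ?c = "\<lambda>e. real (card {w \<in> ?X. {u, w} \<in> killset n E e \<and> {v, w} \<in> killset n E e})"
  have a: "sum ?a ?O = (\<Sum>w\<in>?X. closers n E u w)" by (rule sum_removed_all[OF V]) auto
  have b: "sum ?b ?O = (\<Sum>w\<in>?X. closers n E v w)" by (rule sum_removed_all[OF V]) auto
  have c0: "?c e \<ge> 0" "?c e \<le> ?a e" for e by (auto intro: card_mono)
  have "(\<Sum>e\<in>?O. card {w \<in> ?X. {u, w} \<in> killset n E e \<and> {v, w} \<in> killset n E e}) =
      (\<Sum>e\<in>?O. \<Sum>w\<in>?X. if {u, w} \<in> killset n E e \<and> {v, w} \<in> killset n E e then 1 else 0)"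
    by (intro sum.cong refl card_filter_sum) simp
  also have "\<dots> = (\<Sum>w\<in>?X. \<Sum>e\<in>?O. if {u, w} \<in> killset n E e \<and> {v, w} \<in> killset n E e then 1 else 0)"
    by (rule sum.swap)
  also have "\<dots> = (\<Sum>w\<in>?X. card {e \<in> ?O. {u, w} \<in> killset n E e \<and> {v, w} \<in> killset n E e})"
    by (intro sum.cong refl card_filter_sum[symmetric]) simp
  also have "\<dots> \<le> (\<Sum>w\<in>?X. codeg E u v)"
  proof (rule sum_mono)
    fix w assume w: "w \<in> ?X"
    have "{e \<in> ?O. {u, w} \<in> killset n E e \<and> {v, w} \<in> killset n E e} \<subseteq> (\<lambda>a. {w, a}) ` (nbr E u \<inter> nbr E v)"
    proof
      fix e assume e: "e \<in> {e \<in> ?O. {u, w} \<in> killset n E e \<and> {v, w} \<in> killset n E e}"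
      then have "e \<in> ?O" by simp
      then obtain x y where xy: "e = {x, y}" "y \<in> opn n E x" "x \<in> opn n E y" "x \<noteq> y"
        by (rule open_pair_cases)
      then show "e \<in> (\<lambda>a. {w, a}) ` (nbr E u \<inter> nbr E v)"
        using killed_twice[OF V uv, of w y x] w e by simp
    qed
    then have "card {e \<in> ?O. {u, w} \<in> killset n E e \<and> {v, w} \<in> killset n E e} \<le> card ((\<lambda>a. {w, a}) ` (nbr E u \<inter> nbr E v))"
      by (rule card_mono[rotated]) (use finite_nbr[OF V] in simp)
    also have "\<dots> \<le> codeg E u v" unfolding codeg_def by (rule card_image_le) (use finite_nbr[OF V] in simp)
    finally show "card {e \<in> ?O. {u, w} \<in> killset n E e \<and> {v, w} \<in> killset n E e} \<le> codeg E u v" .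
  qed
  also have "\<dots> = open_codeg n E u v * codeg E u v" by (simp add: open_codeg_def)
  finally have "real (\<Sum>e\<in>?O. card {w \<in> ?X. {u, w} \<in> killset n E e \<and> {v, w} \<in> killset n E e}) \<le>
     real (open_codeg n E u v * codeg E u v)" by (rule of_nat_mono)
  then have c: "sum ?c ?O \<le> real (open_codeg n E u v) * real (codeg E u v)" by simp
  have S: "S = sum ?a ?O + sum ?b ?O" unfolding S_def a b by (simp add: sum.distrib)
  have st: "(\<Sum>e\<in>?O. real (open_codeg n (insert e E) u v) - real (open_codeg n E u v)) =
      - (sum ?a ?O + sum ?b ?O - sum ?c ?O)"
    by (simp add: open_codeg_step[OF V] sum_negf sum.distrib sum_subtractf)
  have "sum ?c ?O \<ge> 0" by (rule sum_nonneg) simp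
  with st S c show "(\<Sum>e\<in>?O. real (open_codeg n (insert e E) u v) - real (open_codeg n E u v)) \<ge> - S"
    and "(\<Sum>e\<in>?O. real (open_codeg n (insert e E) u v) - real (open_codeg n E u v)) \<le>
      - S + real (open_codeg n E u v) * real (codeg E u v)" by linarith+
  have "(\<Sum>e\<in>?O. \<bar>real (open_codeg n (insert e E) u v) - real (open_codeg n E u v)\<bar>) \<le> (\<Sum>e\<in>?O. ?a e + ?b e)"
  proof (rule sum_mono)
    fix e assume "e \<in> ?O"
    then show "\<bar>real (open_codeg n (insert e E) u v) - real (open_codeg n E u v)\<bar> \<le> ?a e + ?b e"
      using open_codeg_step[OF V, of e u v] c0[of e] by linarith
  qed
  then show "(\<Sum>e\<in>?O. \<bar>real (open_codeg n (insert e E) u v) - real (open_codeg n E u v)\<bar>) \<le> S"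
    unfolding S sum.distrib .
qed

lemma open_codeg_jump:
  assumes V: "valid n E" and e: "e \<in> open_pairs n E"
    and b: "\<And>x y. x \<noteq> y \<Longrightarrow> mixed_codeg n E x y \<le> b"
  shows "\<bar>real (open_codeg n (insert e E) u v) - real (open_codeg n E u v)\<bar> \<le> 4 + 2 * real b"
proof -
  let ?X = "opn n E u \<inter> opn n E v"
  have "card {w \<in> ?X. {u, w} \<in> killset n E e} \<le> 2 + b" "card {w \<in> ?X. {v, w} \<in> killset n E e} \<le> 2 + b"
    by (rule removed_row_bound[OF V e]; use b in auto)+
  moreover have "card {w \<in> ?X. {u, w} \<in> killset n E e \<and> {v, w} \<in> killset n E e} \<le> card {w \<in> ?X. {u, w} \<in> killset n E e}"
    by (rule card_mono) auto
  ultimately show ?thesis unfolding open_codeg_step[OF V e] by linarith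
qed

text \<open>The chosen pair has to be the missing side of a cherry between u and v whose other side
  is an edge, and it determines the middle vertex, so at most one common neighbour is new.\<close>

lemma codeg_step:
  assumes V: "valid n E" and uv: "u \<noteq> v" and e: "e \<in> open_pairs n E"
  shows "codeg (insert e E) u v \<le> codeg E u v +
    (if e \<in> (\<lambda>w. {u, w}) ` (opn n E u \<inter> nbr E v) \<union> (\<lambda>w. {v, w}) ` (opn n E v \<inter> nbr E u) then 1 else 0)"
proof -
  obtain x y where xy: "e = {x, y}" "y \<in> opn n E x" "x \<in> opn n E y" "x \<noteq> y"
    using e by (rule open_pair_cases)
  have fin: "finite (nbr E u \<inter> nbr E v)" using finite_nbr[OF V] by blast
  let ?P = "e \<in> (\<lambda>w. {u, w}) ` (opn n E u \<inter> nbr E v) \<union> (\<lambda>w. {v, w}) ` (opn n E v \<inter> nbr E u)"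
  have "\<exists>b. nbr (insert e E) u \<inter> nbr (insert e E) v \<subseteq> (nbr E u \<inter> nbr E v) \<union> (if ?P then {b} else {})"
  proof -
    have a: "w \<in> nbr E u \<inter> nbr E v \<or> (w \<in> nbr E v \<and> e = {u, w}) \<or> (w \<in> nbr E u \<and> e = {v, w})"
      if "w \<in> nbr (insert e E) u \<inter> nbr (insert e E) v" for w
      using that uv unfolding xy(1) nbr_insert by (auto simp: doubleton_eq_iff split: if_splits)
    have b: ?P if "w \<in> nbr E v" "e = {u, w}" for w
      using that e by (auto simp: opn_def)
    have c: ?P if "w \<in> nbr E u" "e = {v, w}" for w
      using that e by (auto simp: opn_def)
    show ?thesis
    proof (cases ?P)
      case False
      then have "nbr (insert e E) u \<inter> nbr (insert e E) v \<subseteq> nbr E u \<inter> nbr E v"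
        using a b c by blast
      then show ?thesis using False by auto
    next
      case True
      have "\<exists>b. nbr (insert e E) u \<inter> nbr (insert e E) v \<subseteq> (nbr E u \<inter> nbr E v) \<union> {b}"
      proof (cases "\<exists>w. e = {u, w}")
        case True
        then obtain w where w: "e = {u, w}" by blast
        have "w' = w" if "e = {u, w'}" for w' using that w by (auto simp: doubleton_eq_iff)
        moreover have "\<not> (w' \<in> nbr E u \<and> e = {v, w'})" for w'
          using w uv valid_nbr(3)[OF V] by (auto simp: doubleton_eq_iff)
        ultimately show ?thesis using a by blast
      next
        case F: False
        show ?thesis
        proof (cases "\<exists>w. e = {v, w}")
          case True
          then obtain w where w: "e = {v, w}" by blast
          have "w' = w" if "e = {v, w'}" for w' using that w by (auto simp: doubleton_eq_iff)
          then show ?thesis using a F by blast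
        next
          case False
          then show ?thesis using a F by blast
        qed
      qed
      then show ?thesis using True by simp
    qed
  qed
  then obtain b where b: "nbr (insert e E) u \<inter> nbr (insert e E) v \<subseteq> (nbr E u \<inter> nbr E v) \<union> (if ?P then {b} else {})" ..
  have "codeg (insert e E) u v \<le> card ((nbr E u \<inter> nbr E v) \<union> (if ?P then {b} else {}))"
    unfolding codeg_def by (rule card_mono[OF _ b]) (use fin in auto)
  also have "\<dots> \<le> codeg E u v + card (if ?P then {b} else {})" unfolding codeg_def by (rule card_Un_le)
  also have "card (if ?P then {b} else {}) = (if ?P then 1 else 0)" by simp
  finally show ?thesis .
qed

lemma codeg_event_card:
  "card (open_pairs n E \<inter> ((\<lambda>w. {u, w}) ` (opn n E u \<inter> nbr E v) \<union> (\<lambda>w. {v, w}) ` (opn n E v \<inter> nbr E u)))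
    \<le> mixed_codeg n E u v + mixed_codeg n E v u"
proof -
  have "card (open_pairs n E \<inter> ((\<lambda>w. {u, w}) ` (opn n E u \<inter> nbr E v) \<union> (\<lambda>w. {v, w}) ` (opn n E v \<inter> nbr E u)))
    \<le> card ((\<lambda>w. {u, w}) ` (opn n E u \<inter> nbr E v) \<union> (\<lambda>w. {v, w}) ` (opn n E v \<inter> nbr E u))"
    by (rule card_mono) auto
  also have "\<dots> \<le> card ((\<lambda>w. {u, w}) ` (opn n E u \<inter> nbr E v)) + card ((\<lambda>w. {v, w}) ` (opn n E v \<inter> nbr E u))"
    by (rule card_Un_le)
  also have "\<dots> \<le> mixed_codeg n E u v + mixed_codeg n E v u"
    unfolding mixed_codeg_def by (intro add_mono card_image_le) auto
  finally show ?thesis .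
qed

text \<open>For w adjacent to v, the vertex v is a common neighbour of u and w, so uw is
  closed.\<close>

lemma mixed_codeg_adjacent:
  assumes V: "valid n E" and "v \<in> nbr E u" shows "mixed_codeg n E u v = 0"
proof -
  have "w \<notin> opn n E u" if "w \<in> nbr E v" for w
  proof -
    have "v \<in> nbr E w" using that nbr_sym by blast
    then show ?thesis using assms opn_iff[OF V] by blast
  qed
  then have "opn n E u \<inter> nbr E v = {}" by blast
  then show ?thesis by (simp add: mixed_codeg_def)
qed

lemma sum_open_deg:
  "(\<Sum>u<n. open_deg n E u) = card {(u, w). w \<in> opn n E u}"
  "card {(u, w). w \<in> opn n E u} = 2 * nopen n E"
proof -
  have s: "{(u, w). w \<in> opn n E u} = Sigma {..<n} (opn n E)" using opn_less by auto
  show "(\<Sum>u<n. open_deg n E u) = card {(u, w). w \<in> opn n E u}"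
    unfolding s open_deg_def by (simp add: card_SigmaI)
  have fin: "finite {(u, w). w \<in> opn n E u}" unfolding s by simp
  have "card {(u, w). w \<in> opn n E u} = card (\<Union>e\<in>open_pairs n E. {(u, w). e = {u, w}})"
    by (rule arg_cong[of _ _ card]) (auto simp: opn_def)
  also have "\<dots> = (\<Sum>e\<in>open_pairs n E. card {(u, w). e = {u, w}})"
  proof (rule card_UN_disjoint)
    show "\<forall>e\<in>open_pairs n E. finite {(u, w). e = {u, w}}"
    proof
      fix e assume "e \<in> open_pairs n E"
      then have "{(u, w). e = {u, w}} \<subseteq> {(u, w). w \<in> opn n E u}" by (auto simp: opn_def)
      then show "finite {(u, w). e = {u, w}}" using fin by (rule finite_subset)
    qed
  qed auto
  also have "\<dots> = (\<Sum>e\<in>open_pairs n E. 2)"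
  proof (rule sum.cong[OF refl])
    fix e assume "e \<in> open_pairs n E"
    then obtain x y where xy: "e = {x, y}" "x \<noteq> y" by (rule open_pairs_E)
    then have "{(u, w). e = {u, w}} = {(x, y), (y, x)}" by (auto simp: doubleton_eq_iff)
    then show "card {(u, w). e = {u, w}} = 2" using xy by simp
  qed
  finally show "card {(u, w). w \<in> opn n E u} = 2 * nopen n E" by (simp add: nopen_def)
qed

section \<open>Bounds in l to the M and discrepancy\<close>

text \<open>The l^M norm of f over I is at most A, stated through M-th powers so that no roots
  occur; the sign of A is fixed separately because an even power does not see it.\<close>

definition lpb :: "nat \<Rightarrow> 'a set \<Rightarrow> ('a \<Rightarrow> real) \<Rightarrow> real \<Rightarrow> bool" where
  "lpb M I f A \<longleftrightarrow> 0 \<le> A \<and> (\<Sum>x\<in>I. \<bar>f x\<bar> ^ M) \<le> A ^ M"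

lemma lpb_nonneg: "lpb M I f A \<Longrightarrow> 0 \<le> A" by (simp add: lpb_def)

lemma lpb_mono: "lpb M I f A \<Longrightarrow> A \<le> B \<Longrightarrow> lpb M I f B"
  unfolding lpb_def by (meson order_trans power_mono)

lemma lpb_abs_le:
  assumes "lpb M I f A" "\<And>x. x \<in> I \<Longrightarrow> \<bar>g x\<bar> \<le> \<bar>f x\<bar>"
  shows "lpb M I g A"
proof -
  have "(\<Sum>x\<in>I. \<bar>g x\<bar> ^ M) \<le> (\<Sum>x\<in>I. \<bar>f x\<bar> ^ M)"
    by (intro sum_mono power_mono assms(2)) auto
  then show ?thesis using assms(1) by (auto simp: lpb_def)
qed

lemma lpb_cong: "lpb M I f A \<Longrightarrow> (\<And>x. x \<in> I \<Longrightarrow> g x = f x) \<Longrightarrow> lpb M I g A"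
  by (erule lpb_abs_le) simp

lemma lpb_subset:
  assumes "lpb M I f A" "J \<subseteq> I" "finite I" shows "lpb M J f A"
proof -
  have "(\<Sum>x\<in>J. \<bar>f x\<bar> ^ M) \<le> (\<Sum>x\<in>I. \<bar>f x\<bar> ^ M)"
    by (rule sum_mono2) (use assms in auto)
  then show ?thesis using assms(1) by (auto simp: lpb_def)
qed

lemma lpb_scale: "lpb M I f A \<Longrightarrow> lpb M I (\<lambda>x. c * f x) (\<bar>c\<bar> * A)"
  by (auto simp: lpb_def power_mult_distrib abs_mult simp flip: sum_distrib_left intro!: mult_left_mono)

lemma lpb_uminus: "lpb M I f A \<Longrightarrow> lpb M I (\<lambda>x. - f x) A"
  by (erule lpb_abs_le) simp

text \<open>N stands for an upper bound on |I|^(1/M), the price of passing from a pointwise bound to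
  l^M. On pairs of vertices it is n^(2/M), a small power of n for large M.\<close>

lemma lpb_pointwise:
  assumes "\<And>x. x \<in> I \<Longrightarrow> \<bar>f x\<bar> \<le> a" "0 \<le> a" "real (card I) \<le> N ^ M" "0 \<le> N"
  shows "lpb M I f (a * N)"
proof -
  have "(\<Sum>x\<in>I. \<bar>f x\<bar> ^ M) \<le> (\<Sum>x\<in>I. a ^ M)"
    by (intro sum_mono power_mono assms(1)) auto
  also have "\<dots> = a ^ M * real (card I)" by simp
  also have "\<dots> \<le> a ^ M * N ^ M" using assms by (intro mult_left_mono) auto
  finally show ?thesis using assms by (simp add: lpb_def power_mult_distrib)
qed

lemma lpb_sup:
  assumes "lpb M I f A" "finite I" "x \<in> I" "0 < M" shows "\<bar>f x\<bar> \<le> A"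
proof -
  have "\<bar>f x\<bar> ^ M \<le> (\<Sum>x\<in>I. \<bar>f x\<bar> ^ M)"
    by (rule member_le_sum) (use assms in auto)
  also have "\<dots> \<le> A ^ M" using assms(1) by (simp add: lpb_def)
  finally show ?thesis using assms power_mono_iff[of "\<bar>f x\<bar>" A M] lpb_nonneg[OF assms(1)] by auto
qed

lemma convex_pow_two:
  fixes x y u v :: real
  assumes "even M" "0 \<le> u" "0 \<le> v" "u + v = 1"
  shows "(u * x + v * y) ^ M \<le> u * x ^ M + v * y ^ M"
proof -
  have u: "u = 1 - v" using assms by simp
  have "((1 - v) *\<^sub>R x + v *\<^sub>R y) ^ M \<le> (1 - v) * x ^ M + v * y ^ M"
    by (rule convex_onD[OF convex_power_even[OF assms(1)]]) (use assms in auto)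
  then show ?thesis unfolding u by simp
qed

text \<open>Minkowski's inequality from the convexity of x^M: f + g is A + B times the convex
  combination of f / A and g / B with weights A / (A + B) and B / (A + B). A zero bound forces a
  zero function and is treated apart.\<close>

lemma lpb_add:
  assumes f: "lpb M I f A" and g: "lpb M I g B" and M: "even M" "0 < M" and I: "finite I"
  shows "lpb M I (\<lambda>x. f x + g x) (A + B)"
proof -
  note A = lpb_nonneg[OF f] and B = lpb_nonneg[OF g]
  consider "A = 0" | "B = 0" | "A > 0" "B > 0" using A B by linarith
  then show ?thesis
  proof cases
    case 1
    have "f x = 0" if "x \<in> I" for x using lpb_sup[OF f I that M(2)] 1 by simp
    then show ?thesis using g 1 by (auto intro: lpb_cong)
  next
    case 2
    have "g x = 0" if "x \<in> I" for x using lpb_sup[OF g I that M(2)] 2 by simp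
    then show ?thesis using f 2 by (auto intro: lpb_cong)
  next
    case 3
    define u where "u = A / (A + B)"
    define v where "v = B / (A + B)"
    have uv: "0 \<le> u" "0 \<le> v" "u + v = 1"
      using 3 by (auto simp: u_def v_def add_divide_distrib[symmetric])
    have uA: "(A + B) * u = A" "(A + B) * v = B" using 3 by (auto simp: u_def v_def)
    have "\<bar>f x + g x\<bar> ^ M \<le> (A + B) ^ M * (u / A ^ M * \<bar>f x\<bar> ^ M + v / B ^ M * \<bar>g x\<bar> ^ M)" for x
    proof -
      have "f x + g x = (A + B) * (u * (f x / A) + v * (g x / B))"
        using 3 uA by (simp add: distrib_left mult.assoc[symmetric])
      then have "\<bar>f x + g x\<bar> ^ M = (A + B) ^ M * (u * (f x / A) + v * (g x / B)) ^ M"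
        using M by (simp add: power_mult_distrib power_even_abs)
      also have "\<dots> \<le> (A + B) ^ M * (u * (f x / A) ^ M + v * (g x / B) ^ M)"
        using 3 by (intro mult_left_mono convex_pow_two M uv) auto
      also have "\<dots> = (A + B) ^ M * (u / A ^ M * \<bar>f x\<bar> ^ M + v / B ^ M * \<bar>g x\<bar> ^ M)"
        using M by (simp add: power_divide power_even_abs)
      finally show ?thesis .
    qed
    then have "(\<Sum>x\<in>I. \<bar>f x + g x\<bar> ^ M) \<le> (\<Sum>x\<in>I. (A + B) ^ M * (u / A ^ M * \<bar>f x\<bar> ^ M + v / B ^ M * \<bar>g x\<bar> ^ M))"
      by (intro sum_mono)
    also have "\<dots> = (A + B) ^ M * (u / A ^ M * (\<Sum>x\<in>I. \<bar>f x\<bar> ^ M) + v / B ^ M * (\<Sum>x\<in>I. \<bar>g x\<bar> ^ M))"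
      by (simp add: sum_distrib_left sum.distrib ring_distribs)
    also have "\<dots> \<le> (A + B) ^ M * (u / A ^ M * A ^ M + v / B ^ M * B ^ M)"
      using f g 3 uv by (intro mult_left_mono add_mono) (auto simp: lpb_def)
    also have "\<dots> = (A + B) ^ M" using 3 uv by simp
    finally show ?thesis using 3 by (simp add: lpb_def)
  qed
qed

lemma lpb_diff:
  assumes "lpb M I f A" "lpb M I g B" "even M" "0 < M" "finite I"
  shows "lpb M I (\<lambda>x. f x - g x) (A + B)"
  using lpb_add[OF assms(1) lpb_uminus[OF assms(2)] assms(3-5)] by simp

lemma lpb_zero [simp]: "0 < M \<Longrightarrow> lpb M I (\<lambda>_. 0) 0"
  by (simp add: lpb_def power_0_left)

section \<open>Jensen's inequality, Schur test and averaging on l^M\<close>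

lemma sum_pow_le:
  fixes f :: "'a \<Rightarrow> real"
  assumes "finite S" "S \<noteq> {}" "even M"
  shows "((\<Sum>x\<in>S. f x) / card S) ^ M \<le> (\<Sum>x\<in>S. \<bar>f x\<bar> ^ M) / card S"
proof -
  have c: "card S > 0" using assms by auto
  have "(\<Sum>x\<in>S. (1 / card S) *\<^sub>R f x) ^ M \<le> (\<Sum>x\<in>S. (1 / card S) * f x ^ M)"
    by (rule convex_on_sum[OF assms(1,2) convex_power_even[OF assms(3)]]) (use c in auto)
  then show ?thesis using assms(3)
    by (simp add: sum_divide_distrib power_even_abs)
qed

text \<open>Schur test for a symmetric 0-1 kernel with row sums at most m: Jensen inside each row
  yields m^(M - 1), and by symmetry the column sums contribute the last factor m.\<close>

lemma lpb_schur:
  assumes f: "lpb M I f A" and I: "finite I" and M: "even M" "0 < M"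
    and P: "\<And>x. x \<in> I \<Longrightarrow> P x \<subseteq> I" and sym: "\<And>x y. x \<in> I \<Longrightarrow> y \<in> P x \<Longrightarrow> x \<in> P y"
    and m: "\<And>x. x \<in> I \<Longrightarrow> real (card (P x)) \<le> m" "0 \<le> m"
  shows "lpb M I (\<lambda>x. \<Sum>y\<in>P x. f y) (m * A)"
proof -
  have fin: "finite (P x)" if "x \<in> I" for x using P[OF that] I by (rule finite_subset)
  have pt: "\<bar>\<Sum>y\<in>P x. f y\<bar> ^ M \<le> m ^ (M - 1) * (\<Sum>y\<in>P x. \<bar>f y\<bar> ^ M)" if x: "x \<in> I" for x
  proof (cases "P x = {}")
    case True
    then show ?thesis using M by (simp add: power_0_left)
  next
    case False
    define k where "k = real (card (P x))"
    have k: "0 < k" "k \<le> m" using False fin[OF x] m(1)[OF x] by (auto simp: k_def card_gt_0_iff)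
    have "((\<Sum>y\<in>P x. f y) / k) ^ M \<le> (\<Sum>y\<in>P x. \<bar>f y\<bar> ^ M) / k"
      unfolding k_def by (rule sum_pow_le[OF fin[OF x] False M(1)])
    then have "\<bar>\<Sum>y\<in>P x. f y\<bar> ^ M \<le> k ^ M * ((\<Sum>y\<in>P x. \<bar>f y\<bar> ^ M) / k)"
      using k M by (simp add: power_divide power_even_abs field_simps)
    also have "\<dots> = k ^ (M - 1) * (\<Sum>y\<in>P x. \<bar>f y\<bar> ^ M)"
      using k power_minus_mult[OF M(2), of k, symmetric] by simp
    also have "\<dots> \<le> m ^ (M - 1) * (\<Sum>y\<in>P x. \<bar>f y\<bar> ^ M)"
      using k by (intro mult_right_mono power_mono sum_nonneg) auto
    finally show ?thesis .
  qed
  have "(\<Sum>x\<in>I. \<bar>\<Sum>y\<in>P x. f y\<bar> ^ M) \<le> (\<Sum>x\<in>I. m ^ (M - 1) * (\<Sum>y\<in>P x. \<bar>f y\<bar> ^ M))"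
    by (intro sum_mono pt)
  also have "\<dots> = m ^ (M - 1) * (\<Sum>x\<in>I. \<Sum>y\<in>P x. \<bar>f y\<bar> ^ M)"
    by (simp add: sum_distrib_left)
  also have "(\<Sum>x\<in>I. \<Sum>y\<in>P x. \<bar>f y\<bar> ^ M) = (\<Sum>x\<in>I. \<Sum>y | y \<in> I \<and> y \<in> P x. \<bar>f y\<bar> ^ M)"
    by (intro sum.cong refl) (use P in blast)
  also have "(\<Sum>x\<in>I. \<Sum>y | y \<in> I \<and> y \<in> P x. \<bar>f y\<bar> ^ M) = (\<Sum>y\<in>I. \<Sum>x | x \<in> I \<and> y \<in> P x. \<bar>f y\<bar> ^ M)"
    by (rule sum.swap_restrict) (use I in auto)
  also have "\<dots> = (\<Sum>y\<in>I. real (card {x \<in> I. y \<in> P x}) * \<bar>f y\<bar> ^ M)" by simp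
  also have "\<dots> \<le> (\<Sum>y\<in>I. m * \<bar>f y\<bar> ^ M)"
  proof (intro sum_mono mult_right_mono)
    fix y assume y: "y \<in> I"
    have "{x \<in> I. y \<in> P x} \<subseteq> P y" using sym by blast
    then have "real (card {x \<in> I. y \<in> P x}) \<le> real (card (P y))" using card_mono[OF fin[OF y]] by simp
    then show "real (card {x \<in> I. y \<in> P x}) \<le> m" using m(1)[OF y] by simp
  qed auto
  also have "\<dots> = m * (\<Sum>y\<in>I. \<bar>f y\<bar> ^ M)" by (simp add: sum_distrib_left)
  also have "m ^ (M - 1) * (m * (\<Sum>y\<in>I. \<bar>f y\<bar> ^ M)) \<le> m ^ (M - 1) * (m * A ^ M)"
    using f m by (intro mult_left_mono) (auto simp: lpb_def)
  also have "\<dots> = (m * A) ^ M" 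
    using power_minus_mult[OF M(2), of m] by (simp add: power_mult_distrib mult.assoc[symmetric])
  finally show ?thesis using f m by (auto simp: lpb_def mult_left_mono)
qed

text \<open>Averaging over the blocks of a partition is a conditional expectation, hence a
  contraction of l^M. The exact constant 1 matters later, where the averages occur with a damping
  factor.\<close>

lemma lpb_average:
  assumes f: "lpb M I f A" and I: "finite I" and M: "even M" "0 < M"
    and P: "\<And>x. x \<in> I \<Longrightarrow> P x \<subseteq> I" and refl: "\<And>x. x \<in> I \<Longrightarrow> x \<in> P x"
    and eqv: "\<And>x y. x \<in> I \<Longrightarrow> y \<in> P x \<Longrightarrow> P y = P x"
  shows "lpb M I (\<lambda>x. (\<Sum>y\<in>P x. f y) / card (P x)) A"
proof -
  have fin: "finite (P x)" if "x \<in> I" for x using P[OF that] I by (rule finite_subset)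
  have ne: "P x \<noteq> {}" if "x \<in> I" for x using refl[OF that] by blast
  have "(\<Sum>x\<in>I. \<bar>(\<Sum>y\<in>P x. f y) / card (P x)\<bar> ^ M) \<le> (\<Sum>x\<in>I. \<Sum>y | y \<in> I \<and> y \<in> P x. \<bar>f y\<bar> ^ M / card (P x))"
  proof (rule sum_mono)
    fix x assume x: "x \<in> I"
    have "\<bar>(\<Sum>y\<in>P x. f y) / card (P x)\<bar> ^ M \<le> (\<Sum>y\<in>P x. \<bar>f y\<bar> ^ M) / card (P x)"
      using sum_pow_le[OF fin[OF x] ne[OF x] M(1), of f] by (simp only: power_even_abs[OF M(1)])
    also have "P x = {y. y \<in> I \<and> y \<in> P x}" using P[OF x] by blast
    finally show "\<bar>(\<Sum>y\<in>P x. f y) / card (P x)\<bar> ^ M \<le> (\<Sum>y | y \<in> I \<and> y \<in> P x. \<bar>f y\<bar> ^ M / card (P x))"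
      using P[OF x] by (simp add: sum_divide_distrib Int_absorb1 Int_commute Collect_conj_eq)
  qed
  also have "\<dots> = (\<Sum>y\<in>I. \<Sum>x | x \<in> I \<and> y \<in> P x. \<bar>f y\<bar> ^ M / card (P x))"
    by (rule sum.swap_restrict) (use I in auto)
  also have "\<dots> = (\<Sum>y\<in>I. \<bar>f y\<bar> ^ M)"
  proof (rule sum.cong[OF HOL.refl])
    fix y assume y: "y \<in> I"
    have s: "{x. x \<in> I \<and> y \<in> P x} = P y"
    proof
      show "{x. x \<in> I \<and> y \<in> P x} \<subseteq> P y" using eqv refl by blast
      show "P y \<subseteq> {x. x \<in> I \<and> y \<in> P x}"
      proof
        fix x assume "x \<in> P y"
        then show "x \<in> {x. x \<in> I \<and> y \<in> P x}" using eqv[OF y, of x] refl[OF y] P[OF y] by auto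
      qed
    qed
    have "(\<Sum>x | x \<in> I \<and> y \<in> P x. \<bar>f y\<bar> ^ M / card (P x)) = (\<Sum>x\<in>P y. \<bar>f y\<bar> ^ M / card (P y))"
      unfolding s by (intro sum.cong HOL.refl) (use eqv[OF y] in auto)
    also have "\<dots> = \<bar>f y\<bar> ^ M" using fin[OF y] ne[OF y] by simp
    finally show "(\<Sum>x | x \<in> I \<and> y \<in> P x. \<bar>f y\<bar> ^ M / card (P x)) = \<bar>f y\<bar> ^ M" .
  qed
  also have "\<dots> \<le> A ^ M" using f by (simp add: lpb_def)
  finally show ?thesis using f by (simp add: lpb_def)
qed

text \<open>A kernel that is small between any two sets of comparable size is small on \<open>\<ell>\<^sup>M\<close>:
  first for indicator functions, by splitting at the level \<open>sqrt \<Theta>\<close>, then in general by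
  binary expansion.\<close>

lemma lpb_kernel_indicator:
  fixes b :: "'a \<Rightarrow> 'a \<Rightarrow> real"
  assumes I: "finite I" and M: "2 \<le> M" and R: "R \<subseteq> I"
    and rows: "\<And>x. x \<in> I \<Longrightarrow> (\<Sum>y\<in>I. \<bar>b x y\<bar>) \<le> \<rho>"
    and cols: "\<And>y. y \<in> I \<Longrightarrow> (\<Sum>x\<in>I. \<bar>b x y\<bar>) \<le> \<rho>"
    and disc: "\<And>S. S \<subseteq> I \<Longrightarrow> \<bar>\<Sum>x\<in>S. \<Sum>y\<in>R. b x y\<bar> \<le> \<rho> * \<mu>\<^sup>2 * (real (card S) + real (card R))"
    and lam: "0 < \<mu>" "\<mu> \<le> 1 / 2" and rho: "0 < \<rho>"
  shows "(\<Sum>x\<in>I. \<bar>\<Sum>y\<in>R. b x y\<bar> ^ M) \<le> \<rho> ^ M * (5 * \<mu>) * real (card R)"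
proof -
  let ?g = "\<lambda>x. \<Sum>y\<in>R. b x y"
  have finR: "finite R" using R I by (rule finite_subset)
  have g_abs: "\<bar>?g x\<bar> \<le> \<rho>" if "x \<in> I" for x
  proof -
    have "\<bar>?g x\<bar> \<le> (\<Sum>y\<in>R. \<bar>b x y\<bar>)" by (rule sum_abs)
    also have "\<dots> \<le> (\<Sum>y\<in>I. \<bar>b x y\<bar>)" by (rule sum_mono2) (use I R in auto)
    finally show ?thesis using rows[OF that] by simp
  qed
  \<comment> \<open>One sign at a time: on a level set S of height \<open>\<mu> * \<rho>\<close> the
    hypothesis gives |S| \<mu> \<rho> <= \<rho> \<mu>^2 (|S| + |R|), and \<mu> <= 1/2 absorbs the
    |S| on the right.\<close>
  have small: "real (card S) \<le> 2 * \<mu> * real (card R)"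
    if S: "S \<subseteq> I" and big: "real (card S) * (\<mu> * \<rho>) \<le> \<bar>\<Sum>x\<in>S. ?g x\<bar>" for S
  proof -
    have "\<rho> * (real (card S) * \<mu>) \<le> \<rho> * (\<mu>\<^sup>2 * (real (card S) + real (card R)))"
      using big disc[OF S] by (simp add: mult_ac)
    then have "real (card S) * \<mu> \<le> \<mu>\<^sup>2 * (real (card S) + real (card R))" using rho by simp
    then have "\<mu> * real (card S) \<le> \<mu> * (\<mu> * (real (card S) + real (card R)))"
      by (simp add: power2_eq_square mult_ac)
    then have "real (card S) \<le> \<mu> * (real (card S) + real (card R))" using lam by simp
    moreover have "\<mu> * real (card S) \<le> 1 / 2 * real (card S)" using lam by (intro mult_right_mono) auto
    ultimately show ?thesis by (simp add: algebra_simps)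
  qed
  define Sp where "Sp = {x \<in> I. ?g x > \<mu> * \<rho>}"
  define Sm where "Sm = {x \<in> I. ?g x < - (\<mu> * \<rho>)}"
  have fs: "finite Sp" "finite Sm" using I by (auto simp: Sp_def Sm_def)
  have cp: "real (card Sp) \<le> 2 * \<mu> * real (card R)"
  proof (rule small)
    have "(\<Sum>x\<in>Sp. \<mu> * \<rho>) \<le> (\<Sum>x\<in>Sp. ?g x)" by (rule sum_mono) (auto simp: Sp_def)
    then show "real (card Sp) * (\<mu> * \<rho>) \<le> \<bar>\<Sum>x\<in>Sp. ?g x\<bar>" by simp
  qed (auto simp: Sp_def)
  have cm: "real (card Sm) \<le> 2 * \<mu> * real (card R)"
  proof (rule small)
    have "(\<Sum>x\<in>Sm. ?g x) \<le> (\<Sum>x\<in>Sm. - (\<mu> * \<rho>))" by (rule sum_mono) (auto simp: Sm_def)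
    then show "real (card Sm) * (\<mu> * \<rho>) \<le> \<bar>\<Sum>x\<in>Sm. ?g x\<bar>" by simp
  qed (auto simp: Sm_def)
  \<comment> \<open>Off both level sets all but one factor of |g|^M is bounded by \<mu> \<rho>, and
    the column sums control the l^1 norm. Adding the shares 2 \<mu>, 2 \<mu> and \<mu> gives the
    constant 5.\<close>
  define T where "T = I - (Sp \<union> Sm)"
  have T: "\<bar>?g x\<bar> ^ M \<le> \<mu> * \<rho> ^ (M - 1) * \<bar>?g x\<bar>" if "x \<in> T" for x
  proof -
    have a: "\<bar>?g x\<bar> \<le> \<mu> * \<rho>" using that by (auto simp: T_def Sp_def Sm_def)
    have "\<bar>?g x\<bar> ^ M = \<bar>?g x\<bar> ^ (M - 1) * \<bar>?g x\<bar>"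
      using power_minus_mult[of M "\<bar>?g x\<bar>"] M by simp
    also have "\<bar>?g x\<bar> ^ (M - 1) \<le> (\<mu> * \<rho>) ^ (M - 1)" by (rule power_mono[OF a]) simp
    also have "\<dots> = \<mu> ^ (M - 1) * \<rho> ^ (M - 1)" by (rule power_mult_distrib)
    also have "\<mu> ^ (M - 1) \<le> \<mu> ^ 1" by (rule power_decreasing) (use lam M in auto)
    finally show ?thesis using lam rho by (simp add: mult_right_mono)
  qed
  have l1: "(\<Sum>x\<in>T. \<bar>?g x\<bar>) \<le> \<rho> * real (card R)"
  proof -
    have "(\<Sum>x\<in>T. \<bar>?g x\<bar>) \<le> (\<Sum>x\<in>I. \<bar>?g x\<bar>)" by (rule sum_mono2) (use I in \<open>auto simp: T_def\<close>)
    also have "\<dots> \<le> (\<Sum>x\<in>I. \<Sum>y\<in>R. \<bar>b x y\<bar>)" by (intro sum_mono sum_abs)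
    also have "\<dots> = (\<Sum>y\<in>R. \<Sum>x\<in>I. \<bar>b x y\<bar>)" by (rule sum.swap)
    also have "\<dots> \<le> (\<Sum>y\<in>R. \<rho>)" by (intro sum_mono cols) (use R in auto)
    finally show ?thesis by (simp add: mult.commute)
  qed
  have Mr: "\<rho> ^ M = \<rho> ^ (M - 1) * \<rho>" using power_minus_mult[of M \<rho>] M by simp
  have SS: "(\<Sum>x\<in>S. \<bar>?g x\<bar> ^ M) \<le> \<rho> ^ M * real (card S)" if "S \<subseteq> I" for S
  proof -
    have "(\<Sum>x\<in>S. \<bar>?g x\<bar> ^ M) \<le> (\<Sum>x\<in>S. \<rho> ^ M)"
      by (intro sum_mono power_mono g_abs) (use that in auto)
    then show ?thesis by (simp add: mult.commute)
  qed
  have "(\<Sum>x\<in>I. \<bar>?g x\<bar> ^ M) = (\<Sum>x\<in>T. \<bar>?g x\<bar> ^ M) + (\<Sum>x\<in>Sp \<union> Sm. \<bar>?g x\<bar> ^ M)"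
    unfolding T_def by (rule sum.subset_diff) (use I in \<open>auto simp: Sp_def Sm_def\<close>)
  also have "(\<Sum>x\<in>Sp \<union> Sm. \<bar>?g x\<bar> ^ M) = (\<Sum>x\<in>Sp. \<bar>?g x\<bar> ^ M) + (\<Sum>x\<in>Sm. \<bar>?g x\<bar> ^ M)"
  proof (rule sum.union_disjoint[OF fs])
    have "0 < \<mu> * \<rho>" using lam rho by simp
    then show "Sp \<inter> Sm = {}" unfolding Sp_def Sm_def by force
  qed
  also have "\<dots> \<le> \<rho> ^ M * (2 * \<mu> * real (card R)) + \<rho> ^ M * (2 * \<mu> * real (card R))"
    by (intro add_mono order_trans[OF SS] mult_left_mono cp cm) (use rho in \<open>auto simp: Sp_def Sm_def\<close>)
  also have "(\<Sum>x\<in>T. \<bar>?g x\<bar> ^ M) \<le> (\<Sum>x\<in>T. \<mu> * \<rho> ^ (M - 1) * \<bar>?g x\<bar>)" by (rule sum_mono[OF T])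
  also have "\<dots> = \<mu> * \<rho> ^ (M - 1) * (\<Sum>x\<in>T. \<bar>?g x\<bar>)" by (simp add: sum_distrib_left)
  also have "\<dots> \<le> \<mu> * \<rho> ^ (M - 1) * (\<rho> * real (card R))"
    using l1 lam rho by (intro mult_left_mono) auto
  finally show ?thesis unfolding Mr by (simp add: algebra_simps)
qed

lemma lpb_kernel_nonneg:
  fixes b :: "'a \<Rightarrow> 'a \<Rightarrow> real"
  assumes I: "finite I" and M: "even M" "2 \<le> M"
    and rows: "\<And>x. x \<in> I \<Longrightarrow> (\<Sum>y\<in>I. \<bar>b x y\<bar>) \<le> \<rho>"
    and ind: "\<And>R. R \<subseteq> I \<Longrightarrow> (\<Sum>x\<in>I. \<bar>\<Sum>y\<in>R. b x y\<bar> ^ M) \<le> (\<rho> * g) ^ M * real (card R)"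
    and rho: "0 < \<rho>" and g: "0 \<le> g" and N: "real (card I) \<le> N ^ M" "0 \<le> N"
    and a: "0 < a" and f: "\<And>x. x \<in> I \<Longrightarrow> 0 \<le> f x \<and> f x \<le> a" and fA: "lpb M I f A"
  shows "lpb M I (\<lambda>x. \<Sum>y\<in>I. b x y * f y) (\<rho> * (g * real L * A * 2 + a * N / 2 ^ L))"
  using a f fA
proof (induction L arbitrary: a f)
  case 0
  have "\<bar>\<Sum>y\<in>I. b x y * f y\<bar> \<le> \<rho> * a" if "x \<in> I" for x
  proof -
    have "\<bar>\<Sum>y\<in>I. b x y * f y\<bar> \<le> (\<Sum>y\<in>I. \<bar>b x y * f y\<bar>)" by (rule sum_abs)
    also have "\<dots> \<le> (\<Sum>y\<in>I. \<bar>b x y\<bar> * a)"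
      by (intro sum_mono) (use 0 in \<open>auto simp: abs_mult intro!: mult_left_mono\<close>)
    also have "\<dots> = (\<Sum>y\<in>I. \<bar>b x y\<bar>) * a" by (simp add: sum_distrib_right)
    also have "\<dots> \<le> \<rho> * a" using rows[OF that] 0 by (intro mult_right_mono) auto
    finally show ?thesis .
  qed
  then have "lpb M I (\<lambda>x. \<Sum>y\<in>I. b x y * f y) (\<rho> * a * N)"
    by (rule lpb_pointwise) (use N rho 0 in auto)
  then show ?case by (simp add: mult.assoc)
next
  case (Suc L)
  \<comment> \<open>The leading binary digit of f at height a: subtracting a / 2 on R leaves a
    function with values in [0, a / 2]. After L rounds the rest is at most a / 2^L and the trivial
    row-sum bound is enough.\<close>
  define R where "R = {y \<in> I. f y \<ge> a / 2}"
  define f' where "f' y = f y - (if y \<in> R then a / 2 else 0)" for y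
  note A = lpb_nonneg[OF Suc.prems(3)]
  have R: "R \<subseteq> I" "finite R" using I by (auto simp: R_def)
  have f'0: "0 \<le> f' y \<and> f' y \<le> a / 2" if "y \<in> I" for y
    using Suc.prems(2)[OF that] that by (auto simp: f'_def R_def)
  have f'A: "lpb M I f' A"
    by (rule lpb_abs_le[OF Suc.prems(3)]) (use Suc.prems f'0 in \<open>force simp: f'_def\<close>)
  have IH: "lpb M I (\<lambda>x. \<Sum>y\<in>I. b x y * f' y) (\<rho> * (g * real L * A * 2 + a / 2 * N / 2 ^ L))"
    by (rule Suc.IH) (use f'0 f'A Suc.prems in auto)
  \<comment> \<open>Chebyshev's inequality for l^M: the level set is so small that the digit itself
    has norm at most A, so every layer costs the same.\<close>
  have cR: "real (card R) * (a / 2) ^ M \<le> A ^ M"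
  proof -
    have "real (card R) * (a / 2) ^ M = (\<Sum>x\<in>R. (a / 2) ^ M)" by simp
    also have "\<dots> \<le> (\<Sum>x\<in>R. \<bar>f x\<bar> ^ M)"
      by (intro sum_mono power_mono) (use Suc.prems in \<open>auto simp: R_def\<close>)
    also have "\<dots> \<le> (\<Sum>x\<in>I. \<bar>f x\<bar> ^ M)" by (rule sum_mono2) (use I R in auto)
    also have "\<dots> \<le> A ^ M" using Suc.prems by (simp add: lpb_def)
    finally show ?thesis .
  qed
  have h: "lpb M I (\<lambda>x. \<Sum>y\<in>R. b x y * (a / 2)) (\<rho> * g * A)"
  proof -
    have "(\<Sum>x\<in>I. \<bar>\<Sum>y\<in>R. b x y * (a / 2)\<bar> ^ M) = (a / 2) ^ M * (\<Sum>x\<in>I. \<bar>\<Sum>y\<in>R. b x y\<bar> ^ M)"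
    proof -
      have "\<bar>\<Sum>y\<in>R. b x y * (a / 2)\<bar> ^ M = (a / 2) ^ M * \<bar>\<Sum>y\<in>R. b x y\<bar> ^ M" for x
        using Suc.prems(1) unfolding sum_distrib_right[symmetric] abs_mult power_mult_distrib by simp
      then show ?thesis by (simp only: sum_distrib_left)
    qed
    also have "\<dots> \<le> (a / 2) ^ M * ((\<rho> * g) ^ M * real (card R))"
      by (intro mult_left_mono ind R) (use Suc.prems in auto)
    also have "\<dots> = (\<rho> * g) ^ M * (real (card R) * (a / 2) ^ M)" by simp
    also have "\<dots> \<le> (\<rho> * g) ^ M * A ^ M" by (rule mult_left_mono[OF cR]) (use rho g in auto)
    finally show ?thesis using A rho g by (simp add: lpb_def power_mult_distrib)
  qed
  have "lpb M I (\<lambda>x. (\<Sum>y\<in>I. b x y * f' y) + (\<Sum>y\<in>R. b x y * (a / 2)))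
    (\<rho> * (g * real L * A * 2 + a / 2 * N / 2 ^ L) + \<rho> * g * A)"
    by (rule lpb_add[OF IH h]) (use M I in auto)
  then have "lpb M I (\<lambda>x. \<Sum>y\<in>I. b x y * f y) (\<rho> * (g * real L * A * 2 + a / 2 * N / 2 ^ L) + \<rho> * g * A)"
  proof (rule lpb_cong)
    fix x
    have "(\<Sum>y\<in>R. b x y * (a / 2)) = (\<Sum>y\<in>I. b x y * (if y \<in> R then a / 2 else 0))"
      by (rule sum.mono_neutral_cong_left) (use I R in auto)
    then show "(\<Sum>y\<in>I. b x y * f y) = (\<Sum>y\<in>I. b x y * f' y) + (\<Sum>y\<in>R. b x y * (a / 2))"
      unfolding f'_def by (simp only: sum.distrib[symmetric] distrib_left[symmetric]) simp
  qed
  then show ?case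
  proof (rule lpb_mono)
    have "0 \<le> \<rho> * g * A" using rho g A by simp
    then show "\<rho> * (g * real L * A * 2 + a / 2 * N / 2 ^ L) + \<rho> * g * A \<le>
        \<rho> * (g * real (Suc L) * A * 2 + a * N / 2 ^ Suc L)"
      by (simp add: algebra_simps)
  qed
qed

lemma lpb_kernel:
  fixes b :: "'a \<Rightarrow> 'a \<Rightarrow> real"
  assumes I: "finite I" and M: "even M" "2 \<le> M"
    and rows: "\<And>x. x \<in> I \<Longrightarrow> (\<Sum>y\<in>I. \<bar>b x y\<bar>) \<le> \<rho>"
    and ind: "\<And>R. R \<subseteq> I \<Longrightarrow> (\<Sum>x\<in>I. \<bar>\<Sum>y\<in>R. b x y\<bar> ^ M) \<le> (\<rho> * g) ^ M * real (card R)"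
    and rho: "0 < \<rho>" and g: "0 \<le> g" and N: "real (card I) \<le> N ^ M" "0 \<le> N"
    and f: "lpb M I f A"
  shows "lpb M I (\<lambda>x. \<Sum>y\<in>I. b x y * f y) (\<rho> * (4 * g * real L + 2 * N / 2 ^ L) * A)"
proof (cases "A = 0")
  case True
  have "f x = 0" if "x \<in> I" for x using lpb_sup[OF f I that] M True by simp
  then show ?thesis using True M by (auto intro!: lpb_cong[OF lpb_zero] sum.neutral)
next
  case False
  then have A: "0 < A" using lpb_nonneg[OF f] by simp
  have b: "\<bar>f x\<bar> \<le> A" if "x \<in> I" for x using lpb_sup[OF f I that] M by simp
  let ?K = "\<rho> * (g * real L * A * 2 + A * N / 2 ^ L)"
  \<comment> \<open>The expansion can start at height A because the l^M bound dominates the sup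
    norm; the signed case costs a factor 2.\<close>
  have p: "lpb M I (\<lambda>x. \<Sum>y\<in>I. b x y * max 0 (f y)) ?K"
    by (rule lpb_kernel_nonneg[OF I M rows ind rho g N A]) (use b f A in \<open>force intro: lpb_abs_le[OF f]\<close>)+
  have m: "lpb M I (\<lambda>x. \<Sum>y\<in>I. b x y * max 0 (- f y)) ?K"
    by (rule lpb_kernel_nonneg[OF I M rows ind rho g N A]) (use b f A in \<open>force intro: lpb_abs_le[OF f]\<close>)+
  have "lpb M I (\<lambda>x. (\<Sum>y\<in>I. b x y * max 0 (f y)) - (\<Sum>y\<in>I. b x y * max 0 (- f y))) (?K + ?K)"
    by (rule lpb_diff[OF p m]) (use M I in auto)
  then have "lpb M I (\<lambda>x. \<Sum>y\<in>I. b x y * f y) (?K + ?K)"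
  proof (rule lpb_cong)
    fix x
    have "f y = max 0 (f y) - max 0 (- f y)" for y by simp
    then show "(\<Sum>y\<in>I. b x y * f y) = (\<Sum>y\<in>I. b x y * max 0 (f y)) - (\<Sum>y\<in>I. b x y * max 0 (- f y))"
      unfolding sum_subtractf[symmetric] right_diff_distrib[symmetric] by simp
  qed
  then show ?thesis by (rule lpb_mono) (simp add: algebra_simps)
qed

text \<open>Edges between S and R counted as ordered pairs: one inside the intersection counts
  twice.\<close>

definition ecount :: "nat set set \<Rightarrow> nat set \<Rightarrow> nat set \<Rightarrow> real" where
  "ecount E S R = (\<Sum>v\<in>S. real (card (R \<inter> nbr E v)))"

text \<open>An upper bound on all edge counts together with near-regularity forces discrepancy
  in both directions.\<close>

lemma link_discrepancy:
  fixes c t p \<Lambda> \<theta> :: real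
  assumes V: "finite V" "V \<noteq> {}" and S: "S \<subseteq> V" and R: "R \<subseteq> V"
    and U: "\<And>S R. S \<subseteq> V \<Longrightarrow> R \<subseteq> V \<Longrightarrow>
      ecount E S R \<le> p * real (card S) * real (card R) + \<Lambda> * (real (card S) + real (card R))"
    and c: "0 < c" and t: "0 < t" and th: "0 < \<theta>" "\<theta> \<le> 1"
    and dens: "c * p * real (card V) \<le> (1 + \<theta>) * t" and lam: "c * \<Lambda> \<le> \<theta>\<^sup>2 * t"
    and reg: "\<And>v. v \<in> V \<Longrightarrow> \<bar>c * real (card (V \<inter> nbr E v)) - t\<bar> \<le> \<theta> * t"
  shows "\<bar>\<Sum>v\<in>S. \<Sum>w\<in>R. c * (if w \<in> nbr E v then 1 else 0) - t / real (card V)\<bar>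
    \<le> 4 * \<theta> * t * (real (card S) + real (card R))"
proof -
  define D where "D = real (card V)"
  have D: "0 < D" using V by (auto simp: D_def card_gt_0_iff)
  define K where "K S R = c * ecount E S R - t * real (card S) * real (card R) / D" for S R
  have fin: "finite A" if "A \<subseteq> V" for A using that V(1) by (rule finite_subset)
  have K: "(\<Sum>v\<in>A. \<Sum>w\<in>B. c * (if w \<in> nbr E v then 1 else 0) - t / real (card V)) = K A B"
    if "A \<subseteq> V" "B \<subseteq> V" for A B
  proof -
    have "(\<Sum>w\<in>B. c * (if w \<in> nbr E v then 1 else 0) - t / D) = c * real (card (B \<inter> nbr E v)) - real (card B) * (t / D)" for v
      using fin[OF that(2)] by (simp add: sum_subtractf sum.If_cases flip: sum_distrib_left)
    then show ?thesis
      by (simp add: K_def ecount_def D_def[symmetric] sum_subtractf sum_distrib_left)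
  qed
  have up: "K A B \<le> \<theta> * t * (real (card A) * real (card B) / D) + \<theta>\<^sup>2 * t * (real (card A) + real (card B))"
    if "A \<subseteq> V" "B \<subseteq> V" for A B
  proof -
    have "c * ecount E A B \<le> c * (p * real (card A) * real (card B) + \<Lambda> * (real (card A) + real (card B)))"
      by (intro mult_left_mono U that) (use c in simp)
    also have "\<dots> = (c * p * D) * (real (card A) * real (card B) / D) + c * \<Lambda> * (real (card A) + real (card B))"
      using D by (simp add: field_simps)
    also have "\<dots> \<le> (1 + \<theta>) * t * (real (card A) * real (card B) / D) + \<theta>\<^sup>2 * t * (real (card A) + real (card B))"
      using dens lam D by (intro add_mono mult_right_mono) (auto simp: D_def)
    finally show ?thesis by (simp add: K_def algebra_simps add_divide_distrib)
  qed
  have cardV: "real (card A) \<le> D" if "A \<subseteq> V" for A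
    using card_mono[OF V(1) that] by (simp add: D_def)
  have th2: "\<theta>\<^sup>2 \<le> \<theta>" using th by (simp add: power2_eq_square mult_left_le)
  have upper: "K S R \<le> 4 * \<theta> * t * (real (card S) + real (card R))"
  proof -
    have "real (card S) * real (card R) / D \<le> real (card S)"
      using cardV[OF R] D by (simp add: pos_divide_le_eq mult_left_mono)
    then have "\<theta> * t * (real (card S) * real (card R) / D) \<le> \<theta> * t * real (card S)"
      using th t by (intro mult_left_mono) auto
    moreover have "\<theta>\<^sup>2 * t * (real (card S) + real (card R)) \<le> \<theta> * t * (real (card S) + real (card R))"
      using th2 t by (intro mult_right_mono) auto
    moreover have "0 \<le> \<theta> * t * real (card S)" "0 \<le> \<theta> * t * real (card R)" using th t by auto
    ultimately show ?thesis using up[OF S R] by (simp add: algebra_simps)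
  qed
  have lower: "- (4 * \<theta> * t * (real (card S) + real (card R))) \<le> K S R"
  proof (cases "real (card S) \<le> \<theta> * D")
    case True
    \<comment> \<open>For |S| <= \<theta> |V| the expected number is itself within the error, so
      nonnegativity of the edge count is a sufficient lower bound.\<close>
    have "t * real (card S) * real (card R) / D \<le> t * \<theta> * real (card R)"
    proof -
      have "t * real (card S) * real (card R) / D = t * real (card R) * (real (card S) / D)" by simp
      also have "\<dots> \<le> t * real (card R) * \<theta>"
        using True D t by (intro mult_left_mono) (auto simp: field_simps)
      finally show ?thesis by (simp add: mult_ac)
    qed
    moreover have "0 \<le> c * ecount E S R" using c by (auto simp: ecount_def intro!: mult_nonneg_nonneg sum_nonneg)
    moreover have "0 \<le> \<theta> * t * real (card S)" "0 \<le> \<theta> * t * real (card R)" using th t by auto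
    ultimately show ?thesis by (simp add: K_def algebra_simps)
  next
    case False
    \<comment> \<open>For large S the lower bound comes from the complement: near-regularity bounds
      K S V from below, the upper bound applies to K S (V - R), and |S| > \<theta> |V| turns
      \<theta>^2 |V - R| into at most \<theta> |S|.\<close>
    have split: "K S V = K S R + K S (V - R)"
    proof -
      have "real (card (V \<inter> nbr E v)) = real (card (R \<inter> nbr E v)) + real (card ((V - R) \<inter> nbr E v))" for v
      proof -
        have "V \<inter> nbr E v = (R \<inter> nbr E v) \<union> ((V - R) \<inter> nbr E v)" using R by blast
        moreover have "card ((R \<inter> nbr E v) \<union> ((V - R) \<inter> nbr E v)) = card (R \<inter> nbr E v) + card ((V - R) \<inter> nbr E v)"
          by (rule card_Un_disjoint) (use V(1) fin[OF R] in auto)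
        ultimately show ?thesis by simp
      qed
      then have e: "ecount E S V = ecount E S R + ecount E S (V - R)"
        by (simp add: ecount_def sum.distrib)
      have "real (card V) = real (card R) + real (card (V - R))"
        using card_Diff_subset[OF fin[OF R] R] card_mono[OF V(1) R] by simp
      then show ?thesis unfolding K_def e by (simp add: algebra_simps add_divide_distrib)
    qed
    have "- (\<theta> * t * real (card S)) \<le> K S V"
    proof -
      have "K S V = (\<Sum>v\<in>S. c * real (card (V \<inter> nbr E v)) - t)"
        using D by (simp add: K_def ecount_def D_def sum_subtractf sum_distrib_left)
      also have "\<dots> \<ge> (\<Sum>v\<in>S. - (\<theta> * t))"
        by (rule sum_mono) (use reg S in \<open>fastforce simp: abs_le_iff\<close>)
      finally show ?thesis by (simp add: mult_ac)
    qed
    moreover have "K S (V - R) \<le> \<theta> * t * real (card S) + 2 * \<theta> * t * real (card S)"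
    proof -
      have VR: "V - R \<subseteq> V" by blast
      have "real (card S) * real (card (V - R)) / D \<le> real (card S)"
        using cardV[OF VR] D by (simp add: pos_divide_le_eq mult_left_mono)
      then have "\<theta> * t * (real (card S) * real (card (V - R)) / D) \<le> \<theta> * t * real (card S)"
        using th t by (intro mult_left_mono) auto
      moreover have "\<theta>\<^sup>2 * t * (real (card S) + real (card (V - R))) \<le> 2 * \<theta> * t * real (card S)"
      proof -
        have "\<theta>\<^sup>2 * real (card (V - R)) \<le> \<theta> * (\<theta> * D)"
          using cardV[OF VR] th by (simp add: power2_eq_square mult_left_mono mult.assoc)
        also have "\<dots> \<le> \<theta> * real (card S)" using False th by (intro mult_left_mono) auto
        finally have "t * (\<theta>\<^sup>2 * real (card (V - R))) \<le> t * (\<theta> * real (card S))" using t by (intro mult_left_mono) auto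
        moreover have "t * (\<theta>\<^sup>2 * real (card S)) \<le> t * (\<theta> * real (card S))"
          using t th2 by (intro mult_left_mono mult_right_mono) auto
        ultimately show ?thesis by (simp add: algebra_simps)
      qed
      ultimately show ?thesis using up[OF S VR] by linarith
    qed
    moreover have "0 \<le> \<theta> * t * real (card R)" using th t by auto
    ultimately show ?thesis unfolding split by (simp add: algebra_simps)
  qed
  show ?thesis unfolding K[OF S R] using upper lower by (simp add: abs_le_iff)
qed

section \<open>Histories and martingale inequalities\<close>

text \<open>A history lists the chosen pairs, the most recent one first.\<close>

primrec hist :: "nat \<Rightarrow> nat \<Rightarrow> nat set list pmf" where
  "hist n 0 = return_pmf []"
| "hist n (Suc i) = bind_pmf (hist n i)
     (\<lambda>l. if length l = i \<and> open_pairs n (set l) \<noteq> {}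
          then map_pmf (\<lambda>e. e # l) (pmf_of_set (open_pairs n (set l))) else return_pmf l)"

primrec wf_hist :: "nat \<Rightarrow> nat set list \<Rightarrow> bool" where
  "wf_hist n [] \<longleftrightarrow> True"
| "wf_hist n (e # l) \<longleftrightarrow> wf_hist n l \<and> e \<in> open_pairs n (set l)"

lemma wf_hist_valid: "wf_hist n l \<Longrightarrow> valid n (set l)"
  by (induction l) (auto intro: valid_insert)

lemma wf_hist_drop: "wf_hist n l \<Longrightarrow> wf_hist n (drop k l)"
proof (induction l arbitrary: k)
  case (Cons e l)
  then show ?case by (cases k) auto
qed simp

lemma set_pmf_hist: "l \<in> set_pmf (hist n i) \<Longrightarrow> wf_hist n l \<and> length l \<le> i"
proof (induction i arbitrary: l)
  case (Suc i)
  then obtain l0 where l0: "l0 \<in> set_pmf (hist n i)"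
    "l \<in> set_pmf (if length l0 = i \<and> open_pairs n (set l0) \<noteq> {}
          then map_pmf (\<lambda>e. e # l0) (pmf_of_set (open_pairs n (set l0))) else return_pmf l0)"
    by auto
  show ?case using Suc.IH[OF l0(1)] l0(2) by (auto split: if_splits)
qed simp

text \<open>A run that stops early keeps a list shorter than i, which is what \<open>None\<close>
  records. Histories are used because the potentials depend on the whole past, not only on the edge
  set.\<close>

lemma process_hist:
  "triangle_free_process n i = map_pmf (\<lambda>l. if length l = i then Some (set l) else None) (hist n i)"
proof (induction i)
  case (Suc i)
  show ?case
    unfolding triangle_free_process.simps hist.simps Suc map_bind_pmf bind_map_pmf
  proof (rule bind_pmf_cong[OF refl])
    fix l assume "l \<in> set_pmf (hist n i)"
    then have "length l \<le> i" using set_pmf_hist by blast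
    then show "(case if length l = i then Some (set l) else None of
          None \<Rightarrow> return_pmf None
        | Some E \<Rightarrow> if open_pairs n E = {} then return_pmf None
            else map_pmf (\<lambda>e. Some (insert e E)) (pmf_of_set (open_pairs n E))) =
        map_pmf (\<lambda>l. if length l = Suc i then Some (set l) else None)
          (if length l = i \<and> open_pairs n (set l) \<noteq> {}
           then map_pmf (\<lambda>e. e # l) (pmf_of_set (open_pairs n (set l))) else return_pmf l)"
      by (auto simp: map_pmf_comp)
  qed
qed simp

text \<open>The last j entries are the first j choices, and truncated subtraction leaves a list that
  stopped before time j whole. Thus events at all earlier times can be read off from one final
  history.\<close>

lemma hist_tail:
  assumes "j \<le> i"
  shows "map_pmf (\<lambda>l. drop (length l - j) l) (hist n i) = hist n j"
  using assms
proof (induction i)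
  case 0
  then show ?case by simp
next
  case (Suc i)
  show ?case
  proof (cases "j = Suc i")
    case True
    have "map_pmf (\<lambda>l. drop (length l - j) l) (hist n (Suc i)) = map_pmf (\<lambda>l. l) (hist n (Suc i))"
      by (rule map_pmf_cong[OF refl]) (use set_pmf_hist True in force)
    then show ?thesis using True by simp
  next
    case False
    then have j: "j \<le> i" using Suc.prems by simp
    have "map_pmf (\<lambda>l. drop (length l - j) l) (hist n (Suc i)) =
        bind_pmf (hist n i) (\<lambda>l. return_pmf (drop (length l - j) l))"
      unfolding hist.simps map_bind_pmf
      by (rule bind_pmf_cong[OF refl]) (auto simp: map_pmf_comp Suc_diff_le j)
    also have "\<dots> = hist n j" using Suc.IH[OF j] by (simp add: map_pmf_def)
    finally show ?thesis .
  qed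
qed

text \<open>The next choice is uniform on the open pairs, so the hypothesis says that the
  conditional mean of f does not increase; a stopped history keeps its value.\<close>

lemma hist_supermartingale:
  assumes f0: "\<And>l. 0 \<le> f l"
    and step: "\<And>l. wf_hist n l \<Longrightarrow> length l < i \<Longrightarrow> open_pairs n (set l) \<noteq> {} \<Longrightarrow>
      (\<Sum>e\<in>open_pairs n (set l). f (e # l)) \<le> f l * real (nopen n (set l))"
  shows "(\<integral>\<^sup>+l. ennreal (f l) \<partial>measure_pmf (hist n i)) \<le> ennreal (f [])"
proof -
  have "(\<integral>\<^sup>+l. ennreal (f l) \<partial>measure_pmf (hist n j)) \<le> ennreal (f [])" if "j \<le> i" for j
    using that
  proof (induction j)
    case 0
    then show ?case by simp
  next
    case (Suc j)
    have "(\<integral>\<^sup>+l. ennreal (f l) \<partial>measure_pmf (hist n (Suc j))) =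
      (\<integral>\<^sup>+l. (\<integral>\<^sup>+l'. ennreal (f l') \<partial>measure_pmf (if length l = j \<and> open_pairs n (set l) \<noteq> {}
          then map_pmf (\<lambda>e. e # l) (pmf_of_set (open_pairs n (set l))) else return_pmf l)) \<partial>measure_pmf (hist n j))"
      by simp
    also have "\<dots> \<le> (\<integral>\<^sup>+l. ennreal (f l) \<partial>measure_pmf (hist n j))"
    proof (rule nn_integral_mono_AE, unfold AE_measure_pmf_iff, rule ballI)
      fix l assume l: "l \<in> set_pmf (hist n j)"
      show "(\<integral>\<^sup>+l'. ennreal (f l') \<partial>measure_pmf (if length l = j \<and> open_pairs n (set l) \<noteq> {}
          then map_pmf (\<lambda>e. e # l) (pmf_of_set (open_pairs n (set l))) else return_pmf l)) \<le> ennreal (f l)"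
      proof (cases "length l = j \<and> open_pairs n (set l) \<noteq> {}")
        case False
        then show ?thesis by auto
      next
        case True
        let ?O = "open_pairs n (set l)"
        have c: "card ?O > 0" using True by (simp add: card_gt_0_iff)
        have "(\<integral>\<^sup>+l'. ennreal (f l') \<partial>measure_pmf (map_pmf (\<lambda>e. e # l) (pmf_of_set ?O))) =
            (\<Sum>e\<in>?O. ennreal (f (e # l))) / ennreal (real (card ?O))"
          using True by (simp add: nn_integral_pmf_of_set ennreal_of_nat_eq_real_of_nat)
        also have "\<dots> = ennreal ((\<Sum>e\<in>?O. f (e # l)) / real (card ?O))"
          using c by (simp add: f0 divide_ennreal sum_nonneg)
        also have "\<dots> \<le> ennreal (f l)"
          using step[of l] set_pmf_hist[OF l] True Suc.prems c
          by (intro ennreal_leI) (simp add: pos_divide_le_eq nopen_def)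
        finally show ?thesis using True by simp
      qed
    qed
    also have "\<dots> \<le> ennreal (f [])" using Suc by simp
    finally show ?case .
  qed
  then show ?thesis by simp
qed

lemma hist_markov:
  assumes f0: "\<And>l. 0 \<le> f l"
    and step: "\<And>l. wf_hist n l \<Longrightarrow> length l < i \<Longrightarrow> open_pairs n (set l) \<noteq> {} \<Longrightarrow>
      (\<Sum>e\<in>open_pairs n (set l). f (e # l)) \<le> f l * real (nopen n (set l))"
    and P: "\<And>l. wf_hist n l \<Longrightarrow> length l \<le> i \<Longrightarrow> P l \<Longrightarrow> c \<le> f l" and c: "0 < c"
  shows "measure_pmf.prob (hist n i) {l. P l} \<le> f [] / c"
proof -
  have "ennreal c * emeasure (measure_pmf (hist n i)) {l. P l} = (\<integral>\<^sup>+l. ennreal c * indicator {l. P l} l \<partial>measure_pmf (hist n i))"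
    by (simp add: nn_integral_cmult_indicator)
  also have "\<dots> \<le> (\<integral>\<^sup>+l. ennreal (f l) \<partial>measure_pmf (hist n i))"
  proof (rule nn_integral_mono_AE, unfold AE_measure_pmf_iff, rule ballI)
    fix l assume "l \<in> set_pmf (hist n i)"
    then show "ennreal c * indicator {l. P l} l \<le> ennreal (f l)"
      using P[of l] set_pmf_hist[of l n i] by (auto simp: indicator_def intro: ennreal_leI)
  qed
  also have "\<dots> \<le> ennreal (f [])" by (rule hist_supermartingale[OF f0 step])
  finally have "ennreal (c * measure_pmf.prob (hist n i) {l. P l}) \<le> ennreal (f [])"
    using c by (simp add: measure_pmf.emeasure_eq_measure ennreal_mult)
  then have "c * measure_pmf.prob (hist n i) {l. P l} \<le> f []" using f0[of "[]"] by (simp add: ennreal_le_iff)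
  then show ?thesis using c by (simp add: field_simps)
qed

lemma hist_union_tails:
  "measure_pmf.prob (hist n i) {l. \<exists>j\<le>i. A j (drop (length l - j) l)} \<le> (\<Sum>j\<le>i. measure_pmf.prob (hist n j) {l. A j l})"
proof -
  have "{l. \<exists>j\<le>i. A j (drop (length l - j) l)} = (\<Union>j\<in>{..i}. (\<lambda>l. drop (length l - j) l) -` {l. A j l})" by auto
  then have "measure_pmf.prob (hist n i) {l. \<exists>j\<le>i. A j (drop (length l - j) l)} \<le>
      (\<Sum>j\<le>i. measure_pmf.prob (hist n i) ((\<lambda>l. drop (length l - j) l) -` {l. A j l}))"
    by (simp only:) (rule measure_pmf.finite_measure_subadditive_finite, auto)
  also have "\<dots> = (\<Sum>j\<le>i. measure_pmf.prob (hist n j) {l. A j l})"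
  proof (rule sum.cong[OF refl])
    fix j assume "j \<in> {..i}"
    then have "hist n j = map_pmf (\<lambda>l. drop (length l - j) l) (hist n i)" using hist_tail by simp
    then show "measure_pmf.prob (hist n i) ((\<lambda>l. drop (length l - j) l) -` {l. A j l}) =
      measure_pmf.prob (hist n j) {l. A j l}" by (simp add: measure_map_pmf)
  qed
  finally show ?thesis .
qed

lemma prob_union_bound:
  assumes "finite I" "\<And>x. x \<in> I \<Longrightarrow> measure_pmf.prob p {l. P x l} \<le> b"
  shows "measure_pmf.prob p {l. \<exists>x\<in>I. P x l} \<le> real (card I) * b"
proof -
  have "{l. \<exists>x\<in>I. P x l} = (\<Union>x\<in>I. {l. P x l})" by auto
  then have "measure_pmf.prob p {l. \<exists>x\<in>I. P x l} \<le> (\<Sum>x\<in>I. measure_pmf.prob p {l. P x l})"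
    by (simp only:) (rule measure_pmf.finite_measure_subadditive_finite, use assms in auto)
  also have "\<dots> \<le> real (card I) * b" using sum_bounded_above[of I _ b] assms by simp
  finally show ?thesis .
qed

lemma exp_le_quadratic:
  fixes x :: real assumes "\<bar>x\<bar> \<le> 1" shows "exp x \<le> 1 + x + x\<^sup>2"
proof (cases "x \<ge> 0")
  case True
  then show ?thesis using exp_bound[of x] assms by simp
next
  case False
  define y where "y = - x"
  have y: "0 < y" using False by (simp add: y_def)
  \<comment> \<open>The product equals 1 + y^3.\<close>
  have "1 \<le> (1 + y) * (1 - y + y\<^sup>2)"
    using y by (simp add: algebra_simps power2_eq_square)
  also have "\<dots> \<le> exp y * (1 - y + y\<^sup>2)"
  proof (rule mult_right_mono)
    show "1 + y \<le> exp y" by simp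
    have "0 \<le> (1 - y / 2)\<^sup>2 + 3 / 4 * y\<^sup>2" by simp
    then show "0 \<le> 1 - y + y\<^sup>2" by (simp add: power2_eq_square algebra_simps)
  qed
  finally have "exp (- y) * 1 \<le> exp (- y) * (exp y * (1 - y + y\<^sup>2))" by (intro mult_left_mono) auto
  also have "\<dots> = 1 - y + y\<^sup>2" by (simp add: exp_minus)
  finally show ?thesis by (simp add: y_def)
qed

text \<open>Increments are skipped whenever the guard fails, so the sum stays a martingale on all
  histories although the increments are controlled only where the guard holds.\<close>

primrec accum :: "('a list \<Rightarrow> bool) \<Rightarrow> ('a list \<Rightarrow> 'a \<Rightarrow> real) \<Rightarrow> 'a list \<Rightarrow> real" where
  "accum G \<Delta> [] = 0"
| "accum G \<Delta> (e # l) = accum G \<Delta> l + (if G l then \<Delta> l e else 0)"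

lemma accum_uminus: "accum G (\<lambda>l e. - \<Delta> l e) l = - accum G \<Delta> l"
  by (induction l) auto

text \<open>Freedman's inequality in the form exp (\<theta> \<Delta>) <= 1 + \<theta> \<Delta> +
  \<theta>^2 b |\<Delta>|: the square of an increment is at most b times its absolute value, so a
  bound v on the mean absolute change replaces the variance. The parameter \<theta> is left free to
  be chosen where the bound is applied.\<close>

lemma hist_freedman_one_sided:
  assumes zero: "\<And>l. wf_hist n l \<Longrightarrow> length l < i \<Longrightarrow> G l \<Longrightarrow> (\<Sum>e\<in>open_pairs n (set l). \<Delta> l e) = 0"
    and bd: "\<And>l e. wf_hist n l \<Longrightarrow> length l < i \<Longrightarrow> G l \<Longrightarrow> e \<in> open_pairs n (set l) \<Longrightarrow> \<bar>\<Delta> l e\<bar> \<le> b"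
    and var: "\<And>l. wf_hist n l \<Longrightarrow> length l < i \<Longrightarrow> G l \<Longrightarrow>
      (\<Sum>e\<in>open_pairs n (set l). \<bar>\<Delta> l e\<bar>) \<le> v * real (nopen n (set l))"
    and th: "0 \<le> \<theta>" "\<theta> * b \<le> 1" and b: "0 \<le> b" and v: "0 \<le> v"
  shows "measure_pmf.prob (hist n i) {l. accum G \<Delta> l \<ge> x} \<le> exp (real i * (\<theta>\<^sup>2 * b * v) - \<theta> * x)"
proof -
  define w where "w = \<theta>\<^sup>2 * b * v"
  have w: "0 \<le> w" using b v by (simp add: w_def)
  let ?f = "\<lambda>l. exp (\<theta> * accum G \<Delta> l - w * real (length l))"
  have "measure_pmf.prob (hist n i) {l. accum G \<Delta> l \<ge> x} \<le> ?f [] / exp (\<theta> * x - w * real i)"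
  proof (rule hist_markov)
    fix l assume "wf_hist n l" "length l \<le> i" "x \<le> accum G \<Delta> l"
    then show "exp (\<theta> * x - w * real i) \<le> exp (\<theta> * accum G \<Delta> l - w * real (length l))"
      using th w by (auto intro!: diff_mono mult_left_mono)
  next
    fix l assume l: "wf_hist n l" "length l < i" and ne: "open_pairs n (set l) \<noteq> {}"
    let ?O = "open_pairs n (set l)"
    show "(\<Sum>e\<in>?O. ?f (e # l)) \<le> ?f l * real (nopen n (set l))"
    proof (cases "G l")
      case False
      have "(\<Sum>e\<in>?O. ?f (e # l)) \<le> (\<Sum>e\<in>?O. ?f l)"
        by (rule sum_mono) (use False w in \<open>auto simp: algebra_simps\<close>)
      then show ?thesis by (simp add: nopen_def mult.commute)
    next
      case True
      have e1: "exp (\<theta> * \<Delta> l e) \<le> 1 + \<theta> * \<Delta> l e + \<theta>\<^sup>2 * b * \<bar>\<Delta> l e\<bar>" if e: "e \<in> ?O" for e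
      proof -
        have a: "\<bar>\<Delta> l e\<bar> \<le> b" by (rule bd[OF l True e])
        have "\<bar>\<theta> * \<Delta> l e\<bar> \<le> \<theta> * b" using a th by (simp add: abs_mult mult_left_mono)
        then have "exp (\<theta> * \<Delta> l e) \<le> 1 + \<theta> * \<Delta> l e + (\<theta> * \<Delta> l e)\<^sup>2" using th by (intro exp_le_quadratic) simp
        also have "(\<theta> * \<Delta> l e)\<^sup>2 = \<theta>\<^sup>2 * (\<bar>\<Delta> l e\<bar> * \<bar>\<Delta> l e\<bar>)" by (simp add: power_mult_distrib power2_eq_square)
        also have "\<dots> \<le> \<theta>\<^sup>2 * (b * \<bar>\<Delta> l e\<bar>)" using a by (intro mult_left_mono mult_right_mono) auto
        finally show ?thesis by (simp add: mult.assoc)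
      qed
      have "(\<Sum>e\<in>?O. exp (\<theta> * \<Delta> l e)) \<le> (\<Sum>e\<in>?O. 1 + \<theta> * \<Delta> l e + \<theta>\<^sup>2 * b * \<bar>\<Delta> l e\<bar>)"
        by (rule sum_mono[OF e1])
      also have "\<dots> = real (nopen n (set l)) + \<theta> * (\<Sum>e\<in>?O. \<Delta> l e) + \<theta>\<^sup>2 * b * (\<Sum>e\<in>?O. \<bar>\<Delta> l e\<bar>)"
        by (simp add: sum.distrib sum_distrib_left nopen_def)
      also have "\<dots> \<le> real (nopen n (set l)) + \<theta>\<^sup>2 * b * (v * real (nopen n (set l)))"
        using zero[OF l True] var[OF l True] b by (auto intro!: mult_left_mono)
      also have "\<dots> = real (nopen n (set l)) * (1 + w)" by (simp add: w_def algebra_simps)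
      also have "\<dots> \<le> real (nopen n (set l)) * exp w"
        by (intro mult_left_mono) auto
      finally have s: "(\<Sum>e\<in>?O. exp (\<theta> * \<Delta> l e)) \<le> real (nopen n (set l)) * exp w" .
      have "?f (e # l) = ?f l * exp (- w) * exp (\<theta> * \<Delta> l e)" for e
        using True by (simp add: exp_add[symmetric] algebra_simps)
      then have "(\<Sum>e\<in>?O. ?f (e # l)) = ?f l * exp (- w) * (\<Sum>e\<in>?O. exp (\<theta> * \<Delta> l e))"
        by (simp only: sum_distrib_left)
      also have "\<dots> \<le> ?f l * exp (- w) * (real (nopen n (set l)) * exp w)"
        by (rule mult_left_mono[OF s]) simp
      also have "\<dots> = ?f l * real (nopen n (set l))" by (simp add: exp_minus)
      finally show ?thesis .
    qed
  qed auto
  also have "?f [] / exp (\<theta> * x - w * real i) = exp (w * real i - \<theta> * x)" by (simp add: exp_diff)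
  finally show ?thesis by (simp add: w_def mult.commute)
qed

lemma hist_freedman:
  assumes zero: "\<And>l. wf_hist n l \<Longrightarrow> length l < i \<Longrightarrow> G l \<Longrightarrow> (\<Sum>e\<in>open_pairs n (set l). \<Delta> l e) = 0"
    and bd: "\<And>l e. wf_hist n l \<Longrightarrow> length l < i \<Longrightarrow> G l \<Longrightarrow> e \<in> open_pairs n (set l) \<Longrightarrow> \<bar>\<Delta> l e\<bar> \<le> b"
    and var: "\<And>l. wf_hist n l \<Longrightarrow> length l < i \<Longrightarrow> G l \<Longrightarrow>
      (\<Sum>e\<in>open_pairs n (set l). \<bar>\<Delta> l e\<bar>) \<le> v * real (nopen n (set l))"
    and th: "0 \<le> \<theta>" "\<theta> * b \<le> 1" and b: "0 \<le> b" and v: "0 \<le> v"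
  shows "measure_pmf.prob (hist n i) {l. \<bar>accum G \<Delta> l\<bar> \<ge> x} \<le> 2 * exp (real i * (\<theta>\<^sup>2 * b * v) - \<theta> * x)"
proof -
  have "{l. \<bar>accum G \<Delta> l\<bar> \<ge> x} = {l. accum G \<Delta> l \<ge> x} \<union> {l. accum G (\<lambda>l e. - \<Delta> l e) l \<ge> x}"
    unfolding accum_uminus by auto
  then have "measure_pmf.prob (hist n i) {l. \<bar>accum G \<Delta> l\<bar> \<ge> x} \<le>
      measure_pmf.prob (hist n i) {l. accum G \<Delta> l \<ge> x} + measure_pmf.prob (hist n i) {l. accum G (\<lambda>l e. - \<Delta> l e) l \<ge> x}"
    by (simp only:) (rule measure_Un_le, auto)
  also have "\<dots> \<le> exp (real i * (\<theta>\<^sup>2 * b * v) - \<theta> * x) + exp (real i * (\<theta>\<^sup>2 * b * v) - \<theta> * x)"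
    by (intro add_mono hist_freedman_one_sided) (use assms in \<open>auto simp: sum_negf\<close>)
  finally show ?thesis by simp
qed

section \<open>Normalised codegrees\<close>

text \<open>After \<open>i\<close> steps, with \<open>t = i / n\<^sup>3\<^sup>/\<^sup>2\<close>, the number of open pairs is about
  \<open>n\<^sup>2 exp (-4 t\<^sup>2) / 2\<close>, and the normalised quantities \<open>al\<close>, \<open>xh\<close>, \<open>dh\<close> are about \<open>t\<close>, \<open>1\<close>, \<open>1\<close>.\<close>

definition rn :: "nat \<Rightarrow> real" where "rn n = real n * sqrt (real n)"

text \<open>With q = 2 \<open>nopen\<close> / n^2 the density of open pairs, this is 1 / (2 q sqrt
  n), about exp (4 t^2) / (2 sqrt n). A vertex has about 2 t sqrt n neighbours, so a mixed codegree
  is about 2 q t sqrt n = t / \<open>cw\<close>.\<close>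

definition cw :: "nat \<Rightarrow> nat set set \<Rightarrow> real" where
  "cw n E = rn n / (4 * real (nopen n E))"

definition al :: "nat \<Rightarrow> nat set set \<Rightarrow> nat \<Rightarrow> nat \<Rightarrow> real" where
  "al n E u v = cw n E * real (mixed_codeg n E u v)"

definition xh :: "nat \<Rightarrow> nat set set \<Rightarrow> nat \<Rightarrow> nat \<Rightarrow> real" where
  "xh n E u v = 4 * (cw n E)\<^sup>2 * real (open_codeg n E u v)"

definition dh :: "nat \<Rightarrow> nat set set \<Rightarrow> nat \<Rightarrow> real" where
  "dh n E u = 2 * cw n E / sqrt (real n) * real (open_deg n E u)"

text \<open>The choice uv is given value 0: it makes u and v adjacent, which ends the tracking of
  this codegree, with a jump too large for the martingale bound.\<close>

definition dA :: "nat \<Rightarrow> nat set set \<Rightarrow> nat \<Rightarrow> nat \<Rightarrow> nat set \<Rightarrow> real" where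
  "dA n E u v e = (if e = {u, v} then 0 else real (mixed_codeg n (insert e E) u v) - real (mixed_codeg n E u v))"

definition dX :: "nat \<Rightarrow> nat set set \<Rightarrow> nat \<Rightarrow> nat \<Rightarrow> nat set \<Rightarrow> real" where
  "dX n E u v e = real (open_codeg n (insert e E) u v) - real (open_codeg n E u v)"

definition dD :: "nat \<Rightarrow> nat set set \<Rightarrow> nat \<Rightarrow> nat set \<Rightarrow> real" where
  "dD n E u e = real (open_deg n (insert e E) u) - real (open_deg n E u)"

text \<open>The exact conditional mean is subtracted, so \<open>nA\<close>, \<open>nX\<close>,
  \<open>nD\<close> are martingale differences. They use the weight \<open>cw\<close> from before
  the step; its change is accounted for in the drift.\<close>

definition centred :: "nat \<Rightarrow> nat set set \<Rightarrow> (nat set \<Rightarrow> real) \<Rightarrow> nat set \<Rightarrow> real" where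
  "centred n E f e = f e - (\<Sum>e\<in>open_pairs n E. f e) / real (nopen n E)"

definition nA :: "nat \<Rightarrow> nat set set \<Rightarrow> nat \<Rightarrow> nat \<Rightarrow> nat set \<Rightarrow> real" where
  "nA n E u v e = cw n E * centred n E (dA n E u v) e"

definition nX :: "nat \<Rightarrow> nat set set \<Rightarrow> nat \<Rightarrow> nat \<Rightarrow> nat set \<Rightarrow> real" where
  "nX n E u v e = 4 * (cw n E)\<^sup>2 * centred n E (dX n E u v) e"

definition nD :: "nat \<Rightarrow> nat set set \<Rightarrow> nat \<Rightarrow> nat set \<Rightarrow> real" where
  "nD n E u e = 2 * cw n E / sqrt (real n) * centred n E (dD n E u) e"

lemma sum_centred:
  assumes "0 < nopen n E" shows "(\<Sum>e\<in>open_pairs n E. centred n E f e) = 0"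
  using assms by (simp add: centred_def sum_subtractf nopen_def)

lemma sum_abs_centred:
  assumes "0 < nopen n E"
  shows "(\<Sum>e\<in>open_pairs n E. \<bar>centred n E f e\<bar>) \<le> 2 * (\<Sum>e\<in>open_pairs n E. \<bar>f e\<bar>)"
proof -
  let ?m = "(\<Sum>e\<in>open_pairs n E. f e) / real (nopen n E)"
  have "(\<Sum>e\<in>open_pairs n E. \<bar>centred n E f e\<bar>) \<le> (\<Sum>e\<in>open_pairs n E. \<bar>f e\<bar> + \<bar>?m\<bar>)"
    by (rule sum_mono) (unfold centred_def, linarith)
  also have "\<dots> = (\<Sum>e\<in>open_pairs n E. \<bar>f e\<bar>) + \<bar>\<Sum>e\<in>open_pairs n E. f e\<bar>"
    using assms by (simp add: sum.distrib nopen_def abs_divide)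
  also have "\<bar>\<Sum>e\<in>open_pairs n E. f e\<bar> \<le> (\<Sum>e\<in>open_pairs n E. \<bar>f e\<bar>)" by (rule sum_abs)
  finally show ?thesis by simp
qed

lemma abs_centred:
  assumes "0 < nopen n E" "\<And>e. e \<in> open_pairs n E \<Longrightarrow> \<bar>f e\<bar> \<le> b" "e \<in> open_pairs n E"
  shows "\<bar>centred n E f e\<bar> \<le> 2 * b"
proof -
  have "\<bar>\<Sum>e\<in>open_pairs n E. f e\<bar> \<le> (\<Sum>e\<in>open_pairs n E. \<bar>f e\<bar>)" by (rule sum_abs)
  also have "\<dots> \<le> real (nopen n E) * b" unfolding nopen_def by (rule sum_bounded_above) (use assms in auto)
  finally have "\<bar>(\<Sum>e\<in>open_pairs n E. f e) / real (nopen n E)\<bar> \<le> b"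
    using assms(1) by (simp add: abs_divide pos_divide_le_eq mult.commute)
  then show ?thesis using assms(2)[OF assms(3)] unfolding centred_def by linarith
qed

text \<open>One step multiplies \<open>cw\<close> by 1 / (1 - y), where y is the fraction of open
  pairs lost, while the counted quantity moves by d. Only the term linear in y is kept; d y and a
  y^2 are errors.\<close>

lemma expand_inverse:
  fixes a d y :: real
  assumes y: "0 \<le> y" "y \<le> 1 / 8" and d: "\<bar>d\<bar> \<le> d0" and a: "\<bar>a\<bar> \<le> a0"
  shows "\<bar>(a + d) / (1 - y) - (a + d + a * y)\<bar> \<le> 2 * (d0 * y + a0 * y\<^sup>2)"
proof -
  have "(a + d) / (1 - y) - (a + d + a * y) = (d * y + a * y\<^sup>2) / (1 - y)"
    using y by (simp add: field_simps power2_eq_square)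
  then have "\<bar>(a + d) / (1 - y) - (a + d + a * y)\<bar> = \<bar>d * y + a * y\<^sup>2\<bar> / (1 - y)"
    using y by (simp add: abs_divide)
  also have "\<dots> \<le> (d0 * y + a0 * y\<^sup>2) / (1 / 2)"
  proof (rule frac_le)
    have "\<bar>d * y + a * y\<^sup>2\<bar> \<le> \<bar>d\<bar> * y + \<bar>a\<bar> * y\<^sup>2" using y by (simp add: abs_mult order_trans[OF abs_triangle_ineq])
    also have "\<dots> \<le> d0 * y + a0 * y\<^sup>2" using d a y by (intro add_mono mult_right_mono) auto
    finally show "\<bar>d * y + a * y\<^sup>2\<bar> \<le> d0 * y + a0 * y\<^sup>2" .
    then show "0 \<le> d0 * y + a0 * y\<^sup>2" by linarith
  qed (use y in auto)
  finally show ?thesis by simp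
qed

lemma expand_inverse_square:
  fixes a d y :: real
  assumes y: "0 \<le> y" "y \<le> 1 / 8" and d: "\<bar>d\<bar> \<le> d0" and a: "\<bar>a\<bar> \<le> a0"
  shows "\<bar>(a + d) / (1 - y)\<^sup>2 - (a + d + 2 * a * y)\<bar> \<le> 2 * (2 * d0 * y + 3 * a0 * y\<^sup>2)"
proof -
  have "(a + d) / (1 - y)\<^sup>2 - (a + d + 2 * a * y) = (d * (2 * y - y\<^sup>2) + a * (3 * y\<^sup>2 - 2 * y ^ 3)) / (1 - y)\<^sup>2"
  proof -
    have k: "(1 - y)\<^sup>2 \<noteq> 0" using y by simp
    have "(a + d) - (a + d + 2 * a * y) * (1 - y)\<^sup>2 = d * (2 * y - y\<^sup>2) + a * (3 * y\<^sup>2 - 2 * y ^ 3)"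
      by (simp add: algebra_simps power2_eq_square power3_eq_cube)
    moreover have "(a + d) / (1 - y)\<^sup>2 - (a + d + 2 * a * y) = ((a + d) - (a + d + 2 * a * y) * (1 - y)\<^sup>2) / (1 - y)\<^sup>2"
      using k by (simp add: diff_divide_distrib)
    ultimately show ?thesis by simp
  qed
  then have "\<bar>(a + d) / (1 - y)\<^sup>2 - (a + d + 2 * a * y)\<bar> = \<bar>d * (2 * y - y\<^sup>2) + a * (3 * y\<^sup>2 - 2 * y ^ 3)\<bar> / (1 - y)\<^sup>2"
    by (simp add: abs_divide)
  also have "\<dots> \<le> (2 * d0 * y + 3 * a0 * y\<^sup>2) / (1 / 2)"
  proof (rule frac_le)
    have y2: "y\<^sup>2 \<le> 1 / 8 * y" unfolding power2_eq_square using y by (intro mult_right_mono) auto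
    have p: "0 \<le> 2 * y - y\<^sup>2" "2 * y - y\<^sup>2 \<le> 2 * y" using y y2 by auto
    have q: "0 \<le> 3 * y\<^sup>2 - 2 * y ^ 3" "3 * y\<^sup>2 - 2 * y ^ 3 \<le> 3 * y\<^sup>2"
    proof -
      have "3 * y\<^sup>2 - 2 * y ^ 3 = y\<^sup>2 * (3 - 2 * y)" by (simp add: algebra_simps power2_eq_square power3_eq_cube)
      moreover have "0 \<le> y\<^sup>2 * (3 - 2 * y)" using y by (intro mult_nonneg_nonneg) auto
      ultimately show "0 \<le> 3 * y\<^sup>2 - 2 * y ^ 3" by simp
      show "3 * y\<^sup>2 - 2 * y ^ 3 \<le> 3 * y\<^sup>2" using y by simp
    qed
    have "\<bar>d * (2 * y - y\<^sup>2) + a * (3 * y\<^sup>2 - 2 * y ^ 3)\<bar> \<le> \<bar>d\<bar> * (2 * y - y\<^sup>2) + \<bar>a\<bar> * (3 * y\<^sup>2 - 2 * y ^ 3)"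
      using abs_triangle_ineq[of "d * (2 * y - y\<^sup>2)" "a * (3 * y\<^sup>2 - 2 * y ^ 3)"]
      by (simp only: abs_mult abs_of_nonneg[OF p(1)] abs_of_nonneg[OF q(1)])
    also have "\<dots> \<le> d0 * (2 * y) + a0 * (3 * y\<^sup>2)" using d a y p q by (intro add_mono mult_mono) auto
    finally show "\<bar>d * (2 * y - y\<^sup>2) + a * (3 * y\<^sup>2 - 2 * y ^ 3)\<bar> \<le> 2 * d0 * y + 3 * a0 * y\<^sup>2" by simp
    then show "0 \<le> 2 * d0 * y + 3 * a0 * y\<^sup>2" by linarith
    have "(7 / 8)\<^sup>2 \<le> (1 - y)\<^sup>2" using y by (intro power_mono) auto
    then show "1 / 2 \<le> (1 - y)\<^sup>2" by (simp add: power2_eq_square)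
  qed auto
  finally show ?thesis by simp
qed

text \<open>All tracked quantities are normalised by the actual number of open pairs; the only
  instability of the mean is thereby factored out.\<close>

locale tracking =
  fixes n :: nat and T \<beta> \<gamma> \<zeta> :: real and z :: nat
  assumes n2: "2 \<le> n" and T1: "1 \<le> T" and be: "0 \<le> \<beta>" "\<beta> \<le> 1 / 2" and ch: "0 < \<gamma>" "\<gamma> \<le> 1 / 2"
    and sT: "10 ^ 4 * T ^ 3 / rn n \<le> \<gamma>" and nch: "1 / sqrt (real n) \<le> \<gamma>"
begin

definition s :: real where "s = 1 / rn n"

text \<open>\<beta> bounds the tracked errors, \<gamma> the weight \<open>cw\<close>, z the
  codegrees and \<zeta> the logarithmic error of the density of open pairs. All nonadjacent pairs
  are covered, closed ones too; for adjacent pairs the mixed codegree is zero.\<close>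

definition good :: "nat set set \<Rightarrow> real \<Rightarrow> bool" where
  "good E t \<longleftrightarrow> 0 < nopen n E \<and> cw n E \<le> \<gamma> \<and>
    (\<forall>u<n. \<forall>v<n. u \<noteq> v \<and> v \<notin> nbr E u \<longrightarrow> \<bar>al n E u v - t\<bar> \<le> \<beta> \<and> \<bar>xh n E u v - 1\<bar> \<le> \<beta>) \<and>
    (\<forall>u<n. \<bar>dh n E u - 1\<bar> \<le> \<beta>) \<and> (\<forall>u v. u \<noteq> v \<longrightarrow> codeg E u v \<le> z) \<and>
    \<bar>ln (2 * real (nopen n E) / (real n)\<^sup>2) + 4 * t\<^sup>2\<bar> \<le> \<zeta>"

text \<open>The rate, per unit of scaled time, of all second-order terms of a step: jump times y,
  the summand 1 in \<open>closers\<close>, double losses, and the term for the choice uv.\<close>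

definition err :: real where "err = 10 ^ 4 * T\<^sup>2 * \<gamma> * (real z + 3)"

lemma T_powers: "T \<le> T\<^sup>2" "T\<^sup>2 \<le> T ^ 3"
  using T1 power_increasing[of 1 2 T] power_increasing[of 2 3 T] by auto

lemma rn_pos: "0 < rn n" using n2 by (simp add: rn_def)
lemma s_pos: "0 < s" using rn_pos by (simp add: s_def)
lemma s_small: "10 ^ 4 * T ^ 3 * s \<le> \<gamma>" using sT by (simp add: s_def)
context
  fixes E :: "nat set set" and t :: real
  assumes V: "valid n E" and g: "good E t" and t: "0 \<le> t" "t \<le> T"
begin

lemma Q_pos: "0 < nopen n E" using g by (simp add: good_def)
lemma c_pos: "0 < cw n E" using Q_pos rn_pos by (simp add: cw_def)
lemma c_le: "cw n E \<le> \<gamma>" using g by (simp add: good_def)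

lemma inv_Q: "1 / real (nopen n E) = 4 * cw n E * s"
  using rn_pos Q_pos by (simp add: cw_def s_def)

lemma al_near: "u < n \<Longrightarrow> v < n \<Longrightarrow> u \<noteq> v \<Longrightarrow> v \<notin> nbr E u \<Longrightarrow> \<bar>al n E u v - t\<bar> \<le> \<beta>"
  and xh_near: "u < n \<Longrightarrow> v < n \<Longrightarrow> u \<noteq> v \<Longrightarrow> v \<notin> nbr E u \<Longrightarrow> \<bar>xh n E u v - 1\<bar> \<le> \<beta>"
  and dh_near: "u < n \<Longrightarrow> \<bar>dh n E u - 1\<bar> \<le> \<beta>"
  and codeg_le: "u \<noteq> v \<Longrightarrow> codeg E u v \<le> z"
  using g by (auto simp: good_def)

lemma al_nonneg: "0 \<le> al n E u v" using c_pos by (simp add: al_def)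

lemma al_le_all:
  assumes "u \<noteq> v" shows "al n E u v \<le> t + \<beta>"
proof (cases "u < n \<and> v < n \<and> v \<notin> nbr E u")
  case True
  then show ?thesis using al_near[of u v] assms by (simp add: abs_le_iff)
next
  case False
  have "mixed_codeg n E u v = 0"
  proof (cases "v \<in> nbr E u")
    case True
    then show ?thesis by (rule mixed_codeg_adjacent[OF V])
  next
    case F: False
    have "opn n E u \<inter> nbr E v = {}"
      using False F opn_less valid_nbr[OF V] by blast
    then show ?thesis by (simp add: mixed_codeg_def)
  qed
  then show ?thesis using t be by (simp add: al_def)
qed

lemma al_le: "u \<noteq> v \<Longrightarrow> al n E u v \<le> 2 * T"
  using al_le_all[of u v] t be T1 by linarith

lemma mixed_le:
  assumes "u \<noteq> v" shows "mixed_codeg n E u v \<le> nat \<lfloor>(t + \<beta>) / cw n E\<rfloor>"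
proof -
  have "real (mixed_codeg n E u v) \<le> (t + \<beta>) / cw n E"
    using al_le_all[OF assms] c_pos by (simp add: al_def field_simps)
  then show ?thesis by (simp add: le_nat_floor)
qed

lemma mixed_bound: "real (nat \<lfloor>(t + \<beta>) / cw n E\<rfloor>) \<le> (t + \<beta>) / cw n E"
  using t be c_pos by (intro of_nat_floor) auto

lemma closers_eq: "closers n E u w = (cw n E + al n E u w + al n E w u) / cw n E"
  using c_pos by (simp add: closers_def al_def field_simps)

lemma sum_dA:
  assumes "u \<noteq> v" "v \<notin> nbr E u"
  shows "(\<Sum>e\<in>open_pairs n E. dA n E u v e) =
    real (open_codeg n E u v) - (\<Sum>w\<in>opn n E u \<inter> nbr E v. closers n E u w)
    + (if v \<in> opn n E u then real (mixed_codeg n E u v) else 0)"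
proof -
  have "(\<Sum>e\<in>open_pairs n E. dA n E u v e) = (\<Sum>e\<in>open_pairs n E - {{u, v}}. dA n E u v e)"
    by (rule sum.mono_neutral_right) (auto simp: dA_def)
  also have "\<dots> = (\<Sum>e\<in>open_pairs n E - {{u, v}}. real (mixed_codeg n (insert e E) u v) - real (mixed_codeg n E u v))"
    by (rule sum.cong) (auto simp: dA_def)
  finally show ?thesis using mixed_drift(1)[OF V assms] by simp
qed

lemma sum_abs_dA:
  assumes "u \<noteq> v" "v \<notin> nbr E u"
  shows "(\<Sum>e\<in>open_pairs n E. \<bar>dA n E u v e\<bar>) \<le>
    real (open_codeg n E u v) + (\<Sum>w\<in>opn n E u \<inter> nbr E v. closers n E u w)"
proof -
  have "(\<Sum>e\<in>open_pairs n E. \<bar>dA n E u v e\<bar>) = (\<Sum>e\<in>open_pairs n E - {{u, v}}. \<bar>dA n E u v e\<bar>)"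
    by (rule sum.mono_neutral_right) (auto simp: dA_def)
  also have "\<dots> = (\<Sum>e\<in>open_pairs n E - {{u, v}}. \<bar>real (mixed_codeg n (insert e E) u v) - real (mixed_codeg n E u v)\<bar>)"
    by (rule sum.cong) (auto simp: dA_def)
  finally show ?thesis using mixed_drift(2)[OF V assms] by simp
qed

lemma abs_dA:
  assumes "u \<noteq> v" "v \<notin> nbr E u" "e \<in> open_pairs n E"
  shows "\<bar>dA n E u v e\<bar> \<le> 2 + real z"
  using mixed_jump[OF V assms(1,2,3), of z] codeg_le by (auto simp: dA_def)

lemma abs_dX:
  assumes "e \<in> open_pairs n E" shows "4 * (cw n E)\<^sup>2 * \<bar>dX n E u v e\<bar> \<le> 32 * T * \<gamma>"
proof -
  have "\<bar>dX n E u v e\<bar> \<le> 4 + 2 * real (nat \<lfloor>(t + \<beta>) / cw n E\<rfloor>)"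
    unfolding dX_def by (rule open_codeg_jump[OF V assms]) (rule mixed_le)
  also have "\<dots> \<le> 4 + 2 * ((t + \<beta>) / cw n E)" using mixed_bound by linarith
  finally have "4 * (cw n E)\<^sup>2 * \<bar>dX n E u v e\<bar> \<le> 4 * (cw n E)\<^sup>2 * (4 + 2 * ((t + \<beta>) / cw n E))"
    by (intro mult_left_mono) auto
  also have "\<dots> = cw n E * (16 * cw n E + 8 * (t + \<beta>))" using c_pos by (simp add: field_simps power2_eq_square)
  also have "\<dots> \<le> \<gamma> * (32 * T)"
    using c_pos c_le t be T1 ch by (intro mult_mono) auto
  finally show ?thesis by (simp add: mult_ac)
qed

lemma abs_dD:
  assumes "e \<in> open_pairs n E" shows "2 * cw n E / sqrt (real n) * \<bar>dD n E u e\<bar> \<le> 8 * T * \<gamma>"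
proof -
  have "\<bar>dD n E u e\<bar> \<le> 2 + real (nat \<lfloor>(t + \<beta>) / cw n E\<rfloor>)"
    unfolding dD_def by (rule open_deg_jump[OF V assms]) (use mixed_le in auto)
  also have "\<dots> \<le> 2 + ((t + \<beta>) / cw n E)" using mixed_bound by linarith
  finally have "2 * cw n E / sqrt (real n) * \<bar>dD n E u e\<bar> \<le> 2 * cw n E / sqrt (real n) * (2 + ((t + \<beta>) / cw n E))"
    using c_pos by (intro mult_left_mono) auto
  also have "\<dots> = (1 / sqrt (real n)) * (4 * cw n E + 2 * (t + \<beta>))" using c_pos n2 by (simp add: field_simps)
  also have "\<dots> \<le> \<gamma> * (8 * T)"
    using c_pos c_le t be T1 ch nch by (intro mult_mono) auto
  finally show ?thesis by (simp add: mult_ac)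
qed

context
  fixes x y :: nat and e :: "nat set" and yy \<psi> :: real
  assumes e: "e = {x, y}" and o: "y \<in> opn n E x"
    and psi: "\<psi> = (al n E x y + al n E y x + cw n E) / 2 - t" and yy: "yy = 8 * s * (t + \<psi>)"
begin

lemma e_open: "e \<in> open_pairs n E" using o e by (simp add: opn_def)

lemma xy: "x < n" "y < n" "x \<noteq> y" "y \<notin> nbr E x" "x \<notin> nbr E y"
  using o opn_iff[OF V] nbr_sym by blast+

lemma yy_bounds: "0 \<le> yy" "yy \<le> 24 * T * s" "yy \<le> 1 / 8"
proof -
  have a: "yy = s * (4 * (al n E x y + al n E y x + cw n E))" using yy psi by (simp add: algebra_simps)
  show "0 \<le> yy" unfolding a using al_nonneg c_pos s_pos by (intro mult_nonneg_nonneg) (auto intro: add_nonneg_nonneg)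
  have "al n E x y + al n E y x + cw n E \<le> 6 * T"
    using al_le_all[OF xy(3)] al_le_all[OF xy(3)[symmetric]] c_le ch t be T1 by linarith
  then have "yy \<le> s * (4 * (6 * T))" unfolding a using s_pos by (intro mult_left_mono) auto
  then show b: "yy \<le> 24 * T * s" by (simp add: mult_ac)
  have "10 ^ 4 * T * s \<le> 10 ^ 4 * T ^ 3 * s" using T_powers s_pos by (intro mult_right_mono mult_left_mono) auto
  then have "10000 * (T * s) \<le> \<gamma>" using s_small by simp
  moreover have "yy \<le> 24 * (T * s)" using b by simp
  ultimately show "yy \<le> 1 / 8" using ch by linarith
qed

text \<open>By \<open>inv_Q\<close> the quotient of \<open>closers n E x y\<close> and
  \<open>nopen n E\<close> is exactly \<open>yy\<close>. So \<open>yy\<close> is the fraction of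
  open pairs lost by choosing xy, and \<psi> is the deviation from t of the mean of the two mixed
  codegrees at xy, up to \<open>cw n E / 2\<close>.\<close>

lemma nopen_next: "real (nopen n (insert e E)) = real (nopen n E) * (1 - yy)"
proof -
  have "real (nopen n (insert e E)) + closers n E x y = real (nopen n E)"
    using nopen_insert[OF V o] unfolding e closers_def by linarith
  moreover have "closers n E x y = real (nopen n E) * yy"
  proof -
    have q: "real (nopen n E) = 1 / (4 * cw n E * s)" unfolding inv_Q[symmetric] by simp
    show ?thesis unfolding closers_eq q yy psi using c_pos s_pos by (simp add: field_simps)
  qed
  ultimately show ?thesis by (simp add: algebra_simps)
qed

lemma cw_next: "cw n (insert e E) = cw n E / (1 - yy)"
  using yy_bounds unfolding cw_def nopen_next by simp

text \<open>\<open>yy\<close> is at most 24 T s, and of its square one factor T^2 s is at most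
  10^(-4) \<gamma> / T by the assumption on T^3 s.\<close>

lemma yy_sq: "a0 * yy\<^sup>2 \<le> a0 * (s * (576 / 10000 * \<gamma> / T))" if "0 \<le> a0"
proof -
  have "yy\<^sup>2 \<le> (24 * T * s)\<^sup>2" using yy_bounds by (intro power_mono) auto
  also have "\<dots> = s * (576 / 10000 * (10 ^ 4 * T ^ 3 * s) / T)" using T1 by (simp add: power2_eq_square power3_eq_cube field_simps)
  also have "\<dots> \<le> s * (576 / 10000 * \<gamma> / T)"
    using s_small s_pos T1 by (intro mult_left_mono divide_right_mono) auto
  finally show ?thesis using that by (rule mult_left_mono)
qed

text \<open>Open cherries turn into mixed ones at rate s \<open>xh\<close>, each existing cherry is
  lost at the rate of its \<open>closers\<close>, and the growth of \<open>cw\<close> contributes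
  the term with \<open>yy\<close>. If every \<open>al\<close> equals t, loss and renormalisation are
  both 8 s t \<open>al\<close> and cancel; then \<open>al\<close> grows by s per step, as t
  does.\<close>

lemma al_next:
  assumes uv: "u < n" "v < n" "u \<noteq> v" "v \<notin> nbr (insert e E) u"
  shows "\<bar>al n (insert e E) u v - (al n E u v + s * xh n E u v
      - 4 * s * cw n E * (\<Sum>w\<in>opn n E u \<inter> nbr E v. al n E u w + al n E w u)
      + al n E u v * yy + nA n E u v e)\<bar> \<le> s * err"
proof -
  let ?c = "cw n E" and ?A = "opn n E u \<inter> nbr E v"
  have nadj: "v \<notin> nbr E u" using uv(4) by (auto simp: nbr_def)
  have euv: "e \<noteq> {u, v}" using uv(4) by (auto simp: nbr_def)
  define d where "d = ?c * dA n E u v e"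
  have new: "al n (insert e E) u v = (al n E u v + d) / (1 - yy)"
    unfolding al_def cw_next d_def dA_def using euv by (simp add: algebra_simps)
  have db: "\<bar>d\<bar> \<le> \<gamma> * (2 + real z)"
    unfolding d_def abs_mult using abs_dA[OF uv(3) nadj e_open] c_pos c_le
    by (intro mult_mono) auto
  have ab: "\<bar>al n E u v\<bar> \<le> 2 * T" using al_nonneg[of u v] al_le[OF uv(3)] by simp
  have 1: "\<bar>al n (insert e E) u v - (al n E u v + d + al n E u v * yy)\<bar> \<le> 2 * (\<gamma> * (2 + real z) * yy + 2 * T * yy\<^sup>2)"
    unfolding new by (rule expand_inverse[OF yy_bounds(1,3) db ab])
  \<comment> \<open>The conditional mean divides by \<open>nopen\<close>, and \<open>inv_Q\<close>
    turns 1 / \<open>nopen\<close> into 4 \<open>cw\<close> s.\<close>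
  have 2: "d = nA n E u v e + ?c * (4 * ?c * s) * (\<Sum>e\<in>open_pairs n E. dA n E u v e)"
    unfolding d_def nA_def centred_def inv_Q[symmetric] using Q_pos by (simp add: algebra_simps)
  have 3: "?c * (4 * ?c * s) * (\<Sum>e\<in>open_pairs n E. dA n E u v e) =
    s * xh n E u v - 4 * s * ?c * (\<Sum>w\<in>?A. al n E u w + al n E w u)
     - 4 * ?c * s * (al n E u v - (if v \<in> opn n E u then al n E u v else 0))"
  proof -
    define C where "C = (\<Sum>w\<in>?A. closers n E u w)"
    have "?c * C = (\<Sum>w\<in>?A. ?c + (al n E u w + al n E w u))"
      unfolding C_def sum_distrib_left closers_eq using c_pos by (intro sum.cong) auto
    then have C: "?c * C = al n E u v + (\<Sum>w\<in>?A. al n E u w + al n E w u)"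
      by (simp add: sum.distrib mixed_codeg_def al_def mult.commute)
    have "?c * (4 * ?c * s) * (real (open_codeg n E u v) - C + (if v \<in> opn n E u then real (mixed_codeg n E u v) else 0)) =
      s * xh n E u v - 4 * s * ?c * (?c * C) + 4 * ?c * s * (if v \<in> opn n E u then al n E u v else 0)"
      by (simp add: xh_def al_def algebra_simps power2_eq_square)
    then show ?thesis unfolding sum_dA[OF uv(3) nadj] C_def[symmetric] C by (simp add: algebra_simps)
  qed
  have 4: "\<bar>4 * ?c * s * (al n E u v - (if v \<in> opn n E u then al n E u v else 0))\<bar> \<le> 4 * \<gamma> * s * (2 * T)"
    unfolding abs_mult using c_pos c_le s_pos ab by (intro mult_mono) auto
  have 5: "2 * (\<gamma> * (2 + real z) * yy + 2 * T * yy\<^sup>2) \<le> s * (48 * T * \<gamma> * (2 + real z) + \<gamma>)"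
  proof -
    have "\<gamma> * (2 + real z) * yy \<le> \<gamma> * (2 + real z) * (24 * T * s)"
      using yy_bounds ch by (intro mult_left_mono) auto
    moreover have "2 * T * yy\<^sup>2 \<le> s * (1152 / 10000 * \<gamma>)" using yy_sq[of "2 * T"] T1 by (simp add: field_simps)
    moreover have "0 \<le> s * \<gamma>" using s_pos ch by simp
    ultimately show ?thesis by (simp add: algebra_simps)
  qed
  have 6: "s * (48 * T * \<gamma> * (2 + real z) + \<gamma>) + 4 * \<gamma> * s * (2 * T) \<le> s * err"
  proof -
    have "\<gamma> * 1 \<le> \<gamma> * (T * (2 + real z))" using ch T1 by (intro mult_left_mono) (simp_all add: mult_ge1_I)
    moreover have "\<gamma> * (T * 1) \<le> \<gamma> * (T * (2 + real z))" using ch T1 by (intro mult_left_mono) auto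
    moreover have "0 \<le> \<gamma> * (T * real z)" "0 \<le> \<gamma> * T" using ch T1 by auto
    ultimately have "48 * T * \<gamma> * (2 + real z) + \<gamma> + 8 * \<gamma> * T \<le> 100 * (\<gamma> * (T * (2 + real z)))"
      by (simp add: algebra_simps)
    also have "\<dots> \<le> 10 ^ 4 * (\<gamma> * (T\<^sup>2 * (real z + 3)))"
      using ch T1 T_powers by (intro mult_mono) auto
    finally have "48 * T * \<gamma> * (2 + real z) + \<gamma> + 8 * \<gamma> * T \<le> err" by (simp add: err_def mult_ac)
    then have "s * (48 * T * \<gamma> * (2 + real z) + \<gamma> + 8 * \<gamma> * T) \<le> s * err" using s_pos by simp
    then show ?thesis by (simp add: algebra_simps)
  qed
  show ?thesis using 1 2 3 4 5 6 unfolding abs_le_iff by linarith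
qed

text \<open>As for \<open>al\<close>, but \<open>cw\<close> enters squared and both rows lose: with
  every \<open>al\<close> equal to t the renormalisation 2 \<open>xh\<close> \<open>yy\<close> and
  the losses are both 16 s t \<open>xh\<close>, so \<open>xh\<close> stays at 1.\<close>

lemma xh_next:
  assumes uv: "u < n" "v < n" "u \<noteq> v" "v \<notin> nbr E u"
  shows "\<bar>xh n (insert e E) u v - (xh n E u v + 2 * xh n E u v * yy
      - 4 * s * (4 * (cw n E)\<^sup>2 * (\<Sum>w\<in>opn n E u \<inter> opn n E v. al n E u w + al n E w u + al n E v w + al n E w v))
      + nX n E u v e)\<bar> \<le> s * err"
proof -
  let ?c = "cw n E" and ?X = "opn n E u \<inter> opn n E v"
  define d where "d = 4 * ?c\<^sup>2 * dX n E u v e"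
  have new: "xh n (insert e E) u v = (xh n E u v + d) / (1 - yy)\<^sup>2"
    unfolding xh_def cw_next d_def dX_def by (simp add: algebra_simps power_divide diff_divide_distrib)
  have db: "\<bar>d\<bar> \<le> 32 * T * \<gamma>"
    using abs_dX[OF e_open, of u v] by (simp add: d_def abs_mult)
  have ab: "\<bar>xh n E u v\<bar> \<le> 2" using xh_near[OF uv] be by linarith
  have xn: "0 \<le> xh n E u v" by (simp add: xh_def)
  have 1: "\<bar>xh n (insert e E) u v - (xh n E u v + d + 2 * xh n E u v * yy)\<bar> \<le> 2 * (2 * (32 * T * \<gamma>) * yy + 3 * 2 * yy\<^sup>2)"
    unfolding new by (rule expand_inverse_square[OF yy_bounds(1,3) db ab])
  define S where "S = (\<Sum>w\<in>?X. al n E u w + al n E w u + al n E v w + al n E w v)"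
  define \<Sigma> where "\<Sigma> = (\<Sum>e\<in>open_pairs n E. dX n E u v e)"
  have 2: "d = nX n E u v e + 4 * ?c\<^sup>2 * (4 * ?c * s) * \<Sigma>"
    unfolding d_def nX_def centred_def inv_Q[symmetric] \<Sigma>_def using Q_pos by (simp add: algebra_simps)
  have cl: "(\<Sum>w\<in>?X. closers n E u w + closers n E v w) = 2 * real (open_codeg n E u v) + S / ?c"
    unfolding closers_eq S_def using c_pos
    by (simp add: sum_divide_distrib open_codeg_def add_divide_distrib sum.distrib)
  have lo: "- (2 * real (open_codeg n E u v) + S / ?c) \<le> \<Sigma>"
    using open_codeg_drift(1)[OF V uv(3,4)] unfolding cl \<Sigma>_def dX_def .
  have up: "\<Sigma> \<le> - (2 * real (open_codeg n E u v) + S / ?c) + real (open_codeg n E u v) * real (codeg E u v)"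
    using open_codeg_drift(2)[OF V uv(3,4)] unfolding cl \<Sigma>_def dX_def .
  have "real (open_codeg n E u v) * real (codeg E u v) \<le> real (open_codeg n E u v) * real z"
    using codeg_le[OF uv(3)] by (intro mult_left_mono) auto
  then have sg: "\<bar>\<Sigma> + S / ?c\<bar> \<le> real (open_codeg n E u v) * (real z + 2)"
    using lo up unfolding abs_le_iff by (simp add: algebra_simps)
  have 3: "\<bar>4 * ?c\<^sup>2 * (4 * ?c * s) * \<Sigma> + 4 * s * (4 * ?c\<^sup>2 * S)\<bar> \<le> 4 * \<gamma> * s * (2 * (real z + 2))"
  proof -
    have "4 * ?c\<^sup>2 * (4 * ?c * s) * \<Sigma> + 4 * s * (4 * ?c\<^sup>2 * S) = 4 * ?c\<^sup>2 * (4 * ?c * s) * (\<Sigma> + S / ?c)"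
      using c_pos by (simp add: field_simps power2_eq_square)
    then have "\<bar>4 * ?c\<^sup>2 * (4 * ?c * s) * \<Sigma> + 4 * s * (4 * ?c\<^sup>2 * S)\<bar> = 4 * ?c\<^sup>2 * (4 * ?c * s) * \<bar>\<Sigma> + S / ?c\<bar>"
      using c_pos s_pos by (simp add: abs_mult)
    also have "\<dots> \<le> 4 * ?c\<^sup>2 * (4 * ?c * s) * (real (open_codeg n E u v) * (real z + 2))"
      using c_pos s_pos by (intro mult_left_mono sg) auto
    also have "\<dots> = 4 * ?c * s * (xh n E u v * (real z + 2))" by (simp add: xh_def)
    also have "\<dots> \<le> 4 * \<gamma> * s * (2 * (real z + 2))"
      using c_pos c_le s_pos ab xn ch by (intro mult_mono) auto
    finally show ?thesis .
  qed
  have 5: "2 * (2 * (32 * T * \<gamma>) * yy + 3 * 2 * yy\<^sup>2) \<le> s * (3072 * T\<^sup>2 * \<gamma> + \<gamma>)"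
  proof -
    have "2 * (32 * T * \<gamma>) * yy \<le> 2 * (32 * T * \<gamma>) * (24 * T * s)"
      using yy_bounds ch T1 by (intro mult_left_mono) auto
    moreover have "6 * yy\<^sup>2 \<le> s * (3456 / 10000 * \<gamma>)"
    proof -
      have "\<gamma> / T \<le> \<gamma>" using T1 ch by (simp add: field_simps)
      then have *: "s * (576 / 10000 * \<gamma> / T) \<le> s * (576 / 10000 * \<gamma>)" using s_pos by (intro mult_left_mono) auto
      have "6 * yy\<^sup>2 \<le> 6 * (s * (576 / 10000 * \<gamma> / T))" by (rule yy_sq) simp
      also have "\<dots> \<le> 6 * (s * (576 / 10000 * \<gamma>))" using * by (rule mult_left_mono) simp
      finally show ?thesis by simp
    qed
    moreover have "0 \<le> s * \<gamma>" using s_pos ch by simp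
    ultimately show ?thesis by (simp add: algebra_simps power2_eq_square)
  qed
  have 6: "s * (3072 * T\<^sup>2 * \<gamma> + \<gamma>) + 4 * \<gamma> * s * (2 * (real z + 2)) \<le> s * err"
  proof -
    have T2: "1 \<le> T\<^sup>2" using T1 by simp
    have "\<gamma> * T\<^sup>2 * 1 \<le> \<gamma> * T\<^sup>2 * (real z + 3)" using ch by (intro mult_left_mono) auto
    moreover have "\<gamma> * 1 * 1 \<le> \<gamma> * T\<^sup>2 * (real z + 3)" using ch T2 by (intro mult_mono) auto
    moreover have "\<gamma> * 1 * (real z + 2) \<le> \<gamma> * T\<^sup>2 * (real z + 3)" using ch T2 by (intro mult_mono) auto
    moreover have "0 \<le> \<gamma> * T\<^sup>2 * (real z + 3)" using ch by simp
    ultimately have "3072 * (\<gamma> * T\<^sup>2 * 1) + \<gamma> * 1 * 1 + 8 * (\<gamma> * 1 * (real z + 2)) \<le> 10000 * (\<gamma> * T\<^sup>2 * (real z + 3))"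
      by linarith
    then have "3072 * T\<^sup>2 * \<gamma> + \<gamma> + 8 * \<gamma> * (real z + 2) \<le> 10 ^ 4 * (\<gamma> * T\<^sup>2 * (real z + 3))"
      by (simp add: mult_ac)
    then have "s * (3072 * T\<^sup>2 * \<gamma> + \<gamma> + 8 * \<gamma> * (real z + 2)) \<le> s * err"
      using s_pos by (intro mult_left_mono) (auto simp: err_def mult_ac)
    then show ?thesis by (simp add: algebra_simps)
  qed
  show ?thesis using 1 2 3 5 6 unfolding abs_le_iff S_def by linarith
qed

lemma dh_next:
  assumes u: "u < n"
  shows "\<bar>dh n (insert e E) u - (dh n E u + dh n E u * yy
      - 4 * s * (2 * cw n E / sqrt (real n) * (\<Sum>w\<in>opn n E u. al n E u w + al n E w u))
      + nD n E u e)\<bar> \<le> s * err"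
proof -
  let ?c = "cw n E" and ?k = "2 * cw n E / sqrt (real n)"
  have k0: "0 \<le> ?k" using c_pos by simp
  define d where "d = ?k * dD n E u e"
  have new: "dh n (insert e E) u = (dh n E u + d) / (1 - yy)"
    unfolding dh_def cw_next d_def dD_def by (simp add: algebra_simps)
  have db: "\<bar>d\<bar> \<le> 8 * T * \<gamma>"
    unfolding d_def abs_mult abs_of_nonneg[OF k0] by (rule abs_dD[OF e_open])
  have ab: "\<bar>dh n E u\<bar> \<le> 2" using dh_near[OF u] be by linarith
  have dn: "0 \<le> dh n E u" unfolding dh_def by (intro mult_nonneg_nonneg k0) simp
  have 1: "\<bar>dh n (insert e E) u - (dh n E u + d + dh n E u * yy)\<bar> \<le> 2 * (8 * T * \<gamma> * yy + 2 * yy\<^sup>2)"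
    unfolding new by (rule expand_inverse[OF yy_bounds(1,3) db ab])
  define S where "S = (\<Sum>w\<in>opn n E u. al n E u w + al n E w u)"
  have 2: "d = nD n E u e + ?k * (4 * ?c * s) * (\<Sum>e\<in>open_pairs n E. dD n E u e)"
    unfolding d_def nD_def centred_def inv_Q[symmetric] using Q_pos by (simp add: algebra_simps)
  have cl: "(\<Sum>e\<in>open_pairs n E. dD n E u e) = - (real (open_deg n E u) + S / ?c)"
    using open_deg_drift(1)[OF V, of u] unfolding dD_def closers_eq S_def using c_pos
    by (simp add: sum_divide_distrib open_deg_def add_divide_distrib sum.distrib)
  have 3: "?k * (4 * ?c * s) * (\<Sum>e\<in>open_pairs n E. dD n E u e) = - 4 * s * (?k * S) - 4 * ?c * s * dh n E u"
  proof -
    define k where "k = ?k"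
    have "4 * ?c * s * (S / ?c) = 4 * s * S" using c_pos by simp
    then have "k * (4 * ?c * s) * - (real (open_deg n E u) + S / ?c) = - 4 * s * (k * S) - 4 * ?c * s * (k * real (open_deg n E u))"
      by (simp add: algebra_simps)
    then show ?thesis unfolding cl dh_def k_def .
  qed
  have 4: "\<bar>4 * ?c * s * dh n E u\<bar> \<le> 4 * \<gamma> * s * 2"
    unfolding abs_mult using c_pos c_le s_pos ab dn ch by (intro mult_mono) auto
  have 5: "2 * (8 * T * \<gamma> * yy + 2 * yy\<^sup>2) \<le> s * (384 * T\<^sup>2 * \<gamma> + \<gamma>)"
  proof -
    have "8 * T * \<gamma> * yy \<le> 8 * T * \<gamma> * (24 * T * s)"
      using yy_bounds ch T1 by (intro mult_left_mono) auto
    moreover have "2 * yy\<^sup>2 \<le> s * (1152 / 10000 * \<gamma>)"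
    proof -
      have "\<gamma> / T \<le> \<gamma>" using T1 ch by (simp add: field_simps)
      then have *: "s * (576 / 10000 * \<gamma> / T) \<le> s * (576 / 10000 * \<gamma>)" using s_pos by (intro mult_left_mono) auto
      have "2 * yy\<^sup>2 \<le> 2 * (s * (576 / 10000 * \<gamma> / T))" by (rule yy_sq) simp
      also have "\<dots> \<le> 2 * (s * (576 / 10000 * \<gamma>))" using * by (rule mult_left_mono) simp
      finally show ?thesis by simp
    qed
    moreover have "0 \<le> s * \<gamma>" using s_pos ch by simp
    ultimately show ?thesis by (simp add: algebra_simps power2_eq_square)
  qed
  have 6: "s * (384 * T\<^sup>2 * \<gamma> + \<gamma>) + 4 * \<gamma> * s * 2 \<le> s * err"
  proof -
    have T2: "1 \<le> T\<^sup>2" using T1 by simp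
    have "\<gamma> * T\<^sup>2 * 1 \<le> \<gamma> * T\<^sup>2 * (real z + 3)" using ch by (intro mult_left_mono) auto
    moreover have "\<gamma> * 1 * 1 \<le> \<gamma> * T\<^sup>2 * (real z + 3)" using ch T2 by (intro mult_mono) auto
    moreover have "0 \<le> \<gamma> * T\<^sup>2 * (real z + 3)" using ch by simp
    ultimately have "384 * (\<gamma> * T\<^sup>2 * 1) + 9 * (\<gamma> * 1 * 1) \<le> 10000 * (\<gamma> * T\<^sup>2 * (real z + 3))"
      by linarith
    then have "384 * T\<^sup>2 * \<gamma> + \<gamma> + 8 * \<gamma> \<le> 10 ^ 4 * (\<gamma> * T\<^sup>2 * (real z + 3))"
      by (simp add: mult_ac)
    then have "s * (384 * T\<^sup>2 * \<gamma> + \<gamma> + 8 * \<gamma>) \<le> s * err"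
      using s_pos by (intro mult_left_mono) (auto simp: err_def mult_ac)
    then show ?thesis by (simp add: algebra_simps)
  qed
  show ?thesis using 1 2 3 4 5 6 unfolding abs_le_iff S_def by linarith
qed

end
end
end

section \<open>Functions and operators on ordered open pairs\<close>

definition Ipairs :: "nat \<Rightarrow> nat set set \<Rightarrow> (nat \<times> nat) set" where
  "Ipairs n E = {(u, v). v \<in> opn n E u}"

lemma Ipairs_iff [simp]: "(u, v) \<in> Ipairs n E \<longleftrightarrow> v \<in> opn n E u"
  by (simp add: Ipairs_def)

lemma Ipairs_Sigma: "Ipairs n E = Sigma {..<n} (opn n E)"
  using opn_less by (auto simp: Ipairs_def)

lemma finite_Ipairs [simp]: "finite (Ipairs n E)"
  by (simp add: Ipairs_Sigma)

lemma card_Ipairs_le: "card (Ipairs n E) \<le> n\<^sup>2"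
proof -
  have "Ipairs n E \<subseteq> {..<n} \<times> {..<n}" using opn_less by (auto simp: Ipairs_def)
  then have "card (Ipairs n E) \<le> card ({..<n} \<times> {..<n})" by (rule card_mono[rotated]) simp
  then show ?thesis by (simp add: power2_eq_square)
qed

text \<open>\<open>al\<close> is not symmetric, which is why pairs are ordered; openness is
  symmetric, so reversal permutes the index set.\<close>

lemma lpb_swap:
  assumes "lpb M (Ipairs n E) f A" shows "lpb M (Ipairs n E) (\<lambda>p. f (snd p, fst p)) A"
proof -
  have "(\<Sum>p\<in>Ipairs n E. \<bar>f (snd p, fst p)\<bar> ^ M) = (\<Sum>p\<in>Ipairs n E. \<bar>f p\<bar> ^ M)"
    by (rule sum.reindex_bij_witness[of _ "\<lambda>p. (snd p, fst p)" "\<lambda>p. (snd p, fst p)"])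
      (auto simp: Ipairs_def opn_sym)
  then show ?thesis using assms by (simp add: lpb_def)
qed

lemma sum_row: "(\<Sum>q\<in>(\<lambda>w. (u, w)) ` A. f q) = (\<Sum>w\<in>A. f (u, w))"
  by (subst sum.reindex) (auto simp: inj_on_def)

lemma card_row: "card ((\<lambda>w. (u, w)) ` A) = card A"
  by (rule card_image) (auto simp: inj_on_def)

text \<open>Schur test in each row: (u, v) is linked to (u, w) when v and w are related, a symmetric
  kernel since Rel is symmetric.\<close>

lemma lpb_row_sum:
  assumes f: "lpb M (Ipairs n E) f A" and M: "even M" "0 < M"
    and sym: "\<And>v w. Rel v w \<Longrightarrow> Rel w v" and m: "0 \<le> m"
    and c: "\<And>u v. v \<in> opn n E u \<Longrightarrow> real (card {w \<in> opn n E u. Rel v w}) \<le> m"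
  shows "lpb M (Ipairs n E) (\<lambda>p. \<Sum>w | w \<in> opn n E (fst p) \<and> Rel (snd p) w. f (fst p, w)) (m * A)"
proof -
  let ?P = "\<lambda>p. (\<lambda>w. (fst p, w)) ` {w \<in> opn n E (fst p). Rel (snd p) w}"
  have "lpb M (Ipairs n E) (\<lambda>p. \<Sum>q\<in>?P p. f q) (m * A)"
    by (rule lpb_schur[OF f finite_Ipairs M]) (use sym c m in \<open>auto simp: card_row\<close>)
  then show ?thesis by (simp only: sum_row)
qed

lemma lpb_row_average:
  assumes f: "lpb M (Ipairs n E) f A" and M: "even M" "0 < M"
  shows "lpb M (Ipairs n E) (\<lambda>p. (\<Sum>w\<in>opn n E (fst p). f (fst p, w)) / card (opn n E (fst p))) A"
proof -
  let ?P = "\<lambda>p. (\<lambda>w. (fst p, w)) ` opn n E (fst p)"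
  have "lpb M (Ipairs n E) (\<lambda>p. (\<Sum>q\<in>?P p. f q) / card (?P p)) A"
    by (rule lpb_average[OF f finite_Ipairs M]) auto
  then show ?thesis by (simp only: sum_row card_row)
qed

text \<open>The link of \<open>u\<close> is the graph on the open neighbourhood of \<open>u\<close>; its normalised adjacency
  operator is close to averaging.\<close>

lemma lpb_link_operator:
  fixes c t p \<Lambda> \<theta> \<mu> g N :: real
  assumes V: "valid n E" and f: "lpb M (Ipairs n E) f A" and M: "even M" "2 \<le> M"
    and U: "\<And>S R. S \<subseteq> {..<n} \<Longrightarrow> R \<subseteq> {..<n} \<Longrightarrow>
      ecount E S R \<le> p * real (card S) * real (card R) + \<Lambda> * (real (card S) + real (card R))"
    and c: "0 < c" and t: "1 \<le> t" and th: "0 < \<theta>" "\<theta> \<le> 1"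
    and dens: "\<And>u. u < n \<Longrightarrow> c * p * real (open_deg n E u) \<le> (1 + \<theta>) * t" and lam: "c * \<Lambda> \<le> \<theta>\<^sup>2 * t"
    and reg: "\<And>u v. v \<in> opn n E u \<Longrightarrow> \<bar>c * real (mixed_codeg n E u v) - t\<bar> \<le> \<theta> * t"
    and mu: "0 < \<mu>" "\<mu> \<le> 1 / 2" "4 * \<theta> \<le> 3 * \<mu>\<^sup>2" and g: "0 \<le> g" "5 * \<mu> \<le> g ^ M"
    and N: "(real n)\<^sup>2 \<le> N ^ M" "0 \<le> N"
  shows "lpb M (Ipairs n E) (\<lambda>p. c * (\<Sum>w\<in>opn n E (fst p) \<inter> nbr E (snd p). f (fst p, w)) -
      t * ((\<Sum>w\<in>opn n E (fst p). f (fst p, w)) / card (opn n E (fst p))))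
    (3 * t * (4 * g * real L + 2 * N / 2 ^ L) * A)"
proof -
  let ?I = "Ipairs n E"
  define D where "D u = real (card (opn n E u))" for u
  define k where "k u v w = c * (if w \<in> nbr E v then 1 else 0) - t / D u" for u v w
  \<comment> \<open>b is block diagonal over u. Each block is the scaled adjacency matrix of the
    link of u minus the constant matrix t / D u, which implements t times the row average.\<close>
  define b where "b p q = (if fst q = fst p then k (fst p) (snd p) (snd q) else 0)" for p q :: "nat \<times> nat"
  have row: "(\<Sum>q\<in>?I. (if fst q = fst p then F (snd q) else 0)) = (\<Sum>w\<in>opn n E (fst p). F w)" for p :: "nat \<times> nat" and F :: "nat \<Rightarrow> real"
  proof -
    have "(\<Sum>q\<in>?I. (if fst q = fst p then F (snd q) else 0)) = (\<Sum>q\<in>(\<lambda>w. (fst p, w)) ` opn n E (fst p). F (snd q))"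
      by (rule sum.mono_neutral_cong_right) auto
    then show ?thesis by (simp add: sum_row)
  qed
  have symb: "b p q = b q p" for p q
    using nbr_sym[of "snd p" E "snd q"] by (auto simp: b_def k_def)
  have rows: "(\<Sum>q\<in>?I. \<bar>b p q\<bar>) \<le> 3 * t" if p: "p \<in> ?I" for p
  proof -
    obtain u v where uv: "p = (u, v)" by force
    have vo: "v \<in> opn n E u" using p uv by simp
    then have Du: "0 < D u" by (auto simp: D_def card_gt_0_iff)
    have "(\<Sum>q\<in>?I. \<bar>b p q\<bar>) = (\<Sum>q\<in>?I. if fst q = fst p then \<bar>k (fst p) (snd p) (snd q)\<bar> else 0)"
      by (rule sum.cong) (auto simp: b_def)
    also have "\<dots> = (\<Sum>w\<in>opn n E u. \<bar>k u v w\<bar>)" by (subst row) (simp add: uv)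
    also have "\<dots> \<le> (\<Sum>w\<in>opn n E u. c * (if w \<in> nbr E v then 1 else 0) + t / D u)"
      by (rule sum_mono) (use c t Du in \<open>auto simp: k_def intro: order_trans[OF abs_triangle_ineq4]\<close>)
    also have "\<dots> = c * real (mixed_codeg n E u v) + t"
      using vo by (auto simp: sum.distrib D_def mixed_codeg_def sum.If_cases simp flip: sum_distrib_left)
    \<comment> \<open>At most 2 t from the scaled mixed codegree and t from the subtracted
      average.\<close>
    also have "\<dots> \<le> 3 * t"
    proof -
      have "\<theta> * t \<le> t" using th t by simp
      then show ?thesis using reg[OF vo] unfolding abs_le_iff by linarith
    qed
    finally show ?thesis .
  qed
  have cols: "(\<Sum>p\<in>?I. \<bar>b p q\<bar>) \<le> 3 * t" if "q \<in> ?I" for q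
    using rows[OF that] by (simp add: symb[of _ q])
  have disc: "\<bar>\<Sum>x\<in>S. \<Sum>y\<in>R. b x y\<bar> \<le> 3 * t * \<mu>\<^sup>2 * (real (card S) + real (card R))"
    if S: "S \<subseteq> ?I" and R: "R \<subseteq> ?I" for S R
  proof -
    define row where "row Z u = {v. (u, v) \<in> Z}" for Z :: "(nat \<times> nat) set" and u
    have sub: "row Z u \<subseteq> opn n E u" if "Z \<subseteq> ?I" for Z u using that by (auto simp: row_def)
    have Sig: "Z = Sigma {..<n} (row Z)" if "Z \<subseteq> ?I" for Z
      using that opn_less by (fastforce simp: row_def)
    have fin: "finite (row Z u)" if "Z \<subseteq> ?I" for Z u using sub[OF that] by (rule finite_subset) simp
    have cardZ: "real (card Z) = (\<Sum>u<n. real (card (row Z u)))" if "Z \<subseteq> ?I" for Z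
    proof -
      have "card Z = card (Sigma {..<n} (row Z))" by (simp only: Sig[OF that, symmetric])
      then show ?thesis by (simp add: card_SigmaI fin[OF that])
    qed
    have R1: "(\<Sum>q\<in>R. b (u, v) q) = (\<Sum>w\<in>row R u. k u v w)" for u v
    proof -
      have "(\<Sum>q\<in>R. b (u, v) q) = (\<Sum>q\<in>(\<lambda>w. (u, w)) ` row R u. k u v (snd q))"
        by (rule sum.mono_neutral_cong_right)
          (use R finite_subset[OF R] in \<open>auto simp: b_def row_def\<close>)
      then show ?thesis by (simp add: sum_row)
    qed
    have "(\<Sum>x\<in>S. \<Sum>y\<in>R. b x y) = (\<Sum>u<n. \<Sum>v\<in>row S u. \<Sum>w\<in>row R u. k u v w)"
    proof -
      have "(\<Sum>x\<in>S. \<Sum>y\<in>R. b x y) = (\<Sum>x\<in>Sigma {..<n} (row S). \<Sum>y\<in>R. b x y)"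
        by (simp only: Sig[OF S, symmetric])
      also have "\<dots> = (\<Sum>(u, v)\<in>Sigma {..<n} (row S). \<Sum>w\<in>row R u. k u v w)"
        by (rule sum.cong) (auto simp: R1)
      also have "\<dots> = (\<Sum>u<n. \<Sum>v\<in>row S u. \<Sum>w\<in>row R u. k u v w)"
        by (rule sum.Sigma[symmetric]) (auto simp: fin[OF S])
      finally show ?thesis .
    qed
    then have "\<bar>\<Sum>x\<in>S. \<Sum>y\<in>R. b x y\<bar> \<le> (\<Sum>u<n. \<bar>\<Sum>v\<in>row S u. \<Sum>w\<in>row R u. k u v w\<bar>)"
      by simp
    also have "\<dots> \<le> (\<Sum>u<n. 4 * \<theta> * t * (real (card (row S u)) + real (card (row R u))))"
    proof (rule sum_mono)
      fix u assume "u \<in> {..<n}"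
      then have u: "u < n" by simp
      show "\<bar>\<Sum>v\<in>row S u. \<Sum>w\<in>row R u. k u v w\<bar> \<le> 4 * \<theta> * t * (real (card (row S u)) + real (card (row R u)))"
      proof (cases "opn n E u = {}")
        case True
        then have "row S u = {}" using sub[OF S, of u] by simp
        then show ?thesis using th t by simp
      next
        case False
        have on: "opn n E u \<subseteq> {..<n}" using opn_less by auto
        show ?thesis unfolding k_def D_def
        proof (rule link_discrepancy[where p = p and \<Lambda> = \<Lambda>])
          show "c * p * real (card (opn n E u)) \<le> (1 + \<theta>) * t"
            using dens[OF u] by (simp add: open_deg_def)
          show "\<bar>c * real (card (opn n E u \<inter> nbr E v)) - t\<bar> \<le> \<theta> * t" if "v \<in> opn n E u" for v
            using reg[OF that] by (simp add: mixed_codeg_def)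
          show "ecount E S' R' \<le> p * real (card S') * real (card R') + \<Lambda> * (real (card S') + real (card R'))"
            if "S' \<subseteq> opn n E u" "R' \<subseteq> opn n E u" for S' R'
            by (rule U) (use that on in auto)
        qed (use False sub[OF S] sub[OF R] c t th lam in auto)
      qed
    qed
    also have "\<dots> = 4 * \<theta> * t * (real (card S) + real (card R))"
      unfolding cardZ[OF S] cardZ[OF R] by (simp add: sum.distrib flip: sum_distrib_left)
    also have "\<dots> \<le> 3 * t * \<mu>\<^sup>2 * (real (card S) + real (card R))"
    proof (rule mult_right_mono)
      have "4 * \<theta> * t \<le> 3 * \<mu>\<^sup>2 * t" using mu t by (intro mult_right_mono) auto
      then show "4 * \<theta> * t \<le> 3 * t * \<mu>\<^sup>2" by (simp add: mult_ac)
    qed simp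
    finally show ?thesis .
  qed
  have ind: "(\<Sum>x\<in>?I. \<bar>\<Sum>y\<in>R. b x y\<bar> ^ M) \<le> (3 * t * g) ^ M * real (card R)" if R: "R \<subseteq> ?I" for R
  proof -
    have "(\<Sum>x\<in>?I. \<bar>\<Sum>y\<in>R. b x y\<bar> ^ M) \<le> (3 * t) ^ M * (5 * \<mu>) * real (card R)"
      by (rule lpb_kernel_indicator[OF finite_Ipairs M(2) R rows cols disc[OF _ R]]) (use mu t in auto)
    also have "\<dots> \<le> (3 * t) ^ M * g ^ M * real (card R)"
      using g t by (intro mult_right_mono mult_left_mono) auto
    finally show ?thesis by (simp add: power_mult_distrib)
  qed
  have cN: "real (card ?I) \<le> N ^ M"
    using card_Ipairs_le[of n E] N(1) by (metis of_nat_le_iff of_nat_power order_trans)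
  have "lpb M ?I (\<lambda>p. \<Sum>q\<in>?I. b p q * f q) (3 * t * (4 * g * real L + 2 * N / 2 ^ L) * A)"
    by (rule lpb_kernel[OF finite_Ipairs M rows ind _ g(1) cN N(2) f]) (use t in auto)
  then show ?thesis
  proof (rule lpb_cong)
    fix p assume p: "p \<in> ?I"
    obtain u v where uv: "p = (u, v)" by force
    have "(\<Sum>q\<in>?I. b p q * f q) = (\<Sum>q\<in>?I. if fst q = fst p then k (fst p) (snd p) (snd q) * f (fst p, snd q) else 0)"
      by (rule sum.cong) (auto simp: b_def)
    also have "\<dots> = (\<Sum>w\<in>opn n E u. k u v w * f (u, w))" by (subst row) (simp add: uv)
    also have "\<dots> = (\<Sum>w\<in>opn n E u. c * (if w \<in> nbr E v then f (u, w) else 0) - t / D u * f (u, w))"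
      by (rule sum.cong) (auto simp: k_def algebra_simps)
    also have "\<dots> = c * (\<Sum>w\<in>opn n E u \<inter> nbr E v. f (u, w)) - t / D u * (\<Sum>w\<in>opn n E u. f (u, w))"
      by (simp only: sum_subtractf sum.inter_restrict[OF finite_opn] sum_distrib_left)
    finally show "c * (\<Sum>w\<in>opn n E (fst p) \<inter> nbr E (snd p). f (fst p, w)) -
      t * ((\<Sum>w\<in>opn n E (fst p). f (fst p, w)) / card (opn n E (fst p))) = (\<Sum>q\<in>?I. b p q * f q)"
      by (simp add: uv D_def)
  qed
qed

section \<open>Propagation of the errors\<close>

text \<open>A deterministic statement: one run on which noise sums and edge counts obey their bounds
  and \<open>good\<close> holds before time h; the aim is \<open>good\<close> at h. The order of
  sizes prevents circularity: quadratic terms are below the noise \<nu>, the grown noise is below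
  \<Phi>, and \<Phi>, even after multiplication by T^2, is below \<beta>.\<close>

locale tracking_upto = tracking +
  fixes E :: "nat \<Rightarrow> nat set set" and en :: "nat \<Rightarrow> nat set" and h M L :: nat
    and \<nu> \<Phi> N W \<kappa> a B \<theta> \<mu> g \<delta> \<Lambda> :: real
  assumes E0: "E 0 = {}"
    and step: "\<And>j. j < h \<Longrightarrow> en j \<in> open_pairs n (E j) \<and> E (Suc j) = insert (en j) (E j)"
    and good_before: "\<And>j. j < h \<Longrightarrow> good (E j) (real j * s)"
    and codeg_h: "\<And>u v. u \<noteq> v \<Longrightarrow> codeg (E h) u v \<le> z"
    and time: "real h * s \<le> T"
    and noiseA: "\<And>j u v. j \<le> h \<Longrightarrow> u < n \<Longrightarrow> v < n \<Longrightarrow> u \<noteq> v \<Longrightarrow> v \<notin> nbr (E j) u \<Longrightarrow>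
      \<bar>\<Sum>k<j. nA n (E k) u v (en k)\<bar> \<le> \<nu>"
    and noiseX: "\<And>j u v. j \<le> h \<Longrightarrow> u < n \<Longrightarrow> v < n \<Longrightarrow> u \<noteq> v \<Longrightarrow> v \<notin> nbr (E j) u \<Longrightarrow>
      \<bar>\<Sum>k<j. nX n (E k) u v (en k)\<bar> \<le> \<nu>"
    and noiseD: "\<And>j u. j \<le> h \<Longrightarrow> u < n \<Longrightarrow> \<bar>\<Sum>k<j. nD n (E k) u (en k)\<bar> \<le> \<nu>"
    and counts: "\<And>j S R. j < h \<Longrightarrow> S \<subseteq> {..<n} \<Longrightarrow> R \<subseteq> {..<n} \<Longrightarrow>
      ecount (E j) S R \<le> (1 + \<delta>) * (2 * real j / (real n)\<^sup>2) * real (card S) * real (card R)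
        + \<Lambda> * (real (card S) + real (card R))"
    and M: "even M" "2 \<le> M" and N: "(real n)\<^sup>2 \<le> N ^ M" "1 \<le> N"
    and nu: "0 < \<nu>" "2 * (1 / (real n - 1)\<^sup>2) \<le> \<nu>"
    and W: "W = 8 * \<nu> * N" and a: "a = 4 / \<kappa>" and B: "B = 100 * (1 + a)" and kap: "0 < \<kappa>"
    and Phi: "(1 + a) * W * exp (\<kappa> * T\<^sup>2 + B * T) \<le> \<Phi>" and chPhi: "\<gamma> \<le> \<Phi>"
    and second: "32 * \<Phi> * \<beta> + err \<le> \<nu>"
    and beta1: "2 * \<nu> + T * (100 * \<Phi> + \<nu>) \<le> \<beta>"
    and beta2: "\<nu> + T * (2 * \<nu> + T * (100 * \<Phi> + \<nu>) + 100 * T * \<Phi>) \<le> \<beta>"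
    and th: "0 < \<theta>" "\<theta> \<le> 1" "\<beta> \<le> \<theta>" "(1 + \<delta>) * (1 + \<beta>) \<le> 1 + \<theta>" "\<gamma> * \<Lambda> \<le> \<theta>\<^sup>2" "0 \<le> \<Lambda>" "0 \<le> \<delta>"
    and mu: "0 < \<mu>" "\<mu> \<le> 1 / 2" "4 * \<theta> \<le> 3 * \<mu>\<^sup>2" and gM: "0 \<le> g" "5 * \<mu> \<le> g ^ M"
    and gain: "8 * (1 + a) * (3 * (4 * g * real L + 2 * N / 2 ^ L)) \<le> \<kappa>"
    and zeta: "20 * T * \<beta> + 10 * T * \<gamma> + 2 * \<gamma> \<le> \<zeta>" "\<zeta> \<le> 1"
    and dens: "exp (4 * (real h * s)\<^sup>2 + \<zeta>) / (2 * sqrt (real n)) \<le> \<gamma>"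
begin

definition tt :: "nat \<Rightarrow> real" where "tt j = real j * s"
text \<open>The growth envelope. Its relative growth per step is at least s (2 \<kappa> t + B): the
  first part pays for the link operator in \<open>Nr\<close> and for the feeding of
  \<open>dd\<close>, the second for all operators of bounded norm.\<close>

definition om :: "nat \<Rightarrow> real" where "om j = exp (\<kappa> * (tt j)\<^sup>2 + B * tt j)"
definition phi :: "nat \<Rightarrow> nat \<Rightarrow> nat \<Rightarrow> real" where "phi j u v = al n (E j) u v - tt j"
text \<open>Solved from \<open>nopen\<close> (E (Suc j)) = \<open>nopen\<close> (E j) (1 - 8 s (t +
  psi)), so no orientation of the chosen pair enters; \<open>ej\<close> recovers the formula in
  terms of \<open>al\<close>.\<close>

definition psi :: "nat \<Rightarrow> real" where
  "psi j = (1 - real (nopen n (E (Suc j))) / real (nopen n (E j))) / (8 * s) - tt j"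

text \<open>The error of \<open>al\<close> on open pairs is split as \<open>fst (kl j) + dd j u + NA j (u, v) + Nr j (u, v)\<close>: a scalar,
  the part \<open>dd\<close> produced by row averages, the accumulated noise, and the rest. Likewise the error of
  \<open>xh\<close> is \<open>snd (kl j) + NX j (u, v) + Hr j (u, v)\<close>. Averaging damps \<open>dd\<close>,
  so it grows only through the other parts, and these feel it only through an operator of small norm.\<close>

primrec kl :: "nat \<Rightarrow> real \<times> real" where
  "kl 0 = (0, xh n {} 0 1 - 1)"
| "kl (Suc j) = (fst (kl j) + 8 * s * tt j * (psi j - fst (kl j)) + s * snd (kl j),
     snd (kl j) + 16 * s * (psi j - fst (kl j)))"

definition f0 :: "nat \<Rightarrow> nat \<times> nat \<Rightarrow> real" where "f0 j p = phi j (fst p) (snd p) - fst (kl j)"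

primrec dd :: "nat \<Rightarrow> nat \<Rightarrow> real" where
  "dd 0 u = 0"
| "dd (Suc j) u = dd j u - 4 * s * tt j *
     ((\<Sum>w\<in>opn n (E j) u. f0 j (u, w) + f0 j (w, u)) / real (card (opn n (E j) u)))"

definition NA :: "nat \<Rightarrow> nat \<times> nat \<Rightarrow> real" where
  "NA j p = (\<Sum>k<j. nA n (E k) (fst p) (snd p) (en k))"
definition NX :: "nat \<Rightarrow> nat \<times> nat \<Rightarrow> real" where
  "NX j p = (\<Sum>k<j. nX n (E k) (fst p) (snd p) (en k))"
definition Nr :: "nat \<Rightarrow> nat \<times> nat \<Rightarrow> real" where "Nr j p = f0 j p - dd j (fst p) - NA j p"
definition Hr :: "nat \<Rightarrow> nat \<times> nat \<Rightarrow> real" where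
  "Hr j p = xh n (E j) (fst p) (snd p) - 1 - snd (kl j) - NX j p"

abbreviation I :: "nat \<Rightarrow> (nat \<times> nat) set" where "I j \<equiv> Ipairs n (E j)"

lemma valid_E: "j \<le> h \<Longrightarrow> valid n (E j)"
proof (induction j)
  case (Suc j)
  then show ?case using step[of j] valid_insert by auto
qed (simp add: E0)

lemma I_Suc: "j < h \<Longrightarrow> I (Suc j) \<subseteq> I j"
  using step[of j] row_step[OF valid_E[of j]] by (auto simp: Ipairs_def)

lemma tt_nonneg: "0 \<le> tt j" using s_pos by (simp add: tt_def)

lemma tt_le: "j \<le> h \<Longrightarrow> tt j \<le> T"
proof -
  assume "j \<le> h"
  then have "tt j \<le> real h * s" unfolding tt_def using s_pos by (intro mult_right_mono) auto
  then show ?thesis using time by simp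
qed

lemma tt_Suc: "tt (Suc j) = tt j + s" by (simp add: tt_def algebra_simps)

lemma a_pos: "0 < a" using kap a by simp
lemma B_pos: "0 < B" "100 \<le> B" using a_pos unfolding B by simp_all
lemma W_pos: "0 < W" using nu N W by simp

lemma om_Suc: "om j * (1 + s * (2 * \<kappa> * tt j + B)) \<le> om (Suc j)"
proof -
  have "om (Suc j) = om j * exp (\<kappa> * (2 * tt j * s + s\<^sup>2) + B * s)"
    by (simp add: om_def tt_Suc exp_add[symmetric] algebra_simps power2_eq_square)
  moreover have "1 + s * (2 * \<kappa> * tt j + B) \<le> exp (\<kappa> * (2 * tt j * s + s\<^sup>2) + B * s)"
  proof -
    have "0 \<le> \<kappa> * s\<^sup>2" using kap by simp
    then have "s * (2 * \<kappa> * tt j + B) \<le> \<kappa> * (2 * tt j * s + s\<^sup>2) + B * s" by (simp add: algebra_simps)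
    then show ?thesis using exp_ge_add_one_self[of "\<kappa> * (2 * tt j * s + s\<^sup>2) + B * s"] by linarith
  qed
  ultimately show ?thesis by (simp add: om_def)
qed

lemma om_ge1: "1 \<le> om j"
  using tt_nonneg[of j] kap B_pos by (simp add: om_def)

lemma om_pos: "0 < om j" by (simp add: om_def)

lemma Phi_bound: "j \<le> h \<Longrightarrow> (1 + a) * W * om j \<le> \<Phi>"
proof -
  assume j: "j \<le> h"
  have "\<kappa> * (tt j)\<^sup>2 + B * tt j \<le> \<kappa> * T\<^sup>2 + B * T"
    using tt_le[OF j] tt_nonneg[of j] kap B_pos by (intro add_mono mult_left_mono power_mono) auto
  then have "(1 + a) * W * om j \<le> (1 + a) * W * exp (\<kappa> * T\<^sup>2 + B * T)"
    unfolding om_def using a_pos W_pos by (intro mult_left_mono) auto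
  then show ?thesis using Phi by simp
qed

lemma Phi_pos: "0 < \<Phi>" using chPhi ch by simp
lemma P_le: "\<nu> * N = W / 8" using W by simp

context
  fixes j assumes j: "j < h"
begin

lemma gj: "good (E j) (tt j)" using good_before[OF j] by (simp add: tt_def)
lemma Vj: "valid n (E j)" using valid_E j by simp
lemma ttj: "tt j \<le> T" using tt_le j by simp

lemmas facts = Vj gj tt_nonneg[of j] ttj
lemmas cpos = c_pos[OF facts] and cle = c_le[OF facts]

lemma ej:
  obtains x y where "en j = {x, y}" "y \<in> opn n (E j) x" "x \<in> opn n (E j) y"
    "psi j = (al n (E j) x y + al n (E j) y x + cw n (E j)) / 2 - tt j"
    "8 * s * (tt j + psi j) = 8 * s * (tt j + ((al n (E j) x y + al n (E j) y x + cw n (E j)) / 2 - tt j))"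
proof -
  have "en j \<in> open_pairs n (E j)" using step[OF j] by simp
  then obtain x y where xy: "en j = {x, y}" "y \<in> opn n (E j) x" "x \<in> opn n (E j) y"
    by (rule open_pair_cases)
  let ?p = "(al n (E j) x y + al n (E j) y x + cw n (E j)) / 2 - tt j"
  have "real (nopen n (E (Suc j))) = real (nopen n (E j)) * (1 - 8 * s * (tt j + ?p))"
    using nopen_next[OF facts xy(1,2) refl refl] step[OF j] by simp
  then have "psi j = ?p"
    using Q_pos[OF facts] s_pos by (simp add: psi_def)
  then show ?thesis using that xy by simp
qed

lemma al_step:
  assumes "u < n" "v < n" "u \<noteq> v" "v \<notin> nbr (E (Suc j)) u"
  shows "\<bar>al n (E (Suc j)) u v - (al n (E j) u v + s * xh n (E j) u v
      - 4 * s * cw n (E j) * (\<Sum>w\<in>opn n (E j) u \<inter> nbr (E j) v. al n (E j) u w + al n (E j) w u)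
      + al n (E j) u v * (8 * s * (tt j + psi j)) + nA n (E j) u v (en j))\<bar> \<le> s * err"
proof -
  obtain x y where xy: "en j = {x, y}" "y \<in> opn n (E j) x" "x \<in> opn n (E j) y"
    "psi j = (al n (E j) x y + al n (E j) y x + cw n (E j)) / 2 - tt j" by (rule ej)
  show ?thesis using al_next[OF facts xy(1,2,4) refl, of u v] step[OF j] assms by simp
qed

lemma xh_step:
  assumes "u < n" "v < n" "u \<noteq> v" "v \<notin> nbr (E j) u"
  shows "\<bar>xh n (E (Suc j)) u v - (xh n (E j) u v + 2 * xh n (E j) u v * (8 * s * (tt j + psi j))
      - 4 * s * (4 * (cw n (E j))\<^sup>2 * (\<Sum>w\<in>opn n (E j) u \<inter> opn n (E j) v.
          al n (E j) u w + al n (E j) w u + al n (E j) v w + al n (E j) w v))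
      + nX n (E j) u v (en j))\<bar> \<le> s * err"
proof -
  obtain x y where xy: "en j = {x, y}" "y \<in> opn n (E j) x" "x \<in> opn n (E j) y"
    "psi j = (al n (E j) x y + al n (E j) y x + cw n (E j)) / 2 - tt j" by (rule ej)
  show ?thesis using xh_next[OF facts xy(1,2,4) refl assms] step[OF j] by simp
qed

lemma dh_step:
  assumes "u < n"
  shows "\<bar>dh n (E (Suc j)) u - (dh n (E j) u + dh n (E j) u * (8 * s * (tt j + psi j))
      - 4 * s * (2 * cw n (E j) / sqrt (real n) * (\<Sum>w\<in>opn n (E j) u. al n (E j) u w + al n (E j) w u))
      + nD n (E j) u (en j))\<bar> \<le> s * err"
proof -
  obtain x y where xy: "en j = {x, y}" "y \<in> opn n (E j) x" "x \<in> opn n (E j) y"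
    "psi j = (al n (E j) x y + al n (E j) y x + cw n (E j)) / 2 - tt j" by (rule ej)
  show ?thesis using dh_next[OF facts xy(1,2,4) refl assms] step[OF j] by simp
qed

lemma al_eq: "al n (E j) u v = tt j + fst (kl j) + f0 j (u, v)"
  by (simp add: f0_def phi_def)

lemma sum_al2: "(\<Sum>w\<in>A. al n (E j) u w + al n (E j) w u) =
    2 * (tt j + fst (kl j)) * real (card A) + (\<Sum>w\<in>A. f0 j (u, w) + f0 j (w, u))"
  by (simp add: al_eq sum.distrib algebra_simps)

text \<open>Writing \<open>al\<close> in the loss as t + k + \<open>f0\<close>, with k the scalar
  part, the common term 8 s (t + k) \<open>al\<close> cancels against the renormalisation 8 s (t +
  psi) \<open>al\<close>. The error of the global density therefore enters only through psi -
  k.\<close>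

lemma phi_step:
  assumes uv: "u < n" "v < n" "u \<noteq> v" "v \<notin> nbr (E (Suc j)) u"
  shows "\<bar>phi (Suc j) u v - (phi j u v + s * (xh n (E j) u v - 1) + 8 * s * (psi j - fst (kl j)) * al n (E j) u v
      - 4 * s * (cw n (E j) * (\<Sum>w\<in>opn n (E j) u \<inter> nbr (E j) v. f0 j (u, w) + f0 j (w, u)))
      + nA n (E j) u v (en j))\<bar> \<le> s * err"
proof -
  let ?S = "\<Sum>w\<in>opn n (E j) u \<inter> nbr (E j) v. f0 j (u, w) + f0 j (w, u)"
  let ?k = "fst (kl j)" and ?c = "cw n (E j)" and ?m = "real (mixed_codeg n (E j) u v)"
  have "?c * (2 * (tt j + ?k) * ?m + ?S) = 2 * (tt j + ?k) * al n (E j) u v + ?c * ?S"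
    by (simp add: al_def algebra_simps)
  then have e: "4 * s * ?c * (2 * (tt j + ?k) * ?m + ?S) = 4 * s * (2 * (tt j + ?k) * al n (E j) u v + ?c * ?S)"
    by (simp add: mult.assoc)
  show ?thesis
    using al_step[OF uv] unfolding sum_al2 mixed_codeg_def[symmetric] e
    by (simp add: phi_def tt_Suc algebra_simps)
qed

lemma xh_step':
  assumes uv: "u < n" "v < n" "u \<noteq> v" "v \<notin> nbr (E j) u"
  shows "\<bar>xh n (E (Suc j)) u v - (xh n (E j) u v + 16 * s * (psi j - fst (kl j)) * xh n (E j) u v
      - 4 * s * (4 * (cw n (E j))\<^sup>2 * (\<Sum>w\<in>opn n (E j) u \<inter> opn n (E j) v.
          f0 j (u, w) + f0 j (w, u) + f0 j (v, w) + f0 j (w, v)))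
      + nX n (E j) u v (en j))\<bar> \<le> s * err"
proof -
  let ?X = "opn n (E j) u \<inter> opn n (E j) v"
  let ?S = "\<Sum>w\<in>?X. f0 j (u, w) + f0 j (w, u) + f0 j (v, w) + f0 j (w, v)"
  let ?k = "fst (kl j)" and ?c = "cw n (E j)" and ?m = "real (open_codeg n (E j) u v)"
  have sm: "(\<Sum>w\<in>?X. al n (E j) u w + al n (E j) w u + al n (E j) v w + al n (E j) w v) =
      4 * (tt j + ?k) * ?m + ?S"
    by (simp add: al_eq sum.distrib open_codeg_def algebra_simps)
  have key: "4 * ?c\<^sup>2 * (4 * (tt j + ?k) * ?m + ?S) = 4 * (tt j + ?k) * xh n (E j) u v + 4 * ?c\<^sup>2 * ?S"
    by (simp add: xh_def algebra_simps)
  show ?thesis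
    using xh_step[OF uv] unfolding sm key by (simp add: algebra_simps)
qed

lemma dh_step':
  assumes u: "u < n"
  shows "\<bar>dh n (E (Suc j)) u - (dh n (E j) u + 8 * s * (psi j - fst (kl j)) * dh n (E j) u
      - 4 * s * (2 * cw n (E j) / sqrt (real n) * (\<Sum>w\<in>opn n (E j) u. f0 j (u, w) + f0 j (w, u)))
      + nD n (E j) u (en j))\<bar> \<le> s * err"
proof -
  let ?S = "\<Sum>w\<in>opn n (E j) u. f0 j (u, w) + f0 j (w, u)"
  let ?k = "fst (kl j)" and ?m = "real (open_deg n (E j) u)"
  define c where "c = 2 * cw n (E j) / sqrt (real n)"
  have d: "dh n (E j) u = c * ?m" by (simp add: dh_def c_def)
  have key: "c * (2 * (tt j + ?k) * ?m + ?S) = 2 * (tt j + ?k) * dh n (E j) u + c * ?S"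
    by (simp add: d algebra_simps)
  show ?thesis
    using dh_step[OF u] unfolding sum_al2 open_deg_def[symmetric] c_def[symmetric] key
    by (simp add: algebra_simps)
qed

end
end

lemma nbr_empty [simp]: "nbr {} u = {}" by (simp add: nbr_def)

lemma opn_empty: "u < n \<Longrightarrow> opn n {} u = {..<n} - {u}"
  using opn_iff[OF valid_empty] by auto

lemma open_codeg_empty:
  assumes "u < n" "v < n" "u \<noteq> v" shows "real (open_codeg n {} u v) = real n - 2"
proof -
  have "opn n {} u \<inter> opn n {} v = {..<n} - {u, v}" using assms by (auto simp: opn_empty)
  moreover have "card ({..<n} - {u, v}) = n - 2" using assms by (simp add: card_Diff_subset)
  moreover have "2 \<le> n" using assms by linarith
  ultimately show ?thesis by (simp add: open_codeg_def)
qed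

lemma open_deg_empty: "u < n \<Longrightarrow> real (open_deg n {} u) = real n - 1"
  by (simp add: open_deg_def opn_empty of_nat_diff)

lemma nopen_empty: "real (nopen n {}) = real n * (real n - 1) / 2"
proof -
  have "(\<Sum>u<n. real (open_deg n {} u)) = (\<Sum>u<n. real n - 1)"
    by (rule sum.cong) (auto simp: open_deg_empty)
  moreover have "real (\<Sum>u<n. open_deg n {} u) = 2 * real (nopen n {})"
    using sum_open_deg[where n = n and E = "{}"] by simp
  ultimately show ?thesis by simp
qed

context tracking
begin

text \<open>The initial error is the same for all pairs, so it can be carried entirely by the scalar
  \<open>snd (kl 0)\<close>.\<close>

lemma xh_empty:
  assumes "u < n" "v < n" "u \<noteq> v"
  shows "xh n {} u v = xh n {} 0 1" "\<bar>xh n {} u v - 1\<bar> = 1 / (real n - 1)\<^sup>2"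
proof -
  have e: "xh n {} u v = 1 - 1 / (real n - 1)\<^sup>2" if "u < n" "v < n" "u \<noteq> v" for u v
  proof -
    define k where "k = real n - 1"
    have n1: "real n \<noteq> 0" "k \<noteq> 0" using n2 by (auto simp: k_def)
    have "cw n {} = sqrt (real n) / (2 * k)"
      unfolding cw_def nopen_empty rn_def k_def[symmetric] using n1 by (simp add: field_simps)
    then have "xh n {} u v = real n * (real n - 2) / k\<^sup>2"
      unfolding xh_def open_codeg_empty[OF that] by (simp add: power_divide power_mult_distrib)
    also have "real n * (real n - 2) = k\<^sup>2 - 1" by (simp add: k_def power2_eq_square algebra_simps)
    finally show ?thesis using n1 by (simp add: diff_divide_distrib k_def)
  qed
  show "xh n {} u v = xh n {} 0 1" using e[OF assms] e[of 0 1] n2 by simp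
  show "\<bar>xh n {} u v - 1\<bar> = 1 / (real n - 1)\<^sup>2" using e[OF assms] by simp
qed

lemma dh_empty: "u < n \<Longrightarrow> dh n {} u = 1"
proof -
  assume u: "u < n"
  define k where "k = real n - 1"
  have n1: "0 < sqrt (real n)" "real n \<noteq> 0" "k \<noteq> 0" using n2 by (auto simp: k_def)
  have "cw n {} = sqrt (real n) / (2 * k)"
    unfolding cw_def nopen_empty rn_def k_def[symmetric] using n1 by (simp add: field_simps)
  then show ?thesis unfolding dh_def open_deg_empty[OF u] k_def[symmetric] using n1 by simp
qed

end

section \<open>Induction for the l^M bounds on open pairs\<close>

context tracking_upto
begin

lemma cardI: "real (card (I j)) \<le> N ^ M"
  using card_Ipairs_le[of n "E j"] N(1) by (metis of_nat_le_iff of_nat_power order_trans)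

lemma Mp: "0 < M" using M by simp

lemma open_facts:
  assumes "j \<le> h" "v \<in> opn n (E j) u"
  shows "u < n" "v < n" "u \<noteq> v" "v \<notin> nbr (E j) u"
  using opn_iff[OF valid_E[OF assms(1)]] assms(2) by blast+

lemma nbr_mono: "j < h \<Longrightarrow> v \<notin> nbr (E (Suc j)) u \<Longrightarrow> v \<notin> nbr (E j) u"
  using step[of j] by (auto simp: nbr_def)

lemma NA_lpb: "j \<le> h \<Longrightarrow> lpb M (I j) (NA j) (W / 8)"
  unfolding P_le[symmetric]
  by (rule lpb_pointwise) (use open_facts noiseA nu cardI N in \<open>auto simp: NA_def Ipairs_def\<close>)

lemma NX_lpb: "j \<le> h \<Longrightarrow> lpb M (I j) (NX j) (W / 8)"
  unfolding P_le[symmetric]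
  by (rule lpb_pointwise) (use open_facts noiseX nu cardI N in \<open>auto simp: NX_def Ipairs_def\<close>)

text \<open>\<open>dd\<close> gets the weight a = 4 / \<kappa>. The other parts feed it at rate 8 t
  W, and this value of a makes that equal to the growth 2 \<kappa> t a W of its own
  envelope.\<close>

definition bounds :: "nat \<Rightarrow> bool" where
  "bounds j \<longleftrightarrow> lpb M (I j) (Nr j) (W / 2 * om j) \<and> lpb M (I j) (\<lambda>p. dd j (fst p)) (a * W * om j) \<and>
    lpb M (I j) (Hr j) (W / 2 * om j)"

lemma W_le: "W / 8 \<le> W / 8 * om j"
  using om_ge1[of j] W_pos by simp

lemma NrNA_lpb:
  assumes "j \<le> h" "bounds j" shows "lpb M (I j) (\<lambda>p. Nr j p + NA j p) (W * om j)"
proof -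
  have "lpb M (I j) (\<lambda>p. Nr j p + NA j p) (W / 2 * om j + W / 8)"
    by (rule lpb_add[OF _ NA_lpb[OF assms(1)] M(1) Mp finite_Ipairs]) (use assms in \<open>simp add: bounds_def\<close>)
  moreover have "0 < W * om j" using W_pos om_pos[of j] by simp
  ultimately show ?thesis
    using W_le[of j] by (elim lpb_mono) linarith
qed

lemma f0_lpb:
  assumes "j \<le> h" "bounds j" shows "lpb M (I j) (f0 j) ((1 + a) * W * om j)"
proof -
  have "lpb M (I j) (\<lambda>p. (Nr j p + NA j p) + dd j (fst p)) (W * om j + a * W * om j)"
    by (rule lpb_add[OF NrNA_lpb[OF assms] _ M(1) Mp finite_Ipairs]) (use assms in \<open>simp add: bounds_def\<close>)
  then show ?thesis by (rule lpb_mono[OF lpb_cong]) (simp_all add: Nr_def algebra_simps)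
qed

definition f1 :: "nat \<Rightarrow> nat \<times> nat \<Rightarrow> real" where "f1 j p = f0 j (snd p, fst p)"

lemma f1_lpb: "j \<le> h \<Longrightarrow> bounds j \<Longrightarrow> lpb M (I j) (f1 j) ((1 + a) * W * om j)"
  unfolding f1_def by (rule lpb_swap[OF f0_lpb])

lemma f01_lpb:
  assumes "j \<le> h" "bounds j" shows "lpb M (I j) (\<lambda>p. f0 j p + f1 j p) (2 * ((1 + a) * W * om j))"
proof -
  have "lpb M (I j) (\<lambda>p. f0 j p + f1 j p) ((1 + a) * W * om j + (1 + a) * W * om j)"
    by (rule lpb_add[OF f0_lpb f1_lpb M(1) Mp finite_Ipairs]) (use assms in auto)
  then show ?thesis by (simp only: mult_2)
qed

lemma f0_sup:
  assumes "j \<le> h" "bounds j" "v \<in> opn n (E j) u" shows "\<bar>f0 j (u, v)\<bar> \<le> \<Phi>"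
  using lpb_sup[OF f0_lpb[OF assms(1,2)] finite_Ipairs _ Mp, of "(u, v)"] assms Phi_bound[of j] by simp

lemma f0_sup2:
  assumes "j \<le> h" "bounds j" "v \<in> opn n (E j) u" shows "\<bar>f0 j (u, v) + f0 j (v, u)\<bar> \<le> 2 * \<Phi>"
proof -
  have "u \<in> opn n (E j) v" using assms(3) opn_sym by blast
  then show ?thesis using f0_sup[OF assms] f0_sup[OF assms(1,2), of u v] by linarith
qed

lemma s4T: "4 * s * T \<le> 1"
proof -
  have "10000 * (T * s) \<le> 10 ^ 4 * T ^ 3 * s" using T_powers s_pos by simp
  then have "10000 * (T * s) \<le> 1 / 2" using s_small ch by linarith
  moreover have "0 \<le> T * s" using T1 s_pos by simp
  ultimately have "4 * (T * s) \<le> 1" by linarith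
  then show ?thesis by (simp add: mult_ac)
qed

lemma nu_le_Phi: "\<nu> \<le> \<Phi>"
proof -
  have "1 * 1 \<le> (1 + a) * (8 * N)" using N a_pos by (intro mult_mono) auto
  then have "\<nu> * 1 \<le> \<nu> * ((1 + a) * (8 * N))" using nu by (intro mult_left_mono) auto
  also have "\<dots> = (1 + a) * W" using W by (simp add: mult_ac)
  also have "\<dots> \<le> (1 + a) * W * exp (\<kappa> * T\<^sup>2 + B * T)"
  proof -
    have "1 \<le> exp (\<kappa> * T\<^sup>2 + B * T)" using kap B_pos T1 by simp
    then show ?thesis using a_pos W_pos mult_left_mono[of 1 _ "(1 + a) * W"] by simp
  qed
  also have "\<dots> \<le> \<Phi>" by (rule Phi)
  finally show ?thesis by simp
qed

lemma err_le: "err \<le> \<nu>" "0 \<le> err"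
proof -
  have "0 \<le> 32 * \<Phi> * \<beta>" using Phi_pos be by simp
  then show "err \<le> \<nu>" using second by linarith
  show "0 \<le> err" using ch by (simp add: err_def)
qed

context
  fixes j assumes j: "j < h" and IH: "bounds j"
begin

text \<open>psi is read off the chosen pair, which is itself open; so psi - k is the mean of two
  values of \<open>f0\<close> plus half of \<open>cw\<close>.\<close>

lemma psi_k: "\<bar>psi j - fst (kl j)\<bar> \<le> 2 * \<Phi>"
proof -
  obtain x y where xy: "en j = {x, y}" "y \<in> opn n (E j) x" "x \<in> opn n (E j) y"
    "psi j = (al n (E j) x y + al n (E j) y x + cw n (E j)) / 2 - tt j" by (rule ej[OF j])
  have "psi j - fst (kl j) = (f0 j (x, y) + f0 j (y, x)) / 2 + cw n (E j) / 2"
    unfolding xy(4) al_eq[OF j] by (simp add: field_simps)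
  moreover have "\<bar>f0 j (x, y) + f0 j (y, x)\<bar> \<le> 2 * \<Phi>"
    using f0_sup2[OF _ IH xy(2)] j by simp
  moreover have "0 < cw n (E j)" using cpos[OF j] .
  moreover have "cw n (E j) \<le> \<Phi>" using cle[OF j] chPhi by linarith
  moreover have "\<bar>x\<bar> \<le> 2 * P" if "x = A / 2 + c / 2" "\<bar>A\<bar> \<le> 2 * P" "0 < c" "c \<le> P" for x A c P :: real
    using that by linarith
  ultimately show ?thesis by blast
qed

text \<open>Two regimes. For t < 1 the additive error \<beta> gives no relative regularity, but
  Schur test and contraction give norm 2 + 1, which is charged to B. For t >= 1 the discrepancy
  bound applies and the norm is a small multiple of t, charged to \<kappa> t.\<close>

lemma link_lpb:
  assumes F: "lpb M (I j) F A"
  shows "\<exists>G\<ge>0. 8 * (1 + a) * G \<le> \<kappa> * tt j + 24 * (1 + a) \<and>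
    lpb M (I j) (\<lambda>p. cw n (E j) * (\<Sum>w\<in>opn n (E j) (fst p) \<inter> nbr (E j) (snd p). F (fst p, w)) -
      tt j * ((\<Sum>w\<in>opn n (E j) (fst p). F (fst p, w)) / card (opn n (E j) (fst p)))) (G * A)"
proof (cases "tt j < 1")
  case True
  let ?c = "cw n (E j)"
  have c: "0 < ?c" by (rule cpos[OF j])
  have "lpb M (I j) (\<lambda>p. \<Sum>w | w \<in> opn n (E j) (fst p) \<and> w \<in> nbr (E j) (snd p). F (fst p, w)) (2 / ?c * A)"
  proof (rule lpb_row_sum[OF F M(1) Mp])
    fix u v assume v: "v \<in> opn n (E j) u"
    have "al n (E j) u v \<le> 2"
      using al_le_all[OF facts[OF j], of u v] open_facts[OF _ v] j True be by force
    then have "real (mixed_codeg n (E j) u v) \<le> 2 / ?c" using c by (simp add: al_def field_simps)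
    then show "real (card {w \<in> opn n (E j) u. w \<in> nbr (E j) v}) \<le> 2 / ?c"
      by (simp add: mixed_codeg_def Int_def)
  next
    fix v w assume "w \<in> nbr (E j) v" then show "v \<in> nbr (E j) w" using nbr_sym by blast
  qed (use c in auto)
  from lpb_scale[OF this, of ?c]
  have 1: "lpb M (I j) (\<lambda>p. ?c * (\<Sum>w\<in>opn n (E j) (fst p) \<inter> nbr (E j) (snd p). F (fst p, w))) (2 * A)"
    using c by (simp add: Int_def)
  from lpb_scale[OF lpb_row_average[OF F M(1) Mp], of "tt j"]
  have 2: "lpb M (I j) (\<lambda>p. tt j * ((\<Sum>w\<in>opn n (E j) (fst p). F (fst p, w)) / card (opn n (E j) (fst p)))) (1 * A)"
    by (rule lpb_mono, intro mult_right_mono) (use True tt_nonneg[of j] lpb_nonneg[OF F] in auto)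
  have "lpb M (I j) (\<lambda>p. ?c * (\<Sum>w\<in>opn n (E j) (fst p) \<inter> nbr (E j) (snd p). F (fst p, w)) -
      tt j * ((\<Sum>w\<in>opn n (E j) (fst p). F (fst p, w)) / card (opn n (E j) (fst p)))) (3 * A)"
    using lpb_diff[OF 1 2 M(1) Mp finite_Ipairs] by simp
  moreover have "0 \<le> \<kappa> * tt j" using kap tt_nonneg[of j] by simp
  ultimately show ?thesis by (intro exI[of _ 3]) auto
next
  case False
  then have t1: "1 \<le> tt j" by simp
  let ?c = "cw n (E j)" and ?G = "3 * tt j * (4 * g * real L + 2 * N / 2 ^ L)"
  have c: "0 < ?c" by (rule cpos[OF j])
  have "lpb M (I j) (\<lambda>p. ?c * (\<Sum>w\<in>opn n (E j) (fst p) \<inter> nbr (E j) (snd p). F (fst p, w)) -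
      tt j * ((\<Sum>w\<in>opn n (E j) (fst p). F (fst p, w)) / card (opn n (E j) (fst p)))) (?G * A)"
  proof (rule lpb_link_operator[OF Vj[OF j] F M counts[OF j] c t1 th(1,2)])
    fix u assume u: "u < n"
    have sn: "0 < sqrt (real n)" "sqrt (real n) * sqrt (real n) = real n" using n2 by auto
    have e1: "?c * real (open_deg n (E j) u) = dh n (E j) u * sqrt (real n) / 2"
      using sn by (simp add: dh_def)
    have e2: "2 * real j / (real n)\<^sup>2 = 2 * tt j / sqrt (real n)"
    proof -
      have "tt j = real j / (real n * sqrt (real n))" by (simp add: tt_def s_def rn_def)
      then have "2 * tt j / sqrt (real n) = 2 * real j / (real n * (sqrt (real n) * sqrt (real n)))" by simp
      then show ?thesis unfolding sn by (simp add: power2_eq_square)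
    qed
    have "?c * ((1 + \<delta>) * (2 * real j / (real n)\<^sup>2)) * real (open_deg n (E j) u) =
        (1 + \<delta>) * (2 * real j / (real n)\<^sup>2) * (?c * real (open_deg n (E j) u))" by simp
    also have "\<dots> = (1 + \<delta>) * dh n (E j) u * tt j"
      unfolding e1 e2 using sn by simp
    also have "\<dots> \<le> (1 + \<delta>) * (1 + \<beta>) * tt j"
      using dh_near[OF facts[OF j] u] th tt_nonneg[of j] by (intro mult_right_mono mult_left_mono) (auto simp: abs_le_iff)
    also have "\<dots> \<le> (1 + \<theta>) * tt j" using th tt_nonneg[of j] by (intro mult_right_mono) auto
    finally show "?c * ((1 + \<delta>) * (2 * real j / (real n)\<^sup>2)) * real (open_deg n (E j) u) \<le> (1 + \<theta>) * tt j" .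
  next
    have "?c * \<Lambda> \<le> \<gamma> * \<Lambda>" using cle[OF j] th by (intro mult_right_mono) auto
    also have "\<dots> \<le> \<theta>\<^sup>2 * 1" using th by simp
    also have "\<dots> \<le> \<theta>\<^sup>2 * tt j" using t1 by (intro mult_left_mono) auto
    finally show "?c * \<Lambda> \<le> \<theta>\<^sup>2 * tt j" .
  next
    fix u v assume v: "v \<in> opn n (E j) u"
    have "\<bar>al n (E j) u v - tt j\<bar> \<le> \<beta>"
      using al_near[OF facts[OF j]] open_facts[OF _ v] j by simp
    also have "\<beta> \<le> \<theta> * 1" using th by simp
    also have "\<dots> \<le> \<theta> * tt j" using t1 th by (intro mult_left_mono) auto
    finally show "\<bar>?c * real (mixed_codeg n (E j) u v) - tt j\<bar> \<le> \<theta> * tt j" by (simp add: al_def)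
  qed (use mu gM N in auto)
  moreover have "8 * (1 + a) * ?G \<le> \<kappa> * tt j + 24 * (1 + a)"
  proof -
    have "8 * (1 + a) * ?G = 8 * (1 + a) * (3 * (4 * g * real L + 2 * N / 2 ^ L)) * tt j" by simp
    also have "\<dots> \<le> \<kappa> * tt j" using gain tt_nonneg[of j] by (rule mult_right_mono)
    finally show ?thesis using a_pos by simp
  qed
  moreover have "0 \<le> ?G" using t1 gM N by simp
  ultimately show ?thesis by (intro exI[of _ ?G]) auto
qed

lemma Nr_step: "lpb M (I (Suc j)) (Nr (Suc j)) (W / 2 * om (Suc j))"
proof -
  let ?c = "cw n (E j)" and ?F = "\<lambda>p. f0 j p + f1 j p" and ?k = "fst (kl j)"
  define Eop where "Eop p = ?c * (\<Sum>w\<in>opn n (E j) (fst p) \<inter> nbr (E j) (snd p). ?F (fst p, w)) -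
      tt j * ((\<Sum>w\<in>opn n (E j) (fst p). ?F (fst p, w)) / card (opn n (E j) (fst p)))" for p
  \<comment> \<open>What is left over is the one-step error and the quadratic term 8 s (psi - k)
    phi, which arises from \<open>al\<close> = t + phi. Both are bounded pointwise by \<nu> per unit
    of time.\<close>
  define Rem where "Rem p = Nr (Suc j) p - (Nr j p + s * (Hr j p + NX j p) - 4 * s * Eop p)" for p
  have jh: "j \<le> h" using j by simp
  obtain G where G: "0 \<le> G" "8 * (1 + a) * G \<le> \<kappa> * tt j + 24 * (1 + a)"
    and El: "lpb M (I j) Eop (G * (2 * ((1 + a) * W * om j)))"
    using link_lpb[OF f01_lpb[OF jh IH]] unfolding Eop_def[abs_def] by blast
  have Rem: "\<bar>Rem p\<bar> \<le> s * \<nu>" if p: "p \<in> I (Suc j)" for p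
  proof -
    obtain u v where uv: "p = (u, v)" by force
    have vo: "v \<in> opn n (E (Suc j)) u" using p uv by simp
    then have vj: "v \<in> opn n (E j) u" using I_Suc[OF j] by (auto simp: Ipairs_def)
    have uvf: "u < n" "v < n" "u \<noteq> v" "v \<notin> nbr (E (Suc j)) u" using open_facts[OF _ vo] j by auto
    have al: "al n (E j) u v = tt j + phi j u v" by (simp add: phi_def)
    have "Rem p = (phi (Suc j) u v - (phi j u v + s * (xh n (E j) u v - 1) + 8 * s * (psi j - ?k) * al n (E j) u v
      - 4 * s * (?c * (\<Sum>w\<in>opn n (E j) u \<inter> nbr (E j) v. f0 j (u, w) + f0 j (w, u)))
      + nA n (E j) u v (en j))) + 8 * s * (psi j - ?k) * phi j u v"
      unfolding Rem_def uv Nr_def Hr_def NA_def NX_def Eop_def f1_def al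
      by (simp add: f0_def[of _ "(u, v)"] f0_def[of "Suc j"] algebra_simps)
    moreover have "\<bar>8 * s * (psi j - ?k) * phi j u v\<bar> \<le> 8 * s * (2 * \<Phi>) * \<beta>"
    proof -
      have "\<bar>phi j u v\<bar> \<le> \<beta>"
        unfolding phi_def using al_near[OF facts[OF j] open_facts[OF jh vj]] .
      then show ?thesis unfolding abs_mult using psi_k s_pos by (intro mult_mono) auto
    qed
    ultimately have "\<bar>Rem p\<bar> \<le> s * err + 8 * s * (2 * \<Phi>) * \<beta>"
      using phi_step[OF j uvf] by linarith
    also have "\<dots> = s * (16 * \<Phi> * \<beta> + err)" by (simp add: algebra_simps)
    also have "\<dots> \<le> s * \<nu>"
    proof (rule mult_left_mono)
      have "0 \<le> \<Phi> * \<beta>" using Phi_pos be by simp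
      then show "16 * \<Phi> * \<beta> + err \<le> \<nu>" using second by linarith
    qed (use s_pos in simp)
    finally show ?thesis .
  qed
  have R: "lpb M (I (Suc j)) Rem (s * \<nu> * N)"
    by (rule lpb_pointwise[OF Rem]) (use s_pos nu N cardI in auto)
  have sub: "lpb M (I (Suc j)) f A" if "lpb M (I j) f A" for f A
    by (rule lpb_subset[OF that I_Suc[OF j] finite_Ipairs])
  have b: "lpb M (I (Suc j)) (Nr j) (W / 2 * om j)" "lpb M (I (Suc j)) (Hr j) (W / 2 * om j)"
    using IH sub by (auto simp: bounds_def)
  have "lpb M (I (Suc j)) (\<lambda>p. s * (Hr j p + NX j p)) (\<bar>s\<bar> * (W / 2 * om j + W / 8))"
    by (intro lpb_scale lpb_add b sub[OF NX_lpb[OF jh]] M Mp finite_Ipairs)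
  note 1 = lpb_add[OF b(1) this M(1) Mp finite_Ipairs]
  have "lpb M (I (Suc j)) (\<lambda>p. 4 * s * Eop p) (\<bar>4 * s\<bar> * (G * (2 * ((1 + a) * W * om j))))"
    by (intro lpb_scale sub[OF El])
  note 2 = lpb_add[OF lpb_diff[OF 1 this M(1) Mp finite_Ipairs] R M(1) Mp finite_Ipairs]
  have "lpb M (I (Suc j)) (Nr (Suc j)) (W / 2 * om j + \<bar>s\<bar> * (W / 2 * om j + W / 8)
      + \<bar>4 * s\<bar> * (G * (2 * ((1 + a) * W * om j))) + s * \<nu> * N)"
    by (rule lpb_cong[OF 2]) (simp add: Rem_def)
  then show ?thesis
  proof (rule lpb_mono)
    have w: "0 < W * om j" using W_pos om_pos[of j] by simp
    have "W / 2 * om j + \<bar>s\<bar> * (W / 2 * om j + W / 8) + \<bar>4 * s\<bar> * (G * (2 * ((1 + a) * W * om j))) + s * \<nu> * N =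
      W / 2 * om j + s * (W / 2 * om j + W / 8 + 8 * (1 + a) * G * (W * om j) + \<nu> * N)"
      using s_pos by (simp add: algebra_simps)
    also have "\<dots> \<le> W / 2 * om j + s * (W / 2 * om j + W / 8 * om j + (\<kappa> * tt j + 24 * (1 + a)) * (W * om j) + W / 8 * om j)"
      using W_le[of j] W_pos s_pos w G(2) unfolding P_le by (intro add_mono mult_left_mono mult_right_mono) auto
    also have "\<dots> = W / 2 * (om j * (1 + s * (3 / 2 + 2 * \<kappa> * tt j + 48 * (1 + a))))"
      by (simp add: algebra_simps)
    \<comment> \<open>B = 100 (1 + a) covers 3/2 + 48 (1 + a).\<close>
    also have "\<dots> \<le> W / 2 * (om j * (1 + s * (2 * \<kappa> * tt j + B)))"
      using W_pos om_pos[of j] s_pos a_pos by (intro mult_left_mono add_left_mono) (auto simp: B)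
    also have "\<dots> \<le> W / 2 * om (Suc j)" using om_Suc[of j] W_pos by (intro mult_left_mono) auto
    finally show "W / 2 * om j + \<bar>s\<bar> * (W / 2 * om j + W / 8)
      + \<bar>4 * s\<bar> * (G * (2 * ((1 + a) * W * om j))) + s * \<nu> * N \<le> W / 2 * om (Suc j)" .
  qed
qed

text \<open>\<open>dd\<close> is constant on rows, so its row average is \<open>dd\<close> itself
  and it enters with the factor 1 - 4 s t. This damping pays exactly for the share a of the reversed
  errors \<open>f1\<close>: (1 - 4 s t) a + 4 s t (2 + a) = a + 8 s t, and only 8 s t remains as
  growth.\<close>

lemma dd_step: "lpb M (I (Suc j)) (\<lambda>p. dd (Suc j) (fst p)) (a * W * om (Suc j))"
proof -
  let ?g = "\<lambda>p. Nr j p + NA j p"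
  have jh: "j \<le> h" using j by simp
  have st: "0 \<le> 4 * s * tt j" "4 * s * tt j \<le> 1"
  proof -
    show "0 \<le> 4 * s * tt j" using s_pos tt_nonneg[of j] by simp
    have "4 * s * tt j \<le> 4 * s * T" using s_pos ttj[OF j] by (intro mult_left_mono) auto
    then show "4 * s * tt j \<le> 1" using s4T by linarith
  qed
  have l: "lpb M (I j) (\<lambda>p. ?g p + f1 j p) (W * om j + (1 + a) * W * om j)"
    by (intro lpb_add NrNA_lpb f1_lpb M Mp finite_Ipairs jh IH)
  note av = lpb_scale[OF lpb_row_average[OF l M(1) Mp], of "4 * s * tt j"]
  have "lpb M (I j) (\<lambda>p. dd j (fst p)) (a * W * om j)" using IH by (simp add: bounds_def)
  from lpb_diff[OF lpb_scale[OF this, of "1 - 4 * s * tt j"] av M(1) Mp finite_Ipairs]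
  have "lpb M (I j) (\<lambda>p. dd (Suc j) (fst p)) (\<bar>1 - 4 * s * tt j\<bar> * (a * W * om j) + \<bar>4 * s * tt j\<bar> * (W * om j + (1 + a) * W * om j))"
  proof (rule lpb_cong)
    fix p assume p: "p \<in> I j"
    obtain u v where uv: "p = (u, v)" by force
    have ne: "real (card (opn n (E j) u)) \<noteq> 0" using p uv by auto
    let ?m = "real (card (opn n (E j) u))"
    have "(\<Sum>w\<in>opn n (E j) u. f0 j (u, w) + f0 j (w, u)) =
        (\<Sum>w\<in>opn n (E j) u. dd j u + (?g (u, w) + f1 j (u, w)))"
      by (rule sum.cong) (auto simp: Nr_def f1_def)
    also have "\<dots> = ?m * dd j u + (\<Sum>w\<in>opn n (E j) u. ?g (u, w) + f1 j (u, w))"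
      by (simp add: sum.distrib)
    finally have "(\<Sum>w\<in>opn n (E j) u. f0 j (u, w) + f0 j (w, u)) / ?m =
        dd j u + (\<Sum>w\<in>opn n (E j) u. ?g (u, w) + f1 j (u, w)) / ?m"
      using ne by (simp add: add_divide_distrib)
    then show "dd (Suc j) (fst p) = (1 - 4 * s * tt j) * dd j (fst p) - 4 * s * tt j *
       ((\<Sum>w\<in>opn n (E j) (fst p). ?g (fst p, w) + f1 j (fst p, w)) / real (card (opn n (E j) (fst p))))"
      unfolding dd.simps uv fst_conv by (simp add: algebra_simps)
  qed
  then have "lpb M (I (Suc j)) (\<lambda>p. dd (Suc j) (fst p)) (\<bar>1 - 4 * s * tt j\<bar> * (a * W * om j) + \<bar>4 * s * tt j\<bar> * (W * om j + (1 + a) * W * om j))"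
    by (rule lpb_subset[OF _ I_Suc[OF j] finite_Ipairs])
  then show ?thesis
  proof (rule lpb_mono)
    have "\<bar>1 - 4 * s * tt j\<bar> * (a * W * om j) + \<bar>4 * s * tt j\<bar> * (W * om j + (1 + a) * W * om j) =
      a * W * om j + 8 * s * tt j * (W * om j)"
      using st by (simp add: algebra_simps)
    also have "\<dots> = a * W * (om j * (1 + s * (2 * \<kappa> * tt j)))"
      using kap by (simp add: a field_simps)
    also have "\<dots> \<le> a * W * (om j * (1 + s * (2 * \<kappa> * tt j + B)))"
      using a_pos W_pos om_pos[of j] s_pos B_pos by (intro mult_left_mono add_left_mono) auto
    also have "\<dots> \<le> a * W * om (Suc j)" using om_Suc[of j] a_pos W_pos by (intro mult_left_mono) auto
    finally show "\<bar>1 - 4 * s * tt j\<bar> * (a * W * om j) + \<bar>4 * s * tt j\<bar> * (W * om j + (1 + a) * W * om j) \<le> a * W * om (Suc j)" .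
  qed
qed

text \<open>The operator in the recursion for \<open>xh\<close> has norm O(1) without a factor t, so
  the plain Schur test suffices. Its cost goes into B, and exp (B T) is n^(o(1)) since T is of order
  sqrt (ln n).\<close>

lemma Hr_step: "lpb M (I (Suc j)) (Hr (Suc j)) (W / 2 * om (Suc j))"
proof -
  let ?c = "cw n (E j)" and ?F = "\<lambda>p. f0 j p + f1 j p" and ?k = "fst (kl j)"
  have jh: "j \<le> h" using j by simp
  have c: "0 < ?c" by (rule cpos[OF j])
  define K where "K p = (\<Sum>w | w \<in> opn n (E j) (fst p) \<and> w \<in> opn n (E j) (snd p). ?F (fst p, w))" for p
  have Kl: "lpb M (I j) K (3 / 2 / (4 * ?c\<^sup>2) * (2 * ((1 + a) * W * om j)))"
    unfolding K_def
  proof (rule lpb_row_sum[OF f01_lpb[OF jh IH] M(1) Mp])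
    fix u v assume v: "v \<in> opn n (E j) u"
    have "xh n (E j) u v \<le> 3 / 2"
      using xh_near[OF facts[OF j] open_facts[OF jh v]] be by linarith
    then have "real (open_codeg n (E j) u v) \<le> 3 / 2 / (4 * ?c\<^sup>2)" using c by (simp add: xh_def field_simps)
    then show "real (card {w \<in> opn n (E j) u. w \<in> opn n (E j) v}) \<le> 3 / 2 / (4 * ?c\<^sup>2)"
      by (simp add: open_codeg_def Int_def)
  next
    fix v w assume "w \<in> opn n (E j) v" then show "v \<in> opn n (E j) w" using opn_sym by blast
  qed (use c in auto)
  define Kop where "Kop p = 4 * ?c\<^sup>2 * (K p + K (snd p, fst p))" for p
  have "lpb M (I j) Kop (\<bar>4 * ?c\<^sup>2\<bar> * (3 / 2 / (4 * ?c\<^sup>2) * (2 * ((1 + a) * W * om j)) + 3 / 2 / (4 * ?c\<^sup>2) * (2 * ((1 + a) * W * om j))))"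
    unfolding Kop_def by (intro lpb_scale lpb_add Kl lpb_swap[OF Kl] M Mp finite_Ipairs)
  then have Kopl: "lpb M (I j) Kop (6 * ((1 + a) * W * om j))"
    by (rule lpb_mono) (use c in \<open>simp add: field_simps\<close>)
  define Rem where "Rem p = Hr (Suc j) p - (Hr j p - 4 * s * Kop p)" for p
  have Rem: "\<bar>Rem p\<bar> \<le> s * \<nu>" if p: "p \<in> I (Suc j)" for p
  proof -
    obtain u v where uv: "p = (u, v)" by force
    have vj: "v \<in> opn n (E j) u" using p uv I_Suc[OF j] by (auto simp: Ipairs_def)
    note uvf = open_facts[OF jh vj]
    have "K (u, v) + K (v, u) = (\<Sum>w\<in>opn n (E j) u \<inter> opn n (E j) v. f0 j (u, w) + f0 j (w, u) + f0 j (v, w) + f0 j (w, v))"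
    proof -
      have "{w. w \<in> opn n (E j) u \<and> w \<in> opn n (E j) v} = opn n (E j) u \<inter> opn n (E j) v"
        "{w. w \<in> opn n (E j) v \<and> w \<in> opn n (E j) u} = opn n (E j) u \<inter> opn n (E j) v" by auto
      then show ?thesis by (simp add: K_def f1_def sum.distrib[symmetric] add.assoc)
    qed
    then have "Rem p = (xh n (E (Suc j)) u v - (xh n (E j) u v + 16 * s * (psi j - ?k) * xh n (E j) u v
      - 4 * s * (4 * ?c\<^sup>2 * (\<Sum>w\<in>opn n (E j) u \<inter> opn n (E j) v.
          f0 j (u, w) + f0 j (w, u) + f0 j (v, w) + f0 j (w, v)))
      + nX n (E j) u v (en j))) + 16 * s * (psi j - ?k) * (xh n (E j) u v - 1)"
      unfolding Rem_def uv Hr_def NX_def Kop_def by (simp add: algebra_simps)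
    moreover have "\<bar>16 * s * (psi j - ?k) * (xh n (E j) u v - 1)\<bar> \<le> 16 * s * (2 * \<Phi>) * \<beta>"
      unfolding abs_mult using psi_k s_pos xh_near[OF facts[OF j] uvf] by (intro mult_mono) auto
    ultimately have "\<bar>Rem p\<bar> \<le> s * err + 16 * s * (2 * \<Phi>) * \<beta>"
      using xh_step'[OF j uvf] by linarith
    also have "\<dots> = s * (32 * \<Phi> * \<beta> + err)" by (simp add: algebra_simps)
    also have "\<dots> \<le> s * \<nu>" using second s_pos by (intro mult_left_mono) auto
    finally show ?thesis .
  qed
  have R: "lpb M (I (Suc j)) Rem (s * \<nu> * N)"
    by (rule lpb_pointwise[OF Rem]) (use s_pos nu N cardI in auto)
  have sub: "lpb M (I (Suc j)) f A" if "lpb M (I j) f A" for f A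
    by (rule lpb_subset[OF that I_Suc[OF j] finite_Ipairs])
  have "lpb M (I (Suc j)) (Hr j) (W / 2 * om j)" using IH sub by (auto simp: bounds_def)
  from lpb_add[OF lpb_diff[OF this lpb_scale[OF sub[OF Kopl], of "4 * s"] M(1) Mp finite_Ipairs] R M(1) Mp finite_Ipairs]
  have "lpb M (I (Suc j)) (Hr (Suc j)) (W / 2 * om j + \<bar>4 * s\<bar> * (6 * ((1 + a) * W * om j)) + s * \<nu> * N)"
    by (rule lpb_cong) (simp add: Rem_def)
  then show ?thesis
  proof (rule lpb_mono)
    have "W / 2 * om j + \<bar>4 * s\<bar> * (6 * ((1 + a) * W * om j)) + s * \<nu> * N =
      W / 2 * om j + s * (24 * ((1 + a) * W * om j) + W / 8)"
      using s_pos P_le by (simp add: algebra_simps)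
    also have "\<dots> \<le> W / 2 * om j + s * (24 * ((1 + a) * W * om j) + W / 8 * om j)"
      using W_le[of j] s_pos by (intro add_left_mono mult_left_mono) auto
    also have "\<dots> = W / 2 * (om j * (1 + s * (48 * (1 + a) + 1 / 4)))" by (simp add: algebra_simps)
    also have "\<dots> \<le> W / 2 * (om j * (1 + s * (2 * \<kappa> * tt j + B)))"
    proof -
      have "0 \<le> \<kappa> * tt j" using kap tt_nonneg[of j] by simp
      then have "48 * (1 + a) + 1 / 4 \<le> 2 * \<kappa> * tt j + B" using a_pos unfolding B by simp
      then show ?thesis using W_pos om_pos[of j] s_pos by (intro mult_left_mono add_left_mono) auto
    qed
    also have "\<dots> \<le> W / 2 * om (Suc j)" using om_Suc[of j] W_pos by (intro mult_left_mono) auto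
    finally show "W / 2 * om j + \<bar>4 * s\<bar> * (6 * ((1 + a) * W * om j)) + s * \<nu> * N \<le> W / 2 * om (Suc j)" .
  qed
qed

end

lemma all_bounds: "j \<le> h \<Longrightarrow> bounds j"
proof (induction j)
  case 0
  \<comment> \<open>At time 0 every \<open>al\<close> is 0 and \<open>xh\<close> is the same for all
    pairs, so the scalar part carries the whole error.\<close>
  have "Nr 0 p = 0" for p
  proof -
    have "al n (E 0) (fst p) (snd p) = 0" unfolding E0 al_def mixed_codeg_def nbr_empty by simp
    then show ?thesis unfolding Nr_def f0_def phi_def tt_def NA_def by simp
  qed
  moreover have "Hr 0 p = 0" if p: "p \<in> I 0" for p
  proof -
    obtain u v where uv: "p = (u, v)" by force
    have "v \<in> opn n (E 0) u" using p uv by simp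
    note uvf = open_facts[OF le0 this]
    have "xh n (E 0) u v = xh n {} 0 1" unfolding E0 by (rule xh_empty(1)[OF uvf(1-3)])
    then show ?thesis by (simp add: Hr_def NX_def uv)
  qed
  moreover have z: "lpb M (I 0) f A" if "\<And>p. p \<in> I 0 \<Longrightarrow> f p = 0" "0 \<le> A" for f A
    by (rule lpb_mono[OF lpb_cong[OF lpb_zero[OF Mp]] that(2)]) (rule that(1))
  moreover have "0 \<le> W / 2 * om 0" "0 \<le> a * W * om 0" using W_pos om_pos[of 0] a_pos by auto
  ultimately have "lpb M (I 0) (Nr 0) (W / 2 * om 0)" "lpb M (I 0) (\<lambda>p. dd 0 (fst p)) (a * W * om 0)"
    "lpb M (I 0) (Hr 0) (W / 2 * om 0)"
    by (auto intro!: z)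
  then show ?case unfolding bounds_def by blast
next
  case (Suc j)
  then show ?case using Nr_step[of j] dd_step[of j] Hr_step[of j] by (simp add: bounds_def)
qed

end

section \<open>From l^M bounds on open pairs to pointwise bounds on all nonadjacent pairs\<close>

context tracking_upto
begin

lemma jsT: "j \<le> h \<Longrightarrow> real j * s \<le> T" using tt_le[of j] by (simp add: tt_def)

lemma drift_sum:
  fixes x x' x0 d y e S b D :: real
  assumes "\<bar>x' - (x + d + y)\<bar> \<le> e" "\<bar>x - x0 - S\<bar> \<le> b" "\<bar>d\<bar> \<le> D"
  shows "\<bar>x' - x0 - (S + y)\<bar> \<le> b + (D + e)"
  using assms by linarith

text \<open>A nonadjacent pair may be closed, and the l^M bounds say nothing about it. But the sums
  in its drift run over open pairs, where \<open>f0_sup\<close> applies, so the error integrates to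
  at most a multiple of T \<Phi> beyond the noise.\<close>

lemma xh_track:
  assumes "j \<le> h" "u < n" "v < n" "u \<noteq> v" "v \<notin> nbr (E j) u"
  shows "\<bar>xh n (E j) u v - 1 - (\<Sum>k<j. nX n (E k) u v (en k))\<bar> \<le> \<nu> / 2 + real j * (s * (96 * \<Phi>) + s * err)"
  using assms
proof (induction j)
  case 0
  have "\<bar>xh n {} u v - 1\<bar> \<le> \<nu> / 2" unfolding xh_empty(2)[OF 0(2,3,4)] using nu by simp
  then show ?case using E0 by simp
next
  case (Suc j)
  then have j: "j < h" and jh: "j \<le> h" by auto
  have nadj: "v \<notin> nbr (E j) u" using nbr_mono[OF j] Suc by blast
  note b = all_bounds[OF jh]
  let ?X = "opn n (E j) u \<inter> opn n (E j) v" and ?c = "cw n (E j)" and ?k = "fst (kl j)"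
  let ?S = "\<Sum>w\<in>?X. f0 j (u, w) + f0 j (w, u) + f0 j (v, w) + f0 j (w, v)"
  have "xh n (E j) u v - 1 \<le> \<beta>"
    using xh_near[OF facts[OF j] Suc.prems(2-4) nadj] by (rule abs_le_D1)
  then have x2: "xh n (E j) u v \<le> 2" using be by linarith
  have x2': "0 \<le> xh n (E j) u v" by (simp add: xh_def)
  have "\<bar>?S\<bar> \<le> (\<Sum>w\<in>?X. 4 * \<Phi>)"
  proof (rule order_trans[OF sum_abs], rule sum_mono)
    fix w assume w: "w \<in> ?X"
    then have "\<bar>f0 j (u, w) + f0 j (w, u)\<bar> \<le> 2 * \<Phi>" "\<bar>f0 j (v, w) + f0 j (w, v)\<bar> \<le> 2 * \<Phi>"
      using f0_sup2[OF jh b] by auto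
    then show "\<bar>f0 j (u, w) + f0 j (w, u) + f0 j (v, w) + f0 j (w, v)\<bar> \<le> 4 * \<Phi>" by linarith
  qed
  then have "4 * ?c\<^sup>2 * \<bar>?S\<bar> \<le> 4 * ?c\<^sup>2 * (real (card ?X) * (4 * \<Phi>))" by (intro mult_left_mono) auto
  also have "\<dots> = xh n (E j) u v * (4 * \<Phi>)" by (simp add: xh_def open_codeg_def)
  also have "\<dots> \<le> 2 * (4 * \<Phi>)" using x2 Phi_pos by (intro mult_right_mono) auto
  finally have 1: "\<bar>4 * s * (4 * ?c\<^sup>2 * ?S)\<bar> \<le> 4 * s * (8 * \<Phi>)"
    using s_pos by (simp add: abs_mult)
  have 2: "\<bar>16 * s * (psi j - ?k) * xh n (E j) u v\<bar> \<le> 16 * s * (2 * \<Phi>) * 2"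
    unfolding abs_mult using psi_k[OF j b] s_pos x2 x2' by (intro mult_mono) auto
  have "\<bar>16 * s * (psi j - ?k) * xh n (E j) u v - 4 * s * (4 * ?c\<^sup>2 * ?S)\<bar> \<le> 16 * s * (2 * \<Phi>) * 2 + 4 * s * (8 * \<Phi>)"
    using 1 2 by linarith
  also have "\<dots> = s * (96 * \<Phi>)" by simp
  finally have 3: "\<bar>16 * s * (psi j - ?k) * xh n (E j) u v - 4 * s * (4 * ?c\<^sup>2 * ?S)\<bar> \<le> s * (96 * \<Phi>)" .
  have st: "\<bar>xh n (E (Suc j)) u v - (xh n (E j) u v + (16 * s * (psi j - ?k) * xh n (E j) u v - 4 * s * (4 * ?c\<^sup>2 * ?S))
      + nX n (E j) u v (en j))\<bar> \<le> s * err"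
    using xh_step'[OF j Suc.prems(2-4) nadj] by (simp add: algebra_simps)
  have "\<bar>xh n (E (Suc j)) u v - 1 - ((\<Sum>k<j. nX n (E k) u v (en k)) + nX n (E j) u v (en j))\<bar> \<le>
      (\<nu> / 2 + real j * (s * (96 * \<Phi>) + s * err)) + (s * (96 * \<Phi>) + s * err)"
    by (rule drift_sum[OF st Suc.IH[OF jh Suc.prems(2-4) nadj] 3])
  then show ?case by (simp add: algebra_simps)
qed

lemma total_le:
  assumes "j \<le> h" "0 \<le> x" shows "real j * (s * x) \<le> T * x"
proof -
  have "(real j * s) * x \<le> T * x" using jsT[OF assms(1)] assms(2) by (rule mult_right_mono)
  then show ?thesis by (simp add: mult.assoc)
qed

lemma xh_sup:
  assumes "j \<le> h" "u < n" "v < n" "u \<noteq> v" "v \<notin> nbr (E j) u"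
  shows "\<bar>xh n (E j) u v - 1\<bar> \<le> 2 * \<nu> + T * (100 * \<Phi> + \<nu>)"
proof -
  have "real j * (s * (96 * \<Phi> + err)) \<le> T * (96 * \<Phi> + err)"
    using total_le[OF assms(1)] Phi_pos err_le by simp
  also have "\<dots> \<le> T * (100 * \<Phi> + \<nu>)" using Phi_pos err_le T1 by (intro mult_left_mono) auto
  finally have "real j * (s * (96 * \<Phi>) + s * err) \<le> T * (100 * \<Phi> + \<nu>)" by (simp add: algebra_simps)
  moreover have "\<bar>\<Sum>k<j. nX n (E k) u v (en k)\<bar> \<le> \<nu>" by (rule noiseX[OF assms])
  ultimately show ?thesis using xh_track[OF assms] nu by linarith
qed

text \<open>The drift contains \<open>xh\<close> - 1, already bounded by an integral over time; this
  second integration is the reason for the T^2 hidden in \<open>beta2\<close>.\<close>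

lemma phi_track:
  assumes "j \<le> h" "u < n" "v < n" "u \<noteq> v" "v \<notin> nbr (E j) u"
  shows "\<bar>phi j u v - 0 - (\<Sum>k<j. nA n (E k) u v (en k))\<bar> \<le>
    0 + real j * (s * (2 * \<nu> + T * (100 * \<Phi> + \<nu>) + 48 * T * \<Phi>) + s * err)"
  using assms
proof (induction j)
  case 0
  then show ?case by (simp add: phi_def al_def E0 mixed_codeg_def tt_def)
next
  case (Suc j)
  then have j: "j < h" and jh: "j \<le> h" by auto
  have nadj: "v \<notin> nbr (E j) u" using nbr_mono[OF j] Suc by blast
  note b = all_bounds[OF jh]
  let ?X = "opn n (E j) u \<inter> nbr (E j) v" and ?c = "cw n (E j)" and ?k = "fst (kl j)"
  let ?S = "\<Sum>w\<in>?X. f0 j (u, w) + f0 j (w, u)"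
  have al2: "al n (E j) u v \<le> 2 * T" "0 \<le> al n (E j) u v"
    using al_le[OF facts[OF j] Suc.prems(4)] al_nonneg[OF facts[OF j]] by auto
  have c: "0 < ?c" by (rule cpos[OF j])
  have "\<bar>?S\<bar> \<le> (\<Sum>w\<in>?X. 2 * \<Phi>)"
    by (rule order_trans[OF sum_abs], rule sum_mono) (use f0_sup2[OF jh b] in auto)
  then have "?c * \<bar>?S\<bar> \<le> ?c * (real (card ?X) * (2 * \<Phi>))" using c by (intro mult_left_mono) auto
  also have "\<dots> = al n (E j) u v * (2 * \<Phi>)" by (simp add: al_def mixed_codeg_def)
  also have "\<dots> \<le> 2 * T * (2 * \<Phi>)" using al2 Phi_pos by (intro mult_right_mono) auto
  finally have 1: "\<bar>4 * s * (?c * ?S)\<bar> \<le> 4 * s * (4 * T * \<Phi>)"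
    using s_pos c by (simp add: abs_mult)
  have 2: "\<bar>8 * s * (psi j - ?k) * al n (E j) u v\<bar> \<le> 8 * s * (2 * \<Phi>) * (2 * T)"
    unfolding abs_mult using psi_k[OF j b] s_pos al2 by (intro mult_mono) auto
  have 3: "\<bar>s * (xh n (E j) u v - 1)\<bar> \<le> s * (2 * \<nu> + T * (100 * \<Phi> + \<nu>))"
    unfolding abs_mult using xh_sup[OF jh Suc.prems(2-4) nadj] s_pos by (simp add: mult_left_mono)
  have 4: "\<bar>s * (xh n (E j) u v - 1) + 8 * s * (psi j - ?k) * al n (E j) u v - 4 * s * (?c * ?S)\<bar> \<le>
      s * (2 * \<nu> + T * (100 * \<Phi> + \<nu>) + 48 * T * \<Phi>)"
  proof -
    have "\<bar>s * (xh n (E j) u v - 1) + 8 * s * (psi j - ?k) * al n (E j) u v - 4 * s * (?c * ?S)\<bar> \<le>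
      s * (2 * \<nu> + T * (100 * \<Phi> + \<nu>)) + 8 * s * (2 * \<Phi>) * (2 * T) + 4 * s * (4 * T * \<Phi>)"
      using 1 2 3 by linarith
    then show ?thesis by (simp add: algebra_simps)
  qed
  have st: "\<bar>phi (Suc j) u v - (phi j u v + (s * (xh n (E j) u v - 1) + 8 * s * (psi j - ?k) * al n (E j) u v - 4 * s * (?c * ?S))
      + nA n (E j) u v (en j))\<bar> \<le> s * err"
    using phi_step[OF j Suc.prems(2-5)] by (simp add: algebra_simps)
  have "\<bar>phi (Suc j) u v - 0 - ((\<Sum>k<j. nA n (E k) u v (en k)) + nA n (E j) u v (en j))\<bar> \<le>
      (0 + real j * (s * (2 * \<nu> + T * (100 * \<Phi> + \<nu>) + 48 * T * \<Phi>) + s * err)) + (s * (2 * \<nu> + T * (100 * \<Phi> + \<nu>) + 48 * T * \<Phi>) + s * err)"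
    by (rule drift_sum[OF st Suc.IH[OF jh Suc.prems(2-4) nadj] 4])
  then show ?case by (simp add: algebra_simps)
qed

lemma phi_sup:
  assumes "j \<le> h" "u < n" "v < n" "u \<noteq> v" "v \<notin> nbr (E j) u"
  shows "\<bar>phi j u v\<bar> \<le> \<beta>"
proof -
  let ?q = "2 * \<nu> + T * (100 * \<Phi> + \<nu>)"
  have q: "0 \<le> ?q" using nu Phi_pos T1 by simp
  have "0 \<le> 48 * T * \<Phi>" using T1 Phi_pos by simp
  then have "real j * (s * (?q + 48 * T * \<Phi> + err)) \<le> T * (?q + 48 * T * \<Phi> + err)"
    using total_le[OF assms(1)] q err_le by simp
  also have "\<dots> \<le> T * (?q + 100 * T * \<Phi>)"
  proof (intro mult_left_mono)
    have "1 * \<Phi> \<le> T * \<Phi>" using T1 Phi_pos by (intro mult_right_mono) auto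
    then show "?q + 48 * T * \<Phi> + err \<le> ?q + 100 * T * \<Phi>" using err_le nu_le_Phi Phi_pos by linarith
  qed (use T1 in auto)
  finally have "real j * (s * (?q + 48 * T * \<Phi>) + s * err) \<le> T * (?q + 100 * T * \<Phi>)" by (simp add: algebra_simps)
  moreover have "\<bar>\<Sum>k<j. nA n (E k) u v (en k)\<bar> \<le> \<nu>" by (rule noiseA[OF assms])
  ultimately show ?thesis using phi_track[OF assms] beta2 by linarith
qed

lemma dh_track:
  assumes "j \<le> h" "u < n"
  shows "\<bar>dh n (E j) u - 1 - (\<Sum>k<j. nD n (E k) u (en k))\<bar> \<le> 0 + real j * (s * (48 * \<Phi>) + s * err)"
  using assms
proof (induction j)
  case 0
  then show ?case by (simp add: E0 dh_empty)
next
  case (Suc j)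
  then have j: "j < h" and jh: "j \<le> h" by auto
  note b = all_bounds[OF jh]
  let ?X = "opn n (E j) u" and ?k = "fst (kl j)"
  let ?S = "\<Sum>w\<in>?X. f0 j (u, w) + f0 j (w, u)"
  define c where "c = 2 * cw n (E j) / sqrt (real n)"
  have c: "0 \<le> c" using cpos[OF j] by (simp add: c_def)
  have d: "dh n (E j) u = c * real (card ?X)" by (simp add: dh_def c_def open_deg_def)
  have "dh n (E j) u - 1 \<le> \<beta>" using dh_near[OF facts[OF j] Suc.prems(2)] by (rule abs_le_D1)
  then have d2: "dh n (E j) u \<le> 2" using be by linarith
  have d2': "0 \<le> dh n (E j) u" unfolding d using c by simp
  have "\<bar>?S\<bar> \<le> (\<Sum>w\<in>?X. 2 * \<Phi>)"
    by (rule order_trans[OF sum_abs], rule sum_mono) (use f0_sup2[OF jh b] in auto)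
  then have "c * \<bar>?S\<bar> \<le> c * (real (card ?X) * (2 * \<Phi>))" using c by (intro mult_left_mono) auto
  also have "\<dots> = dh n (E j) u * (2 * \<Phi>)" by (simp add: d)
  also have "\<dots> \<le> 2 * (2 * \<Phi>)" using d2 Phi_pos by (intro mult_right_mono) auto
  finally have 1: "\<bar>4 * s * (c * ?S)\<bar> \<le> 4 * s * (4 * \<Phi>)"
    using s_pos c by (simp add: abs_mult)
  have 2: "\<bar>8 * s * (psi j - ?k) * dh n (E j) u\<bar> \<le> 8 * s * (2 * \<Phi>) * 2"
    unfolding abs_mult using psi_k[OF j b] s_pos d2 d2' by (intro mult_mono) auto
  have "\<bar>8 * s * (psi j - ?k) * dh n (E j) u - 4 * s * (c * ?S)\<bar> \<le> 8 * s * (2 * \<Phi>) * 2 + 4 * s * (4 * \<Phi>)"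
    using 1 2 by linarith
  also have "\<dots> = s * (48 * \<Phi>)" by simp
  finally have 3: "\<bar>8 * s * (psi j - ?k) * dh n (E j) u - 4 * s * (c * ?S)\<bar> \<le> s * (48 * \<Phi>)" .
  have st: "\<bar>dh n (E (Suc j)) u - (dh n (E j) u + (8 * s * (psi j - ?k) * dh n (E j) u - 4 * s * (c * ?S))
      + nD n (E j) u (en j))\<bar> \<le> s * err"
    using dh_step'[OF j Suc.prems(2)] unfolding c_def by (simp add: algebra_simps)
  have "\<bar>dh n (E (Suc j)) u - 1 - ((\<Sum>k<j. nD n (E k) u (en k)) + nD n (E j) u (en j))\<bar> \<le>
      (0 + real j * (s * (48 * \<Phi>) + s * err)) + (s * (48 * \<Phi>) + s * err)"
    by (rule drift_sum[OF st Suc.IH[OF jh Suc.prems(2)] 3])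
  then show ?case by (simp add: algebra_simps)
qed

lemma dh_sup:
  assumes "j \<le> h" "u < n" shows "\<bar>dh n (E j) u - 1\<bar> \<le> \<beta>"
proof -
  have "real j * (s * (48 * \<Phi> + err)) \<le> T * (48 * \<Phi> + err)"
    using total_le[OF assms(1)] Phi_pos err_le by simp
  also have "\<dots> \<le> T * (100 * \<Phi> + \<nu>)" using Phi_pos err_le T1 by (intro mult_left_mono) auto
  finally have "real j * (s * (48 * \<Phi>) + s * err) \<le> T * (100 * \<Phi> + \<nu>)" by (simp add: algebra_simps)
  moreover have "\<bar>\<Sum>k<j. nD n (E k) u (en k)\<bar> \<le> \<nu>" by (rule noiseD[OF assms])
  ultimately show ?thesis using dh_track[OF assms] beta1 nu by linarith
qed

text \<open>Each step adds ln (1 - y) with y = 8 s (t + psi) to ln \<open>nopen\<close>, while 4 t^2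
  increases by 8 s t + 4 s^2. The main terms cancel and only psi, of size about \<beta>, and
  quadratic terms accumulate.\<close>

lemma Q_track:
  assumes "j \<le> h"
  shows "0 < nopen n (E j) \<and>
    \<bar>ln (real (nopen n (E j))) - ln (real (nopen n {})) + 4 * (tt j)\<^sup>2\<bar> \<le> real j * (s * (8 * \<beta> + 9 * \<gamma>))"
  using assms
proof (induction j)
  case 0
  have "0 < real (nopen n {})" unfolding nopen_empty using n2 by simp
  then show ?case by (simp add: E0 tt_def)
next
  case (Suc j)
  then have j: "j < h" and jh: "j \<le> h" by auto
  obtain x y where xy: "en j = {x, y}" "y \<in> opn n (E j) x" "x \<in> opn n (E j) y"
    "psi j = (al n (E j) x y + al n (E j) y x + cw n (E j)) / 2 - tt j" by (rule ej[OF j])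
  let ?y = "8 * s * (tt j + psi j)"
  note Y = yy_bounds[OF facts[OF j] xy(1,2,4) refl]
  have Q: "real (nopen n (E (Suc j))) = real (nopen n (E j)) * (1 - ?y)"
    using nopen_next[OF facts[OF j] xy(1,2,4) refl] step[OF j] by simp
  have q0: "0 < real (nopen n (E j))" using Q_pos[OF facts[OF j]] by simp
  have y1: "0 < 1 - ?y" using Y by linarith
  have pos: "0 < nopen n (E (Suc j))"
  proof -
    have "0 < real (nopen n (E (Suc j)))" unfolding Q using q0 y1 by simp
    then show ?thesis by simp
  qed
  have lnQ: "ln (real (nopen n (E (Suc j)))) = ln (real (nopen n (E j))) + ln (1 - ?y)"
    unfolding Q using q0 y1 by (simp add: ln_mult)
  have l1: "ln (1 - ?y) \<le> - ?y" using ln_le_minus_one[OF y1] by simp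
  have l2: "- ?y - 2 * ?y\<^sup>2 \<le> ln (1 - ?y)" by (rule ln_one_minus_pos_lower_bound) (use Y in auto)
  have ysq: "2 * ?y\<^sup>2 \<le> s * (\<gamma> / 2)"
  proof -
    have "2 * ?y\<^sup>2 \<le> 2 * (s * (576 / 10000 * \<gamma> / T))" by (rule yy_sq[OF facts[OF j] xy(1,2,4) refl]) simp
    also have "\<dots> \<le> s * (\<gamma> / 2)"
    proof -
      have "\<gamma> / T \<le> \<gamma>" using T1 ch by (simp add: field_simps)
      then have "s * (\<gamma> / T) \<le> s * \<gamma>" using s_pos by (intro mult_left_mono) auto
      have "2 * (s * (576 / 10000 * \<gamma> / T)) = 1152 / 10000 * (s * (\<gamma> / T))" using T1 by (simp add: field_simps)
      also have "\<dots> \<le> 1152 / 10000 * (s * \<gamma>)" by (rule mult_left_mono) (fact, simp)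
      also have "\<dots> \<le> s * (\<gamma> / 2)" using s_pos ch by simp
      finally show ?thesis .
    qed
    finally show ?thesis .
  qed
  have s4: "4 * s\<^sup>2 \<le> s * (\<gamma> / 2)"
  proof -
    have "10000 * (1 * s) \<le> 10000 * (T ^ 3 * s)" using T1 s_pos by (intro mult_left_mono mult_right_mono) auto
    also have "\<dots> \<le> \<gamma>" using s_small by simp
    finally have "s * (4 * s) \<le> s * (\<gamma> / 2)" using s_pos by (intro mult_left_mono) auto
    then show ?thesis by (simp add: power2_eq_square)
  qed
  have ps: "\<bar>psi j\<bar> \<le> \<beta> + \<gamma> / 2"
  proof -
    have "\<bar>al n (E j) x y - tt j\<bar> \<le> \<beta>" "\<bar>al n (E j) y x - tt j\<bar> \<le> \<beta>"
      using al_near[OF facts[OF j] open_facts[OF jh xy(2)]] al_near[OF facts[OF j] open_facts[OF jh xy(3)]] by auto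
    moreover have "psi j = (al n (E j) x y - tt j) / 2 + (al n (E j) y x - tt j) / 2 + cw n (E j) / 2"
      unfolding xy(4) by (simp add: field_simps)
    moreover have "0 < cw n (E j)" "cw n (E j) \<le> \<gamma>" using cpos[OF j] cle[OF j] by auto
    moreover have "\<bar>p\<bar> \<le> b + r / 2"
      if "p = A / 2 + B / 2 + C / 2" "\<bar>A\<bar> \<le> b" "\<bar>B\<bar> \<le> b" "0 < C" "C \<le> r" for p A B C b r :: real
      using that by linarith
    ultimately show ?thesis by blast
  qed
  have "\<bar>8 * s * psi j\<bar> \<le> 8 * s * (\<beta> + \<gamma> / 2)" using ps s_pos by (simp add: abs_mult mult_left_mono)
  have "\<bar>ln (1 - ?y) + (8 * s * tt j + 4 * s\<^sup>2)\<bar> \<le> 8 * s * (\<beta> + \<gamma> / 2) + s * (\<gamma> / 2) + s * (\<gamma> / 2)"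
  proof -
    have yeq: "?y = 8 * s * tt j + 8 * s * psi j" by (simp add: algebra_simps)
    have gen: "\<bar>l + (p + q)\<bar> \<le> b + e + e"
      if "l \<le> - y" "- y - r \<le> l" "y = p + A" "\<bar>A\<bar> \<le> b" "r \<le> e" "q \<le> e" "0 \<le> q" "0 \<le> e" for l y p q A b e r :: real
      using that by linarith
    show ?thesis
      by (rule gen[OF l1 l2 yeq \<open>\<bar>8 * s * psi j\<bar> \<le> 8 * s * (\<beta> + \<gamma> / 2)\<close> ysq s4]) (use s_pos ch in auto)
  qed
  also have "\<dots> \<le> s * (8 * \<beta> + 9 * \<gamma>)"
  proof -
    have "0 \<le> s * \<gamma>" using s_pos ch by simp
    then show ?thesis by (simp add: algebra_simps)
  qed
  finally have "\<bar>ln (1 - ?y) + (8 * s * tt j + 4 * s\<^sup>2)\<bar> \<le> s * (8 * \<beta> + 9 * \<gamma>)" .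
  moreover have "4 * (tt (Suc j))\<^sup>2 = 4 * (tt j)\<^sup>2 + (8 * s * tt j + 4 * s\<^sup>2)"
    by (simp add: tt_Suc power2_eq_square algebra_simps)
  moreover have "real (Suc j) * (s * (8 * \<beta> + 9 * \<gamma>)) = real j * (s * (8 * \<beta> + 9 * \<gamma>)) + s * (8 * \<beta> + 9 * \<gamma>)"
    by (simp add: algebra_simps)
  ultimately have "\<bar>ln (real (nopen n (E (Suc j)))) - ln (real (nopen n {})) + 4 * (tt (Suc j))\<^sup>2\<bar> \<le> real (Suc j) * (s * (8 * \<beta> + 9 * \<gamma>))"
    using Suc.IH[OF jh] lnQ by linarith
  then show ?case using pos by blast
qed

theorem good_at: "good (E h) (real h * s)"
proof -
  have hh: "h \<le> h" by simp
  have Q: "0 < nopen n (E h)" using Q_track[OF hh] by blast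
  have q: "\<bar>ln (2 * real (nopen n (E h)) / (real n)\<^sup>2) + 4 * (tt h)\<^sup>2\<bar> \<le> \<zeta>"
  proof -
    have npos: "0 < real n" "0 < real n - 1" using n2 by auto
    have e1: "ln (2 * real (nopen n (E h)) / (real n)\<^sup>2) = ln 2 + ln (real (nopen n (E h))) - 2 * ln (real n)"
      using Q npos by (simp add: ln_div ln_mult ln_realpow)
    have e2: "ln (real (nopen n {})) = ln (real n) + ln (real n - 1) - ln 2"
      unfolding nopen_empty using npos by (simp add: ln_div ln_mult)
    have e3: "ln (real n - 1) - ln (real n) = ln (1 - 1 / real n)"
    proof -
      have "1 - 1 / real n = (real n - 1) / real n" using npos by (simp add: diff_divide_distrib)
      then show ?thesis using ln_div[of "real n - 1" "real n"] npos by simp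
    qed
    have n1: "1 / real n \<le> 1 / 2" using n2 by simp
    have "0 < 1 - 1 / real n" using n1 by linarith
    then have u: "ln (1 - 1 / real n) \<le> 0" using npos by (simp add: ln_le_zero_iff)
    have "- (1 / real n) - 2 * (1 / real n)\<^sup>2 \<le> ln (1 - 1 / real n)"
      by (rule ln_one_minus_pos_lower_bound) (use n1 npos in auto)
    moreover have "2 * (1 / real n)\<^sup>2 \<le> 1 / real n"
    proof -
      have "(1 / real n) * (1 / real n) \<le> (1 / 2) * (1 / real n)" using n1 npos by (intro mult_right_mono) auto
      then show ?thesis by (simp add: power2_eq_square)
    qed
    moreover have "1 / real n \<le> \<gamma>"
    proof -
      have "sqrt (real n) \<le> real n"
        using npos n2 by (intro real_le_lsqrt) (auto simp: power2_eq_square)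
      then have "1 / real n \<le> 1 / sqrt (real n)" using npos by (intro divide_left_mono) auto
      then show ?thesis using nch by linarith
    qed
    ultimately have l: "- (2 * \<gamma>) \<le> ln (1 - 1 / real n)" by linarith
    have "real h * (s * (8 * \<beta> + 9 * \<gamma>)) \<le> T * (8 * \<beta> + 9 * \<gamma>)" by (rule total_le) (use be ch in auto)
    moreover have "0 \<le> T * \<beta>" "0 \<le> T * \<gamma>" using T1 be ch by auto
    ultimately have "real h * (s * (8 * \<beta> + 9 * \<gamma>)) + 2 * \<gamma> \<le> \<zeta>"
      using zeta(1) by (simp add: algebra_simps)
    then show ?thesis using Q_track[OF hh] e1 e2 e3 u l by linarith
  qed
  \<comment> \<open>The bound on \<open>cw\<close> is recovered from the logarithm of the density;
    this is where the end of the tracking time enters, through \<open>dens\<close>.\<close>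
  have c: "cw n (E h) \<le> \<gamma>"
  proof -
    have npos: "0 < real n" "0 < sqrt (real n)" using n2 by auto
    have Qr: "0 < 2 * real (nopen n (E h)) / (real n)\<^sup>2" using Q npos by simp
    have "- (4 * (tt h)\<^sup>2 + \<zeta>) \<le> ln (2 * real (nopen n (E h)) / (real n)\<^sup>2)" using q by linarith
    then have "exp (- (4 * (tt h)\<^sup>2 + \<zeta>)) \<le> 2 * real (nopen n (E h)) / (real n)\<^sup>2"
      using Qr by (simp add: ln_ge_iff)
    then have "1 / (2 * real (nopen n (E h)) / (real n)\<^sup>2) \<le> 1 / exp (- (4 * (tt h)\<^sup>2 + \<zeta>))"
      by (intro divide_left_mono mult_pos_pos) (use Qr in auto)
    also have "1 / exp (- (4 * (tt h)\<^sup>2 + \<zeta>)) = exp (4 * (tt h)\<^sup>2 + \<zeta>)"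
      by (simp only: exp_minus inverse_eq_divide) simp
    finally have "1 / (2 * real (nopen n (E h)) / (real n)\<^sup>2) / (2 * sqrt (real n)) \<le> exp (4 * (tt h)\<^sup>2 + \<zeta>) / (2 * sqrt (real n))"
      by (intro divide_right_mono) auto
    also have "\<dots> \<le> \<gamma>" using dens by (simp add: tt_def)
    also have "1 / (2 * real (nopen n (E h)) / (real n)\<^sup>2) / (2 * sqrt (real n)) = cw n (E h)"
    proof -
      have "(real n)\<^sup>2 = rn n * sqrt (real n)" using npos by (simp add: rn_def power2_eq_square)
      then show ?thesis using npos Q by (simp add: cw_def)
    qed
    finally show ?thesis .
  qed
  have "\<bar>xh n (E h) u v - 1\<bar> \<le> \<beta>" if "u < n" "v < n" "u \<noteq> v" "v \<notin> nbr (E h) u" for u v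
    using xh_sup[OF hh that] beta1 by linarith
  then show ?thesis unfolding good_def
    using Q q c codeg_h phi_sup[OF hh] dh_sup[OF hh] by (auto simp: phi_def tt_def)
qed

end

section \<open>Exponential supermartingales for edge counts, noise and codegrees\<close>

definition ocount :: "nat \<Rightarrow> nat set set \<Rightarrow> nat set \<Rightarrow> nat set \<Rightarrow> real" where
  "ocount n E S R = (\<Sum>x\<in>S. real (card (R \<inter> opn n E x)))"

definition hits :: "nat \<Rightarrow> nat set set \<Rightarrow> nat set \<Rightarrow> nat set \<Rightarrow> nat set \<Rightarrow> real" where
  "hits n E S R e = (\<Sum>x\<in>S. real (card {y \<in> R \<inter> opn n E x. e = {x, y}}))"

definition losses :: "nat \<Rightarrow> nat set set \<Rightarrow> nat set \<Rightarrow> nat set \<Rightarrow> nat set \<Rightarrow> real" where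
  "losses n E S R e = (\<Sum>x\<in>S. real (card {y \<in> R \<inter> opn n E x. {x, y} \<in> killset n E e}))"

lemma ecount_insert:
  assumes V: "valid n E" and e: "e \<in> open_pairs n E" and R: "finite R"
  shows "ecount (insert e E) S R = ecount E S R + hits n E S R e"
proof -
  have "real (card (R \<inter> nbr (insert e E) x)) = real (card (R \<inter> nbr E x)) + real (card {y \<in> R \<inter> opn n E x. e = {x, y}})" for x
  proof -
    have "R \<inter> nbr (insert e E) x = (R \<inter> nbr E x) \<union> {y \<in> R \<inter> opn n E x. e = {x, y}}"
      using e by (auto simp: nbr_def opn_def)
    moreover have "(R \<inter> nbr E x) \<inter> {y \<in> R \<inter> opn n E x. e = {x, y}} = {}"
      using e by (auto simp: nbr_def open_pairs_def)
    ultimately show ?thesis using R by (simp add: card_Un_disjoint)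
  qed
  then show ?thesis by (simp add: ecount_def hits_def sum.distrib)
qed

lemma ocount_insert:
  assumes V: "valid n E" and e: "e \<in> open_pairs n E" and R: "finite R"
  shows "ocount n (insert e E) S R = ocount n E S R - losses n E S R e"
proof -
  have "real (card (R \<inter> opn n (insert e E) x)) = real (card (R \<inter> opn n E x)) - real (card {y \<in> R \<inter> opn n E x. {x, y} \<in> killset n E e})" for x
  proof -
    have "R \<inter> opn n (insert e E) x = {y \<in> R \<inter> opn n E x. \<not> {x, y} \<in> killset n E e}"
      using row_step[OF V e, of x] by blast
    then show ?thesis using card_split_filter[of "R \<inter> opn n E x" "\<lambda>y. {x, y} \<in> killset n E e"] by simp
  qed
  then show ?thesis by (simp add: ocount_def losses_def sum_subtractf)
qed

lemma sum_hits:
  assumes "finite S"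
  shows "(\<Sum>e\<in>open_pairs n E. hits n E S R e) = ocount n E S R"
proof -
  have "(\<Sum>e\<in>open_pairs n E. hits n E S R e) =
      (\<Sum>x\<in>S. \<Sum>e\<in>open_pairs n E. real (card {y \<in> R \<inter> opn n E x. e = {x, y}}))"
    unfolding hits_def by (rule sum.swap)
  also have "\<dots> = (\<Sum>x\<in>S. real (card (R \<inter> opn n E x)))"
  proof (rule sum.cong[OF refl])
    fix x
    have "(\<Sum>e\<in>open_pairs n E. card {y \<in> R \<inter> opn n E x. e = {x, y}}) = card (R \<inter> opn n E x)"
    proof (rule sum_count_pairs)
      show "{x, w} \<in> open_pairs n E" if "w \<in> R \<inter> opn n E x" for w using that by (auto simp: opn_def)
    qed auto
    then have "real (\<Sum>e\<in>open_pairs n E. card {y \<in> R \<inter> opn n E x. e = {x, y}}) = real (card (R \<inter> opn n E x))"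
      by (rule arg_cong)
    then show "(\<Sum>e\<in>open_pairs n E. real (card {y \<in> R \<inter> opn n E x. e = {x, y}})) = real (card (R \<inter> opn n E x))"
      unfolding of_nat_sum .
  qed
  finally show ?thesis by (simp add: ocount_def)
qed

lemma sum_losses:
  assumes V: "valid n E"
  shows "(\<Sum>e\<in>open_pairs n E. losses n E S R e) = (\<Sum>x\<in>S. \<Sum>y\<in>R \<inter> opn n E x. closers n E x y)"
proof -
  have "(\<Sum>e\<in>open_pairs n E. losses n E S R e) =
      (\<Sum>x\<in>S. \<Sum>e\<in>open_pairs n E. real (card {y \<in> R \<inter> opn n E x. {x, y} \<in> killset n E e}))"
    unfolding losses_def by (rule sum.swap)
  also have "\<dots> = (\<Sum>x\<in>S. \<Sum>y\<in>R \<inter> opn n E x. closers n E x y)"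
    by (rule sum.cong[OF refl], rule sum_removed_all[OF V]) auto
  finally show ?thesis .
qed

lemma card_orderings_le:
  assumes "card f = 2"
  shows "finite {(x, y). f = {x, y}}" "card {(x, y). f = {x, y}} \<le> 2"
proof -
  obtain a b where f: "f = {a, b}" using assms by (auto simp: card_2_iff)
  have s: "{(x, y). f = {x, y}} \<subseteq> {(a, b), (b, a)}" unfolding f by (auto simp: doubleton_eq_iff)
  then show "finite {(x, y). f = {x, y}}" by (rule finite_subset) simp
  have "card {(x, y). f = {x, y}} \<le> card {(a, b), (b, a)}" by (rule card_mono[OF _ s]) simp
  also have "\<dots> \<le> 2" using card_length[of "[(a, b), (b, a)]"] by simp
  finally show "card {(x, y). f = {x, y}} \<le> 2" .
qed

lemma card_ordered_in:
  assumes F: "finite F" "\<And>f. f \<in> F \<Longrightarrow> card f = 2" and S: "finite S"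
  shows "(\<Sum>x\<in>S. real (card {y \<in> R \<inter> opn n E x. {x, y} \<in> F})) \<le> 2 * real (card F)"
proof -
  have "(\<Sum>x\<in>S. card {y \<in> R \<inter> opn n E x. {x, y} \<in> F}) = card (Sigma S (\<lambda>x. {y \<in> R \<inter> opn n E x. {x, y} \<in> F}))"
    using S by (simp add: card_SigmaI)
  also have "\<dots> \<le> card (\<Union>f\<in>F. {(x, y). f = {x, y}})"
    by (rule card_mono) (use F card_orderings_le in auto)
  also have "\<dots> \<le> (\<Sum>f\<in>F. card {(x, y). f = {x, y}})" by (rule card_UN_le[OF F(1)])
  also have "\<dots> \<le> (\<Sum>f\<in>F. 2)" by (intro sum_mono card_orderings_le F)
  finally have "(\<Sum>x\<in>S. card {y \<in> R \<inter> opn n E x. {x, y} \<in> F}) \<le> 2 * card F" by simp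
  then have "real (\<Sum>x\<in>S. card {y \<in> R \<inter> opn n E x. {x, y} \<in> F}) \<le> real (2 * card F)" by (rule of_nat_mono)
  then show ?thesis by simp
qed

lemma killset_subset: "e \<in> open_pairs n E \<Longrightarrow> killset n E e \<subseteq> open_pairs n E"
  by (erule open_pair_cases) (simp add: kills_subset)

lemma card_killset:
  assumes "valid n E" "y \<in> opn n E x"
  shows "real (card (killset n E {x, y})) = closers n E x y"
  using card_kills[OF assms] by (simp add: closers_def)

lemma hits_bounds:
  assumes e: "e \<in> open_pairs n E" and S: "finite S"
  shows "0 \<le> hits n E S R e" "hits n E S R e \<le> 2"
proof -
  show "0 \<le> hits n E S R e" by (simp add: hits_def sum_nonneg)
  have "hits n E S R e = (\<Sum>x\<in>S. real (card {y \<in> R \<inter> opn n E x. {x, y} \<in> {e}}))"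
    unfolding hits_def by (intro sum.cong refl arg_cong[of _ _ "\<lambda>A. real (card A)"]) auto
  also have "\<dots> \<le> 2 * real (card {e})"
    by (rule card_ordered_in) (use e S in \<open>auto simp: open_pairs_def\<close>)
  finally show "hits n E S R e \<le> 2" by simp
qed

lemma losses_bounds:
  assumes e: "e \<in> open_pairs n E" and S: "finite S"
  shows "0 \<le> losses n E S R e" "losses n E S R e \<le> 2 * real (card (killset n E e))"
proof -
  show "0 \<le> losses n E S R e" by (simp add: losses_def sum_nonneg)
  show "losses n E S R e \<le> 2 * real (card (killset n E e))"
    unfolding losses_def
    by (rule card_ordered_in)
      (use killset_subset[OF e] finite_subset[OF killset_subset[OF e]] S in \<open>auto simp: open_pairs_def\<close>)
qed

lemma ocount_bounds:
  assumes "finite S" shows "0 \<le> ocount n E S R" "ocount n E S R \<le> 2 * real (nopen n E)"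
proof -
  show "0 \<le> ocount n E S R" by (simp add: ocount_def sum_nonneg)
  have "ocount n E S R = (\<Sum>x\<in>S. real (card {y \<in> R \<inter> opn n E x. {x, y} \<in> open_pairs n E}))"
    unfolding ocount_def by (intro sum.cong refl arg_cong[of _ _ "\<lambda>A. real (card A)"]) (auto simp: opn_def)
  also have "\<dots> \<le> 2 * real (card (open_pairs n E))"
    by (rule card_ordered_in) (use assms in \<open>auto simp: open_pairs_def\<close>)
  finally show "ocount n E S R \<le> 2 * real (nopen n E)" by (simp add: nopen_def)
qed

lemma two_near:
  fixes p q r x b :: real
  assumes "- (q - x) \<le> b" "- (r - x) \<le> b" "0 < p"
  shows "2 * (x - b) \<le> p + q + r"
  using assms unfolding right_diff_distrib by linarith

context tracking
begin

context
  fixes E :: "nat set set" and t :: real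
  assumes V: "valid n E" and g: "good E t" and t: "0 \<le> t" "t \<le> T"
begin

text \<open>G is the predicted value of 1 / \<open>nopen\<close>; the product of the two is exp d
  with |d| <= \<zeta>.\<close>

lemma QG:
  defines "G \<equiv> 2 / (real n)\<^sup>2 * exp (4 * t\<^sup>2)"
  assumes z: "\<zeta> \<le> 1 / 8"
  shows "0 < G" "real (nopen n E) * G \<le> 5 / 4" "3 / 4 \<le> real (nopen n E) * G"
    "1 / real (nopen n E) \<le> G * (1 + 2 * \<zeta>)"
proof -
  define X where "X = 2 * real (nopen n E) / (real n)\<^sup>2"
  have X: "0 < X" using Q_pos[OF V g t] n2 by (simp add: X_def)
  define d where "d = ln X + 4 * t\<^sup>2"
  have d: "\<bar>d\<bar> \<le> \<zeta>" using g by (simp add: good_def d_def X_def)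
  show "0 < G" using n2 by (simp add: G_def)
  have eq: "real (nopen n E) * G = exp d"
    using X by (simp add: d_def exp_add G_def) (simp add: X_def)
  have q: "exp x \<le> 1 + 2 * \<zeta>" if "\<bar>x\<bar> \<le> \<zeta>" for x
  proof -
    have "exp x \<le> exp \<zeta>" using that by simp
    also have "\<dots> \<le> 1 + \<zeta> + \<zeta>\<^sup>2" by (rule exp_le_quadratic) (use that z in auto)
    also have "\<zeta>\<^sup>2 \<le> 1 * \<zeta>" unfolding power2_eq_square by (rule mult_right_mono) (use that z in auto)
    finally show ?thesis by simp
  qed
  show "real (nopen n E) * G \<le> 5 / 4" using q[OF d] z unfolding eq by linarith
  have "1 + d \<le> exp d" by simp
  then show "3 / 4 \<le> real (nopen n E) * G" using d z unfolding eq by linarith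
  have "1 / real (nopen n E) = G * exp (- d)"
    using eq Q_pos[OF V g t] by (simp add: exp_minus field_simps)
  also have "\<dots> \<le> G * (1 + 2 * \<zeta>)" using q[of "- d"] d \<open>0 < G\<close> by (intro mult_left_mono) auto
  finally show "1 / real (nopen n E) \<le> G * (1 + 2 * \<zeta>)" .
qed

lemma c_Q: "1 / cw n E = 4 * s * real (nopen n E)"
proof -
  have "4 * cw n E * s * real (nopen n E) = 1"
    unfolding inv_Q[OF V g t, symmetric] using Q_pos[OF V g t] by simp
  then show ?thesis using c_pos[OF V g t] by (simp add: field_simps)
qed

lemma closers_bounds:
  assumes o: "y \<in> opn n E x"
  shows "8 * s * real (nopen n E) * (t - \<beta>) \<le> closers n E x y"
    "closers n E x y \<le> 24 * T * s * real (nopen n E)"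
proof -
  have xy: "x < n" "y < n" "x \<noteq> y" "y \<notin> nbr E x" "x \<notin> nbr E y"
    using o opn_iff[OF V] nbr_sym by blast+
  have cl: "closers n E x y = (cw n E + al n E x y + al n E y x) * (4 * s * real (nopen n E))"
    unfolding closers_eq[OF V g t] c_Q[symmetric] by simp
  have p: "0 \<le> 4 * s * real (nopen n E)" using s_pos by simp
  have "2 * (t - \<beta>) \<le> cw n E + al n E x y + al n E y x"
  proof -
    show ?thesis
      by (rule two_near[OF abs_le_D2[OF al_near[OF V g t xy(1-4)]]
          abs_le_D2[OF al_near[OF V g t xy(2,1) xy(3)[symmetric] xy(5)]] c_pos[OF V g t]])
  qed
  from mult_right_mono[OF this p] show "8 * s * real (nopen n E) * (t - \<beta>) \<le> closers n E x y"
    unfolding cl by (simp add: algebra_simps)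
  have "cw n E + al n E x y + al n E y x \<le> 6 * T"
    using al_le[OF V g t xy(3)] al_le[OF V g t xy(3)[symmetric]] c_le[OF V g t] ch T1 by linarith
  from mult_right_mono[OF this p] show "closers n E x y \<le> 24 * T * s * real (nopen n E)"
    unfolding cl by (simp add: mult_ac)
qed

text \<open>The weight \<open>w\<close> of an open pair anticipates the probability that it becomes an edge within
  the remaining \<open>r\<close> steps; the factor \<open>1 + \<delta>\<close> leaves room for the second order terms.\<close>

lemma weight_step:
  fixes \<delta> r :: real
  defines "G \<equiv> 2 / (real n)\<^sup>2 * exp (4 * t\<^sup>2)" and "G' \<equiv> 2 / (real n)\<^sup>2 * exp (4 * (t + s)\<^sup>2)"
  defines "w \<equiv> (1 + \<delta>) * r * G" and "w' \<equiv> (1 + \<delta>) * (r - 1) * G'"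
  assumes z: "\<zeta> \<le> 1 / 8" and d: "0 \<le> \<delta>" "\<delta> \<le> 1" "8 * \<zeta> \<le> \<delta>" "200 * T * \<beta> \<le> \<delta>" and sb: "s \<le> \<beta>"
    and r: "1 \<le> r" "r * s \<le> T"
  shows "0 \<le> w'" "w' * s \<le> 4 * T * G" "\<bar>w' - w\<bar> \<le> 50 * T\<^sup>2 * G"
    "1 / real (nopen n E) - 8 * s * (t - \<beta>) * w' + (w' - w) \<le> - G * \<delta> / 2"
proof -
  have G: "0 < G" "1 / real (nopen n E) \<le> G * (1 + 2 * \<zeta>)" using QG[OF z] by (auto simp: G_def)
  have T2: "1 \<le> T\<^sup>2" "T \<le> T\<^sup>2" using T1 T_powers by auto
  have s1: "s \<le> 1 / 2" using sb be by linarith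
  define x where "x = 8 * t * s + 4 * s\<^sup>2"
  have x0: "0 \<le> x" using t s_pos by (simp add: x_def)
  have ss: "s\<^sup>2 \<le> s * 1" unfolding power2_eq_square using s1 s_pos by (intro mult_left_mono) auto
  have x1: "x \<le> s * (12 * T)"
  proof -
    have "t * s \<le> T * s" "1 * s \<le> T * s" using t s_pos T1 by (intro mult_right_mono; simp)+
    then show ?thesis using ss unfolding x_def by (simp add: mult_ac)
  qed
  have "10000 * (T * s) \<le> 10 ^ 4 * T ^ 3 * s" using T_powers s_pos by simp
  then have "T * s * 10000 \<le> 1 / 2" using s_small ch by linarith
  then have xs: "x \<le> 1 / 2" using x1 by (simp add: mult_ac)
  have G'eq: "G' = G * exp x"
    unfolding G_def G'_def x_def by (simp add: exp_add[symmetric] power2_eq_square algebra_simps)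
  have ex: "exp x \<le> 2"
  proof -
    have "exp x \<le> 1 + x + x\<^sup>2" by (rule exp_le_quadratic) (use x0 xs in auto)
    also have "x\<^sup>2 \<le> (1 / 2) * (1 / 2)" unfolding power2_eq_square using x0 xs by (intro mult_mono) auto
    finally show ?thesis using xs by linarith
  qed
  have G'2: "G' \<le> 2 * G" unfolding G'eq using ex G by (simp add: mult.commute)
  have G'0: "0 < G'" unfolding G'eq using G by simp
  have GG': "G \<le> G'" unfolding G'eq using G x0 by simp
  have dG: "G' - G \<le> G' * x"
  proof -
    have "1 - x \<le> exp (- x)" using exp_ge_add_one_self[of "- x"] by simp
    then have "G' * (1 - x) \<le> G' * exp (- x)" using G'0 by (intro mult_left_mono) auto
    also have "\<dots> = G" unfolding G'eq by (simp add: exp_minus)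
    finally show ?thesis by (simp add: algebra_simps)
  qed
  show w'0: "0 \<le> w'" using d r G'0 by (simp add: w'_def)
  have w'4: "w' \<le> 4 * r * G"
  proof -
    have "w' \<le> (1 + \<delta>) * r * G'" unfolding w'_def using d G'0 by (intro mult_right_mono mult_left_mono) auto
    also have "\<dots> \<le> 2 * r * (2 * G)" using d r G'2 G'0 by (intro mult_mono) auto
    finally show ?thesis by simp
  qed
  have "w' * s \<le> 4 * r * G * s" using w'4 s_pos by (intro mult_right_mono) auto
  also have "\<dots> = (r * s) * (4 * G)" by simp
  also have "\<dots> \<le> T * (4 * G)" using r G by (intro mult_right_mono) auto
  finally show ws: "w' * s \<le> 4 * T * G" by simp
  have dw: "w' - w = (1 + \<delta>) * ((r - 1) * (G' - G)) - (1 + \<delta>) * G"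
    by (simp add: w_def w'_def algebra_simps)
  have dw1: "(1 + \<delta>) * ((r - 1) * (G' - G)) \<le> w' * x"
  proof -
    have "(1 + \<delta>) * ((r - 1) * (G' - G)) \<le> (1 + \<delta>) * ((r - 1) * (G' * x))"
      using d r dG by (intro mult_left_mono) auto
    then show ?thesis by (simp add: w'_def mult_ac)
  qed
  have wx: "w' * x \<le> 48 * T\<^sup>2 * G"
  proof -
    have "w' * x \<le> w' * (s * (12 * T))" using x1 w'0 by (rule mult_left_mono)
    also have "\<dots> = (w' * s) * (12 * T)" by simp
    also have "\<dots> \<le> 4 * T * G * (12 * T)" using ws T1 by (intro mult_right_mono) auto
    finally show ?thesis by (simp add: power2_eq_square mult_ac)
  qed
  have dG2: "(1 + \<delta>) * G \<le> 2 * T\<^sup>2 * G" using d G T2 by (intro mult_right_mono) auto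
  have nn: "0 \<le> (1 + \<delta>) * ((r - 1) * (G' - G))" "0 \<le> (1 + \<delta>) * G" "0 \<le> T\<^sup>2 * G" using d r GG' G by auto
  show "\<bar>w' - w\<bar> \<le> 50 * T\<^sup>2 * G"
    unfolding dw using dw1 wx dG2 nn by (simp add: abs_le_iff)
  \<comment> \<open>Without errors and without \<delta> the three terms cancel: the chance to remain
    open decays like the number of open pairs, so a pair is chosen in each later step with the same
    probability G, and r G solves the recursion. The surplus \<delta> G pays for all errors.\<close>
  have "w' - w - 8 * s * (t - \<beta>) * w' \<le> w' * x - (1 + \<delta>) * G - 8 * s * (t - \<beta>) * w'"
    unfolding dw using dw1 by simp
  also have "\<dots> = (w' * s) * (8 * \<beta> + 4 * s) - (1 + \<delta>) * G" by (simp add: x_def power2_eq_square algebra_simps)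
  also have "\<dots> \<le> 4 * T * G * (12 * \<beta>) - (1 + \<delta>) * G"
  proof -
    have "(w' * s) * (8 * \<beta> + 4 * s) \<le> (4 * T * G) * (12 * \<beta>)"
      by (rule mult_mono) (use ws sb be s_pos w'0 G T1 in auto)
    then show ?thesis by simp
  qed
  also have "\<dots> = G * (48 * T * \<beta> - 1 - \<delta>)" by (simp add: algebra_simps)
  finally have "1 / real (nopen n E) - 8 * s * (t - \<beta>) * w' + (w' - w) \<le> G * (1 + 2 * \<zeta>) + G * (48 * T * \<beta> - 1 - \<delta>)"
    using G(2) by linarith
  also have "\<dots> = G * (2 * \<zeta> + 48 * T * \<beta> - \<delta>)" by (simp add: algebra_simps)
  also have "\<dots> \<le> G * (- \<delta> / 2)" using G d by (intro mult_left_mono) auto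
  finally show "1 / real (nopen n E) - 8 * s * (t - \<beta>) * w' + (w' - w) \<le> - G * \<delta> / 2" by simp
qed

text \<open>The potential is the number of edges present plus the expected number still to come from
  the open pairs. Thanks to \<delta> its change \<open>Dl\<close> has a negative mean proportional
  to \<open>ocount\<close>; its absolute mean is also O(T^2 \<open>ocount\<close>), so for small k
  the quadratic term of the exponential is dominated.\<close>

lemma count_exp_step:
  fixes \<delta> r k :: real
  defines "G \<equiv> 2 / (real n)\<^sup>2 * exp (4 * t\<^sup>2)" and "G' \<equiv> 2 / (real n)\<^sup>2 * exp (4 * (t + s)\<^sup>2)"
  defines "w \<equiv> (1 + \<delta>) * r * G" and "w' \<equiv> (1 + \<delta>) * (r - 1) * G'"
  assumes z: "\<zeta> \<le> 1 / 8" and d: "0 \<le> \<delta>" "\<delta> \<le> 1" "8 * \<zeta> \<le> \<delta>" "200 * T * \<beta> \<le> \<delta>" and sb: "s \<le> \<beta>"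
    and r: "1 \<le> r" "r * s \<le> T" and k: "0 \<le> k" "10 ^ 6 * T ^ 4 * k \<le> \<delta>"
    and SR: "finite S" "finite R"
  shows "(\<Sum>e\<in>open_pairs n E. exp (k * (ecount (insert e E) S R + w' * ocount n (insert e E) S R))) \<le>
    exp (k * (ecount E S R + w * ocount n E S R)) * real (nopen n E)"
proof -
  let ?O = "open_pairs n E"
  define Q where "Q = real (nopen n E)"
  define oc where "oc = ocount n E S R"
  define Dl where "Dl e = hits n E S R e - w' * losses n E S R e + (w' - w) * oc" for e
  note W = weight_step[OF z d sb r, folded G_def G'_def, folded w_def w'_def, folded Q_def]
  have G: "0 < G" "Q * G \<le> 5 / 4" "3 / 4 \<le> Q * G" using QG[OF z] by (auto simp: G_def Q_def)
  have Q0: "0 < Q" using Q_pos[OF V g t] by (simp add: Q_def)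
  have T2: "1 \<le> T\<^sup>2" using T1 by simp
  have oc: "0 \<le> oc" "oc \<le> 2 * Q" using ocount_bounds[OF SR(1)] by (auto simp: oc_def Q_def)
  have TG: "T\<^sup>2 * (Q * G) \<le> 5 / 4 * T\<^sup>2" 
  proof -
    have "T\<^sup>2 * (Q * G) \<le> T\<^sup>2 * (5 / 4)" by (rule mult_left_mono[OF G(2)]) simp
    then show ?thesis by linarith
  qed
  have step: "ecount (insert e E) S R + w' * ocount n (insert e E) S R = (ecount E S R + w * oc) + Dl e" if "e \<in> ?O" for e
    unfolding ecount_insert[OF V that SR(2)] ocount_insert[OF V that SR(2)] Dl_def oc_def
    by (simp add: algebra_simps)
  have wl: "w' * (24 * T * s * Q) \<le> 120 * T\<^sup>2"
  proof -
    have "w' * (24 * T * s * Q) = (w' * s) * (24 * T * Q)" by simp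
    also have "\<dots> \<le> 4 * T * G * (24 * T * Q)" using W(2) T1 Q0 by (intro mult_right_mono) auto
    also have "\<dots> = 96 * (T\<^sup>2 * (Q * G))" by (simp add: power2_eq_square mult_ac)
    also have "\<dots> \<le> 120 * T\<^sup>2" using TG by linarith
    finally show ?thesis .
  qed
  have dwQ: "Q * \<bar>w' - w\<bar> \<le> 63 * T\<^sup>2"
  proof -
    have "Q * \<bar>w' - w\<bar> \<le> Q * (50 * T\<^sup>2 * G)" using W(3) Q0 by (intro mult_left_mono) auto
    also have "\<dots> = 50 * (T\<^sup>2 * (Q * G))" by simp
    also have "\<dots> \<le> 50 * (5 / 4 * T\<^sup>2)" by (rule mult_left_mono[OF TG]) simp
    finally show ?thesis using T2 by simp
  qed
  have Dl_abs: "\<bar>Dl e\<bar> \<le> hits n E S R e + w' * losses n E S R e + \<bar>w' - w\<bar> * oc" if e: "e \<in> ?O" for e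
  proof -
    have "0 \<le> w' * losses n E S R e" using W(1) losses_bounds(1)[OF e SR(1), of R] by simp
    moreover have "\<bar>(w' - w) * oc\<bar> = \<bar>w' - w\<bar> * oc" using oc by (simp add: abs_mult)
    ultimately show ?thesis using hits_bounds(1)[OF e SR(1), of R] unfolding Dl_def by linarith
  qed
  have Dl_max: "\<bar>Dl e\<bar> \<le> 400 * T\<^sup>2" if e: "e \<in> ?O" for e
  proof -
    obtain x y where xy: "e = {x, y}" "y \<in> opn n E x" "x \<in> opn n E y" "x \<noteq> y"
      using e by (rule open_pair_cases)
    have "losses n E S R e \<le> 2 * closers n E x y"
      using losses_bounds(2)[OF e SR(1)] card_killset[OF V xy(2)] xy(1) by simp
    also have "\<dots> \<le> 2 * (24 * T * s * Q)" using closers_bounds(2)[OF xy(2)] by (simp add: Q_def)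
    finally have "w' * losses n E S R e \<le> w' * (2 * (24 * T * s * Q))" using W(1) by (rule mult_left_mono)
    also have "\<dots> \<le> 240 * T\<^sup>2" using wl by simp
    finally have 1: "w' * losses n E S R e \<le> 240 * T\<^sup>2" .
    have "\<bar>w' - w\<bar> * oc \<le> \<bar>w' - w\<bar> * (2 * Q)" using oc by (intro mult_left_mono) auto
    also have "\<dots> \<le> 126 * T\<^sup>2" using dwQ by (simp add: mult_ac)
    finally show ?thesis using Dl_abs[OF e] hits_bounds(2)[OF e SR(1), of R] 1 T2 by linarith
  qed
  have cl_up: "(\<Sum>x\<in>S. \<Sum>y\<in>R \<inter> opn n E x. closers n E x y) \<le> oc * (24 * T * s * Q)"
  proof -
    have "(\<Sum>x\<in>S. \<Sum>y\<in>R \<inter> opn n E x. closers n E x y) \<le> (\<Sum>x\<in>S. \<Sum>y\<in>R \<inter> opn n E x. 24 * T * s * Q)"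
      unfolding Q_def by (intro sum_mono closers_bounds(2)) auto
    then show ?thesis by (simp add: oc_def ocount_def sum_distrib_right)
  qed
  have cl_lo: "oc * (8 * s * Q * (t - \<beta>)) \<le> (\<Sum>x\<in>S. \<Sum>y\<in>R \<inter> opn n E x. closers n E x y)"
  proof -
    have "(\<Sum>x\<in>S. \<Sum>y\<in>R \<inter> opn n E x. 8 * s * Q * (t - \<beta>)) \<le> (\<Sum>x\<in>S. \<Sum>y\<in>R \<inter> opn n E x. closers n E x y)"
      unfolding Q_def by (intro sum_mono closers_bounds(1)) auto
    then show ?thesis by (simp add: oc_def ocount_def sum_distrib_right)
  qed
  have cO: "real (card ?O) = Q" by (simp add: Q_def nopen_def)
  have sumD: "(\<Sum>e\<in>?O. Dl e) \<le> - (3 / 8 * \<delta> * oc)"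
  proof -
    have "(\<Sum>e\<in>?O. Dl e) = oc - w' * (\<Sum>x\<in>S. \<Sum>y\<in>R \<inter> opn n E x. closers n E x y) + Q * ((w' - w) * oc)"
      unfolding Dl_def using sum_hits[OF SR(1)] sum_losses[OF V]
      by (simp add: sum.distrib sum_subtractf sum_distrib_left[symmetric] cO oc_def)
    also have "\<dots> \<le> oc - w' * (oc * (8 * s * Q * (t - \<beta>))) + Q * ((w' - w) * oc)"
      using mult_left_mono[OF cl_lo W(1)] by simp
    also have "\<dots> = oc * Q * (1 / Q - 8 * s * (t - \<beta>) * w' + (w' - w))"
      using Q0 by (simp add: field_simps)
    also have "\<dots> \<le> oc * Q * (- G * \<delta> / 2)" using W(4) oc Q0 by (intro mult_left_mono) auto
    also have "\<dots> = - (Q * G * (\<delta> / 2 * oc))" by simp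
    also have "\<dots> \<le> - (3 / 4 * (\<delta> / 2 * oc))"
      using mult_right_mono[OF G(3), of "\<delta> / 2 * oc"] d oc by simp
    finally show ?thesis by simp
  qed
  have sumA: "(\<Sum>e\<in>?O. \<bar>Dl e\<bar>) \<le> 200 * T\<^sup>2 * oc"
  proof -
    have "(\<Sum>e\<in>?O. \<bar>Dl e\<bar>) \<le> (\<Sum>e\<in>?O. hits n E S R e + w' * losses n E S R e + \<bar>w' - w\<bar> * oc)"
      by (rule sum_mono[OF Dl_abs])
    also have "\<dots> = oc + w' * (\<Sum>x\<in>S. \<Sum>y\<in>R \<inter> opn n E x. closers n E x y) + Q * (\<bar>w' - w\<bar> * oc)"
      using sum_hits[OF SR(1)] sum_losses[OF V]
      by (simp add: sum.distrib sum_distrib_left[symmetric] cO oc_def)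
    also have "\<dots> \<le> oc + w' * (oc * (24 * T * s * Q)) + Q * (\<bar>w' - w\<bar> * oc)"
      using mult_left_mono[OF cl_up W(1)] by simp
    also have "\<dots> = oc * (1 + w' * (24 * T * s * Q) + Q * \<bar>w' - w\<bar>)" by (simp add: algebra_simps)
    also have "\<dots> \<le> oc * (200 * T\<^sup>2)"
    proof (rule mult_left_mono[OF _ oc(1)])
      show "1 + w' * (24 * T * s * Q) + Q * \<bar>w' - w\<bar> \<le> 200 * T\<^sup>2" using wl dwQ T2 by linarith
    qed
    finally show ?thesis by (simp add: mult_ac)
  qed
  \<comment> \<open>The product 400 * 200 of the maximal and the mean absolute change gives 80000
    T^4; the condition on k puts k times this below the gain 3/8 \<delta>.\<close>
  have kT: "k * (400 * T\<^sup>2) \<le> 1" "k * (80000 * T ^ 4) \<le> 3 / 8 * \<delta>"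
  proof -
    have T24: "T\<^sup>2 \<le> T ^ 4" using T1 by (intro power_increasing) auto
    have "k * T\<^sup>2 \<le> k * T ^ 4" using T24 k by (intro mult_left_mono) auto
    moreover have kk: "1000000 * (k * T ^ 4) \<le> \<delta>" using k by (simp add: mult_ac)
    moreover have "0 \<le> k * T ^ 4" using k T1 by simp
    ultimately show "k * (400 * T\<^sup>2) \<le> 1" "k * (80000 * T ^ 4) \<le> 3 / 8 * \<delta>" using d by (auto simp: mult_ac)
  qed
  have e1: "exp (k * Dl e) \<le> 1 + k * Dl e + k * (k * (400 * T\<^sup>2) * \<bar>Dl e\<bar>)" if e: "e \<in> ?O" for e
  proof -
    have "\<bar>k * Dl e\<bar> \<le> k * (400 * T\<^sup>2)" using Dl_max[OF e] k by (simp add: abs_mult mult_left_mono)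
    then have "exp (k * Dl e) \<le> 1 + k * Dl e + (k * Dl e)\<^sup>2" using kT by (intro exp_le_quadratic) simp
    also have "(k * Dl e)\<^sup>2 = k * (k * (\<bar>Dl e\<bar> * \<bar>Dl e\<bar>))" by (simp add: power2_eq_square abs_mult_self)
    also have "\<dots> \<le> k * (k * (400 * T\<^sup>2 * \<bar>Dl e\<bar>))"
      using Dl_max[OF e] k by (intro mult_left_mono mult_right_mono) auto
    finally show ?thesis by (simp add: mult_ac)
  qed
  have "(\<Sum>e\<in>?O. exp (k * Dl e)) \<le> (\<Sum>e\<in>?O. 1 + k * Dl e + k * (k * (400 * T\<^sup>2) * \<bar>Dl e\<bar>))"
    by (rule sum_mono[OF e1])
  also have "\<dots> = Q + k * (\<Sum>e\<in>?O. Dl e) + k * (k * (400 * T\<^sup>2) * (\<Sum>e\<in>?O. \<bar>Dl e\<bar>))"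
    by (simp add: sum.distrib sum_distrib_left cO)
  also have "\<dots> \<le> Q + k * (- (3 / 8 * \<delta> * oc)) + k * (k * (400 * T\<^sup>2) * (200 * T\<^sup>2 * oc))"
    using sumD sumA k by (intro add_mono mult_left_mono) auto
  also have "\<dots> = Q + k * (oc * (k * (80000 * T ^ 4) - 3 / 8 * \<delta>))"
    by (simp add: algebra_simps power2_eq_square power4_eq_xxxx)
  also have "\<dots> \<le> Q"
    using kT(2) k oc by (simp add: mult_nonneg_nonpos)
  finally have main: "(\<Sum>e\<in>?O. exp (k * Dl e)) \<le> Q" .
  have "(\<Sum>e\<in>?O. exp (k * (ecount (insert e E) S R + w' * ocount n (insert e E) S R))) =
      (\<Sum>e\<in>?O. exp (k * (ecount E S R + w * oc)) * exp (k * Dl e))"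
    by (rule sum.cong[OF refl]) (simp only: step exp_add[symmetric] distrib_left)
  also have "\<dots> = exp (k * (ecount E S R + w * oc)) * (\<Sum>e\<in>?O. exp (k * Dl e))" by (simp only: sum_distrib_left)
  also have "\<dots> \<le> exp (k * (ecount E S R + w * oc)) * Q" by (rule mult_left_mono[OF main]) simp
  finally show ?thesis by (simp add: oc_def Q_def)
qed

lemma noise_zero:
  "(\<Sum>e\<in>open_pairs n E. nA n E u v e) = 0" "(\<Sum>e\<in>open_pairs n E. nX n E u v e) = 0"
  "(\<Sum>e\<in>open_pairs n E. nD n E u e) = 0"
  unfolding nA_def nX_def nD_def sum_distrib_left[symmetric] using sum_centred[OF Q_pos[OF V g t]] by simp_all

text \<open>\<open>nA\<close> jumps by at most about z because of \<open>mixed_jump\<close>.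
  \<open>nX\<close> and \<open>nD\<close> may jump by a whole mixed codegree, of size about t /
  \<open>cw\<close>, but their normalisation carries a further small factor, \<open>cw\<close> or 1
  / sqrt n.\<close>

lemma noise_jump:
  assumes e: "e \<in> open_pairs n E"
  shows "u \<noteq> v \<Longrightarrow> v \<notin> nbr E u \<Longrightarrow> \<bar>nA n E u v e\<bar> \<le> 64 * T * \<gamma> * (real z + 2)"
    "\<bar>nX n E u v e\<bar> \<le> 64 * T * \<gamma> * (real z + 2)" "\<bar>nD n E u e\<bar> \<le> 64 * T * \<gamma> * (real z + 2)"
proof -
  note Q = Q_pos[OF V g t] and c = c_pos[OF V g t] and cl = c_le[OF V g t]
  have z1: "1 \<le> real z + 2" by simp
  have base: "0 \<le> T * \<gamma>" using T1 ch by simp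
  have T\<gamma>: "T * \<gamma> * 1 \<le> T * \<gamma> * (real z + 2)" using z1 base by (rule mult_left_mono)
  show "\<bar>nA n E u v e\<bar> \<le> 64 * T * \<gamma> * (real z + 2)" if uv: "u \<noteq> v" "v \<notin> nbr E u"
  proof -
    have "\<bar>centred n E (dA n E u v) e\<bar> \<le> 2 * (2 + real z)"
      by (rule abs_centred[OF Q abs_dA[OF V g t uv] e])
    then have "\<bar>nA n E u v e\<bar> \<le> \<gamma> * (2 * (2 + real z))"
      unfolding nA_def abs_mult using c cl by (intro mult_mono) auto
    also have "\<dots> = 2 * (1 * \<gamma> * (real z + 2))" by simp
    also have "\<dots> \<le> 2 * (T * \<gamma> * (real z + 2))" using T1 ch by (intro mult_left_mono mult_right_mono) auto
    also have "\<dots> \<le> 64 * T * \<gamma> * (real z + 2)" using T\<gamma> base by simp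
    finally show ?thesis .
  qed
  have "\<bar>centred n E (dX n E u v) e\<bar> \<le> 2 * (32 * T * \<gamma> / (4 * (cw n E)\<^sup>2))"
    by (rule abs_centred[OF Q _ e]) (use abs_dX[OF V g t] c in \<open>simp add: field_simps\<close>)
  then have "4 * (cw n E)\<^sup>2 * \<bar>centred n E (dX n E u v) e\<bar> \<le> 4 * (cw n E)\<^sup>2 * (2 * (32 * T * \<gamma> / (4 * (cw n E)\<^sup>2)))"
    by (intro mult_left_mono) auto
  also have "\<dots> = 64 * (T * \<gamma> * 1)" using c by simp
  also have "\<dots> \<le> 64 * (T * \<gamma> * (real z + 2))" by (rule mult_left_mono[OF T\<gamma>]) simp
  finally show "\<bar>nX n E u v e\<bar> \<le> 64 * T * \<gamma> * (real z + 2)"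
    by (simp add: nX_def abs_mult mult.assoc)
  define k where "k = 2 * cw n E / sqrt (real n)"
  have k: "0 < k" using c n2 by (simp add: k_def)
  have "\<bar>centred n E (dD n E u) e\<bar> \<le> 2 * (8 * T * \<gamma> / k)"
    by (rule abs_centred[OF Q _ e]) (use abs_dD[OF V g t, folded k_def] k in \<open>simp add: field_simps\<close>)
  then have "k * \<bar>centred n E (dD n E u) e\<bar> \<le> k * (2 * (8 * T * \<gamma> / k))"
    using k by (intro mult_left_mono) auto
  also have "\<dots> = 16 * (T * \<gamma> * 1)" using k by simp
  also have "\<dots> \<le> 16 * (T * \<gamma> * (real z + 2))" by (rule mult_left_mono[OF T\<gamma>]) simp
  also have "\<dots> \<le> 64 * (T * \<gamma> * (real z + 2))" using T\<gamma> base by linarith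
  finally show "\<bar>nD n E u e\<bar> \<le> 64 * T * \<gamma> * (real z + 2)"
    using k by (simp add: nD_def abs_mult mult.assoc k_def[symmetric])
qed

text \<open>The mean absolute increment is O(T^2 s), so over T / s steps the total is O(T^3), and
  times the maximal jump this bounds the quadratic variation.\<close>

lemma noise_var:
  shows "u < n \<Longrightarrow> v < n \<Longrightarrow> u \<noteq> v \<Longrightarrow> v \<notin> nbr E u \<Longrightarrow>
      (\<Sum>e\<in>open_pairs n E. \<bar>nA n E u v e\<bar>) \<le> 200 * T\<^sup>2 * s * real (nopen n E)"
    "u < n \<Longrightarrow> v < n \<Longrightarrow> u \<noteq> v \<Longrightarrow> v \<notin> nbr E u \<Longrightarrow>
      (\<Sum>e\<in>open_pairs n E. \<bar>nX n E u v e\<bar>) \<le> 200 * T\<^sup>2 * s * real (nopen n E)"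
    "u < n \<Longrightarrow> (\<Sum>e\<in>open_pairs n E. \<bar>nD n E u e\<bar>) \<le> 200 * T\<^sup>2 * s * real (nopen n E)"
proof -
  note Q = Q_pos[OF V g t] and c = c_pos[OF V g t] and cl = c_le[OF V g t]
  define q where "q = real (nopen n E)"
  have q0: "0 < q" using Q by (simp add: q_def)
  have cq: "cw n E * (4 * s * q) = 1" unfolding q_def c_Q[symmetric] using c by simp
  have TT: "T \<le> T\<^sup>2" "1 \<le> T\<^sup>2" using T_powers T1 by auto
  have sq: "0 < s * q" using s_pos q0 by simp
  have Tsq: "0 \<le> T * (q * s)" "0 \<le> T * (s * q)" using sq T1 by (auto simp: mult.commute)
  have clb: "(\<Sum>w\<in>A. closers n E u w) \<le> real (card A) * (24 * T * s * q)" if "A \<subseteq> opn n E u" for A u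
    unfolding q_def by (rule sum_bounded_above) (use that closers_bounds(2) in auto)
  show "(\<Sum>e\<in>open_pairs n E. \<bar>nA n E u v e\<bar>) \<le> 200 * T\<^sup>2 * s * real (nopen n E)"
    if uv: "u < n" "v < n" "u \<noteq> v" "v \<notin> nbr E u"
  proof -
    have "(\<Sum>e\<in>open_pairs n E. \<bar>nA n E u v e\<bar>) = cw n E * (\<Sum>e\<in>open_pairs n E. \<bar>centred n E (dA n E u v) e\<bar>)"
      using c by (simp add: nA_def abs_mult sum_distrib_left)
    also have "\<dots> \<le> cw n E * (2 * (\<Sum>e\<in>open_pairs n E. \<bar>dA n E u v e\<bar>))"
      using c by (intro mult_left_mono sum_abs_centred Q) auto
    also have "\<dots> \<le> cw n E * (2 * (real (open_codeg n E u v) + real (mixed_codeg n E u v) * (24 * T * s * q)))"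
      using sum_abs_dA[OF V g t uv(3,4)] clb[of "opn n E u \<inter> nbr E v" u] c
      by (intro mult_left_mono) (auto simp: mixed_codeg_def)
    also have "\<dots> = 2 * (cw n E * real (open_codeg n E u v)) + 2 * al n E u v * (24 * T * s * q)"
      by (simp add: al_def algebra_simps)
    also have "cw n E * real (open_codeg n E u v) = xh n E u v * (s * q)"
    proof -
      have "cw n E * real (open_codeg n E u v) = cw n E * real (open_codeg n E u v) * (cw n E * (4 * s * q))"
        unfolding cq by simp
      then show ?thesis by (simp add: xh_def power2_eq_square mult_ac)
    qed
    also have "2 * (xh n E u v * (s * q)) + 2 * al n E u v * (24 * T * s * q) \<le> 2 * (2 * (s * q)) + 2 * (2 * T) * (24 * T * s * q)"
      using xh_near[OF V g t uv] al_le[OF V g t uv(3)] be sq Tsq T1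
      by (intro add_mono mult_right_mono mult_left_mono) (auto simp: abs_le_iff)
    also have "\<dots> = (4 + 96 * T\<^sup>2) * (s * q)" by (simp add: power2_eq_square algebra_simps)
    also have "\<dots> \<le> (200 * T\<^sup>2) * (s * q)" using TT sq by (intro mult_right_mono) auto
    finally show ?thesis by (simp add: q_def mult.assoc)
  qed
  show "(\<Sum>e\<in>open_pairs n E. \<bar>nX n E u v e\<bar>) \<le> 200 * T\<^sup>2 * s * real (nopen n E)"
    if uv: "u < n" "v < n" "u \<noteq> v" "v \<notin> nbr E u"
  proof -
    let ?X = "opn n E u \<inter> opn n E v"
    have "(\<Sum>e\<in>open_pairs n E. \<bar>nX n E u v e\<bar>) = 4 * (cw n E)\<^sup>2 * (\<Sum>e\<in>open_pairs n E. \<bar>centred n E (dX n E u v) e\<bar>)"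
      by (simp add: nX_def abs_mult sum_distrib_left)
    also have "\<dots> \<le> 4 * (cw n E)\<^sup>2 * (2 * (\<Sum>e\<in>open_pairs n E. \<bar>dX n E u v e\<bar>))"
      by (intro mult_left_mono sum_abs_centred Q) auto
    also have "\<dots> \<le> 4 * (cw n E)\<^sup>2 * (2 * (2 * (real (open_codeg n E u v) * (24 * T * s * q))))"
    proof -
      have "(\<Sum>e\<in>open_pairs n E. \<bar>dX n E u v e\<bar>) \<le> (\<Sum>w\<in>?X. closers n E u w + closers n E v w)"
        unfolding dX_def by (rule open_codeg_drift(3)[OF V uv(3,4)])
      also have "\<dots> = (\<Sum>w\<in>?X. closers n E u w) + (\<Sum>w\<in>?X. closers n E v w)" by (rule sum.distrib)
      also have "\<dots> \<le> 2 * (real (open_codeg n E u v) * (24 * T * s * q))"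
        using clb[of ?X u] clb[of ?X v] by (simp add: open_codeg_def)
      finally show ?thesis by (intro mult_left_mono) auto
    qed
    also have "\<dots> = xh n E u v * (96 * T * (s * q))" by (simp add: xh_def)
    also have "\<dots> \<le> 2 * (96 * T * (s * q))"
      using xh_near[OF V g t uv] be sq Tsq T1 by (intro mult_right_mono) (auto simp: abs_le_iff)
    also have "\<dots> = 192 * T * (s * q)" by simp
    also have "\<dots> \<le> (200 * T\<^sup>2) * (s * q)" using TT T1 sq by (intro mult_right_mono) auto
    finally show ?thesis by (simp add: q_def mult.assoc)
  qed
  show "(\<Sum>e\<in>open_pairs n E. \<bar>nD n E u e\<bar>) \<le> 200 * T\<^sup>2 * s * real (nopen n E)" if u: "u < n"
  proof -
    define k where "k = 2 * cw n E / sqrt (real n)"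
    have k: "0 < k" using c n2 by (simp add: k_def)
    have d: "dh n E u = k * real (open_deg n E u)" by (simp add: dh_def k_def)
    have "(\<Sum>e\<in>open_pairs n E. \<bar>nD n E u e\<bar>) = k * (\<Sum>e\<in>open_pairs n E. \<bar>centred n E (dD n E u) e\<bar>)"
      unfolding nD_def k_def[symmetric] using k by (simp add: abs_mult sum_distrib_left)
    also have "\<dots> \<le> k * (2 * (\<Sum>e\<in>open_pairs n E. \<bar>dD n E u e\<bar>))"
      using k by (intro mult_left_mono sum_abs_centred Q) auto
    also have "\<dots> \<le> k * (2 * (real (open_deg n E u) * (24 * T * s * q)))"
    proof -
      have "(\<Sum>e\<in>open_pairs n E. \<bar>dD n E u e\<bar>) \<le> (\<Sum>w\<in>opn n E u. closers n E u w)"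
        unfolding dD_def by (rule open_deg_drift(2)[OF V])
      also have "\<dots> \<le> real (open_deg n E u) * (24 * T * s * q)"
        using clb[of "opn n E u" u] by (simp add: open_deg_def)
      finally show ?thesis using k by (intro mult_left_mono) auto
    qed
    also have "\<dots> = dh n E u * (48 * T * (s * q))" by (simp add: d)
    also have "\<dots> \<le> 2 * (48 * T * (s * q))"
      using dh_near[OF V g t u] be sq Tsq T1 by (intro mult_right_mono) (auto simp: abs_le_iff)
    also have "\<dots> = 96 * T * (s * q)" by simp
    also have "\<dots> \<le> (200 * T\<^sup>2) * (s * q)" using TT T1 sq by (intro mult_right_mono) auto
    finally show ?thesis by (simp add: q_def mult.assoc)
  qed
qed

text \<open>A codegree rises with probability at most (\<open>al n E u v\<close> +
  \<open>al n E v u\<close>) 4 s <= 16 T s, and exp 1 <= 1 + 2. Over the whole run the exponential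
  moment is thus at most exp (32 T^2).\<close>

lemma codeg_exp_step:
  assumes uv: "u \<noteq> v"
  shows "(\<Sum>e\<in>open_pairs n E. exp (real (codeg (insert e E) u v))) \<le>
    exp (real (codeg E u v)) * exp (32 * T * s) * real (nopen n E)"
proof -
  let ?O = "open_pairs n E"
  let ?A = "(\<lambda>w. {u, w}) ` (opn n E u \<inter> nbr E v) \<union> (\<lambda>w. {v, w}) ` (opn n E v \<inter> nbr E u)"
  let ?k = "exp (real (codeg E u v))"
  have "exp (real (codeg (insert e E) u v)) \<le> ?k * (1 + 2 * (if e \<in> ?A then 1 else 0))" if e: "e \<in> ?O" for e
  proof -
    have "real (codeg (insert e E) u v) \<le> real (codeg E u v + (if e \<in> ?A then 1 else 0))"
      using codeg_step[OF V uv e] by (rule of_nat_mono)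
    then have "exp (real (codeg (insert e E) u v)) \<le> exp (real (codeg E u v) + (if e \<in> ?A then 1 else 0))"
      by (cases "e \<in> ?A") simp_all
    also have "\<dots> = ?k * exp (if e \<in> ?A then 1 else 0)" by (rule exp_add)
    also have "\<dots> \<le> ?k * (1 + 2 * (if e \<in> ?A then 1 else 0))"
      using exp_le by (intro mult_left_mono) (cases "e \<in> ?A", simp_all)
    finally show ?thesis .
  qed
  then have "(\<Sum>e\<in>?O. exp (real (codeg (insert e E) u v))) \<le> (\<Sum>e\<in>?O. ?k * (1 + 2 * (if e \<in> ?A then 1 else 0)))"
    by (rule sum_mono)
  also have "\<dots> = ?k * (real (nopen n E) + 2 * real (card (?O \<inter> ?A)))"
  proof -
    have "(\<Sum>e\<in>?O. if e \<in> ?A then 1 else 0) = (\<Sum>e\<in>?O \<inter> ?A. 1 :: real)"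
      by (rule sum.inter_restrict[symmetric]) simp
    then show ?thesis
      by (simp only: sum_distrib_left[symmetric] sum.distrib) (simp add: nopen_def)
  qed
  also have "real (card (?O \<inter> ?A)) \<le> real (mixed_codeg n E u v) + real (mixed_codeg n E v u)"
    using codeg_event_card[of n E u v] by linarith
  also have "\<dots> = (al n E u v + al n E v u) * (4 * s * real (nopen n E))"
    unfolding c_Q[symmetric] al_def using c_pos[OF V g t] by (simp add: field_simps)
  also have "\<dots> \<le> (4 * T) * (4 * s * real (nopen n E))"
    using al_le[OF V g t uv] al_le[OF V g t uv[symmetric]] s_pos by (intro mult_right_mono) auto
  finally have "(\<Sum>e\<in>?O. exp (real (codeg (insert e E) u v))) \<le> ?k * (real (nopen n E) + 2 * (4 * T * (4 * s * real (nopen n E))))"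
    by simp
  also have "\<dots> = ?k * (1 + 32 * T * s) * real (nopen n E)" by (simp add: algebra_simps)
  also have "\<dots> \<le> ?k * exp (32 * T * s) * real (nopen n E)"
    by (intro mult_right_mono mult_left_mono exp_ge_add_one_self) auto
  finally show ?thesis .
qed

end
end

section \<open>The process reaches the tracking time\<close>

lemma sum_Pow_power:
  fixes x :: real assumes "finite A" shows "(\<Sum>S\<in>Pow A. x ^ card S) = (1 + x) ^ card A"
  using assms
proof (induction A)
  case (insert a A)
  have "(\<Sum>S\<in>Pow (insert a A). x ^ card S) = (\<Sum>S\<in>Pow A. x ^ card S) + (\<Sum>S\<in>insert a ` Pow A. x ^ card S)"
    unfolding Pow_insert by (rule sum.union_disjoint) (use insert in auto)
  also have "(\<Sum>S\<in>insert a ` Pow A. x ^ card S) = (\<Sum>S\<in>Pow A. x ^ card (insert a S))"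
    by (subst sum.reindex) (use insert in \<open>auto simp: inj_on_def\<close>)
  also have "\<dots> = (\<Sum>S\<in>Pow A. x * x ^ card S)"
  proof (rule sum.cong[OF refl])
    fix S assume "S \<in> Pow A"
    then have "finite S" "a \<notin> S" using insert by (auto intro: finite_subset)
    then show "x ^ card (insert a S) = x * x ^ card S" by simp
  qed
  also have "\<dots> = x * (\<Sum>S\<in>Pow A. x ^ card S)" by (simp only: sum_distrib_left)
  finally show ?case using insert by (simp add: algebra_simps)
qed simp

text \<open>The history as it was after j steps, lists being ordered from the latest choice to the
  first.\<close>

definition tail_at :: "'a list \<Rightarrow> nat \<Rightarrow> 'a list" where
  "tail_at l j = drop (length l - j) l"

lemma tail_at_0 [simp]: "tail_at l 0 = []" by (simp add: tail_at_def)
lemma length_tail_at: "j \<le> length l \<Longrightarrow> length (tail_at l j) = j" by (simp add: tail_at_def)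

lemma tail_at_Suc: "j < length l \<Longrightarrow> tail_at l (Suc j) = l ! (length l - Suc j) # tail_at l j"
  unfolding tail_at_def by (metis Cons_nth_drop_Suc Suc_diff_Suc diff_less length_greater_0_conv list.size(3) not_less_zero zero_less_Suc)

lemma drop_tail_at: "j \<le> length l \<Longrightarrow> k \<le> j \<Longrightarrow> drop k (tail_at l j) = tail_at l (j - k)"
  unfolding tail_at_def drop_drop by (rule arg_cong2[of _ _ _ _ drop]) auto

lemma accum_tail_at:
  assumes "j \<le> length l" "\<And>k. k < j \<Longrightarrow> G (tail_at l k)"
  shows "accum G \<Delta> (tail_at l j) = (\<Sum>k<j. \<Delta> (tail_at l k) (l ! (length l - Suc k)))"
  using assms
proof (induction j)
  case (Suc j)
  then have "j < length l" by simp
  then show ?case using Suc by (simp add: tail_at_Suc)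
qed simp

lemma hist_stuck:
  "l \<in> set_pmf (hist n i) \<Longrightarrow> length l < i \<Longrightarrow> open_pairs n (set l) = {}"
proof (induction i arbitrary: l)
  case (Suc i)
  then obtain l0 where l0: "l0 \<in> set_pmf (hist n i)"
    "l \<in> set_pmf (if length l0 = i \<and> open_pairs n (set l0) \<noteq> {}
          then map_pmf (\<lambda>e. e # l0) (pmf_of_set (open_pairs n (set l0))) else return_pmf l0)"
    by auto
  have le: "length l0 \<le> i" using set_pmf_hist[OF l0(1)] by simp
  show ?case
  proof (cases "length l0 = i \<and> open_pairs n (set l0) \<noteq> {}")
    case True
    then have "length l = Suc i" using l0(2) by auto
    then show ?thesis using Suc.prems by simp
  next
    case False
    then have "l = l0" using l0(2) by auto
    then show ?thesis using False le Suc.IH[OF l0(1)] by (cases "length l0 = i") auto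
  qed
qed simp

context tracking
begin

definition gd :: "nat set list \<Rightarrow> bool" where "gd l \<longleftrightarrow> good (set l) (real (length l) * s)"

text \<open>Only strictly earlier times are required to be good, so the condition is decided before
  the last choice and, once violated, stays violated. Potentials multiplied by its indicator remain
  supermartingales.\<close>

definition pregood :: "nat set list \<Rightarrow> bool" where
  "pregood l \<longleftrightarrow> (\<forall>k. 0 < k \<and> k \<le> length l \<longrightarrow> gd (drop k l))"

lemma pregood_Nil [simp]: "pregood []" by (simp add: pregood_def)

lemma pregood_Cons [simp]: "pregood (e # l) \<longleftrightarrow> gd l \<and> pregood l"
proof
  assume p: "pregood (e # l)"
  have "gd (drop k l)" if "k \<le> length l" for k
    using p[unfolded pregood_def, rule_format, of "Suc k"] that by simp
  from this[of 0] this show "gd l \<and> pregood l" by (auto simp: pregood_def)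
next
  assume p: "gd l \<and> pregood l"
  show "pregood (e # l)" unfolding pregood_def
  proof (intro allI impI)
    fix k assume k: "0 < k \<and> k \<le> length (e # l)"
    then obtain k' where k': "k = Suc k'" by (cases k) auto
    show "gd (drop k (e # l))"
    proof (cases "k' = 0")
      case True
      then show ?thesis using p k' by simp
    next
      case False
      then show ?thesis using p k k' by (simp add: pregood_def)
    qed
  qed
qed

definition b0 :: real where "b0 = 64 * T * \<gamma> * (real z + 2)"

lemma b0_pos: "0 < b0" using T1 ch by (simp add: b0_def)

lemma noise_prob:
  assumes jm: "j \<le> m" and mT: "real m * s \<le> T" and nu: "0 < \<nu>" "\<nu> \<le> 1"
    and zero: "\<And>l. wf_hist n l \<Longrightarrow> length l < m \<Longrightarrow> G l \<Longrightarrow> (\<Sum>e\<in>open_pairs n (set l). \<Delta> l e) = 0"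
    and bd: "\<And>l e. wf_hist n l \<Longrightarrow> length l < m \<Longrightarrow> G l \<Longrightarrow> e \<in> open_pairs n (set l) \<Longrightarrow> \<bar>\<Delta> l e\<bar> \<le> b0"
    and var: "\<And>l. wf_hist n l \<Longrightarrow> length l < m \<Longrightarrow> G l \<Longrightarrow>
      (\<Sum>e\<in>open_pairs n (set l). \<bar>\<Delta> l e\<bar>) \<le> 200 * T\<^sup>2 * s * real (nopen n (set l))"
  shows "measure_pmf.prob (hist n j) {l. \<bar>accum G \<Delta> l\<bar> \<ge> \<nu>} \<le> 2 * exp (- (\<nu>\<^sup>2 / (800 * T ^ 3 * b0)))"
proof -
  \<comment> \<open>Chosen so that the accumulated variance term is half of the gain
    \<open>th\<close> \<nu>; the exponent is then -\<open>th\<close> \<nu> / 2.\<close>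
  define th where "th = \<nu> / (400 * T ^ 3 * b0)"
  have T3: "1 \<le> T ^ 3" using T1 by simp
  have th: "0 \<le> th" "th * b0 \<le> 1"
  proof -
    show "0 \<le> th" unfolding th_def using nu b0_pos T1 by (intro divide_nonneg_nonneg mult_nonneg_nonneg) auto
    have "th * b0 = \<nu> / (400 * T ^ 3)" using b0_pos by (simp add: th_def)
    also have "\<dots> \<le> 1" unfolding divide_le_eq_1 using nu T3 by linarith
    finally show "th * b0 \<le> 1" .
  qed
  have "measure_pmf.prob (hist n j) {l. \<bar>accum G \<Delta> l\<bar> \<ge> \<nu>} \<le> 2 * exp (real j * (th\<^sup>2 * b0 * (200 * T\<^sup>2 * s)) - th * \<nu>)"
    by (rule hist_freedman[where b = b0 and v = "200 * T\<^sup>2 * s"]) (use zero bd var th b0_pos s_pos jm in auto)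
  also have "real j * (th\<^sup>2 * b0 * (200 * T\<^sup>2 * s)) \<le> th * \<nu> / 2"
  proof -
    have "real j * s \<le> T" using mT jm s_pos by (meson mult_right_mono of_nat_mono order_trans less_imp_le)
    then have "(real j * s) * (th\<^sup>2 * b0 * (200 * T\<^sup>2)) \<le> T * (th\<^sup>2 * b0 * (200 * T\<^sup>2))"
      using b0_pos by (intro mult_right_mono) auto
    also have "\<dots> = th * (th * (200 * T ^ 3 * b0))" by (simp add: power2_eq_square power3_eq_cube)
    also have "th * (200 * T ^ 3 * b0) = \<nu> / 2" using T1 T3 b0_pos by (simp add: th_def field_simps)
    finally show ?thesis by (simp add: mult_ac)
  qed
  also have "th * \<nu> / 2 - th * \<nu> = - (\<nu>\<^sup>2 / (800 * T ^ 3 * b0))"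
    using T3 b0_pos by (simp add: th_def power2_eq_square field_simps)
  finally show ?thesis by simp
qed

lemma gd_facts:
  assumes "wf_hist n l" "length l < m" "real m * s \<le> T" "gd l"
  shows "valid n (set l)" "good (set l) (real (length l) * s)" "0 \<le> real (length l) * s" "real (length l) * s \<le> T"
proof -
  show "valid n (set l)" using assms(1) by (rule wf_hist_valid)
  show "good (set l) (real (length l) * s)" using assms(4) by (simp add: gd_def)
  show "0 \<le> real (length l) * s" using s_pos by simp
  have "real (length l) * s \<le> real m * s" using assms(2) s_pos by (intro mult_right_mono) auto
  then show "real (length l) * s \<le> T" using assms(3) by linarith
qed

text \<open>Markov's inequality for exp of the codegree, discounted by the growth 32 T s per step
  and set to zero after tracking has failed.\<close>

lemma codeg_prob:
  assumes jm: "j \<le> m" and mT: "real m * s \<le> T" and uv: "u \<noteq> v"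
  shows "measure_pmf.prob (hist n j) {l. pregood l \<and> codeg (set l) u v > z} \<le> exp (32 * T\<^sup>2 - real z)"
proof -
  define f where "f l = (if pregood l then exp (real (codeg (set l) u v) - 32 * T * s * real (length l)) else 0)" for l
  have "measure_pmf.prob (hist n j) {l. pregood l \<and> codeg (set l) u v > z} \<le> f [] / exp (real z - 32 * T\<^sup>2)"
  proof (rule hist_markov)
    fix l assume l: "wf_hist n l" "length l \<le> j" and p: "pregood l \<and> codeg (set l) u v > z"
    have "real (length l) * s \<le> real m * s" using l jm s_pos by (intro mult_right_mono) auto
    then have "32 * T * (real (length l) * s) \<le> 32 * T * T" using mT T1 by (intro mult_left_mono) auto
    then show "exp (real z - 32 * T\<^sup>2) \<le> f l" using p by (simp add: f_def power2_eq_square mult_ac)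
  next
    fix l assume l: "wf_hist n l" "length l < j" and ne: "open_pairs n (set l) \<noteq> {}"
    show "(\<Sum>e\<in>open_pairs n (set l). f (e # l)) \<le> f l * real (nopen n (set l))"
    proof (cases "gd l \<and> pregood l")
      case False
      then have "f (e # l) = 0" for e by (simp add: f_def)
      then show ?thesis by (simp add: f_def)
    next
      case True
      note F = gd_facts[OF l(1) order_less_le_trans[OF l(2) jm] mT conjunct1[OF True]]
      let ?c = "exp (- (32 * T * s) - 32 * T * s * real (length l))"
      have "f (e # l) = exp (real (codeg (insert e (set l)) u v)) * ?c" for e
        using True by (simp add: f_def exp_add[symmetric] algebra_simps)
      then have "(\<Sum>e\<in>open_pairs n (set l). f (e # l)) = (\<Sum>e\<in>open_pairs n (set l). exp (real (codeg (insert e (set l)) u v))) * ?c"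
        by (simp only: sum_distrib_right)
      also have "\<dots> \<le> (exp (real (codeg (set l) u v)) * exp (32 * T * s) * real (nopen n (set l))) * ?c"
        by (rule mult_right_mono[OF codeg_exp_step[OF F uv]]) simp
      also have "\<dots> = f l * real (nopen n (set l))"
      proof -
        have "exp (real (codeg (set l) u v)) * exp (32 * T * s) * ?c = exp (real (codeg (set l) u v) - 32 * T * s * real (length l))"
          by (simp add: exp_add[symmetric])
        then show ?thesis using True by (simp add: f_def mult_ac)
      qed
      finally show ?thesis .
    qed
  qed (auto simp: f_def)
  also have "f [] = 1" by (simp add: f_def codeg_def)
  also have "1 / exp (real z - 32 * T\<^sup>2) = exp (32 * T\<^sup>2 - real z)"
    by (simp add: exp_diff)
  finally show ?thesis .
qed

text \<open>The weight depends on the remaining time up to the fixed horizon i. At time i it is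
  zero, so the potential is the edge count alone; at time 0 it is at most (1 + \<delta>) (2 i / n^2)
  |S| |R|.\<close>

lemma count_prob:
  assumes im: "i \<le> m" and mT: "real m * s \<le> T"
    and z: "\<zeta> \<le> 1 / 8" and d: "0 \<le> \<delta>" "\<delta> \<le> 1" "8 * \<zeta> \<le> \<delta>" "200 * T * \<beta> \<le> \<delta>" and sb: "s \<le> \<beta>"
    and k: "0 \<le> k" "10 ^ 6 * T ^ 4 * k \<le> \<delta>" and SR: "S \<subseteq> {..<n}" "R \<subseteq> {..<n}"
  shows "measure_pmf.prob (hist n i) {l. pregood l \<and> ecount (set l) S R >
      (1 + \<delta>) * (2 * real i / (real n)\<^sup>2) * real (card S) * real (card R) + \<Lambda>}
    \<le> exp (- (k * \<Lambda>))"
proof -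
  have fin: "finite S" "finite R" using SR by (auto intro: finite_subset)
  define w where "w j = (1 + \<delta>) * (real i - real j) * (2 / (real n)\<^sup>2 * exp (4 * (real j * s)\<^sup>2))" for j
  define f where "f l = (if pregood l then exp (k * (ecount (set l) S R + w (length l) * ocount n (set l) S R)) else 0)" for l
  let ?b = "(1 + \<delta>) * (2 * real i / (real n)\<^sup>2) * real (card S) * real (card R)"
  have "measure_pmf.prob (hist n i) {l. pregood l \<and> ecount (set l) S R > ?b + \<Lambda>} \<le> f [] / exp (k * (?b + \<Lambda>))"
  proof (rule hist_markov)
    fix l assume l: "wf_hist n l" "length l \<le> i" and p: "pregood l \<and> ecount (set l) S R > ?b + \<Lambda>"
    have "0 \<le> w (length l) * ocount n (set l) S R"
      using l d ocount_bounds(1)[OF fin(1)] by (simp add: w_def)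
    then have "k * (?b + \<Lambda>) \<le> k * (ecount (set l) S R + w (length l) * ocount n (set l) S R)"
      using p k by (intro mult_left_mono) auto
    then show "exp (k * (?b + \<Lambda>)) \<le> f l" using p by (simp add: f_def)
  next
    fix l assume l: "wf_hist n l" "length l < i" and ne: "open_pairs n (set l) \<noteq> {}"
    show "(\<Sum>e\<in>open_pairs n (set l). f (e # l)) \<le> f l * real (nopen n (set l))"
    proof (cases "gd l \<and> pregood l")
      case False
      then have "f (e # l) = 0" for e by (simp add: f_def)
      then show ?thesis by (simp add: f_def)
    next
      case True
      note F = gd_facts[OF l(1) order_less_le_trans[OF l(2) im] mT conjunct1[OF True]]
      let ?t = "real (length l) * s" and ?r = "real i - real (length l)"
      have r: "1 \<le> ?r" using l by linarith
      have "?r * s \<le> real m * s" using im s_pos by (intro mult_right_mono) auto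
      then have rT: "?r * s \<le> T" using mT by linarith
      have w1: "w (Suc (length l)) = (1 + \<delta>) * (?r - 1) * (2 / (real n)\<^sup>2 * exp (4 * (?t + s)\<^sup>2))"
        by (simp add: w_def algebra_simps)
      have "(\<Sum>e\<in>open_pairs n (set l). f (e # l)) =
          (\<Sum>e\<in>open_pairs n (set l). exp (k * (ecount (insert e (set l)) S R + w (Suc (length l)) * ocount n (insert e (set l)) S R)))"
        using True by (simp add: f_def)
      also have "\<dots> \<le> exp (k * (ecount (set l) S R + w (length l) * ocount n (set l) S R)) * real (nopen n (set l))"
        unfolding w1 unfolding w_def
        by (rule count_exp_step[OF F z d sb r rT k fin])
      finally show ?thesis using True by (simp add: f_def)
    qed
  qed (auto simp: f_def)
  also have "f [] \<le> exp (k * ?b)"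
  proof -
    have "ocount n {} S R \<le> (\<Sum>x\<in>S. real (card R))"
      unfolding ocount_def by (intro sum_mono of_nat_mono card_mono) (use fin in auto)
    then have "w 0 * ocount n {} S R \<le> w 0 * (real (card S) * real (card R))"
      using d by (intro mult_left_mono) (auto simp: w_def)
    also have "\<dots> = ?b" by (simp add: w_def)
    finally have "k * (w 0 * ocount n {} S R) \<le> k * ?b" using k by (intro mult_left_mono) auto
    then show ?thesis by (simp add: f_def ecount_def)
  qed
  then have "f [] / exp (k * (?b + \<Lambda>)) \<le> exp (k * ?b) / exp (k * (?b + \<Lambda>))" by (intro divide_right_mono) auto
  also have "\<dots> = exp (- (k * \<Lambda>))" by (simp add: exp_diff[symmetric] algebra_simps)
  finally show ?thesis .
qed

end

section \<open>Failure events and their union bound\<close>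

locale tracking_params = tracking +
  fixes m M L :: nat and \<nu> \<Phi> N W \<kappa> a B \<theta> \<mu> g \<delta> \<Lambda> :: real
  assumes time: "real m * s \<le> T"
    and M: "even M" "2 \<le> M" and N: "(real n)\<^sup>2 \<le> N ^ M" "1 \<le> N"
    and nu: "0 < \<nu>" "2 * (1 / (real n - 1)\<^sup>2) \<le> \<nu>" "\<nu> \<le> 1"
    and W: "W = 8 * \<nu> * N" and a: "a = 4 / \<kappa>" and B: "B = 100 * (1 + a)" and kap: "0 < \<kappa>"
    and Phi: "(1 + a) * W * exp (\<kappa> * T\<^sup>2 + B * T) \<le> \<Phi>" and chPhi: "\<gamma> \<le> \<Phi>"
    and second: "32 * \<Phi> * \<beta> + err \<le> \<nu>"
    and beta1: "2 * \<nu> + T * (100 * \<Phi> + \<nu>) \<le> \<beta>"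
    and beta2: "\<nu> + T * (2 * \<nu> + T * (100 * \<Phi> + \<nu>) + 100 * T * \<Phi>) \<le> \<beta>"
    and th: "0 < \<theta>" "\<theta> \<le> 1" "\<beta> \<le> \<theta>" "(1 + \<delta>) * (1 + \<beta>) \<le> 1 + \<theta>" "\<gamma> * \<Lambda> \<le> \<theta>\<^sup>2"
    and mu: "0 < \<mu>" "\<mu> \<le> 1 / 2" "4 * \<theta> \<le> 3 * \<mu>\<^sup>2" and gM: "0 \<le> g" "5 * \<mu> \<le> g ^ M"
    and gain: "8 * (1 + a) * (3 * (4 * g * real L + 2 * N / 2 ^ L)) \<le> \<kappa>"
    and zeta: "20 * T * \<beta> + 10 * T * \<gamma> + 2 * \<gamma> \<le> \<zeta>" "\<zeta> \<le> 1 / 8"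
    and dens: "exp (4 * (real m * s)\<^sup>2 + \<zeta>) / (2 * sqrt (real n)) \<le> \<gamma>"
    and del: "0 < \<delta>" "\<delta> \<le> 1" "8 * \<zeta> \<le> \<delta>" "200 * T * \<beta> \<le> \<delta>" and sb: "s \<le> \<beta>"
    and Lam: "\<Lambda> = 4 * 10 ^ 6 * T ^ 4 * ln (real n) / \<delta>"
begin

text \<open>Drift and jump bounds are available only while u and v are nonadjacent, so the noise of
  the pair is collected only until uv becomes an edge.\<close>

definition GA :: "nat \<Rightarrow> nat \<Rightarrow> nat set list \<Rightarrow> bool" where
  "GA u v l \<longleftrightarrow> gd l \<and> v \<notin> nbr (set l) u"

definition bad :: "nat \<Rightarrow> nat set list \<Rightarrow> bool" where
  "bad j l \<longleftrightarrow>
    (\<exists>p\<in>{..<n} \<times> {..<n}. fst p \<noteq> snd p \<and>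
      \<bar>accum (GA (fst p) (snd p)) (\<lambda>l e. nA n (set l) (fst p) (snd p) e) l\<bar> \<ge> \<nu>) \<or>
    (\<exists>p\<in>{..<n} \<times> {..<n}. fst p \<noteq> snd p \<and>
      \<bar>accum (GA (fst p) (snd p)) (\<lambda>l e. nX n (set l) (fst p) (snd p) e) l\<bar> \<ge> \<nu>) \<or>
    (\<exists>p\<in>{..<n} \<times> {..<n}. \<bar>accum gd (\<lambda>l e. nD n (set l) (fst p) e) l\<bar> \<ge> \<nu>) \<or>
    (\<exists>p\<in>{..<n} \<times> {..<n}. fst p \<noteq> snd p \<and> pregood l \<and> codeg (set l) (fst p) (snd p) > z) \<or>
    (\<exists>p\<in>Pow {..<n} \<times> Pow {..<n}. fst p \<noteq> {} \<and> snd p \<noteq> {} \<and> pregood l \<and>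
      ecount (set l) (fst p) (snd p) > (1 + \<delta>) * (2 * real j / (real n)\<^sup>2) * real (card (fst p)) * real (card (snd p))
        + \<Lambda> * (real (card (fst p)) + real (card (snd p))))"

definition p0 :: real where
  "p0 = (real n)\<^sup>2 * (6 * exp (- (\<nu>\<^sup>2 / (800 * T ^ 3 * b0))) + exp (32 * T\<^sup>2 - real z)) + 9 / real n ^ 6"

lemma prob_pairs:
  assumes "\<And>p. p \<in> {..<n} \<times> {..<n} \<Longrightarrow> measure_pmf.prob D {l. P p l} \<le> b"
  shows "measure_pmf.prob D {l. \<exists>p\<in>{..<n} \<times> {..<n}. P p l} \<le> (real n)\<^sup>2 * b"
  using prob_union_bound[of "{..<n} \<times> {..<n}" D P b] assms by (simp add: power2_eq_square)

text \<open>\<open>\<Lambda>\<close> is chosen so that k \<Lambda> = 4 ln n, which gives probability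
  n^(-4q) with q = |S| + |R|. For nonempty sets q >= 2, so 4q >= 6 + q: one factor 1 / n per element
  pays for the union over all sets, as (1 + 1/n)^n <= 3, and n^(-6) is left over.\<close>

lemma prob_counts:
  assumes j: "j \<le> m"
  shows "measure_pmf.prob (hist n j) {l. \<exists>p\<in>Pow {..<n} \<times> Pow {..<n}. fst p \<noteq> {} \<and> snd p \<noteq> {} \<and> pregood l \<and>
      ecount (set l) (fst p) (snd p) > (1 + \<delta>) * (2 * real j / (real n)\<^sup>2) * real (card (fst p)) * real (card (snd p))
        + \<Lambda> * (real (card (fst p)) + real (card (snd p)))} \<le> 9 / real n ^ 6"
proof -
  define k where "k = \<delta> / (10 ^ 6 * T ^ 4)"
  have T4: "0 < 10 ^ 6 * T ^ 4" using T1 by simp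
  have k: "0 \<le> k" "10 ^ 6 * T ^ 4 * k \<le> \<delta>" using del T4 by (auto simp: k_def)
  have kL: "k * \<Lambda> = 4 * ln (real n)" using del T4 by (simp add: k_def Lam)
  have n0: "0 < real n" using n2 by simp
  let ?I = "{p \<in> Pow {..<n} \<times> Pow {..<n}. fst p \<noteq> {} \<and> snd p \<noteq> {}}"
  define P where "P p l \<longleftrightarrow> pregood l \<and>
      ecount (set l) (fst p) (snd p) > (1 + \<delta>) * (2 * real j / (real n)\<^sup>2) * real (card (fst p)) * real (card (snd p))
        + \<Lambda> * (real (card (fst p)) + real (card (snd p)))" for p l
  have one: "measure_pmf.prob (hist n j) {l. P p l} \<le> 1 / real n ^ 6 * ((1 / real n) ^ card (fst p) * (1 / real n) ^ card (snd p))"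
    if p: "p \<in> ?I" for p
  proof -
    have sub: "fst p \<subseteq> {..<n}" "snd p \<subseteq> {..<n}" using p by auto
    have c: "1 \<le> card (fst p)" "1 \<le> card (snd p)"
      using p finite_subset[OF sub(1)] finite_subset[OF sub(2)] by (auto simp: Suc_le_eq card_gt_0_iff)
    define q where "q = card (fst p) + card (snd p)"
    have "measure_pmf.prob (hist n j) {l. P p l} \<le> exp (- (k * (\<Lambda> * (real (card (fst p)) + real (card (snd p))))))"
      unfolding P_def by (rule count_prob[OF j time zeta(2) _ del(2-4) sb k sub]) (use del in simp)
    also have "k * (\<Lambda> * (real (card (fst p)) + real (card (snd p)))) = real (4 * q) * ln (real n)"
      using kL by (simp add: q_def mult.assoc[symmetric])
    also have "exp (- (real (4 * q) * ln (real n))) = 1 / real n ^ (4 * q)"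
      unfolding exp_minus exp_of_nat_mult using n0 by (simp add: inverse_eq_divide)
    also have "\<dots> \<le> 1 / real n ^ (6 + q)"
    proof (rule divide_left_mono)
      show "real n ^ (6 + q) \<le> real n ^ (4 * q)" using n2 c by (intro power_increasing) (auto simp: q_def)
    qed (use n0 in auto)
    also have "\<dots> = 1 / real n ^ 6 * ((1 / real n) ^ card (fst p) * (1 / real n) ^ card (snd p))"
      by (simp add: q_def power_add power_divide)
    finally show ?thesis .
  qed
  have fin: "finite ?I" by simp
  have "{l. \<exists>p\<in>Pow {..<n} \<times> Pow {..<n}. fst p \<noteq> {} \<and> snd p \<noteq> {} \<and> P p l} = (\<Union>p\<in>?I. {l. P p l})" by blast
  then have "measure_pmf.prob (hist n j) {l. \<exists>p\<in>Pow {..<n} \<times> Pow {..<n}. fst p \<noteq> {} \<and> snd p \<noteq> {} \<and> P p l}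
      \<le> (\<Sum>p\<in>?I. measure_pmf.prob (hist n j) {l. P p l})"
    by (simp only:) (rule measure_pmf.finite_measure_subadditive_finite[OF fin], auto)
  also have "\<dots> \<le> (\<Sum>p\<in>?I. 1 / real n ^ 6 * ((1 / real n) ^ card (fst p) * (1 / real n) ^ card (snd p)))"
    by (rule sum_mono[OF one])
  also have "\<dots> \<le> (\<Sum>p\<in>Pow {..<n} \<times> Pow {..<n}. 1 / real n ^ 6 * ((1 / real n) ^ card (fst p) * (1 / real n) ^ card (snd p)))"
    by (rule sum_mono2) auto
  also have "\<dots> = 1 / real n ^ 6 * (\<Sum>p\<in>Pow {..<n} \<times> Pow {..<n}. (1 / real n) ^ card (fst p) * (1 / real n) ^ card (snd p))"
    by (simp only: sum_distrib_left)
  also have "(\<Sum>p\<in>Pow {..<n} \<times> Pow {..<n}. (1 / real n) ^ card (fst p) * (1 / real n) ^ card (snd p)) =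
      (\<Sum>S\<in>Pow {..<n}. \<Sum>R\<in>Pow {..<n}. (1 / real n) ^ card S * (1 / real n) ^ card R)"
    unfolding sum.cartesian_product by (rule sum.cong) auto
  also have "\<dots> = (\<Sum>S\<in>Pow {..<n}. (1 / real n) ^ card S) * (\<Sum>R\<in>Pow {..<n}. (1 / real n) ^ card R)"
    by (simp only: sum_product)
  also have "(\<Sum>S\<in>Pow {..<n}. (1 / real n) ^ card S) = (1 + 1 / real n) ^ n"
    by (subst sum_Pow_power) auto
  also have "(1 + 1 / real n) ^ n * (1 + 1 / real n) ^ n \<le> 3 * 3"
  proof -
    have "(1 + 1 / real n) ^ n \<le> exp (1 / real n) ^ n" by (intro power_mono exp_ge_add_one_self) (use n0 in auto)
    also have "\<dots> = exp 1" using n0 by (simp add: exp_of_nat_mult[symmetric])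
    also have "\<dots> \<le> 3" by (rule exp_le)
    finally have "(1 + 1 / real n) ^ n \<le> 3" .
    then show ?thesis using n0 by (intro mult_mono) auto
  qed
  finally show ?thesis unfolding P_def using n0 by (simp add: divide_right_mono)
qed

lemma prob_bad:
  assumes j: "j \<le> m" shows "measure_pmf.prob (hist n j) {l. bad j l} \<le> p0"
proof -
  let ?D = "hist n j" and ?e = "exp (- (\<nu>\<^sup>2 / (800 * T ^ 3 * b0)))" and ?I = "{..<n} \<times> {..<n}"
  note nv = j time nu(1) nu(3)
  have A: "measure_pmf.prob ?D {l. \<exists>p\<in>?I. fst p \<noteq> snd p \<and> \<bar>accum (GA (fst p) (snd p)) (\<lambda>l e. nA n (set l) (fst p) (snd p) e) l\<bar> \<ge> \<nu>} \<le> (real n)\<^sup>2 * (2 * ?e)"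
  proof (rule prob_pairs)
    fix p assume p: "p \<in> ?I"
    show "measure_pmf.prob ?D {l. fst p \<noteq> snd p \<and> \<bar>accum (GA (fst p) (snd p)) (\<lambda>l e. nA n (set l) (fst p) (snd p) e) l\<bar> \<ge> \<nu>} \<le> 2 * ?e"
    proof (cases "fst p = snd p")
      case False
      have "measure_pmf.prob ?D {l. \<bar>accum (GA (fst p) (snd p)) (\<lambda>l e. nA n (set l) (fst p) (snd p) e) l\<bar> \<ge> \<nu>} \<le> 2 * ?e"
        by (rule noise_prob[OF nv])
          (use p False in \<open>auto simp: GA_def b0_def intro: noise_zero(1)[OF gd_facts[OF _ _ time]] noise_jump(1)[OF gd_facts[OF _ _ time]] noise_var(1)[OF gd_facts[OF _ _ time]]\<close>)
      then show ?thesis using False by simp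
    qed simp
  qed
  have X: "measure_pmf.prob ?D {l. \<exists>p\<in>?I. fst p \<noteq> snd p \<and> \<bar>accum (GA (fst p) (snd p)) (\<lambda>l e. nX n (set l) (fst p) (snd p) e) l\<bar> \<ge> \<nu>} \<le> (real n)\<^sup>2 * (2 * ?e)"
  proof (rule prob_pairs)
    fix p assume p: "p \<in> ?I"
    show "measure_pmf.prob ?D {l. fst p \<noteq> snd p \<and> \<bar>accum (GA (fst p) (snd p)) (\<lambda>l e. nX n (set l) (fst p) (snd p) e) l\<bar> \<ge> \<nu>} \<le> 2 * ?e"
    proof (cases "fst p = snd p")
      case False
      have "measure_pmf.prob ?D {l. \<bar>accum (GA (fst p) (snd p)) (\<lambda>l e. nX n (set l) (fst p) (snd p) e) l\<bar> \<ge> \<nu>} \<le> 2 * ?e"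
        by (rule noise_prob[OF nv])
          (use p False in \<open>auto simp: GA_def b0_def intro: noise_zero(2)[OF gd_facts[OF _ _ time]] noise_jump(2)[OF gd_facts[OF _ _ time]] noise_var(2)[OF gd_facts[OF _ _ time]]\<close>)
      then show ?thesis using False by simp
    qed simp
  qed
  have Dd: "measure_pmf.prob ?D {l. \<exists>p\<in>?I. \<bar>accum gd (\<lambda>l e. nD n (set l) (fst p) e) l\<bar> \<ge> \<nu>} \<le> (real n)\<^sup>2 * (2 * ?e)"
  proof (rule prob_pairs)
    fix p assume p: "p \<in> ?I"
    show "measure_pmf.prob ?D {l. \<bar>accum gd (\<lambda>l e. nD n (set l) (fst p) e) l\<bar> \<ge> \<nu>} \<le> 2 * ?e"
      by (rule noise_prob[OF nv])
        (use p in \<open>auto simp: b0_def intro: noise_zero(3)[OF gd_facts[OF _ _ time]] noise_jump(3)[OF gd_facts[OF _ _ time]] noise_var(3)[OF gd_facts[OF _ _ time]]\<close>)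
  qed
  have Z: "measure_pmf.prob ?D {l. \<exists>p\<in>?I. fst p \<noteq> snd p \<and> pregood l \<and> codeg (set l) (fst p) (snd p) > z} \<le> (real n)\<^sup>2 * exp (32 * T\<^sup>2 - real z)"
  proof (rule prob_pairs)
    fix p assume p: "p \<in> ?I"
    show "measure_pmf.prob ?D {l. fst p \<noteq> snd p \<and> pregood l \<and> codeg (set l) (fst p) (snd p) > z} \<le> exp (32 * T\<^sup>2 - real z)"
    proof (cases "fst p = snd p")
      case False
      then show ?thesis using codeg_prob[OF j time, of "fst p" "snd p"] by simp
    qed simp
  qed
  have un: "measure_pmf.prob ?D {l. P l \<or> Q l} \<le> measure_pmf.prob ?D {l. P l} + measure_pmf.prob ?D {l. Q l}" for P Q
    unfolding Collect_disj_eq by (rule measure_Un_le) auto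
  show ?thesis unfolding bad_def p0_def
    by (rule order_trans[OF un order_trans[OF add_mono[OF A order_trans[OF un add_mono[OF X order_trans[OF un
        add_mono[OF Dd order_trans[OF un add_mono[OF Z prob_counts[OF j]]]]]]]]]])
      (simp add: algebra_simps)
qed

lemma not_badD:
  assumes nb: "\<not> bad j l"
  shows "u < n \<Longrightarrow> v < n \<Longrightarrow> u \<noteq> v \<Longrightarrow> \<bar>accum (GA u v) (\<lambda>l e. nA n (set l) u v e) l\<bar> \<le> \<nu>"
    and "u < n \<Longrightarrow> v < n \<Longrightarrow> u \<noteq> v \<Longrightarrow> \<bar>accum (GA u v) (\<lambda>l e. nX n (set l) u v e) l\<bar> \<le> \<nu>"
    and "u < n \<Longrightarrow> \<bar>accum gd (\<lambda>l e. nD n (set l) u e) l\<bar> \<le> \<nu>"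
    and "u < n \<Longrightarrow> v < n \<Longrightarrow> u \<noteq> v \<Longrightarrow> pregood l \<Longrightarrow> codeg (set l) u v \<le> z"
    and "S \<subseteq> {..<n} \<Longrightarrow> R \<subseteq> {..<n} \<Longrightarrow> S \<noteq> {} \<Longrightarrow> R \<noteq> {} \<Longrightarrow> pregood l \<Longrightarrow>
      ecount (set l) S R \<le> (1 + \<delta>) * (2 * real j / (real n)\<^sup>2) * real (card S) * real (card R)
        + \<Lambda> * (real (card S) + real (card R))"
proof -
  note c = nb[unfolded bad_def de_Morgan_disj]
  have nbex: "\<not> P x" if "\<not> (\<exists>x\<in>A. P x)" "x \<in> A" for A :: "'b set" and P x using that by blast
  have pr: "(u, v) \<in> {..<n} \<times> {..<n}" if "u < n" "v < n" for u v using that by simp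
  show "\<bar>accum (GA u v) (\<lambda>l e. nA n (set l) u v e) l\<bar> \<le> \<nu>" if "u < n" "v < n" "u \<noteq> v"
    using nbex[OF c[THEN conjunct1] pr[OF that(1,2)]] that(3) by (simp add: not_le)
  show "\<bar>accum (GA u v) (\<lambda>l e. nX n (set l) u v e) l\<bar> \<le> \<nu>" if "u < n" "v < n" "u \<noteq> v"
    using nbex[OF c[THEN conjunct2, THEN conjunct1] pr[OF that(1,2)]] that(3) by (simp add: not_le)
  show "\<bar>accum gd (\<lambda>l e. nD n (set l) u e) l\<bar> \<le> \<nu>" if "u < n"
    using nbex[OF c[THEN conjunct2, THEN conjunct2, THEN conjunct1] pr[OF that that]] by (simp add: not_le)
  show "codeg (set l) u v \<le> z" if "u < n" "v < n" "u \<noteq> v" "pregood l"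
    using nbex[OF c[THEN conjunct2, THEN conjunct2, THEN conjunct2, THEN conjunct1] pr[OF that(1,2)]] that(3,4) by (simp add: not_less)
  show "ecount (set l) S R \<le> (1 + \<delta>) * (2 * real j / (real n)\<^sup>2) * real (card S) * real (card R)
        + \<Lambda> * (real (card S) + real (card R))"
    if "S \<subseteq> {..<n}" "R \<subseteq> {..<n}" "S \<noteq> {}" "R \<noteq> {}" "pregood l"
    using nbex[OF c[THEN conjunct2, THEN conjunct2, THEN conjunct2, THEN conjunct2], of "(S, R)"] that by (simp add: not_less)
qed

text \<open>The noise bounds are guarded by goodness at earlier times. In a strong induction all
  these guards hold, so the guarded sums are the true noise sums and the deterministic theorem
  \<open>good_at\<close> extends goodness by one step.\<close>

lemma tracking_succeeds:
  assumes wf: "wf_hist n l" and lm: "length l \<le> m" and nb: "\<And>j. j \<le> length l \<Longrightarrow> \<not> bad j (tail_at l j)"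
    and h: "h \<le> length l"
  shows "gd (tail_at l h)"
  using h
proof (induction h rule: less_induct)
  case (less h)
  let ?E = "\<lambda>j. set (tail_at l j)" and ?en = "\<lambda>j. l ! (length l - Suc j)"
  have wt: "wf_hist n (tail_at l j)" for j unfolding tail_at_def by (rule wf_hist_drop[OF wf])
  have gb: "gd (tail_at l j)" if "j < h" for j using less that by simp
  have pg: "pregood (tail_at l j)" if "j \<le> h" for j
    unfolding pregood_def using less.prems that gb by (auto simp: length_tail_at drop_tail_at)
  have nbr_mono: "v \<notin> nbr (?E k) u" if "v \<notin> nbr (?E j) u" "k \<le> j" "j \<le> h" for u v k j
  proof -
    have "tail_at l k = drop (j - k) (tail_at l j)" using that less.prems by (simp add: drop_tail_at)
    then have "?E k \<subseteq> ?E j" by (simp add: set_drop_subset)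
    then show ?thesis using that(1) by (auto simp: nbr_def)
  qed
  have acA: "accum (GA u v) \<Delta> (tail_at l j) = (\<Sum>k<j. \<Delta> (tail_at l k) (?en k))"
    if "j \<le> h" "v \<notin> nbr (?E j) u" for u v j \<Delta>
    by (rule accum_tail_at) (use that less.prems gb nbr_mono in \<open>auto simp: GA_def\<close>)
  have acD: "accum gd \<Delta> (tail_at l j) = (\<Sum>k<j. \<Delta> (tail_at l k) (?en k))" if "j \<le> h" for j \<Delta>
    by (rule accum_tail_at) (use that less.prems gb in auto)
  have nbj: "\<not> bad j (tail_at l j)" if "j \<le> h" for j using nb that less.prems by simp
  interpret tu: tracking_upto n T \<beta> \<gamma> \<zeta> z ?E ?en h M L \<nu> \<Phi> N W \<kappa> a B \<theta> \<mu> g \<delta> \<Lambda>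
  proof (unfold_locales)
    show "?E 0 = {}" by simp
    show "?en j \<in> open_pairs n (?E j) \<and> ?E (Suc j) = insert (?en j) (?E j)" if "j < h" for j
      using wt[of "Suc j"] that less.prems by (simp add: tail_at_Suc)
    show "good (?E j) (real j * s)" if "j < h" for j
      using gb[OF that] that less.prems by (simp add: gd_def length_tail_at)
    show "codeg (?E h) u v \<le> z" if "u \<noteq> v" for u v
    proof (cases "u < n \<and> v < n")
      case True
      then show ?thesis using not_badD(4)[OF nbj[OF order_refl]] that pg[of h] by blast
    next
      case False
      have "nbr (?E h) w = {}" if "\<not> w < n" for w
        using valid_nbr(1)[OF wf_hist_valid[OF wt]] that by blast
      then have "nbr (?E h) u \<inter> nbr (?E h) v = {}" using False by blast
      then show ?thesis by (simp add: codeg_def)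
    qed
    show "real h * s \<le> T"
    proof -
      have "real h * s \<le> real m * s" using less.prems lm s_pos by (intro mult_right_mono) auto
      then show ?thesis using time by linarith
    qed
    show "\<bar>\<Sum>k<j. nA n (?E k) u v (?en k)\<bar> \<le> \<nu>"
      if "j \<le> h" "u < n" "v < n" "u \<noteq> v" "v \<notin> nbr (?E j) u" for j u v
      using not_badD(1)[OF nbj[OF that(1)] that(2-4)] acA[OF that(1,5), of "\<lambda>l e. nA n (set l) u v e"] by simp
    show "\<bar>\<Sum>k<j. nX n (?E k) u v (?en k)\<bar> \<le> \<nu>"
      if "j \<le> h" "u < n" "v < n" "u \<noteq> v" "v \<notin> nbr (?E j) u" for j u v
      using not_badD(2)[OF nbj[OF that(1)] that(2-4)] acA[OF that(1,5), of "\<lambda>l e. nX n (set l) u v e"] by simp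
    show "\<bar>\<Sum>k<j. nD n (?E k) u (?en k)\<bar> \<le> \<nu>" if "j \<le> h" "u < n" for j u
      using not_badD(3)[OF nbj[OF that(1)] that(2)] acD[OF that(1), of "\<lambda>l e. nD n (set l) u e"] by simp
    show "ecount (?E j) S R \<le> (1 + \<delta>) * (2 * real j / (real n)\<^sup>2) * real (card S) * real (card R) + \<Lambda> * (real (card S) + real (card R))"
      if "j < h" "S \<subseteq> {..<n}" "R \<subseteq> {..<n}" for j S R
    proof (cases "S = {} \<or> R = {}")
      case True
      have "0 \<le> \<Lambda>" using n2 del T1 by (simp add: Lam)
      moreover have "ecount (?E j) S R = 0" using True by (auto simp: ecount_def)
      ultimately show ?thesis using del by simp
    next
      case False
      then show ?thesis using not_badD(5)[OF nbj[OF less_imp_le[OF that(1)]] that(2,3)] pg[OF less_imp_le[OF that(1)]] by simp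
    qed
    show "0 \<le> \<Lambda>" using n2 del T1 by (simp add: Lam)
    show "exp (4 * (real h * s)\<^sup>2 + \<zeta>) / (2 * sqrt (real n)) \<le> \<gamma>"
    proof -
      have "real h * s \<le> real m * s" using less.prems lm s_pos by (intro mult_right_mono) auto
      then have "(real h * s)\<^sup>2 \<le> (real m * s)\<^sup>2" using s_pos by (intro power_mono) auto
      then have "exp (4 * (real h * s)\<^sup>2 + \<zeta>) / (2 * sqrt (real n)) \<le> exp (4 * (real m * s)\<^sup>2 + \<zeta>) / (2 * sqrt (real n))"
        by (intro divide_right_mono) auto
      then show ?thesis using dens by linarith
    qed
  qed (use M N nu W a B kap Phi chPhi second beta1 beta2 th mu gM gain zeta del in \<open>auto simp: err_def\<close>)
  show ?case using tu.good_at less.prems by (simp add: gd_def length_tail_at)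
qed

theorem tracking_prob:
  "measure_pmf.prob (hist n m) {l. \<not> (length l = m \<and> (\<forall>h\<le>m. gd (tail_at l h)))} \<le> (real m + 1) * p0"
proof -
  let ?F = "{l. \<not> (length l = m \<and> (\<forall>h\<le>m. gd (tail_at l h)))}"
  have "measure_pmf.prob (hist n m) ?F \<le> measure_pmf.prob (hist n m) {l. \<exists>j\<le>m. bad j (drop (length l - j) l)}"
  proof (rule measure_pmf.finite_measure_mono_AE)
    show "AE l in measure_pmf (hist n m). l \<in> ?F \<longrightarrow> l \<in> {l. \<exists>j\<le>m. bad j (drop (length l - j) l)}"
      unfolding AE_measure_pmf_iff
    proof (intro ballI impI, rule ccontr)
      fix l assume l: "l \<in> set_pmf (hist n m)" and f: "l \<in> ?F"
        and nb: "l \<notin> {l. \<exists>j\<le>m. bad j (drop (length l - j) l)}"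
      have wf: "wf_hist n l" "length l \<le> m" using set_pmf_hist[OF l] by auto
      have g: "gd (tail_at l h)" if "h \<le> length l" for h
        by (rule tracking_succeeds[OF wf _ that]) (use nb wf in \<open>auto simp: tail_at_def\<close>)
      \<comment> \<open>Goodness includes the existence of an open pair, so a good history cannot be
        stuck before time m.\<close>
      have "length l = m"
      proof (rule ccontr)
        assume "length l \<noteq> m"
        then have "open_pairs n (set l) = {}" using hist_stuck[OF l] wf by simp
        moreover have "gd l" using g[of "length l"] by (simp add: tail_at_def)
        then have "0 < nopen n (set l)" by (simp add: gd_def good_def)
        ultimately show False by (simp add: nopen_def)
      qed
      then show False using f g by auto
    qed
  qed simp
  also have "\<dots> \<le> (\<Sum>j\<le>m. measure_pmf.prob (hist n j) {l. bad j l})" by (rule hist_union_tails)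
  also have "\<dots> \<le> (\<Sum>j\<le>m. p0)" by (rule sum_mono) (simp add: prob_bad)
  also have "\<dots> = (real m + 1) * p0" by simp
  finally show ?thesis .
qed

end

section \<open>The early graph\<close>

text \<open>Double counting: every vertex receives weight at least 1, and an independent set passes
  its weight on to at most k vertices.\<close>

lemma fractional_chromatic_ge:
  assumes G: "simple_graph G" and ind: "\<And>I. I \<in> independent_sets G \<Longrightarrow> card I \<le> k" and k: "0 < k"
  shows "real (card (verts G)) / real k \<le> fractional_chromatic_number G"
  unfolding fractional_chromatic_number_def
proof (rule cInf_greatest)
  have finV: "finite (verts G)" using G by (simp add: simple_graph_def)
  have finI: "finite (independent_sets G)"
    by (rule finite_subset[of _ "Pow (verts G)"]) (use finV in \<open>auto simp: independent_sets_def\<close>)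
  \<comment> \<open>The infimum is over a nonempty set: weight 1 everywhere is a fractional
    colouring since singletons are independent.\<close>
  have "fractional_colouring G (\<lambda>_. 1)"
    unfolding fractional_colouring_def
  proof (intro conjI ballI)
    fix v assume v: "v \<in> verts G"
    have "{v} \<notin> edges G" using G by (auto simp: simple_graph_def)
    then have "{v} \<in> independent_sets G" using v by (auto simp: independent_sets_def)
    then have "card {{v}} \<le> card {I. I \<in> independent_sets G \<and> v \<in> I}"
      using finI by (intro card_mono) auto
    then show "(1::real) \<le> (\<Sum>I | I \<in> independent_sets G \<and> v \<in> I. 1)" by simp
  qed simp
  then show "{\<Sum>I\<in>independent_sets G. w I |w. fractional_colouring G w} \<noteq> {}" by blast
  fix x assume "x \<in> {\<Sum>I\<in>independent_sets G. w I |w. fractional_colouring G w}"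
  then obtain w where x: "x = (\<Sum>I\<in>independent_sets G. w I)" and w: "fractional_colouring G w" by blast
  have w0: "0 \<le> w I" if "I \<in> independent_sets G" for I using w that by (simp add: fractional_colouring_def)
  have "real (card (verts G)) = (\<Sum>v\<in>verts G. 1)" by simp
  also have "\<dots> \<le> (\<Sum>v\<in>verts G. \<Sum>I | I \<in> independent_sets G \<and> v \<in> I. w I)"
    by (rule sum_mono) (use w in \<open>simp add: fractional_colouring_def\<close>)
  also have "\<dots> = (\<Sum>v\<in>verts G. \<Sum>I\<in>independent_sets G. if v \<in> I then w I else 0)"
    by (rule sum.cong[OF refl]) (simp add: sum.inter_filter[OF finI, symmetric])
  also have "\<dots> = (\<Sum>I\<in>independent_sets G. \<Sum>v\<in>verts G. if v \<in> I then w I else 0)" by (rule sum.swap)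
  also have "\<dots> \<le> (\<Sum>I\<in>independent_sets G. real k * w I)"
  proof (rule sum_mono)
    fix I assume I: "I \<in> independent_sets G"
    have "{v \<in> verts G. v \<in> I} = I" using I by (auto simp: independent_sets_def)
    then have "(\<Sum>v\<in>verts G. if v \<in> I then w I else 0) = real (card I) * w I"
      by (simp add: sum.inter_filter[OF finV, symmetric])
    also have "\<dots> \<le> real k * w I" using ind[OF I] w0[OF I] by (intro mult_right_mono) auto
    finally show "(\<Sum>v\<in>verts G. if v \<in> I then w I else 0) \<le> real k * w I" .
  qed
  also have "\<dots> = real k * x" by (simp only: x sum_distrib_left)
  finally show "real (card (verts G)) / real k \<le> x" using k by (simp add: field_simps)
qed

text \<open>Labelled four-cycles. Each one occurs eight times, and every vertex on a four-cycle is
  the first component of some tuple.\<close>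

definition squares :: "nat \<Rightarrow> nat set set \<Rightarrow> (nat \<times> nat \<times> nat \<times> nat) set" where
  "squares n E = {(a, b, c, d). a < n \<and> b < n \<and> c < n \<and> d < n \<and> distinct [a, b, c, d] \<and>
     {{a, b}, {b, c}, {c, d}, {d, a}} \<subseteq> E}"

lemma finite_squares: "finite (squares n E)"
  by (rule finite_subset[of _ "{..<n} \<times> {..<n} \<times> {..<n} \<times> {..<n}"]) (auto simp: squares_def)

lemma h5f_ge:
  assumes V: "valid n E'" and sub: "E \<subseteq> E'" and sq: "2 * card (squares n E) \<le> n"
    and ind: "\<And>S. S \<subseteq> {..<n} \<Longrightarrow> card S = k \<Longrightarrow> \<exists>e\<in>E. e \<subseteq> S" and k: "0 < k"
  shows "real n / (2 * real k) \<le> h5f ({..<n}, E')"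
proof -
  \<comment> \<open>All vertices on four-cycles are deleted, at most
    \<open>card (squares n E)\<close> of them. H is the graph induced by the early edges on the
    rest, so independent sets of H contain no edge of E; triangles are excluded by the process
    itself.\<close>
  define U where "U = {..<n} - fst ` squares n E"
  define H where "H = (U, {e \<in> E. e \<subseteq> U})"
  have E: "e \<subseteq> {..<n}" "card e = 2" if "e \<in> E" for e using V sub that by (auto simp: valid_def)
  have H: "simple_graph H" using E by (auto simp: H_def U_def simple_graph_def)
  have G: "simple_graph ({..<n}, E')" using V by (auto simp: valid_def simple_graph_def)
  have sg: "subgraph H ({..<n}, E')" using H sub by (auto simp: subgraph_def H_def U_def)
  have "5 \<le> girth H" unfolding girth_def
  proof (rule Inf_greatest)
    fix y assume "y \<in> {enat (length c) |c. is_cycle H c}"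
    then obtain c where y: "y = enat (length c)" and c: "is_cycle H c" by blast
    have c3: "3 \<le> length c" "distinct c" "set c \<subseteq> U" using c by (auto simp: is_cycle_def H_def)
    have ce: "{c ! i, c ! (Suc i mod length c)} \<in> E" if "i < length c" for i
      using c that by (auto simp: is_cycle_def H_def)
    have "length c \<noteq> 3"
    proof
      assume l: "length c = 3"
      have "distinct [c ! 0, c ! 1, c ! 2]" using c3(2) l by (auto simp: nth_eq_iff_index_eq)
      moreover have "{c ! 0, c ! 1} \<in> E'" "{c ! 1, c ! 2} \<in> E'" "{c ! 0, c ! 2} \<in> E'"
        using ce[of 0] ce[of 1] ce[of 2] l sub by (auto simp: insert_commute numeral_2_eq_2)
      ultimately show False using V unfolding valid_def triangle_free_def by blast
    qed
    moreover have "length c \<noteq> 4"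
    proof
      assume l: "length c = 4"
      have mem: "c ! i \<in> U" if "i < 4" for i using c3(3) l that nth_mem by (metis subsetD)
      have "distinct [c ! 0, c ! 1, c ! 2, c ! 3]" using c3(2) l by (auto simp: nth_eq_iff_index_eq)
      moreover have "{c ! 0, c ! 1} \<in> E" "{c ! 1, c ! 2} \<in> E" "{c ! 2, c ! 3} \<in> E" "{c ! 3, c ! 0} \<in> E"
      proof -
      have md: "Suc 0 mod 4 = (1::nat)" "Suc 1 mod 4 = (2::nat)" "Suc 2 mod 4 = (3::nat)" "Suc 3 mod 4 = (0::nat)"
        by simp_all
      show "{c ! 0, c ! 1} \<in> E" "{c ! 1, c ! 2} \<in> E" "{c ! 2, c ! 3} \<in> E" "{c ! 3, c ! 0} \<in> E"
        using ce[of 0, unfolded l md] ce[of 1, unfolded l md] ce[of 2, unfolded l md] ce[of 3, unfolded l md] by simp_all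
      qed
      ultimately have "(c ! 0, c ! 1, c ! 2, c ! 3) \<in> squares n E"
        using mem[of 0] mem[of 1] mem[of 2] mem[of 3] by (simp add: squares_def U_def)
      then have "c ! 0 \<in> fst ` squares n E" by force
      then show False using mem[of 0] by (simp add: U_def)
    qed
    ultimately have "5 \<le> length c" using c3(1) by linarith
    then show "5 \<le> y" by (simp add: y numeral_eq_enat)
  qed
  then have "fractional_chromatic_number H \<le> h5f ({..<n}, E')"
    unfolding h5f_def using sg h5f_set_finite[OF G] by (intro Max_ge) blast+
  moreover have "real (card (verts H)) / real k \<le> fractional_chromatic_number H"
  proof (rule fractional_chromatic_ge[OF H _ k])
    fix I assume I: "I \<in> independent_sets H"
    show "card I \<le> k"
    proof (rule ccontr)
      assume "\<not> card I \<le> k"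
      then obtain S where S: "S \<subseteq> I" "card S = k"
        by (metis nat_le_linear obtain_subset_with_card_n)
      have IU: "I \<subseteq> U" using I by (simp add: independent_sets_def H_def)
      then obtain e where e: "e \<in> E" "e \<subseteq> S" using ind[of S] S by (auto simp: U_def)
      then obtain u v where uv: "e = {u, v}" using E[OF e(1)] by (auto simp: card_2_iff)
      have "{u, v} \<in> edges H" using e uv S IU by (auto simp: H_def)
      then show False using I e uv S by (auto simp: independent_sets_def)
    qed
  qed
  moreover have "real n / (2 * real k) \<le> real (card (verts H)) / real k"
  proof -
    have "card (fst ` squares n E) \<le> card (squares n E)" by (rule card_image_le[OF finite_squares])
    moreover have "card {..<n} - card (fst ` squares n E) \<le> card U"
      unfolding U_def by (rule diff_card_le_card_Diff) (simp add: finite_squares)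
    ultimately have "n \<le> 2 * card U" using sq by simp
    then have "real n / 2 \<le> real (card (verts H))" by (simp add: H_def)
    then have "real n / 2 / real k \<le> real (card (verts H)) / real k" by (rule divide_right_mono) simp
    then show ?thesis by simp
  qed
  ultimately show ?thesis by linarith
qed

text \<open>Early in the process a constant fraction of all pairs is open.\<close>

definition sparse :: "nat \<Rightarrow> nat set list \<Rightarrow> bool" where
  "sparse n l \<longleftrightarrow> (real n)\<^sup>2 / 8 \<le> real (nopen n (set l))"

text \<open>P at all strictly earlier times, again so that the condition is decided before the last
  choice.\<close>

primrec hereditary :: "('a list \<Rightarrow> bool) \<Rightarrow> 'a list \<Rightarrow> bool" where
  "hereditary P [] \<longleftrightarrow> True"
| "hereditary P (e # l) \<longleftrightarrow> P l \<and> hereditary P l"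

lemma tail_at_Cons: "k \<le> length l \<Longrightarrow> tail_at (e # l) k = tail_at l k"
  by (simp add: tail_at_def Suc_diff_le)

lemma hereditaryI: "(\<And>k. k < length l \<Longrightarrow> P (tail_at l k)) \<Longrightarrow> hereditary P l"
proof (induction l)
  case (Cons e l)
  have "P (tail_at (e # l) (length l))" using Cons.prems[of "length l"] by simp
  then have "P l" by (simp add: tail_at_Cons) (simp add: tail_at_def)
  moreover have "hereditary P l"
    using Cons.IH Cons.prems by (metis length_Cons less_SucI less_imp_le tail_at_Cons)
  ultimately show ?case by simp
qed simp

section \<open>Four-cycles, degrees and independent sets while the graph is sparse\<close>

definition edge_weight :: "nat \<Rightarrow> nat \<Rightarrow> nat set set \<Rightarrow> nat set list \<Rightarrow> real" where
  "edge_weight n i F l = ((real i - real (length l)) * (8 / (real n)\<^sup>2)) ^ card (F - set l)"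

text \<open>\<open>edge_weight\<close> bounds the chance that all of F is present at time i: each
  missing edge is charged the remaining time times 8 / n^2, which exceeds 1 / \<open>nopen\<close>
  in the sparse phase. One step lowers the base from w + q to w and hits a missing edge with
  probability at most k q, so the claim is Bernoulli's inequality w^k + k q w^(k - 1) <= (w +
  q)^k.\<close>

lemma edge_weight_step:
  assumes n: "0 < n" and l: "wf_hist n l" "length l < i" and sp: "sparse n l" and F: "finite F"
  shows "(\<Sum>e\<in>open_pairs n (set l). edge_weight n i F (e # l)) \<le> edge_weight n i F l * real (nopen n (set l))"
proof -
  define q where "q = 8 / (real n)\<^sup>2"
  define w where "w = (real i - real (length l) - 1) * q"
  define k where "k = card (F - set l)"
  let ?O = "open_pairs n (set l)" and ?N = "real (nopen n (set l))"
  have q: "0 < q" using n by (simp add: q_def)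
  have w: "0 \<le> w" using l(2) q by (simp add: w_def)
  have qN: "1 \<le> q * ?N" using sp n by (simp add: sparse_def q_def field_simps)
  have new: "edge_weight n i F (e # l) \<le> w ^ k + (if e \<in> F then w ^ (k - 1) else 0)" if e: "e \<in> ?O" for e
  proof (cases "e \<in> F")
    case True
    have "e \<notin> set l" using e by (simp add: open_pairs_def)
    then have "card (F - set (e # l)) = k - 1"
      using True F unfolding k_def by (simp add: Diff_insert[of F e "set l"])
    then show ?thesis using True w by (simp add: edge_weight_def w_def q_def algebra_simps)
  next
    case False
    then have "F - set (e # l) = F - set l" by auto
    then show ?thesis using False by (simp add: edge_weight_def w_def q_def k_def algebra_simps)
  qed
  have "(\<Sum>e\<in>?O. edge_weight n i F (e # l)) \<le> (\<Sum>e\<in>?O. w ^ k + (if e \<in> F then w ^ (k - 1) else 0))"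
    by (rule sum_mono[OF new])
  also have "\<dots> = ?N * w ^ k + real (card (?O \<inter> F)) * w ^ (k - 1)"
    by (simp add: sum.distrib nopen_def sum.If_cases)
  also have "\<dots> \<le> ?N * w ^ k + (q * ?N) * (real k * w ^ (k - 1))"
  proof -
    have "?O \<inter> F \<subseteq> F - set l" by (auto simp: open_pairs_def)
    then have "card (?O \<inter> F) \<le> k" unfolding k_def using F by (intro card_mono) auto
    then have "real (card (?O \<inter> F)) * w ^ (k - 1) \<le> 1 * (real k * w ^ (k - 1))"
      using w by (simp add: mult_right_mono)
    also have "\<dots> \<le> (q * ?N) * (real k * w ^ (k - 1))" using qN w by (intro mult_right_mono) auto
    finally show ?thesis by simp
  qed
  also have "\<dots> = ?N * (w ^ k + real k * q * w ^ (k - 1))" by (simp add: algebra_simps)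
  also have "\<dots> \<le> ?N * (w + q) ^ k"
  proof (rule mult_left_mono)
    show "w ^ k + real k * q * w ^ (k - 1) \<le> (w + q) ^ k"
    proof (induction k)
      case (Suc k)
      have "w ^ Suc k + real (Suc k) * q * w ^ (Suc k - 1) \<le> (w + q) * (w ^ k + real k * q * w ^ (k - 1))"
      proof -
        have e: "w * (real k * w ^ (k - 1)) = real k * w ^ k" by (cases k) auto
        have "(w + q) * (w ^ k + real k * q * w ^ (k - 1)) =
            w ^ Suc k + q * w ^ k + q * (w * (real k * w ^ (k - 1))) + q * (real k * q * w ^ (k - 1))"
          by (simp add: algebra_simps)
        also have "\<dots> = w ^ Suc k + real (Suc k) * q * w ^ k + q * (real k * q * w ^ (k - 1))"
          unfolding e by (simp add: algebra_simps)
        finally show ?thesis using q w by simp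
      qed
      also have "\<dots> \<le> (w + q) * (w + q) ^ k" using Suc q w by (intro mult_left_mono) auto
      finally show ?case by simp
    qed simp
  qed simp
  also have "w + q = (real i - real (length l)) * q" by (simp add: w_def algebra_simps)
  also have "?N * ((real i - real (length l)) * q) ^ k = edge_weight n i F l * ?N"
    by (simp add: edge_weight_def q_def k_def)
  finally show ?thesis .
qed

lemma edge_weight_nonneg: "length l \<le> i \<Longrightarrow> 0 \<le> edge_weight n i F l"
  by (simp add: edge_weight_def)

lemma many_squares_prob:
  assumes n: "0 < n"
  shows "measure_pmf.prob (hist n i) {l. hereditary (sparse n) l \<and> n < 2 * card (squares n (set l))}
    \<le> 2 * real n ^ 3 * (real i * (8 / (real n)\<^sup>2)) ^ 4"
proof -
  let ?I = "{(a, b, c, d). a < n \<and> b < n \<and> c < n \<and> d < n \<and> distinct [a, b, c, d]}"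
  define F where "F t = (case t of (a, b, c, d) \<Rightarrow> {{a, b}, {b, c}, {c, d}, {d, a}})" for t :: "nat \<times> nat \<times> nat \<times> nat"
  \<comment> \<open>Beyond time i the base of \<open>edge_weight\<close> is negative, so the length
    is part of the guard: f has to be nonnegative on all lists.\<close>
  define f where "f l = (if hereditary (sparse n) l \<and> length l \<le> i then (\<Sum>t\<in>?I. edge_weight n i (F t) l) else 0)" for l
  have sub: "?I \<subseteq> {..<n} \<times> {..<n} \<times> {..<n} \<times> {..<n}" by auto
  have finI: "finite ?I" by (rule finite_subset[OF sub]) simp
  have finF: "finite (F t)" for t by (cases t) (simp add: F_def)
  have cF: "card (F t) = 4" if "t \<in> ?I" for t
    using that by (cases t) (auto simp: F_def card_insert_if doubleton_eq_iff)
  have "measure_pmf.prob (hist n i) {l. hereditary (sparse n) l \<and> n < 2 * card (squares n (set l))} \<le> f [] / (real n / 2)"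
  proof (rule hist_markov)
    fix l show "0 \<le> f l" by (auto simp: f_def intro!: sum_nonneg edge_weight_nonneg)
  next
    fix l assume l: "wf_hist n l" "length l < i"
    show "(\<Sum>e\<in>open_pairs n (set l). f (e # l)) \<le> f l * real (nopen n (set l))"
    proof (cases "sparse n l \<and> hereditary (sparse n) l")
      case False
      then have "\<not> hereditary (sparse n) (e # l)" for e by simp
      then have "f (e # l) = 0" for e by (simp only: f_def simp_thms if_False)
      moreover have "0 \<le> f l" by (auto simp: f_def intro!: sum_nonneg edge_weight_nonneg)
      ultimately show ?thesis by simp
    next
      case True
      have "(\<Sum>e\<in>open_pairs n (set l). f (e # l)) = (\<Sum>e\<in>open_pairs n (set l). \<Sum>t\<in>?I. edge_weight n i (F t) (e # l))"
        using True l by (simp add: f_def)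
      also have "\<dots> = (\<Sum>t\<in>?I. \<Sum>e\<in>open_pairs n (set l). edge_weight n i (F t) (e # l))" by (rule sum.swap)
      also have "\<dots> \<le> (\<Sum>t\<in>?I. edge_weight n i (F t) l * real (nopen n (set l)))"
        by (rule sum_mono) (use edge_weight_step[OF n l] True finF in blast)
      also have "\<dots> = f l * real (nopen n (set l))" using True l by (simp add: f_def sum_distrib_right)
      finally show ?thesis .
    qed
  next
    fix l assume l: "wf_hist n l" "length l \<le> i" and p: "hereditary (sparse n) l \<and> n < 2 * card (squares n (set l))"
    have sq: "squares n (set l) = {t \<in> ?I. F t \<subseteq> set l}" by (auto simp: squares_def F_def)
    have "real (card (squares n (set l))) = (\<Sum>t\<in>squares n (set l). edge_weight n i (F t) l)"
    proof -
      have "edge_weight n i (F t) l = 1" if "t \<in> squares n (set l)" for t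
      proof -
        have "F t - set l = {}" using that unfolding sq by blast
        then show ?thesis unfolding edge_weight_def by (simp only: card.empty power_0)
      qed
      then show ?thesis by simp
    qed
    also have "\<dots> \<le> (\<Sum>t\<in>?I. edge_weight n i (F t) l)"
      by (rule sum_mono2[OF finI]) (use sq l in \<open>auto intro: edge_weight_nonneg\<close>)
    finally show "real n / 2 \<le> f l" using p l by (simp add: f_def)
  qed (use n in simp)
  also have "f [] = (\<Sum>t\<in>?I. (real i * (8 / (real n)\<^sup>2)) ^ 4)"
    unfolding f_def using cF by (simp add: edge_weight_def)
  also have "\<dots> = real (card ?I) * (real i * (8 / (real n)\<^sup>2)) ^ 4" by simp
  also have "\<dots> / (real n / 2) \<le> real n ^ 4 * (real i * (8 / (real n)\<^sup>2)) ^ 4 / (real n / 2)"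
  proof -
    have "card ?I \<le> card ({..<n} \<times> {..<n} \<times> {..<n} \<times> {..<n})" by (rule card_mono[OF _ sub]) simp
    also have "\<dots> = n ^ 4" by (simp add: power4_eq_xxxx mult.assoc)
    finally have "real (card ?I) \<le> real n ^ 4" unfolding of_nat_power[symmetric] by (rule of_nat_mono)
    then show ?thesis using n by (intro divide_right_mono mult_right_mono) auto
  qed
  also have "\<dots> = 2 * real n ^ 3 * (real i * (8 / (real n)\<^sup>2)) ^ 4"
    using n by (simp add: power4_eq_xxxx power3_eq_cube)
  finally show ?thesis .
qed

lemma card_open_at: "card {e \<in> open_pairs n E. u \<in> e} \<le> n"
proof -
  have "{e \<in> open_pairs n E. u \<in> e} \<subseteq> (\<lambda>w. {u, w}) ` {..<n}"
  proof
    fix e assume "e \<in> {e \<in> open_pairs n E. u \<in> e}"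
    then have e: "e \<in> open_pairs n E" "u \<in> e" by auto
    then show "e \<in> (\<lambda>w. {u, w}) ` {..<n}"
      by (elim open_pairs_E) (auto simp: insert_commute)
  qed
  then have "card {e \<in> open_pairs n E. u \<in> e} \<le> card ((\<lambda>w. {u, w}) ` {..<n})" by (intro card_mono) auto
  also have "\<dots> \<le> n" using card_image_le[of "{..<n}" "\<lambda>w. {u, w}"] by simp
  finally show ?thesis .
qed

text \<open>2^degree doubles only if the choice contains u, which has probability at most n /
  \<open>nopen\<close> <= 8 / n in the sparse phase; the exponential factor compensates this
  growth.\<close>

lemma high_degree_prob:
  assumes n: "0 < n"
  shows "measure_pmf.prob (hist n i) {l. hereditary (sparse n) l \<and> x < card (nbr (set l) u)}
    \<le> exp (8 * real i / real n) / 2 ^ x"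
proof -
  define f where "f l = (if hereditary (sparse n) l then 2 ^ card (nbr (set l) u) * exp (8 * (real i - real (length l)) / real n) else 0)" for l
  have "measure_pmf.prob (hist n i) {l. hereditary (sparse n) l \<and> x < card (nbr (set l) u)} \<le> f [] / 2 ^ x"
  proof (rule hist_markov)
    fix l show "0 \<le> f l" by (simp add: f_def)
  next
    fix l assume l: "wf_hist n l" "length l < i"
    let ?O = "open_pairs n (set l)"
    show "(\<Sum>e\<in>?O. f (e # l)) \<le> f l * real (nopen n (set l))"
    proof (cases "sparse n l \<and> hereditary (sparse n) l")
      case False
      then have "f (e # l) = 0" for e by (simp add: f_def)
      moreover have "0 \<le> f l" by (simp add: f_def)
      ultimately show ?thesis by simp
    next
      case True
      define c where "c = 2 ^ card (nbr (set l) u) * exp (8 * (real i - real (length l)) / real n)"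
      define c' where "c' = c * exp (- (8 / real n))"
      have c': "0 \<le> c'" by (simp add: c'_def c_def)
      have new: "f (e # l) \<le> c' + (if u \<in> e then c' else 0)" if e: "e \<in> ?O" for e
      proof -
        have ex: "exp (8 * (real i - real (length (e # l))) / real n) = exp (8 * (real i - real (length l)) / real n) * exp (- (8 / real n))"
          using n by (simp add: exp_add[symmetric] field_simps)
        obtain a b where ab: "e = {a, b}" "a \<noteq> b" using e by (rule open_pairs_E)
        have "card (nbr (insert e (set l)) u) \<le> card (nbr (set l) u) + (if u \<in> e then 1 else 0)"
        proof -
          have "nbr (insert e (set l)) u \<subseteq> nbr (set l) u \<union> (if u \<in> e then e - {u} else {})"
            unfolding ab nbr_insert using ab(2) by auto
          then have "card (nbr (insert e (set l)) u) \<le> card (nbr (set l) u \<union> (if u \<in> e then e - {u} else {}))"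
            using finite_nbr[OF wf_hist_valid[OF l(1)]] ab by (intro card_mono) auto
          also have "\<dots> \<le> card (nbr (set l) u) + card (if u \<in> e then e - {u} else {})" by (rule card_Un_le)
          also have "card (if u \<in> e then e - {u} else {}) = (if u \<in> e then 1 else 0)" using ab by auto
          finally show ?thesis .
        qed
        then have "(2::real) ^ card (nbr (insert e (set l)) u) \<le> 2 ^ (card (nbr (set l) u) + (if u \<in> e then 1 else 0))"
          by (intro power_increasing) auto
        then have "f (e # l) \<le> 2 ^ (card (nbr (set l) u) + (if u \<in> e then 1 else 0)) * (exp (8 * (real i - real (length l)) / real n) * exp (- (8 / real n)))"
          unfolding f_def ex using True by (auto intro!: mult_right_mono)
        also have "\<dots> = c' + (if u \<in> e then c' else 0)" by (simp add: c'_def c_def)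
        finally show ?thesis .
      qed
      have "(\<Sum>e\<in>?O. f (e # l)) \<le> (\<Sum>e\<in>?O. c' + (if u \<in> e then c' else 0))" by (rule sum_mono[OF new])
      also have "\<dots> = real (nopen n (set l)) * c' + real (card {e \<in> ?O. u \<in> e}) * c'"
        by (simp add: sum.distrib nopen_def sum.If_cases Int_def)
      also have "\<dots> \<le> real (nopen n (set l)) * c' + (8 / real n * real (nopen n (set l))) * c'"
      proof -
        have "real n \<le> 8 / real n * real (nopen n (set l))"
          using True n by (simp add: sparse_def field_simps power2_eq_square)
        then have "real (card {e \<in> ?O. u \<in> e}) \<le> 8 / real n * real (nopen n (set l))"
          using card_open_at[of n "set l" u] by linarith
        then have "real (card {e \<in> ?O. u \<in> e}) * c' \<le> 8 / real n * real (nopen n (set l)) * c'"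
          using c' by (rule mult_right_mono)
        then show ?thesis by simp
      qed
      also have "\<dots> = real (nopen n (set l)) * c * ((1 + 8 / real n) * exp (- (8 / real n)))"
        by (simp add: c'_def algebra_simps)
      also have "\<dots> \<le> real (nopen n (set l)) * c * (exp (8 / real n) * exp (- (8 / real n)))"
        by (intro mult_left_mono mult_right_mono exp_ge_add_one_self) (auto simp: c_def)
      also have "\<dots> = f l * real (nopen n (set l))" using True by (simp add: f_def c_def exp_add[symmetric])
      finally show ?thesis .
    qed
  next
    fix l assume l: "length l \<le> i" and p: "hereditary (sparse n) l \<and> x < card (nbr (set l) u)"
    have "(2::real) ^ x * 1 \<le> 2 ^ card (nbr (set l) u) * exp (8 * (real i - real (length l)) / real n)"
      using p l by (intro mult_mono power_increasing) auto
    then show "2 ^ x \<le> f l" using p by (simp add: f_def)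
  qed simp
  also have "f [] = exp (8 * real i / real n)" by (simp add: f_def nbr_def)
  finally show ?thesis .
qed

lemma card_pairs_of_set: "finite S \<Longrightarrow> 2 * card {e. e \<subseteq> S \<and> card e = 2} = card S * (card S - 1)"
proof -
  assume "finite S"
  moreover have "even (card S * (card S - 1))" by (cases "card S") auto
  ultimately show ?thesis by (simp add: n_subsets choose_two)
qed

lemma nopen_le: "real (nopen n E) \<le> (real n)\<^sup>2 / 2"
proof -
  have "nopen n E \<le> card {e. e \<subseteq> {..<n} \<and> card e = 2}" unfolding nopen_def
    by (rule card_mono) (auto simp: open_pairs_def intro: finite_subset[of _ "Pow {..<n}"])
  then have "2 * nopen n E \<le> n * (n - 1)" using card_pairs_of_set[of "{..<n}"] by simp
  also have "\<dots> \<le> n * n" by simp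
  finally have "2 * nopen n E \<le> n * n" .
  then have "real (2 * nopen n E) \<le> real (n * n)" by (rule of_nat_mono)
  then show ?thesis by (simp add: power2_eq_square)
qed

text \<open>A pair inside an independent set that is not open has a common neighbour, and each of
  the n possible ones accounts for at most x^2 pairs.\<close>

lemma open_in_independent:
  assumes V: "valid n E" and S: "S \<subseteq> {..<n}" and ind: "\<not> (\<exists>e\<in>E. e \<subseteq> S)"
    and deg: "\<And>v. v < n \<Longrightarrow> card (nbr E v) \<le> x"
  shows "card S * (card S - 1) \<le> 2 * card {e \<in> open_pairs n E. e \<subseteq> S} + 2 * (n * x\<^sup>2)"
proof -
  let ?P = "{e. e \<subseteq> S \<and> card e = 2}" and ?O = "{e \<in> open_pairs n E. e \<subseteq> S}"
  let ?K = "(\<Union>v\<in>{..<n}. (\<lambda>(a, b). {a, b}) ` (nbr E v \<times> nbr E v))"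
  have fin: "finite S" using S by (rule finite_subset) simp
  have "?P \<subseteq> ?O \<union> ?K"
  proof
    fix e assume "e \<in> ?P"
    then obtain a b where ab: "e = {a, b}" "a \<noteq> b" "a \<in> S" "b \<in> S" by (auto simp: card_2_iff)
    have nE: "b \<notin> nbr E a" using ind ab by (auto simp: nbr_def)
    show "e \<in> ?O \<union> ?K"
    proof (cases "nbr E a \<inter> nbr E b = {}")
      case True
      then have "e \<in> open_pairs n E" using open_iff[OF V, of a b] ab nE S by auto
      then show ?thesis using ab by simp
    next
      case False
      then obtain v where v: "v \<in> nbr E a" "v \<in> nbr E b" by blast
      then have "a \<in> nbr E v" "b \<in> nbr E v" "v < n" using nbr_sym valid_nbr(2)[OF V] by blast+
      then show ?thesis using ab by (intro UnI2 UN_I[of v]) auto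
    qed
  qed
  then have "card ?P \<le> card (?O \<union> ?K)"
    by (rule card_mono[rotated]) (use finite_nbr[OF V] in auto)
  also have "\<dots> \<le> card ?O + card ?K" by (rule card_Un_le)
  also have "card ?K \<le> (\<Sum>v<n. card ((\<lambda>(a, b). {a, b}) ` (nbr E v \<times> nbr E v)))"
    by (rule card_UN_le) simp
  also have "\<dots> \<le> (\<Sum>v<n. x\<^sup>2)"
  proof (rule sum_mono)
    fix v assume "v \<in> {..<n}"
    have "card ((\<lambda>(a, b). {a, b}) ` (nbr E v \<times> nbr E v)) \<le> card (nbr E v \<times> nbr E v)"
      by (rule card_image_le) (simp add: finite_nbr[OF V])
    also have "\<dots> \<le> x\<^sup>2" unfolding card_cartesian_product power2_eq_square
      using deg \<open>v \<in> {..<n}\<close> by (intro mult_mono) auto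
    finally show "card ((\<lambda>(a, b). {a, b}) ` (nbr E v \<times> nbr E v)) \<le> x\<^sup>2" .
  qed
  finally show ?thesis using card_pairs_of_set[OF fin] by simp
qed

definition low_degree :: "nat \<Rightarrow> nat \<Rightarrow> nat set list \<Rightarrow> bool" where
  "low_degree n x l \<longleftrightarrow> (\<forall>v<n. card (nbr (set l) v) \<le> x)"

text \<open>While S contains no edge, the conditions on k leave at least k^2 / 8 open pairs inside
  S, out of at most n^2 / 2 in all. So each step puts an edge into S with probability at least k^2 /
  (4 n^2).\<close>

lemma independent_prob:
  assumes n: "0 < n" and S: "S \<subseteq> {..<n}" "card S = k" and k: "8 * (n * x\<^sup>2) \<le> k\<^sup>2" "4 \<le> k"
  shows "measure_pmf.prob (hist n i) {l. length l = i \<and> hereditary (low_degree n x) l \<and> \<not> (\<exists>e\<in>set l. e \<subseteq> S)}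
    \<le> exp (- (real i * (real k)\<^sup>2 / (4 * (real n)\<^sup>2)))"
proof -
  define p where "p = (real k)\<^sup>2 / (4 * (real n)\<^sup>2)"
  define f where "f l = (if hereditary (low_degree n x) l \<and> \<not> (\<exists>e\<in>set l. e \<subseteq> S) then exp (p * real (length l)) else 0)" for l
  have "measure_pmf.prob (hist n i) {l. length l = i \<and> hereditary (low_degree n x) l \<and> \<not> (\<exists>e\<in>set l. e \<subseteq> S)} \<le> f [] / exp (p * real i)"
  proof (rule hist_markov)
    fix l show "0 \<le> f l" by (simp add: f_def)
  next
    fix l assume l: "wf_hist n l"
    let ?O = "open_pairs n (set l)"
    show "(\<Sum>e\<in>?O. f (e # l)) \<le> f l * real (nopen n (set l))"
    proof (cases "low_degree n x l \<and> hereditary (low_degree n x) l \<and> \<not> (\<exists>e\<in>set l. e \<subseteq> S)")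
      case False
      then have "f (e # l) = 0" for e by (auto simp: f_def)
      moreover have "0 \<le> f l" by (simp add: f_def)
      ultimately show ?thesis by simp
    next
      case True
      let ?OS = "{e \<in> ?O. e \<subseteq> S}"
      have "k * (k - 1) \<le> 2 * card ?OS + 2 * (n * x\<^sup>2)"
        using open_in_independent[OF wf_hist_valid[OF l] S(1), of x] True S(2) by (simp add: low_degree_def)
      then have "real (k * (k - 1)) \<le> 2 * real (card ?OS) + 2 * real (n * x\<^sup>2)"
        unfolding of_nat_le_iff[where 'a = real, symmetric] by (simp only: of_nat_add of_nat_mult of_nat_numeral)
      moreover have "real (k * (k - 1)) = (real k)\<^sup>2 - real k" using k(2) by (simp add: of_nat_diff power2_eq_square algebra_simps)
      moreover have "real (8 * (n * x\<^sup>2)) \<le> real (k\<^sup>2)" using k(1) by (rule of_nat_mono)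
      moreover have "4 * real k \<le> (real k)\<^sup>2" unfolding power2_eq_square using k(2) by (intro mult_right_mono) auto
      ultimately have "(real k)\<^sup>2 / 8 \<le> real (card ?OS)" by simp
      moreover have "p * real (nopen n (set l)) \<le> p * ((real n)\<^sup>2 / 2)"
        by (rule mult_left_mono[OF nopen_le]) (simp add: p_def)
      moreover have "p * ((real n)\<^sup>2 / 2) = (real k)\<^sup>2 / 8" using n by (simp add: p_def)
      ultimately have OS: "p * real (nopen n (set l)) \<le> real (card ?OS)" by linarith
      have "(\<Sum>e\<in>?O. f (e # l)) = (\<Sum>e\<in>?O. if e \<subseteq> S then 0 else exp (p * real (length l)) * exp p)"
        using True by (intro sum.cong) (auto simp: f_def exp_add[symmetric] algebra_simps)
      also have "\<dots> = real (card {e \<in> ?O. \<not> e \<subseteq> S}) * (exp (p * real (length l)) * exp p)"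
        by (simp add: sum.If_cases Int_def)
      also have "card {e \<in> ?O. \<not> e \<subseteq> S} = nopen n (set l) - card ?OS"
      proof -
        have "{e \<in> ?O. \<not> e \<subseteq> S} = ?O - ?OS" by auto
        then show ?thesis by (simp add: nopen_def card_Diff_subset)
      qed
      also have "real (nopen n (set l) - card ?OS) = real (nopen n (set l)) - real (card ?OS)"
        by (rule of_nat_diff) (auto simp: nopen_def intro: card_mono)
      also have "(real (nopen n (set l)) - real (card ?OS)) * (exp (p * real (length l)) * exp p)
          \<le> (real (nopen n (set l)) * exp (- p)) * (exp (p * real (length l)) * exp p)"
      proof (rule mult_right_mono)
        have "real (nopen n (set l)) * (1 + (- p)) \<le> real (nopen n (set l)) * exp (- p)"
          by (intro mult_left_mono exp_ge_add_one_self) simp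
        then show "real (nopen n (set l)) - real (card ?OS) \<le> real (nopen n (set l)) * exp (- p)"
          using OS by (simp add: algebra_simps)
      qed simp
      also have "\<dots> = f l * real (nopen n (set l))" using True by (simp add: f_def exp_minus)
      finally show ?thesis .
    qed
  qed (auto simp: f_def)
  also have "f [] = 1" by (simp add: f_def)
  also have "1 / exp (p * real i) = exp (- (real i * (real k)\<^sup>2 / (4 * (real n)\<^sup>2)))"
    by (simp add: p_def exp_minus inverse_eq_divide mult.commute)
  finally show ?thesis .
qed

definition dense_start :: "nat \<Rightarrow> nat \<Rightarrow> nat set list \<Rightarrow> bool" where
  "dense_start n k l \<longleftrightarrow> 2 * card (squares n (set l)) \<le> n \<and>
    (\<forall>S. S \<subseteq> {..<n} \<longrightarrow> card S = k \<longrightarrow> (\<exists>e\<in>set l. e \<subseteq> S))"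

text \<open>\<open>independent_prob\<close> uses low degrees at all times before i, whence the
  factor \<open>Suc i\<close> in the second term; n^k bounds the number of candidate sets.\<close>

lemma sparse_start_prob:
  assumes n: "0 < n" and k: "8 * (n * x\<^sup>2) \<le> k\<^sup>2" "4 \<le> k"
  shows "measure_pmf.prob (hist n i) {l. length l = i \<and> hereditary (sparse n) l \<and> \<not> dense_start n k l}
    \<le> 2 * real n ^ 3 * (real i * (8 / (real n)\<^sup>2)) ^ 4
      + real (Suc i) * (real n * (exp (8 * real i / real n) / 2 ^ x))
      + real n ^ k * exp (- (real i * (real k)\<^sup>2 / (4 * (real n)\<^sup>2)))"
proof -
  let ?D = "hist n i"
  let ?A = "{l. hereditary (sparse n) l \<and> n < 2 * card (squares n (set l))}"
  let ?B = "{l. \<exists>j\<le>i. (\<lambda>l. hereditary (sparse n) l \<and> \<not> low_degree n x l) (drop (length l - j) l)}"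
  let ?SS = "{S. S \<subseteq> {..<n} \<and> card S = k}"
  let ?C = "{l. \<exists>S\<in>?SS. length l = i \<and> hereditary (low_degree n x) l \<and> \<not> (\<exists>e\<in>set l. e \<subseteq> S)}"
  have her: "hereditary P (tail_at l j)" if "hereditary P l" "j \<le> length l" for P and l :: "nat set list" and j
    using that
  proof (induction l arbitrary: j)
    case (Cons e l)
    then show ?case by (cases "j = Suc (length l)") (auto simp: tail_at_Cons, simp add: tail_at_def)
  qed simp
  have "{l. length l = i \<and> hereditary (sparse n) l \<and> \<not> dense_start n k l} \<subseteq> ?A \<union> ?B \<union> ?C"
  proof
    fix l assume "l \<in> {l. length l = i \<and> hereditary (sparse n) l \<and> \<not> dense_start n k l}"
    then have l: "length l = i" "hereditary (sparse n) l" "\<not> dense_start n k l" by auto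
    show "l \<in> ?A \<union> ?B \<union> ?C"
    proof (rule ccontr)
      assume "l \<notin> ?A \<union> ?B \<union> ?C"
      then have no: "l \<notin> ?A" "l \<notin> ?B" "l \<notin> ?C" by auto
      have "low_degree n x (tail_at l j)" if "j < length l" for j
        using no(2) her[OF l(2), of j] that l(1) by (auto simp: tail_at_def)
      then have "hereditary (low_degree n x) l" by (rule hereditaryI)
      then show False using no(1,3) l unfolding dense_start_def by (auto simp: not_less)
    qed
  qed
  then have "measure_pmf.prob ?D {l. length l = i \<and> hereditary (sparse n) l \<and> \<not> dense_start n k l} \<le> measure_pmf.prob ?D (?A \<union> ?B \<union> ?C)"
    by (intro measure_pmf.finite_measure_mono) auto
  also have "\<dots> \<le> measure_pmf.prob ?D (?A \<union> ?B) + measure_pmf.prob ?D ?C" by (rule measure_Un_le) auto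
  also have "measure_pmf.prob ?D (?A \<union> ?B) \<le> measure_pmf.prob ?D ?A + measure_pmf.prob ?D ?B" by (rule measure_Un_le) auto
  also have "measure_pmf.prob ?D ?A \<le> 2 * real n ^ 3 * (real i * (8 / (real n)\<^sup>2)) ^ 4" by (rule many_squares_prob[OF n])
  also have "measure_pmf.prob ?D ?B \<le> (\<Sum>j\<le>i. measure_pmf.prob (hist n j) {l. hereditary (sparse n) l \<and> \<not> low_degree n x l})"
    by (rule hist_union_tails)
  also have "\<dots> \<le> (\<Sum>j\<le>i. real n * (exp (8 * real i / real n) / 2 ^ x))"
  proof (rule sum_mono)
    fix j assume j: "j \<in> {..i}"
    have "{l. hereditary (sparse n) l \<and> \<not> low_degree n x l} = {l. \<exists>u\<in>{..<n}. hereditary (sparse n) l \<and> x < card (nbr (set l) u)}"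
      by (auto simp: low_degree_def not_le)
    also have "measure_pmf.prob (hist n j) \<dots> \<le> real (card {..<n}) * (exp (8 * real i / real n) / 2 ^ x)"
    proof (rule prob_union_bound)
      fix u
      have "measure_pmf.prob (hist n j) {l. hereditary (sparse n) l \<and> x < card (nbr (set l) u)} \<le> exp (8 * real j / real n) / 2 ^ x"
        by (rule high_degree_prob[OF n])
      also have "\<dots> \<le> exp (8 * real i / real n) / 2 ^ x" using j by (auto intro!: divide_right_mono)
      finally show "measure_pmf.prob (hist n j) {l. hereditary (sparse n) l \<and> x < card (nbr (set l) u)} \<le> exp (8 * real i / real n) / 2 ^ x" .
    qed simp
    finally show "measure_pmf.prob (hist n j) {l. hereditary (sparse n) l \<and> \<not> low_degree n x l} \<le> real n * (exp (8 * real i / real n) / 2 ^ x)"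
      by simp
  qed
  also have "\<dots> = real (Suc i) * (real n * (exp (8 * real i / real n) / 2 ^ x))" by simp
  also have "measure_pmf.prob ?D ?C \<le> real (card ?SS) * exp (- (real i * (real k)\<^sup>2 / (4 * (real n)\<^sup>2)))"
    by (rule prob_union_bound) (use independent_prob[OF n _ _ k] in auto)
  also have "\<dots> \<le> real n ^ k * exp (- (real i * (real k)\<^sup>2 / (4 * (real n)\<^sup>2)))"
  proof (rule mult_right_mono)
    have "card ?SS = n choose k" using n_subsets[of "{..<n}" k] by simp
    also have "\<dots> \<le> n ^ k" by (cases "k \<le> n") (auto intro: binomial_le_pow simp: binomial_eq_0)
    finally show "real (card ?SS) \<le> real n ^ k" by (metis of_nat_le_iff of_nat_power)
  qed simp
  finally show ?thesis by simp
qed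

section \<open>Choice of the parameters\<close>

text \<open>Here \<open>p = n powr (\<epsilon> / 100)\<close> and \<open>c = 100 / \<epsilon>\<close>; all error parameters are powers of \<open>p\<close>.\<close>

lemma params_eventually:
  fixes c :: real and M :: nat
  assumes c: "400 \<le> c" and M: "2 \<le> M"
  defines "T \<equiv> \<lambda>p. sqrt (c * ln p)" and "B \<equiv> 100 * (1 + 4 * c)"
  shows "\<forall>\<^sub>F p :: real in at_top. 2 \<le> p"
    and "\<forall>\<^sub>F p in at_top. 1 \<le> T p"
    and "\<forall>\<^sub>F p in at_top. 10 ^ 4 * T p ^ 3 / p ^ 600 \<le> 1 / p ^ 100"
    and "\<forall>\<^sub>F p :: real in at_top. 2 * (1 / (p ^ 400 - 1)\<^sup>2) \<le> 1 / p ^ 40"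
    and "\<forall>\<^sub>F p in at_top. (1 + 4 * c) * (8 * (1 / p ^ 40) * p) * (p * exp (B * T p)) \<le> 1 / p ^ 35"
    and "\<forall>\<^sub>F p in at_top. 32 * (1 / p ^ 35) * (1 / p ^ 30) + 10 ^ 4 * (T p)\<^sup>2 * (1 / p ^ 100) * (p ^ 5 + 1 + 3) \<le> 1 / p ^ 40"
    and "\<forall>\<^sub>F p in at_top. 2 * (1 / p ^ 40) + T p * (100 * (1 / p ^ 35) + 1 / p ^ 40) \<le> 1 / p ^ 30"
    and "\<forall>\<^sub>F p in at_top. 1 / p ^ 40 + T p * (2 * (1 / p ^ 40) + T p * (100 * (1 / p ^ 35) + 1 / p ^ 40) + 100 * T p * (1 / p ^ 35)) \<le> 1 / p ^ 30"
    and "\<forall>\<^sub>F p :: real in at_top. (1 + 1 / p ^ 20) * (1 + 1 / p ^ 30) \<le> 1 + 1 / p ^ 10"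
    and "\<forall>\<^sub>F p in at_top. 1 / p ^ 100 * (4 * 10 ^ 6 * T p ^ 4 * (c * ln p) / (1 / p ^ 20)) \<le> (1 / p ^ 10)\<^sup>2"
    and "\<forall>\<^sub>F p :: real in at_top. 4 * (1 / p ^ 10) \<le> 3 * (1 / p ^ 4)\<^sup>2"
    and "\<forall>\<^sub>F p in at_top. 8 * (1 + 4 * c) * (3 * (4 * (5 / p ^ 4) powr (1 / real M) * (4 * c * ln p + 1) + 2 * p / p\<^sup>2)) \<le> 1 / c"
    and "\<forall>\<^sub>F p in at_top. 20 * T p * (1 / p ^ 30) + 10 * T p * (1 / p ^ 100) + 2 * (1 / p ^ 100) \<le> 1 / p ^ 25"
    and "\<forall>\<^sub>F p in at_top. 200 * T p * (1 / p ^ 30) \<le> 1 / p ^ 20"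
proof -
  have c0: "0 < c" using c by simp
  have B0: "0 < B" using c by (simp add: B_def)
  show "\<forall>\<^sub>F p :: real in at_top. 2 \<le> p" by (rule eventually_ge_at_top)
  show "\<forall>\<^sub>F p in at_top. 1 \<le> T p" unfolding T_def using c0 by real_asymp
  show "\<forall>\<^sub>F p in at_top. 10 ^ 4 * T p ^ 3 / p ^ 600 \<le> 1 / p ^ 100" unfolding T_def using c0 by real_asymp
  show "\<forall>\<^sub>F p :: real in at_top. 2 * (1 / (p ^ 400 - 1)\<^sup>2) \<le> 1 / p ^ 40" by real_asymp
  show "\<forall>\<^sub>F p in at_top. (1 + 4 * c) * (8 * (1 / p ^ 40) * p) * (p * exp (B * T p)) \<le> 1 / p ^ 35"
    unfolding T_def using c0 B0 by real_asymp
  show "\<forall>\<^sub>F p in at_top. 32 * (1 / p ^ 35) * (1 / p ^ 30) + 10 ^ 4 * (T p)\<^sup>2 * (1 / p ^ 100) * (p ^ 5 + 1 + 3) \<le> 1 / p ^ 40"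
    unfolding T_def using c0 by real_asymp
  show "\<forall>\<^sub>F p in at_top. 2 * (1 / p ^ 40) + T p * (100 * (1 / p ^ 35) + 1 / p ^ 40) \<le> 1 / p ^ 30"
    unfolding T_def using c0 by real_asymp
  show "\<forall>\<^sub>F p in at_top. 1 / p ^ 40 + T p * (2 * (1 / p ^ 40) + T p * (100 * (1 / p ^ 35) + 1 / p ^ 40) + 100 * T p * (1 / p ^ 35)) \<le> 1 / p ^ 30"
    unfolding T_def using c0 by real_asymp
  show "\<forall>\<^sub>F p :: real in at_top. (1 + 1 / p ^ 20) * (1 + 1 / p ^ 30) \<le> 1 + 1 / p ^ 10" by real_asymp
  show "\<forall>\<^sub>F p in at_top. 1 / p ^ 100 * (4 * 10 ^ 6 * T p ^ 4 * (c * ln p) / (1 / p ^ 20)) \<le> (1 / p ^ 10)\<^sup>2"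
    unfolding T_def using c0 by real_asymp
  show "\<forall>\<^sub>F p :: real in at_top. 4 * (1 / p ^ 10) \<le> 3 * (1 / p ^ 4)\<^sup>2" by real_asymp
  show "\<forall>\<^sub>F p in at_top. 8 * (1 + 4 * c) * (3 * (4 * (5 / p ^ 4) powr (1 / real M) * (4 * c * ln p + 1) + 2 * p / p\<^sup>2)) \<le> 1 / c"
  proof -
    \<comment> \<open>A fixed positive exponent: p^(-4h) beats ln p however small h is, so the gain
      tends to 0 for every constant M.\<close>
    define h where "h = 1 / real M"
    have h: "0 < h" using M by (simp add: h_def)
    have A: "((\<lambda>p. 4 * (5 / p ^ 4) powr h * (4 * c * ln p + 1)) \<longlongrightarrow> 0) at_top"
      using c0 h by real_asymp
    have B: "((\<lambda>p :: real. 2 * p / p\<^sup>2) \<longlongrightarrow> 0) at_top" by real_asymp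
    have "((\<lambda>p. 8 * (1 + 4 * c) * (3 * (4 * (5 / p ^ 4) powr h * (4 * c * ln p + 1) + 2 * p / p\<^sup>2))) \<longlongrightarrow> 8 * (1 + 4 * c) * (3 * (0 + 0))) at_top"
      by (intro tendsto_mult tendsto_const tendsto_add A B)
    then have "((\<lambda>p. 8 * (1 + 4 * c) * (3 * (4 * (5 / p ^ 4) powr h * (4 * c * ln p + 1) + 2 * p / p\<^sup>2))) \<longlongrightarrow> 0) at_top"
      by simp
    then have "\<forall>\<^sub>F p in at_top. 8 * (1 + 4 * c) * (3 * (4 * (5 / p ^ 4) powr h * (4 * c * ln p + 1) + 2 * p / p\<^sup>2)) < 1 / c"
      using c0 by (intro order_tendstoD) auto
    then show ?thesis unfolding h_def by eventually_elim simp
  qed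
  show "\<forall>\<^sub>F p in at_top. 20 * T p * (1 / p ^ 30) + 10 * T p * (1 / p ^ 100) + 2 * (1 / p ^ 100) \<le> 1 / p ^ 25"
    unfolding T_def using c0 by real_asymp
  show "\<forall>\<^sub>F p in at_top. 200 * T p * (1 / p ^ 30) \<le> 1 / p ^ 20"
    unfolding T_def using c0 by real_asymp
qed

text \<open>With \<nu> = p^(-40) and jumps of order p^(-95) up to logarithms, the exponent \<nu>^2 /
  b0 is about p^15, and p^5 beats 32 c ln p. Both overcome the polynomial prefactors, where p^(2c)
  is n^2.\<close>

lemma failure_bound:
  fixes c :: real assumes c: "400 \<le> c"
  shows "((\<lambda>p. 2 * p powr (2 * c) * (p powr (2 * c) * (6 * exp (- ((1 / p ^ 40)\<^sup>2 / (800 * sqrt (c * ln p) ^ 3 *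
      (64 * sqrt (c * ln p) * (1 / p ^ 100) * (p ^ 5 + 3)))))
      + exp (32 * (c * ln p) - p ^ 5)) + 9 / p powr (6 * c))) \<longlongrightarrow> 0) at_top"
proof -
  have "0 < c" using c by simp
  then show ?thesis by real_asymp
qed


text \<open>Up to scaled time 1/4 the logarithm of the density is at least -1/4 - 1/8 > -1, and exp
  (-1) >= 1/4.\<close>

lemma (in tracking_params) sparse_of_gd:
  assumes "gd l" "real (length l) * s \<le> 1 / 4" shows "sparse n l"
proof -
  let ?Q = "2 * real (nopen n (set l)) / (real n)\<^sup>2"
  have n0: "0 < real n" using n2 by simp
  have Q: "0 < ?Q" using assms(1) n0 by (simp add: gd_def good_def)
  have "(real (length l) * s)\<^sup>2 \<le> (1 / 4)\<^sup>2" using assms(2) s_pos by (intro power_mono) auto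
  moreover have "- \<zeta> \<le> ln ?Q + 4 * (real (length l) * s)\<^sup>2"
    using abs_le_D2[of "ln ?Q + 4 * (real (length l) * s)\<^sup>2" \<zeta>] assms(1) by (simp add: gd_def good_def)
  ultimately have "- 1 \<le> ln ?Q" using zeta by (simp add: power2_eq_square)
  then have "exp (- 1) \<le> ?Q" using Q by (simp add: ln_ge_iff)
  moreover have "1 / 4 \<le> exp (- 1 :: real)" using exp_le by (simp add: exp_minus field_simps)
  ultimately have "1 / 4 \<le> ?Q" by linarith
  then show ?thesis using n0 by (simp add: sparse_def field_simps)
qed

text \<open>One history carries both events: tracking up to m makes all graphs before time i sparse,
  so the estimates for the early graph apply to its tail of length i, whose edges are still present
  at time m.\<close>

lemma (in tracking_params) success_prob:
  assumes im: "i \<le> m" and it: "real i * s \<le> 1 / 4" and k: "8 * (n * x\<^sup>2) \<le> k\<^sup>2" "4 \<le> k"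
    and K: "K \<le> real n / (2 * real k)"
  shows "1 - (real m + 1) * p0 - (2 * real n ^ 3 * (real i * (8 / (real n)\<^sup>2)) ^ 4
      + real (Suc i) * (real n * (exp (8 * real i / real n) / 2 ^ x))
      + real n ^ k * exp (- (real i * (real k)\<^sup>2 / (4 * (real n)\<^sup>2))))
    \<le> measure_pmf.prob (triangle_free_process n m) {Some E |E. K \<le> h5f ({..<n}, E)}"
proof -
  let ?D = "hist n m"
  let ?q = "2 * real n ^ 3 * (real i * (8 / (real n)\<^sup>2)) ^ 4
      + real (Suc i) * (real n * (exp (8 * real i / real n) / 2 ^ x))
      + real n ^ k * exp (- (real i * (real k)\<^sup>2 / (4 * (real n)\<^sup>2)))"
  let ?F = "{l. \<not> (length l = m \<and> (\<forall>h\<le>m. gd (tail_at l h)))}"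
  let ?R = "{l. length l = i \<and> hereditary (sparse n) l \<and> \<not> dense_start n k l}"
  let ?G = "{l. length l = m \<and> K \<le> h5f ({..<n}, set l)}"
  have n0: "0 < n" using n2 by simp
  have R: "measure_pmf.prob ?D ((\<lambda>l. tail_at l i) -` ?R) \<le> ?q"
  proof -
    have "measure_pmf.prob ?D ((\<lambda>l. tail_at l i) -` ?R) = measure_pmf.prob (hist n i) ?R"
      unfolding hist_tail[OF im, symmetric] tail_at_def by (simp only: measure_map_pmf)
    then show ?thesis using sparse_start_prob[OF n0 k, of i] by simp
  qed
  have good: "l \<in> ?G" if l: "l \<in> set_pmf ?D" "l \<notin> ?F" "l \<notin> (\<lambda>l. tail_at l i) -` ?R" for l
  proof -
    have V: "valid n (set l)" using set_pmf_hist[OF l(1)] wf_hist_valid by blast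
    have lm: "length l = m" and g: "gd (tail_at l h)" if "h \<le> m" for h using l(2) that by auto
    have li: "length (tail_at l i) = i" using lm im by (simp add: length_tail_at)
    have "hereditary (sparse n) (tail_at l i)"
    proof (rule hereditaryI)
      fix h assume h: "h < length (tail_at l i)"
      then have "tail_at (tail_at l i) h = tail_at l h"
        using drop_tail_at[of i l "i - h"] lm im li by (simp add: tail_at_def)
      moreover have "sparse n (tail_at l h)"
      proof (rule sparse_of_gd)
        show "gd (tail_at l h)" using g h li im by simp
        have "real h * s \<le> real i * s" using h li s_pos by (intro mult_right_mono) auto
        then show "real (length (tail_at l h)) * s \<le> 1 / 4" using it h li im lm by (simp add: length_tail_at)
      qed
      ultimately show "sparse n (tail_at (tail_at l i) h)" by simp
    qed
    then have d: "dense_start n k (tail_at l i)" using l(3) li by simp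
    have "real n / (2 * real k) \<le> h5f ({..<n}, set l)"
      by (rule h5f_ge[OF V, of "set (tail_at l i)"])
        (use d k in \<open>auto simp: dense_start_def tail_at_def dest: in_set_dropD\<close>)
    then show ?thesis using K lm im by simp
  qed
  have "1 = measure_pmf.prob ?D UNIV" by simp
  also have "\<dots> \<le> measure_pmf.prob ?D ((?F \<union> (\<lambda>l. tail_at l i) -` ?R) \<union> ?G)"
    by (rule measure_pmf.finite_measure_mono_AE) (use good in \<open>auto simp: AE_measure_pmf_iff\<close>)
  also have "\<dots> \<le> measure_pmf.prob ?D (?F \<union> (\<lambda>l. tail_at l i) -` ?R) + measure_pmf.prob ?D ?G"
    by (rule measure_Un_le) auto
  also have "measure_pmf.prob ?D (?F \<union> (\<lambda>l. tail_at l i) -` ?R) \<le> measure_pmf.prob ?D ?F + measure_pmf.prob ?D ((\<lambda>l. tail_at l i) -` ?R)"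
    by (rule measure_Un_le) auto
  also have "measure_pmf.prob ?D ?F \<le> (real m + 1) * p0" by (rule tracking_prob)
  also note R
  also have "measure_pmf.prob ?D ?G = measure_pmf.prob (triangle_free_process n m) {Some E |E. K \<le> h5f ({..<n}, E)}"
    unfolding process_hist measure_map_pmf by (rule arg_cong2[of _ _ _ _ measure]) auto
  finally show ?thesis by simp
qed

text \<open>i, x, k and K are quantified inside the eventuality so that they may be chosen depending
  on n, while the tracking failure r does not involve them.\<close>

lemma process_success:
  fixes \<epsilon> :: real assumes eps: "0 < \<epsilon>" "\<epsilon> < 1 / 4"
  shows "\<exists>r. r \<longlonglongrightarrow> 0 \<and> (\<forall>\<^sub>F n in sequentially. \<forall>i x k K.
    i \<le> i_max \<epsilon> n \<longrightarrow> real i / rn n \<le> 1 / 4 \<longrightarrow> 8 * (n * x\<^sup>2) \<le> k\<^sup>2 \<longrightarrow> 4 \<le> k \<longrightarrow> K \<le> real n / (2 * real k) \<longrightarrow>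
    1 - r n - (2 * real n ^ 3 * (real i * (8 / (real n)\<^sup>2)) ^ 4
      + real (Suc i) * (real n * (exp (8 * real i / real n) / 2 ^ x))
      + real n ^ k * exp (- (real i * (real k)\<^sup>2 / (4 * (real n)\<^sup>2)))) \<le> prob_h5f_ge \<epsilon> n K)"
proof -
  \<comment> \<open>With p = n^(1/c) this gives n^\<epsilon> = p^100, the reason for
    \<open>\<gamma>\<close> = 1 / p^100. Since \<epsilon> < 1/4, c >= 400, so n >= p^400, sqrt n >=
    p^200 and \<open>rn n\<close> >= p^600.\<close>
  define c where "c = 100 / \<epsilon>"
  \<comment> \<open>M >= 2 c gives n^2 <= p^M, so passing between l^M and pointwise bounds costs
    only N = p.\<close>
  define M where "M = 2 * nat \<lceil>c\<rceil>"
  define T where "T p = sqrt (c * ln p)" for p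
  define B where "B = 100 * (1 + 4 * c)"
  define P where "P n = real n powr (1 / c)" for n
  define R where "R p = 2 * p powr (2 * c) * (p powr (2 * c) * (6 * exp (- ((1 / p ^ 40)\<^sup>2 / (800 * T p ^ 3 *
      (64 * T p * (1 / p ^ 100) * (p ^ 5 + 3)))))
      + exp (32 * (c * ln p) - p ^ 5)) + 9 / p powr (6 * c))" for p
  have c: "400 \<le> c" using eps by (simp add: c_def field_simps)
  have M: "2 \<le> M" "even M" "2 * c \<le> real M"
  proof -
    have "c \<le> real (nat \<lceil>c\<rceil>)" by (rule real_nat_ceiling_ge)
    then show "2 * c \<le> real M" by (simp add: M_def)
    then have "2 \<le> real M" using c by linarith
    then show "2 \<le> M" by simp
    show "even M" by (simp add: M_def)
  qed
  have Pinf: "filterlim P at_top sequentially"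
  proof -
    have "0 < c" using c by simp
    then show ?thesis unfolding P_def by real_asymp
  qed
  have "(R \<longlongrightarrow> 0) at_top" unfolding R_def T_def by (rule failure_bound[OF c])
  then have lim: "(\<lambda>n. R (P n)) \<longlonglongrightarrow> 0" by (rule filterlim_compose[OF _ Pinf])
  note ev = params_eventually[OF c M(1), folded T_def B_def, THEN eventually_compose_filterlim[OF _ Pinf]]
  have "\<forall>\<^sub>F n in sequentially. \<forall>i x k K.
    i \<le> i_max \<epsilon> n \<longrightarrow> real i / rn n \<le> 1 / 4 \<longrightarrow> 8 * (n * x\<^sup>2) \<le> k\<^sup>2 \<longrightarrow> 4 \<le> k \<longrightarrow> K \<le> real n / (2 * real k) \<longrightarrow>
    1 - R (P n) - (2 * real n ^ 3 * (real i * (8 / (real n)\<^sup>2)) ^ 4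
      + real (Suc i) * (real n * (exp (8 * real i / real n) / 2 ^ x))
      + real n ^ k * exp (- (real i * (real k)\<^sup>2 / (4 * (real n)\<^sup>2)))) \<le> prob_h5f_ge \<epsilon> n K"
    using ev
  proof eventually_elim
    case (elim n)
    note E = elim
    define p where "p = P n"
    define m where "m = i_max \<epsilon> n"
    \<comment> \<open>Large enough for exp (32 T^2 - z) to survive a union bound over pairs and
      times, small enough for \<gamma> z to stay near p^(-95).\<close>
    define z where "z = nat \<lceil>p ^ 5\<rceil>"
    \<comment> \<open>Enough binary digits to have 2^L >= p^2, so the undecomposed rest 2 N / 2^L is
      at most 2 / p.\<close>
    define L where "L = nat \<lceil>4 * c * ln p\<rceil>"
    note E = E[folded p_def]
    have p2: "2 \<le> p" by (rule E(1))
    have n0: "0 < n" using p2 by (cases "n = 0") (auto simp: p_def P_def)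
    have np: "real n = p powr c" using n0 c by (simp add: p_def P_def powr_powr)
    have n400: "p ^ 400 \<le> real n"
    proof -
      have "p powr 400 \<le> p powr c" using p2 c by (intro powr_mono) auto
      then show ?thesis using p2 by (simp add: np powr_numeral)
    qed
    have pw: "p ^ j \<le> p ^ k" if "j \<le> k" for j k using p2 that by (intro power_increasing) auto
    have pp: "1 \<le> p ^ j" "0 < p ^ j" for j using p2 by auto
    have ip: "0 < 1 / p ^ j" "0 \<le> 1 / p ^ j" "1 / p ^ j \<le> 1" for j using pp[of j] by auto
    have inv: "1 / p ^ k \<le> 1 / p ^ j" if "j \<le> k" for j k using pw[OF that] pp by (intro divide_left_mono) auto
    have inv2: "1 / p ^ k \<le> 1 / 2 ^ k" for k using p2 by (intro divide_left_mono power_mono) auto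
    have lnn: "ln (real n) = c * ln p" using p2 by (simp add: np ln_powr)
    have T1: "1 \<le> T p" by (rule E(2))
    have T2: "(T p)\<^sup>2 = c * ln p"
    proof -
      have "0 \<le> c * ln p" using p2 c by simp
      then show ?thesis by (simp add: T_def)
    qed
    have sq200: "p ^ 200 \<le> sqrt (real n)"
    proof (rule real_le_rsqrt)
      show "(p ^ 200)\<^sup>2 \<le> real n" using n400 by (simp add: power_mult[symmetric])
    qed
    have rn600: "p ^ 600 \<le> rn n"
    proof -
      have "p ^ 400 * p ^ 200 \<le> real n * sqrt (real n)"
        by (rule mult_mono[OF n400 sq200]) (use pp in \<open>auto intro: less_imp_le\<close>)
      then show ?thesis by (simp add: rn_def power_add[symmetric])
    qed
    have rn0: "0 < rn n" using rn600 pp(2)[of 600] by linarith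
    have z: "p ^ 5 \<le> real z" "real z \<le> p ^ 5 + 1" using pp(2)[of 5] unfolding z_def by linarith+
    have tmT: "t_max \<epsilon> n \<le> T p" "(2 * t_max \<epsilon> n)\<^sup>2 = (1 / 2 - \<epsilon>) * ln (real n)" "0 \<le> t_max \<epsilon> n"
    proof -
      have l0: "0 \<le> ln (real n)" using n0 by simp
      have "sqrt ((1 / 2 - \<epsilon>) * ln (real n)) \<le> sqrt (1 * ln (real n))"
        using eps l0 by (intro real_sqrt_le_mono mult_right_mono) auto
      moreover have "0 \<le> sqrt ((1 / 2 - \<epsilon>) * ln (real n))" using eps l0 by simp
      ultimately show "t_max \<epsilon> n \<le> T p" "0 \<le> t_max \<epsilon> n" unfolding t_max_def T_def lnn mult_1 by linarith+
      show "(2 * t_max \<epsilon> n)\<^sup>2 = (1 / 2 - \<epsilon>) * ln (real n)" using eps l0 by (simp add: t_max_def)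
    qed
    have rnp: "rn n = real n powr (3 / 2)"
    proof -
      have "real n powr (1 + 1 / 2) = real n powr 1 * real n powr (1 / 2)" by (rule powr_add)
      then show ?thesis using n0 by (simp add: rn_def powr_half_sqrt)
    qed
    have mle: "real m \<le> t_max \<epsilon> n * rn n"
      unfolding m_def i_max_def rnp using tmT(3) by simp
    have ms: "real m * (1 / rn n) \<le> t_max \<epsilon> n" using mle rn0 by (simp add: field_simps)
    interpret tracking n "T p" "1 / p ^ 30" "1 / p ^ 100" "1 / p ^ 25" z
    proof
      have "2 \<le> p ^ 400" using p2 pw[of 1 400] by simp
      then show "2 \<le> n" using n400 by linarith
      show "1 \<le> T p" by (rule T1)
      show "0 \<le> 1 / p ^ 30" "0 < 1 / p ^ 100" by (rule ip)+
      show "1 / p ^ 30 \<le> 1 / 2" "1 / p ^ 100 \<le> 1 / 2" using inv2[of 30] inv2[of 100] by auto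
      have "10 ^ 4 * T p ^ 3 / rn n \<le> 10 ^ 4 * T p ^ 3 / p ^ 600"
        using rn600 pp(2)[of 600] rn0 T1 by (intro divide_left_mono) auto
      then show "10 ^ 4 * T p ^ 3 / rn n \<le> 1 / p ^ 100" using E(3) by linarith
      have "1 / sqrt (real n) \<le> 1 / p ^ 200" using sq200 pp(2)[of 200] n0 by (intro divide_left_mono) auto
      then show "1 / sqrt (real n) \<le> 1 / p ^ 100" using inv[of 100 200] by simp
    qed
    have L: "real L \<le> 4 * c * ln p + 1" "p\<^sup>2 \<le> 2 ^ L"
    proof -
      have l0: "0 \<le> 4 * c * ln p" using p2 c by simp
      then show "real L \<le> 4 * c * ln p + 1" unfolding L_def by linarith
      have "4 * c * ln p \<le> real L" unfolding L_def by (rule real_nat_ceiling_ge)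
      moreover have "4 * ln p \<le> 4 * c * ln p" using p2 c by (intro mult_right_mono) auto
      ultimately have "4 * ln p \<le> real L" by linarith
      have "p\<^sup>2 = exp (2 * ln p)" using p2 by (simp add: exp_of_nat_mult[of 2, simplified])
      also have "\<dots> \<le> exp (real L * ln 2)"
      proof -
        have "real L * (1 / 2) \<le> real L * ln 2" using ln2_ge_two_thirds by (intro mult_left_mono) auto
        then show ?thesis using \<open>4 * ln p \<le> real L\<close> by simp
      qed
      also have "\<dots> = 2 ^ L" by (simp add: exp_of_nat_mult)
      finally show "p\<^sup>2 \<le> 2 ^ L" .
    qed
    interpret tp: tracking_params n "T p" "1 / p ^ 30" "1 / p ^ 100" "1 / p ^ 25" z m M L "1 / p ^ 40" "1 / p ^ 35" p
      "8 * (1 / p ^ 40) * p" "1 / c" "4 * c" B "1 / p ^ 10" "1 / p ^ 4" "(5 / p ^ 4) powr (1 / real M)" "1 / p ^ 20"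
      "4 * 10 ^ 6 * T p ^ 4 * ln (real n) / (1 / p ^ 20)"
    proof
      show "real m * s \<le> T p" using ms tmT(1) unfolding s_def by linarith
      show "even M" "2 \<le> M" using M by auto
      show "(real n)\<^sup>2 \<le> p ^ M"
      proof -
        have "(real n)\<^sup>2 = p powr (2 * c)" by (simp add: np power2_eq_square powr_add[symmetric])
        also have "\<dots> \<le> p powr real M" using M p2 by (intro powr_mono) auto
        finally show ?thesis using p2 by (simp add: powr_realpow)
      qed
      show "1 \<le> p" using p2 by simp
      show "0 < 1 / p ^ 40" "1 / p ^ 40 \<le> 1" by (rule ip)+
      have "2 * (1 / (real n - 1)\<^sup>2) \<le> 2 * (1 / (p ^ 400 - 1)\<^sup>2)"
      proof -
        have "1 < p ^ 400" using p2 pw[of 1 400] by simp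
        then have "0 < (p ^ 400 - 1)\<^sup>2" "(p ^ 400 - 1)\<^sup>2 \<le> (real n - 1)\<^sup>2" using n400 by (auto intro!: power_mono)
        then have "1 / (real n - 1)\<^sup>2 \<le> 1 / (p ^ 400 - 1)\<^sup>2" by (intro frac_le) auto
        then show ?thesis by simp
      qed
      then show "2 * (1 / (real n - 1)\<^sup>2) \<le> 1 / p ^ 40" using E(4) by linarith
      show "8 * (1 / p ^ 40) * p = 8 * (1 / p ^ 40) * p" ..
      show "4 * c = 4 / (1 / c)" "0 < 1 / c" using c by auto
      show "B = 100 * (1 + 4 * c)" by (rule B_def)
      have "exp (1 / c * (T p)\<^sup>2 + B * T p) = p * exp (B * T p)" using T2 c p2 by (simp add: exp_add)
      then show "(1 + 4 * c) * (8 * (1 / p ^ 40) * p) * exp (1 / c * (T p)\<^sup>2 + B * T p) \<le> 1 / p ^ 35"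
        using E(5) by simp
      show "1 / p ^ 100 \<le> 1 / p ^ 35" by (rule inv) simp
      show "32 * (1 / p ^ 35) * (1 / p ^ 30) + err \<le> 1 / p ^ 40"
      proof -
        have "err \<le> 10 ^ 4 * (T p)\<^sup>2 * (1 / p ^ 100) * (p ^ 5 + 1 + 3)"
          unfolding err_def using z(2) pp(2)[of 100] by (intro mult_left_mono) auto
        then show ?thesis using E(6) by linarith
      qed
      show "2 * (1 / p ^ 40) + T p * (100 * (1 / p ^ 35) + 1 / p ^ 40) \<le> 1 / p ^ 30" by (rule E(7))
      show "1 / p ^ 40 + T p * (2 * (1 / p ^ 40) + T p * (100 * (1 / p ^ 35) + 1 / p ^ 40) + 100 * T p * (1 / p ^ 35)) \<le> 1 / p ^ 30"
        by (rule E(8))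
      show "0 < 1 / p ^ 10" "1 / p ^ 10 \<le> 1" by (rule ip)+
      show "1 / p ^ 30 \<le> 1 / p ^ 10" by (rule inv) simp
      show "(1 + 1 / p ^ 20) * (1 + 1 / p ^ 30) \<le> 1 + 1 / p ^ 10" by (rule E(9))
      show "1 / p ^ 100 * (4 * 10 ^ 6 * T p ^ 4 * ln (real n) / (1 / p ^ 20)) \<le> (1 / p ^ 10)\<^sup>2" unfolding lnn by (rule E(10))
      show "0 < 1 / p ^ 4" by (rule ip)
      show "1 / p ^ 4 \<le> 1 / 2" using inv2[of 4] by auto
      show "4 * (1 / p ^ 10) \<le> 3 * (1 / p ^ 4)\<^sup>2" by (rule E(11))
      show "0 \<le> (5 / p ^ 4) powr (1 / real M)" by simp
      show "5 * (1 / p ^ 4) \<le> ((5 / p ^ 4) powr (1 / real M)) ^ M"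
        using M(1) pp(2)[of 4] by (simp add: powr_realpow[symmetric] powr_powr)
      show "8 * (1 + 4 * c) * (3 * (4 * (5 / p ^ 4) powr (1 / real M) * real L + 2 * p / 2 ^ L)) \<le> 1 / c"
      proof -
        have "4 * (5 / p ^ 4) powr (1 / real M) * real L + 2 * p / 2 ^ L
            \<le> 4 * (5 / p ^ 4) powr (1 / real M) * (4 * c * ln p + 1) + 2 * p / p\<^sup>2"
          using L p2 by (intro add_mono mult_left_mono divide_left_mono) auto
        then have "8 * (1 + 4 * c) * (3 * (4 * (5 / p ^ 4) powr (1 / real M) * real L + 2 * p / 2 ^ L))
            \<le> 8 * (1 + 4 * c) * (3 * (4 * (5 / p ^ 4) powr (1 / real M) * (4 * c * ln p + 1) + 2 * p / p\<^sup>2))"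
          using c by (intro mult_left_mono) auto
        then show ?thesis using E(12) by linarith
      qed
      show "20 * T p * (1 / p ^ 30) + 10 * T p * (1 / p ^ 100) + 2 * (1 / p ^ 100) \<le> 1 / p ^ 25" by (rule E(13))
      show "1 / p ^ 25 \<le> 1 / 8" using inv2[of 25] by auto
      \<comment> \<open>By the definition of the tracking time exp (4 t^2) <= n^(1/2 - \<epsilon>) =
        sqrt n / p^100; the factor 2 in the denominator leaves room for exp (1 / p^25) <= 2.\<close>
      show "exp (4 * (real m * s)\<^sup>2 + 1 / p ^ 25) / (2 * sqrt (real n)) \<le> 1 / p ^ 100"
      proof -
        have "0 \<le> real m * s" using s_pos by simp
        then have "(real m * s)\<^sup>2 \<le> (t_max \<epsilon> n)\<^sup>2" using ms unfolding s_def by (intro power_mono) auto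
        then have "4 * (real m * s)\<^sup>2 \<le> (1 / 2 - \<epsilon>) * ln (real n)" using tmT(2) by (simp add: power_mult_distrib)
        moreover have "1 / p ^ 25 \<le> ln 2" using inv2[of 25] ln2_ge_two_thirds by auto
        ultimately have "exp (4 * (real m * s)\<^sup>2 + 1 / p ^ 25) \<le> exp ((1 / 2 - \<epsilon>) * ln (real n) + ln 2)" by simp
        also have "\<dots> = 2 * sqrt (real n) * (1 / p ^ 100)"
        proof -
          have "c * \<epsilon> = 100" using eps by (simp add: c_def)
          then have "p powr (c * \<epsilon>) = p ^ 100" using p2 by (simp add: powr_numeral)
          then have pe: "real n powr \<epsilon> = p ^ 100" by (simp add: np powr_powr)
          have "exp ((1 / 2 - \<epsilon>) * ln (real n)) = real n powr (1 / 2 - \<epsilon>)" using n0 by (simp add: powr_def)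
          also have "\<dots> = sqrt (real n) / p ^ 100" using n0 by (simp add: powr_diff pe powr_half_sqrt)
          finally show ?thesis by (simp add: exp_add)
        qed
        finally show ?thesis using n0 by (simp add: field_simps)
      qed
      show "0 < 1 / p ^ 20" "1 / p ^ 20 \<le> 1" by (rule ip)+
      show "8 * (1 / p ^ 25) \<le> 1 / p ^ 20"
      proof -
        have "2 ^ 5 * p ^ 20 \<le> p ^ 5 * p ^ 20" using p2 by (intro mult_right_mono power_mono) auto
        then have "32 * p ^ 20 \<le> p ^ 25" by (simp add: power_add[symmetric])
        then have "8 * p ^ 20 \<le> p ^ 25" using pp(2)[of 20] by linarith
        then show ?thesis using pp(2)[of 20] pp(2)[of 25] by (simp add: field_simps)
      qed
      show "200 * T p * (1 / p ^ 30) \<le> 1 / p ^ 20" by (rule E(14))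
      have "s \<le> 1 / p ^ 600" unfolding s_def using rn600 pp(2)[of 600] rn0 by (intro divide_left_mono) auto
      then show "s \<le> 1 / p ^ 30" using inv[of 30 600] by simp
      show "4 * 10 ^ 6 * T p ^ 4 * ln (real n) / (1 / p ^ 20) = 4 * 10 ^ 6 * T p ^ 4 * ln (real n) / (1 / p ^ 20)" ..
    qed
    have fail: "(real m + 1) * tp.p0 \<le> R p"
    proof -
      have m2: "real m + 1 \<le> 2 * p powr (2 * c)"
      proof -
        have n1: "1 \<le> real n" using n0 by simp
        have "(t_max \<epsilon> n)\<^sup>2 \<le> (sqrt (real n))\<^sup>2"
        proof -
          have "(t_max \<epsilon> n)\<^sup>2 \<le> ln (real n)"
            using tmT(1,3) T2 power_mono[of "t_max \<epsilon> n" "T p" 2] by (simp add: lnn)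
          also have "\<dots> \<le> real n" using n0 ln_le_minus_one[of "real n"] by simp
          finally show ?thesis by simp
        qed
        then have "t_max \<epsilon> n \<le> sqrt (real n)" by (rule power2_le_imp_le) simp
        then have "t_max \<epsilon> n * rn n \<le> sqrt (real n) * rn n" using rn0 by (intro mult_right_mono) auto
        also have "\<dots> = (real n)\<^sup>2" by (simp add: rn_def power2_eq_square)
        finally have "real m \<le> (real n)\<^sup>2" using mle by linarith
        moreover have "1 \<le> (real n)\<^sup>2" using n1 by simp
        moreover have "(real n)\<^sup>2 = p powr (2 * c)" by (simp add: np power2_eq_square powr_add[symmetric])
        ultimately show ?thesis by linarith
      qed
      have e1: "exp (- ((1 / p ^ 40)\<^sup>2 / (800 * T p ^ 3 * b0))) \<le>
          exp (- ((1 / p ^ 40)\<^sup>2 / (800 * T p ^ 3 * (64 * T p * (1 / p ^ 100) * (p ^ 5 + 3)))))"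
      proof -
        have "b0 \<le> 64 * T p * (1 / p ^ 100) * (p ^ 5 + 3)"
          unfolding b0_def using z(2) T1 pp(2)[of 100] by (intro mult_left_mono) auto
        then have "800 * T p ^ 3 * b0 \<le> 800 * T p ^ 3 * (64 * T p * (1 / p ^ 100) * (p ^ 5 + 3))"
          using T1 by (intro mult_left_mono) auto
        moreover have "0 < 800 * T p ^ 3 * b0" using T1 b0_pos by simp
        ultimately show ?thesis by (simp only: exp_le_cancel_iff neg_le_iff_le) (rule frac_le, simp, simp, assumption, assumption)
      qed
      have e2: "exp (32 * (T p)\<^sup>2 - real z) \<le> exp (32 * (c * ln p) - p ^ 5)" using z(1) T2 by simp
      have n2c: "(real n)\<^sup>2 = p powr (2 * c)" by (simp add: np power2_eq_square powr_add[symmetric])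
      have n6c: "real n ^ 6 = p powr (6 * c)" using p2 by (simp add: np powr_realpow[symmetric] powr_powr mult.commute)
      have "tp.p0 \<le> p powr (2 * c) * (6 * exp (- ((1 / p ^ 40)\<^sup>2 / (800 * T p ^ 3 *
          (64 * T p * (1 / p ^ 100) * (p ^ 5 + 3))))) + exp (32 * (c * ln p) - p ^ 5)) + 9 / p powr (6 * c)"
        unfolding tp.p0_def n2c n6c using e1 e2 by (intro add_mono mult_left_mono) auto
      moreover have "0 \<le> tp.p0" unfolding tp.p0_def by simp
      ultimately show ?thesis unfolding R_def using m2 by (intro mult_mono) auto
    qed
    show ?case
    proof (intro allI impI)
      fix i x k :: nat and K :: real
      assume a: "i \<le> i_max \<epsilon> n" "real i / rn n \<le> 1 / 4" "8 * (n * x\<^sup>2) \<le> k\<^sup>2" "4 \<le> k" "K \<le> real n / (2 * real k)"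
      have "real i * s \<le> 1 / 4" using a(2) by (simp add: s_def)
      note sp = tp.success_prob[OF a(1)[folded m_def] this a(3-5)]
      show "1 - R (P n) - (2 * real n ^ 3 * (real i * (8 / (real n)\<^sup>2)) ^ 4
        + real (Suc i) * (real n * (exp (8 * real i / real n) / 2 ^ x))
        + real n ^ k * exp (- (real i * (real k)\<^sup>2 / (4 * (real n)\<^sup>2)))) \<le> prob_h5f_ge \<epsilon> n K"
        using sp fail unfolding prob_h5f_ge_def p_def[symmetric] m_def[symmetric] by linarith
    qed
  qed
  with lim show ?thesis by (intro exI[of _ "\<lambda>n. R (P n)"]) blast
qed

text \<open>The bound b < 1/4 is met twice: about n^(4b) four-cycles have to be o(n), and the n x^2
  pairs with a common neighbour, about n^(1 + 2b), have to be fewer than k^2, about n^(2 - 2b) (ln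
  n)^2.\<close>

lemma start_eventually:
  fixes b \<epsilon> :: real assumes b: "0 < b" "b < 1 / 4" and eps: "0 < \<epsilon>" "\<epsilon> < 1 / 4"
  shows "\<forall>\<^sub>F n in sequentially. real n powr (1 + b) + 2 \<le> t_max \<epsilon> n * real n powr (3 / 2)"
    and "\<forall>\<^sub>F n in sequentially. (real n powr (1 + b) + 1) / rn n \<le> 1 / 4"
    and "\<forall>\<^sub>F n in sequentially. 8 * (real n * (32 * real n powr b + 1)\<^sup>2) \<le> (8 * real n powr (1 - b) * ln (real n))\<^sup>2"
    and "\<forall>\<^sub>F n in sequentially. 1 \<le> real n powr (1 - b) * ln (real n)"
    and "((\<lambda>n. 2 * real n ^ 3 * (16 * real n powr (b - 1)) ^ 4
      + 3 * real n powr (1 + b) * (real n * exp (8 - 8 * real n powr b)) + 1 / real n) \<longlongrightarrow> 0) sequentially"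
proof -
  have e: "0 < 1 / 2 - \<epsilon>" using eps by simp
  define d where "d = 1 / 2 - \<epsilon>"
  have d: "0 < d" using e by (simp add: d_def)
  show "\<forall>\<^sub>F n in sequentially. real n powr (1 + b) + 2 \<le> t_max \<epsilon> n * real n powr (3 / 2)"
    unfolding t_max_def d_def[symmetric] using b d by real_asymp
  show "\<forall>\<^sub>F n in sequentially. (real n powr (1 + b) + 1) / rn n \<le> 1 / 4"
    unfolding rn_def using b by real_asymp
  show "\<forall>\<^sub>F n in sequentially. 8 * (real n * (32 * real n powr b + 1)\<^sup>2) \<le> (8 * real n powr (1 - b) * ln (real n))\<^sup>2"
    using b by real_asymp
  show "\<forall>\<^sub>F n in sequentially. 1 \<le> real n powr (1 - b) * ln (real n)"
    using b by real_asymp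
  have "((\<lambda>n. 2 * real n ^ 3 * (16 * real n powr (b - 1)) ^ 4) \<longlongrightarrow> 0) sequentially"
    using b by real_asymp
  moreover have "((\<lambda>n. 3 * real n powr (1 + b) * (real n * exp (8 - 8 * real n powr b))) \<longlongrightarrow> 0) sequentially"
    using b by real_asymp
  moreover have "((\<lambda>n. 1 / real n) \<longlongrightarrow> 0) sequentially" by real_asymp
  ultimately show "((\<lambda>n. 2 * real n ^ 3 * (16 * real n powr (b - 1)) ^ 4
      + 3 * real n powr (1 + b) * (real n * exp (8 - 8 * real n powr b)) + 1 / real n) \<longlonglongrightarrow> 0)"
    by (intro tendsto_add_zero)
qed

text \<open>The constants 8 and 32 come from here: i k / (4 n^2) >= 2 ln n makes the union over
  k-sets cost at most n^(-k), and 2^x >= exp (16 n^b) beats the moment exp (8 n^b + 8) of a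
  degree.\<close>

lemma start_failure_bound:
  fixes b :: real and n i x k :: nat
  assumes n: "3 \<le> n" and b: "0 < b" and i: "real n powr (1 + b) \<le> real i" "real i \<le> real n powr (1 + b) + 1"
    and x: "32 * real n powr b \<le> real x" and k: "8 * real n powr (1 - b) * ln (real n) \<le> real k" "4 \<le> k"
  shows "2 * real n ^ 3 * (real i * (8 / (real n)\<^sup>2)) ^ 4
      + real (Suc i) * (real n * (exp (8 * real i / real n) / 2 ^ x))
      + real n ^ k * exp (- (real i * (real k)\<^sup>2 / (4 * (real n)\<^sup>2)))
    \<le> 2 * real n ^ 3 * (16 * real n powr (b - 1)) ^ 4
      + 3 * real n powr (1 + b) * (real n * exp (8 - 8 * real n powr b)) + 1 / real n"
proof -
  have n0: "0 < real n" using n by simp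
  have n1: "1 \<le> real n powr (1 + b)" using n b by (intro ge_one_powr_ge_zero) auto
  have pb: "real n powr (1 + b) = real n * real n powr b" using n0 by (simp add: powr_add)
  have pb2: "real n powr (b - 1) = real n powr b / real n" using n0 by (simp add: powr_diff)
  have A: "real i * (8 / (real n)\<^sup>2) \<le> 16 * real n powr (b - 1)"
  proof -
    have "real i * (8 / (real n)\<^sup>2) \<le> (2 * real n powr (1 + b)) * (8 / (real n)\<^sup>2)"
      using i n1 by (intro mult_right_mono) auto
    then show ?thesis using n0 by (simp add: pb pb2 power2_eq_square)
  qed
  have E: "exp (8 * real i / real n) / 2 ^ x \<le> exp (8 - 8 * real n powr b)"
  proof -
    have "real x * (1 / 2) \<le> real x * ln 2" by (rule mult_left_mono) (use ln2_ge_two_thirds in auto)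
    then have "16 * real n powr b \<le> real x * ln 2" using x by linarith
    then have "exp (16 * real n powr b) \<le> exp (real x * ln 2)" by (simp only: exp_le_cancel_iff)
    also have "\<dots> = 2 ^ x" by (simp add: exp_of_nat_mult)
    finally have X: "exp (16 * real n powr b) \<le> 2 ^ x" .
    have "8 * real i / real n \<le> 8 * (real n powr (1 + b) + 1) / real n" using i n0 by (intro divide_right_mono) auto
    also have "\<dots> = 8 * real n powr b + 8 / real n" using n0 by (simp add: pb field_simps)
    also have "\<dots> \<le> 8 * real n powr b + 8" using n by (simp add: field_simps)
    finally have "exp (8 * real i / real n) / 2 ^ x \<le> exp (8 * real n powr b + 8) / exp (16 * real n powr b)"
      using X by (intro frac_le) auto
    also have "\<dots> = exp (8 - 8 * real n powr b)" by (simp add: exp_diff[symmetric])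
    finally show ?thesis .
  qed
  have S: "real (Suc i) \<le> 3 * real n powr (1 + b)" using i n1 by simp
  have Kk: "real n ^ k * exp (- (real i * (real k)\<^sup>2 / (4 * (real n)\<^sup>2))) \<le> 1 / real n"
  proof -
    have l0: "0 \<le> ln (real n)" using n by simp
    have "8 * (real n)\<^sup>2 * ln (real n) = real n powr (1 + b) * (8 * real n powr (1 - b) * ln (real n))"
      using n0 by (simp add: power2_eq_square powr_add[symmetric] mult_ac)
    also have "\<dots> \<le> real i * real k" using i k l0 by (intro mult_mono) auto
    finally have "2 * ln (real n) \<le> real i * real k / (4 * (real n)\<^sup>2)" using n0 by (simp add: field_simps)
    then have "real k * (2 * ln (real n)) \<le> real k * (real i * real k / (4 * (real n)\<^sup>2))" by (intro mult_left_mono) auto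
    also have "\<dots> = real i * (real k)\<^sup>2 / (4 * (real n)\<^sup>2)" by (simp add: power2_eq_square)
    finally have ex: "real k * (2 * ln (real n)) \<le> real i * (real k)\<^sup>2 / (4 * (real n)\<^sup>2)" .
    have "real n ^ k = exp (real k * ln (real n))" using n0 by (simp add: exp_of_nat_mult)
    then have "real n ^ k * exp (- (real i * (real k)\<^sup>2 / (4 * (real n)\<^sup>2)))
        = exp (real k * ln (real n) - real i * (real k)\<^sup>2 / (4 * (real n)\<^sup>2))" by (simp add: exp_diff exp_minus field_simps)
    also have "\<dots> \<le> exp (- ln (real n))"
    proof -
      have "1 * ln (real n) \<le> real k * ln (real n)" using k(2) l0 by (intro mult_right_mono) auto
      then show ?thesis using ex by simp
    qed
    also have "\<dots> = 1 / real n" using n0 by (simp add: exp_minus inverse_eq_divide)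
    finally show ?thesis .
  qed
  show ?thesis
    by (intro add_mono Kk mult_mono power_mono A S E order_refl) (use n0 in auto)
qed

lemma h5f_power_growth:
  fixes \<delta> \<epsilon> :: real assumes eps: "0 < \<epsilon>" "\<epsilon> < 1 / 4" and del: "0 < \<delta>" "\<delta> < 1 / 2"
  shows "(\<lambda>n. prob_h5f_ge \<epsilon> n (real n powr (\<delta> / 2 - ln (18 * ln (real n)) / ln (real n)))) \<longlonglongrightarrow> 1"
proof -
  \<comment> \<open>The early time is n^(1 + b) with b = \<delta>/2, so \<delta> < 1/2 is the
    condition b < 1/4.\<close>
  define b where "b = \<delta> / 2"
  have b: "0 < b" "b < 1 / 4" using del by (auto simp: b_def)
  define q where "q n = 2 * real n ^ 3 * (16 * real n powr (b - 1)) ^ 4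
      + 3 * real n powr (1 + b) * (real n * exp (8 - 8 * real n powr b)) + 1 / real n" for n
  have q: "q \<longlonglongrightarrow> 0" unfolding q_def by (rule start_eventually(5)[OF b eps])
  obtain r where r: "r \<longlonglongrightarrow> 0" and ev: "\<forall>\<^sub>F n in sequentially. \<forall>i x k K.
    i \<le> i_max \<epsilon> n \<longrightarrow> real i / rn n \<le> 1 / 4 \<longrightarrow> 8 * (n * x\<^sup>2) \<le> k\<^sup>2 \<longrightarrow> 4 \<le> k \<longrightarrow> K \<le> real n / (2 * real k) \<longrightarrow>
    1 - r n - (2 * real n ^ 3 * (real i * (8 / (real n)\<^sup>2)) ^ 4
      + real (Suc i) * (real n * (exp (8 * real i / real n) / 2 ^ x))
      + real n ^ k * exp (- (real i * (real k)\<^sup>2 / (4 * (real n)\<^sup>2)))) \<le> prob_h5f_ge \<epsilon> n K"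
    using process_success[OF eps] by blast
  let ?K = "\<lambda>n. real n powr (b - ln (18 * ln (real n)) / ln (real n))"
  have "\<forall>\<^sub>F n in sequentially. 1 - r n - q n \<le> prob_h5f_ge \<epsilon> n (?K n)"
    using ev start_eventually(1-4)[OF b eps] eventually_ge_at_top[of 3]
  proof eventually_elim
    case (elim n)
    define i where "i = nat \<lceil>real n powr (1 + b)\<rceil>"
    define x where "x = nat \<lceil>32 * real n powr b\<rceil>"
    define k where "k = nat \<lceil>8 * real n powr (1 - b) * ln (real n)\<rceil>"
    have n0: "0 < real n" using elim by simp
    have i: "real n powr (1 + b) \<le> real i" "real i \<le> real n powr (1 + b) + 1"
      unfolding i_def using of_nat_ceiling[of "real n powr (1 + b)"] by (auto simp: ceiling_correct) 
    have x: "32 * real n powr b \<le> real x" "real x \<le> 32 * real n powr b + 1"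
      unfolding x_def using of_nat_ceiling[of "32 * real n powr b"] by (auto simp: ceiling_correct)
    have kl: "8 \<le> 8 * real n powr (1 - b) * ln (real n)" using elim(5) by simp
    have k: "8 * real n powr (1 - b) * ln (real n) \<le> real k" "real k \<le> 8 * real n powr (1 - b) * ln (real n) + 1"
      using kl unfolding k_def by linarith+
    have k4: "4 \<le> k" using k(1) kl by linarith
    have im: "i \<le> i_max \<epsilon> n"
    proof -
      have "real i \<le> t_max \<epsilon> n * real n powr (3 / 2) - 1" using i elim(2) by linarith
      then show ?thesis unfolding i_max_def by linarith
    qed
    have rn0: "0 < rn n" using n0 by (simp add: rn_def)
    have irn: "real i / rn n \<le> 1 / 4"
    proof -
      have "real i / rn n \<le> (real n powr (1 + b) + 1) / rn n" using i rn0 by (intro divide_right_mono) auto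
      then show ?thesis using elim(3) by linarith
    qed
    have xk: "8 * (n * x\<^sup>2) \<le> k\<^sup>2"
    proof -
      have "8 * (real n * (real x)\<^sup>2) \<le> 8 * (real n * (32 * real n powr b + 1)\<^sup>2)"
        using x by (intro mult_left_mono power_mono) auto
      also have "\<dots> \<le> (8 * real n powr (1 - b) * ln (real n))\<^sup>2" by (rule elim(4))
      also have "\<dots> \<le> (real k)\<^sup>2" by (rule power_mono[OF k(1)]) (use kl in linarith)
      finally have "real (8 * (n * x\<^sup>2)) \<le> real (k\<^sup>2)" by simp
      then show ?thesis by (simp only: of_nat_le_iff)
    qed
    \<comment> \<open>k is at most 9 n^(1 - b) ln n, so n / (2 k) >= n^b / (18 ln n), and ln (18 ln
      n) / ln n is the exponent that writes 18 ln n as a power of n.\<close>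
    have K: "?K n \<le> real n / (2 * real k)"
    proof -
      have l1: "0 < ln (real n)" using elim by simp
      then have "?K n = real n powr b / (18 * ln (real n))"
        unfolding powr_diff using n0 elim(6) by (simp add: powr_def[of "real n" "ln (18 * ln (real n)) / ln (real n)"])
      also have "\<dots> = real n / (18 * (real n powr (1 - b) * ln (real n)))"
        using n0 l1 elim(6) by (simp add: powr_diff field_simps)
      also have "\<dots> \<le> real n / (2 * real k)"
      proof (rule frac_le)
        show "2 * real k \<le> 18 * (real n powr (1 - b) * ln (real n))" using k kl by linarith
      qed (use k4 in auto)
      finally show ?thesis .
    qed
    have "1 - r n - (2 * real n ^ 3 * (real i * (8 / (real n)\<^sup>2)) ^ 4
      + real (Suc i) * (real n * (exp (8 * real i / real n) / 2 ^ x))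
      + real n ^ k * exp (- (real i * (real k)\<^sup>2 / (4 * (real n)\<^sup>2)))) \<le> prob_h5f_ge \<epsilon> n (?K n)"
      using elim(1) im irn xk k4 K by blast
    moreover have "2 * real n ^ 3 * (real i * (8 / (real n)\<^sup>2)) ^ 4
      + real (Suc i) * (real n * (exp (8 * real i / real n) / 2 ^ x))
      + real n ^ k * exp (- (real i * (real k)\<^sup>2 / (4 * (real n)\<^sup>2))) \<le> q n"
      unfolding q_def using start_failure_bound[OF _ b(1) i x(1) k(1) k4] elim by simp
    ultimately show ?case by linarith
  qed
  moreover have "\<forall>\<^sub>F n in sequentially. prob_h5f_ge \<epsilon> n (?K n) \<le> 1"
    by (simp add: prob_h5f_ge_def)
  moreover have "(\<lambda>n. 1 - r n - q n) \<longlonglongrightarrow> 1 - 0 - 0" by (intro tendsto_intros r q)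
  then have "(\<lambda>n. 1 - r n - q n) \<longlonglongrightarrow> 1" by simp
  ultimately have "(\<lambda>n. prob_h5f_ge \<epsilon> n (?K n)) \<longlonglongrightarrow> 1"
    by (rule tendsto_sandwich[OF _ _ _ tendsto_const])
  then show ?thesis by (simp only: b_def)
qed

lemma prob_h5f_ge_antimono: "K \<le> K' \<Longrightarrow> prob_h5f_ge \<epsilon> n K' \<le> prob_h5f_ge \<epsilon> n K"
  unfolding prob_h5f_ge_def by (rule measure_pmf.finite_measure_mono) auto

theorem corollary10p18:
  shows "\<exists>\<epsilon>\<^sub>0>0. \<forall>\<epsilon>::real. 0 < \<epsilon> \<and> \<epsilon> < \<epsilon>\<^sub>0 \<longrightarrow>
    (\<forall>K::real. (\<lambda>n. prob_h5f_ge \<epsilon> n K) \<longlonglongrightarrow> 1) \<and>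
    (\<forall>\<delta>::real. 0 < \<delta> \<and> \<delta> < 1 / 2 \<longrightarrow>
      (\<exists>\<eta> :: nat \<Rightarrow> real. \<eta> \<longlonglongrightarrow> 0 \<and>
        (\<lambda>n. prob_h5f_ge \<epsilon> n (real n powr (\<delta> / 2 - \<eta> n))) \<longlonglongrightarrow> 1))"
proof (intro exI[of _ "1 / 4"] conjI allI impI)
  fix \<epsilon> :: real assume "0 < \<epsilon> \<and> \<epsilon> < 1 / 4"
  then have eps: "0 < \<epsilon>" "\<epsilon> < 1 / 4" by auto
  show "(\<lambda>n. prob_h5f_ge \<epsilon> n K) \<longlonglongrightarrow> 1" for K :: real
  proof (rule tendsto_sandwich[OF _ _ h5f_power_growth[OF eps, of "1 / 4"] tendsto_const])
    \<comment> \<open>The growth rate with \<delta> = 1/4 already tends to infinity, so it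
      eventually exceeds any constant K.\<close>
    have "filterlim (\<lambda>n. real n powr (1 / 4 / 2 - ln (18 * ln (real n)) / ln (real n))) at_top sequentially"
      by real_asymp
    then have "\<forall>\<^sub>F n in sequentially. K \<le> real n powr (1 / 4 / 2 - ln (18 * ln (real n)) / ln (real n))"
      by (simp add: filterlim_at_top)
    then show "\<forall>\<^sub>F n in sequentially. prob_h5f_ge \<epsilon> n (real n powr (1 / 4 / 2 - ln (18 * ln (real n)) / ln (real n))) \<le> prob_h5f_ge \<epsilon> n K"
      by eventually_elim (rule prob_h5f_ge_antimono)
  qed (auto simp: prob_h5f_ge_def)
  fix \<delta> :: real assume "0 < \<delta> \<and> \<delta> < 1 / 2"
  moreover have "(\<lambda>n. ln (18 * ln (real n)) / ln (real n)) \<longlonglongrightarrow> 0" by real_asymp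
  ultimately show "\<exists>\<eta> :: nat \<Rightarrow> real. \<eta> \<longlonglongrightarrow> 0 \<and> (\<lambda>n. prob_h5f_ge \<epsilon> n (real n powr (\<delta> / 2 - \<eta> n))) \<longlonglongrightarrow> 1"
    using h5f_power_growth[OF eps] by blast
qed simp

end
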